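(* Let $\epsilon>0$ and for each $n\ge 1$ let $\Gamma(n)$ be an $\epsilon$-balanced random digraph on the vertex set $[n]=\{1,\dots,n\}$; the distributions may differ for different $n$, but $\epsilon$ is independent of $n$. Then for every integer $a>0$ and every finite abelian group $G$ whose exponent divides $a$, \[\lim_{n\to\infty}\mathbb{P}\big(S(\Gamma(n))\otimes(\mathbb{Z}/a\mathbb{Z})\cong G\big)=\mathbb{P}\big(Y\otimes(\mathbb{Z}/a\mathbb{Z})\cong G\big).\]
   Context: Digraphs may have multiple edges (and loops). For vertices $i,j$, $\deg(i,j)$ is the number of edges from $i$ to $j$, and $\mathrm{outdeg}(i)$ is the number of edges leaving $i$. A random variable $y$ in a ring $T$ is $\epsilon$-balanced if for every maximal ideal $\mathfrak p$ of $T$ and every $r\in T/\mathfrak p$ we have $\mathbb{P}(y\equiv r \bmod \mathfrak p)\le 1-\epsilon$. A random digraph on $[n]$ is $\epsilon$-balanced if the random variables $\deg(i,j)$, over ordered pairs of distinct vertices $i\neq j$, are independent, each an $\epsilon$-balanced random variable in $\mathbb{Z}$. The Laplacian $L=L(\Gamma)$ is the $n\times n$ integer matrix with off-diagonal entries $L_{ij}=-\deg(j,i)$ for $i\ne j$ and diagonal entries $L_{jj}=\mathrm{outdeg}(j)-\deg(j,j)$. Every column of $L$ sums to $0$. $\mathbb{Z}^n_0\subseteq\mathbb{Z}^n$ is the subgroup of vectors whose entries sum to $0$. The total sandpile group is $S(\Gamma)=\mathbb{Z}^n_0/L\mathbb{Z}^n$. For a prime $p$, $Q_p=\prod_{k\ge2}(1-p^{-k})$,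 and $Q=\prod_{p}Q_p$. $Y$ denotes the random finite abelian group with $\mathbb{P}(Y\cong H)=\dfrac{Q}{|H|\,|\mathrm{Aut}(H)|}$ for every finite abelian group $H$. Equivalently, $Y$ is the product over all primes $p$ of independent random $p$-groups $Y_p$ with $\mathbb{P}(Y_p\cong H)=Q_p/(|H||\mathrm{Aut}(H)|)$. *)

theory Defs
  imports "HOL-Algebra.Algebra" "HOL-Probability.Probability"
begin

definition eps_balanced_rv ::
  "('r, 'm) ring_scheme \<Rightarrow> 'w pmf \<Rightarrow> ('w \<Rightarrow> 'r) \<Rightarrow> real \<Rightarrow> bool" where
  "eps_balanced_rv T P y eps \<longleftrightarrow>
     (\<forall>I. maximalideal I T \<longrightarrow>
        (\<forall>r \<in> carrier T. measure_pmf.prob P {w. y w \<in> I +>\<^bsub>T\<^esub> r} \<le> 1 - eps))"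

text \<open>A (multi-)digraph with loops is given by its edge-multiplicity function:
  D i j = deg(i,j), the number of edges from i to j.  A digraph on [n] = {1..n}
  has D i j = 0 unless i, j are in {1..n}.  Since the set of digraphs on [n] is
  countable, a random digraph on [n] is a probability mass function on such
  functions.\<close>
definition digraph_on :: "nat \<Rightarrow> (nat \<Rightarrow> nat \<Rightarrow> nat) \<Rightarrow> bool" where
  "digraph_on n D \<longleftrightarrow> (\<forall>i j. (i \<notin> {1..n} \<or> j \<notin> {1..n}) \<longrightarrow> D i j = 0)"

definition eps_balanced_digraph :: "nat \<Rightarrow> real \<Rightarrow> (nat \<Rightarrow> nat \<Rightarrow> nat) pmf \<Rightarrow> bool" where
  "eps_balanced_digraph n eps P \<longleftrightarrow>
     (\<forall>D \<in> set_pmf P. digraph_on n D) \<and>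
     prob_space.indep_vars (measure_pmf P) (\<lambda>_. count_space UNIV)
        (\<lambda>(i, j) D. D i j) {(i, j). i \<in> {1..n} \<and> j \<in> {1..n} \<and> i \<noteq> j} \<and>
     (\<forall>i \<in> {1..n}. \<forall>j \<in> {1..n}. i \<noteq> j \<longrightarrow>
        eps_balanced_rv \<Z> P (\<lambda>D. int (D i j)) eps)"

definition outdeg :: "nat \<Rightarrow> (nat \<Rightarrow> nat \<Rightarrow> nat) \<Rightarrow> nat \<Rightarrow> nat" where
  "outdeg n D j = (\<Sum>k\<in>{1..n}. D j k)"

definition laplacian :: "nat \<Rightarrow> (nat \<Rightarrow> nat \<Rightarrow> nat) \<Rightarrow> nat \<Rightarrow> nat \<Rightarrow> int" where
  "laplacian n D i j =
     (if i = j then int (outdeg n D j) - int (D j j) else - int (D j i))"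

definition int_vecs :: "nat \<Rightarrow> (nat \<Rightarrow> int) set" where
  "int_vecs n = {v. \<forall>i. i \<notin> {1..n} \<longrightarrow> v i = 0}"

definition zero_sum_vecs :: "nat \<Rightarrow> (nat \<Rightarrow> int) set" where
  "zero_sum_vecs n = {v \<in> int_vecs n. (\<Sum>i\<in>{1..n}. v i) = 0}"

definition Zn0 :: "nat \<Rightarrow> (nat \<Rightarrow> int) monoid" where
  "Zn0 n = \<lparr>carrier = zero_sum_vecs n, Group.monoid.mult = (\<lambda>x y i. x i + y i), Group.monoid.one = (\<lambda>i. 0)\<rparr>"

definition mat_vec :: "nat \<Rightarrow> (nat \<Rightarrow> nat \<Rightarrow> int) \<Rightarrow> (nat \<Rightarrow> int) \<Rightarrow> nat \<Rightarrow> int" where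
  "mat_vec n M w = (\<lambda>i. if i \<in> {1..n} then (\<Sum>j\<in>{1..n}. M i j * w j) else 0)"

definition laplacian_image :: "nat \<Rightarrow> (nat \<Rightarrow> nat \<Rightarrow> nat) \<Rightarrow> (nat \<Rightarrow> int) set" where
  "laplacian_image n D = mat_vec n (laplacian n D) ` int_vecs n"

definition sandpile :: "nat \<Rightarrow> (nat \<Rightarrow> nat \<Rightarrow> nat) \<Rightarrow> (nat \<Rightarrow> int) set monoid" where
  "sandpile n D = Zn0 n Mod laplacian_image n D"

text \<open>For an abelian group H, H tensor Z/aZ is H/aH; in multiplicative notation
  aH is the subgroup of a-th powers.\<close>
definition tensor_mod :: "('g, 'c) monoid_scheme \<Rightarrow> nat \<Rightarrow> 'g set monoid" where
  "tensor_mod H a = H Mod {x [^]\<^bsub>H\<^esub> a | x. x \<in> carrier H}"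

definition Q_p :: "nat \<Rightarrow> real" where
  "Q_p p = prodinf (\<lambda>k::nat. 1 - 1 / real p ^ (k + 2))"

definition Q_const :: real where
  "Q_const = prodinf (\<lambda>p::nat. if Factorial_Ring.prime p then Q_p p else 1)"

text \<open>Finite abelian groups with carrier in nat: every finite abelian group is
  isomorphic to one of these, so their isomorphism classes are exactly the
  isomorphism classes of finite abelian groups.\<close>
definition fin_ab_groups :: "nat monoid set" where
  "fin_ab_groups = {H. comm_group H \<and> finite (carrier H)}"

definition fin_ab_iso_classes :: "nat monoid set set" where
  "fin_ab_iso_classes = fin_ab_groups // {(H, K). H \<in> fin_ab_groups \<and> K \<in> fin_ab_groups \<and> H \<cong> K}"

definition Y_weight :: "nat monoid \<Rightarrow> real" where
  "Y_weight H = Q_const / (real (card (carrier H)) * real (card (auto H)))"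

definition prob_Y_tensor :: "nat \<Rightarrow> ('g, 'c) monoid_scheme \<Rightarrow> real" where
  "prob_Y_tensor a G =
     (\<Sum>\<^sub>\<infinity>C \<in> fin_ab_iso_classes.
        (let H = (SOME H. H \<in> C) in if tensor_mod H a \<cong> G then Y_weight H else 0))"

end

theory Submission
  imports Defs "HOL-Library.Function_Algebras" "HOL-Real_Asymp.Real_Asymp"
begin

text \<open>Write \<open>F\<close> for the lattice of zero-sum vectors, of rank \<open>n - 1\<close>. For a finite abelian group \<open>K\<close>, the
  expected number of surjections from the sandpile group to \<open>K\<close> tends to \<open>1 / |K|\<close>: a surjection from \<open>F\<close>
  kills the Laplacian iff \<open>n\<close> independent random walks on \<open>K\<close>, one per column, return to the identity, and
  all but a negligible proportion of the surjections give walks that equidistribute exponentially fast.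

  The same moments arise from an explicit model: choose a finite-index subgroup \<open>N\<close> of \<open>F\<close> with probability
  proportional to \<open>[F : N] ^ (- n)\<close>. The normalising constant is \<open>\<zeta>(2) \<cdots> \<zeta>(n)\<close>, the probability that \<open>N\<close> is
  contained in a given \<open>M\<close> is exactly \<open>[F : M] ^ (- n)\<close>, and \<open>F / N\<close> converges in distribution to \<open>Y\<close>.

  It remains to see that the moments determine the limit law of \<open>F / U\<close>, where \<open>U\<close> contains \<open>a F\<close>. For
  \<open>U \<subseteq> M\<close>, the indicator of \<open>U = M\<close> is approximated by a polynomial in the numbers of homomorphisms
  \<open>M / U \<rightarrow> \<int>/p\<close>, \<open>p\<close> dividing \<open>a\<close>, with an error bounded by another such polynomial. The expectations of these
  polynomials are finite combinations of moments, hence have the same limits in both models, and in the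
  explicit model the expected error is at most \<open>2 ^ (c - m)\<close>, where \<open>m\<close> is the sieve parameter and \<open>c\<close> the
  number of primes dividing \<open>a\<close>.\<close>

section \<open>Random walks on finite abelian groups\<close>

text \<open>The delicate part of the moment estimate is the surjections whose vertex labels crowd in
  one coset of a proper subgroup H. A column then returns with probability near 1/|H| rather than
  1/|K|; as most vertices choose among |H| labels, number and probability balance, and such maps
  could contribute an amount of order one. Surjectivity tips the scale: some vertex lies outside the
  coset, its edges keep the walk away from H with probability at least \<epsilon>, and so nearly
  every column loses a factor 1 - \<epsilon>.

  The exponent n of the explicit model is the number of Laplacian columns: n independent Haar
  columns in the profinite completion of F all lie in the closure of M with probability [F : M] ^ (-
  n). A law on subgroups of the discrete lattice with this property needs only sums over
  finite-index subgroups.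

  The moments are not inverted by an infinite alternating series. Inclusion-exclusion is cut at a
  finite level, and since the mean of the error is fixed by the moments, a bound for it in the
  explicit model passes to the digraphs, where no direct bound is at hand.\<close>

definition residue_balanced :: "real \<Rightarrow> nat pmf \<Rightarrow> bool" where
  "residue_balanced \<epsilon> \<mu> \<longleftrightarrow>
     (\<forall>p r. Factorial_Ring.prime p \<longrightarrow> measure_pmf.prob \<mu> {d. d mod p = r} \<le> 1 - \<epsilon>)"

text \<open>The exponents \<open>z\<close> with \<open>g [^] z \<in> J\<close> are the multiples of
  one number m, and m > 1 because \<open>g\<close> itself is not in \<open>J\<close>; any prime
  factor of m serves. This turns a coset condition into one on residues modulo a prime, the only
  residues that balance controls.\<close>

lemma (in group) int_pow_mem_subgroup_dvd:
  assumes g: "g \<in> carrier G" and J: "subgroup J G" and "g \<notin> J" and fin: "finite (carrier G)"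
  obtains p :: nat where "Factorial_Ring.prime p" "\<And>z::int. g [^] z \<in> J \<Longrightarrow> int p dvd z"
proof -
  define P where "P k \<longleftrightarrow> k > 0 \<and> g [^] k \<in> J" for k :: nat
  have "P (Coset.order G)"
    unfolding P_def using pow_order_eq_1[OF g] subgroup.one_closed[OF J] order_gt_0_iff_finite fin
    by metis
  then have PL: "P (LEAST k. P k)" by (rule LeastI)
  define m where "m = (LEAST k. P k)"
  have m: "m > 0" "g [^] m \<in> J" using PL by (auto simp: P_def m_def)
  have mmin: "\<not> P k" if "k < m" for k using that not_less_Least unfolding m_def by blast
  have "m \<noteq> 1" using m \<open>g \<notin> J\<close> g by auto
  then obtain p where p: "Factorial_Ring.prime p" "p dvd m" using prime_factor_nat by blast
  have dv: "int m dvd z" if z: "g [^] z \<in> J" for z :: int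
  proof -
    have "g [^] (int m * (z div int m)) \<in> J"
    proof -
      have "g [^] (int m * (z div int m)) = (g [^] m) [^] (z div int m)"
        using g by (simp add: int_pow_pow int_pow_int[symmetric])
      also have "\<dots> \<in> J" using J m(2)
        by (simp add: subgroup_int_pow_closed)
      finally show ?thesis .
    qed
    then have "g [^] z \<otimes> inv (g [^] (int m * (z div int m))) \<in> J"
      using z J subgroup.m_closed subgroup.m_inv_closed by metis
    moreover have "g [^] z \<otimes> inv (g [^] (int m * (z div int m))) = g [^] (z mod int m)"
      using g by (simp add: int_pow_diff[symmetric] minus_mult_div_eq_mod)
    ultimately have zJ: "g [^] (z mod int m) \<in> J" by (simp only:)
    obtain r where r: "z mod int m = int r" using m(1) by (metis nonneg_int_cases of_nat_0_less_iff pos_mod_sign)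
    have "g [^] r \<in> J" using zJ unfolding r int_pow_int .
    moreover have "int r < int m" unfolding r[symmetric] using m(1) by (intro pos_mod_bound) simp
    then have "r < m" by (simp only: of_nat_less_iff)
    ultimately have "r = 0" using mmin[of r] unfolding P_def by fast
    then have "z mod int m = 0" using r by simp
    then show ?thesis by blast
  qed
  show thesis
  proof (rule that[OF p(1)])
    fix z :: int assume "g [^] z \<in> J"
    then show "int p dvd z" using dv p(2) by (meson dvd_trans int_dvd_int_iff)
  qed
qed

text \<open>Two exponents that land in the same coset of \<open>J\<close> differ by an exponent that
  lands in \<open>J\<close>, so all of them share one residue modulo the prime of
  \<open>int_pow_mem_subgroup_dvd\<close>. If no exponent lands there,
  \<open>\<epsilon> \<le> 1\<close> gives the bound.\<close>

lemma (in group) residue_balanced_coset: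
  assumes bal: "residue_balanced \<epsilon> \<mu>" and \<epsilon>: "\<epsilon> \<le> 1"
    and g: "g \<in> carrier G" and J: "subgroup J G" and gJ: "g \<notin> J" and fin: "finite (carrier G)"
    and c: "c \<in> carrier G"
  shows "measure_pmf.prob \<mu> {d. g [^] d \<in> J #> c} \<le> 1 - \<epsilon>"
proof (cases "{d::nat. g [^] d \<in> J #> c} = {}")
  case True
  then show ?thesis using \<epsilon> by simp
next
  case False
  then obtain d0 :: nat where d0: "g [^] d0 \<in> J #> c" by blast
  obtain p where p: "Factorial_Ring.prime p" "\<And>z::int. g [^] z \<in> J \<Longrightarrow> int p dvd z"
    using int_pow_mem_subgroup_dvd[OF g J gJ fin] by blast
  interpret J: subgroup J G by (rule J)
  have "{d. g [^] d \<in> J #> c} \<subseteq> {d. d mod p = d0 mod p}"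
  proof clarify
    fix d :: nat assume d: "g [^] d \<in> J #> c"
    have "J #> c = J #> (g [^] d0)" using d0 J.subgroup_axioms c repr_independence by metis
    then have "g [^] d \<otimes> inv (g [^] d0) \<in> J"
      using d g by (metis J.rcos_module_imp is_group nat_pow_closed)
    then have "g [^] (int d - int d0) \<in> J" using g by (simp add: int_pow_diff int_pow_int)
    then have "int p dvd int d - int d0" by (rule p(2))
    then show "d mod p = d0 mod p"
      by (metis mod_eq_dvd_iff of_nat_eq_iff zmod_int)
  qed
  then have "measure_pmf.prob \<mu> {d. g [^] d \<in> J #> c} \<le> measure_pmf.prob \<mu> {d. d mod p = d0 mod p}"
    by (intro measure_pmf.finite_measure_mono) auto
  also have "\<dots> \<le> 1 - \<epsilon>" using bal p(1) unfolding residue_balanced_def by blast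
  finally show ?thesis .
qed

text \<open>A finite group has finitely many pairs of a set S and an element of its span, so word
  lengths have a common bound L. It depends on the group alone: \<open>a\<close> stands for any
  subadditive, inversion-invariant gauge, later the shift norm of the law of an arbitrarily long
  walk.\<close>

lemma (in group) word_length_bound:
  assumes fin: "finite (carrier G)"
  obtains L :: nat where "L > 0"
    "\<And>S k a \<tau>. S \<subseteq> carrier G \<Longrightarrow> k \<in> generate G S \<Longrightarrow> a \<one> \<le> (0::real) \<Longrightarrow>
      (\<And>x y. x \<in> carrier G \<Longrightarrow> y \<in> carrier G \<Longrightarrow> a (x \<otimes> y) \<le> a x + a y) \<Longrightarrow>
      (\<And>x. x \<in> carrier G \<Longrightarrow> a (inv x) = a x) \<Longrightarrow> (\<And>s. s \<in> S \<Longrightarrow> a s \<le> \<tau>) \<Longrightarrow> \<tau> \<ge> 0 \<Longrightarrow>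
      a k \<le> real L * \<tau>"
proof -
  define ok where "ok S k L \<longleftrightarrow> (\<forall>a \<tau>. a \<one> \<le> (0::real) \<longrightarrow>
      (\<forall>x\<in>carrier G. \<forall>y\<in>carrier G. a (x \<otimes> y) \<le> a x + a y) \<longrightarrow>
      (\<forall>x\<in>carrier G. a (inv x) = a x) \<longrightarrow> (\<forall>s\<in>S. a s \<le> \<tau>) \<longrightarrow> \<tau> \<ge> 0 \<longrightarrow>
      a k \<le> real L * \<tau>)" for S k and L :: nat
  have okD: "a k \<le> real L * \<tau>" if "ok S k L" and A: "a \<one> \<le> (0::real)"
      "\<forall>x\<in>carrier G. \<forall>y\<in>carrier G. a (x \<otimes> y) \<le> a x + a y"
      "\<forall>x\<in>carrier G. a (inv x) = a x" "\<forall>s\<in>S. a s \<le> \<tau>" "\<tau> \<ge> 0" for S k a \<tau> and L :: nat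
    by (rule that(1)[unfolded ok_def, THEN spec[of _ a], THEN spec[of _ \<tau>], THEN mp, OF A(1), THEN mp, OF A(2),
          THEN mp, OF A(3), THEN mp, OF A(4), THEN mp, OF A(5)])
  have ex: "\<exists>L. ok S k L" if S: "S \<subseteq> carrier G" and k: "k \<in> generate G S" for S k
    using k
  proof (induction rule: generate.induct)
    case one
    show ?case by (rule exI[of _ 0]) (simp add: ok_def)
  next
    case (incl h)
    then show ?case by (intro exI[of _ 1]) (simp add: ok_def)
  next
    case (inv h)
    then have "h \<in> carrier G" using S by auto
    with inv show ?case by (intro exI[of _ 1]) (simp add: ok_def)
  next
    case (eng h1 h2)
    then obtain L1 L2 where L: "ok S h1 L1" "ok S h2 L2" by blast
    have h: "h1 \<in> carrier G" "h2 \<in> carrier G" using eng generate_in_carrier[OF S] by auto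
    show ?case
    proof (intro exI[of _ "L1 + L2"], unfold ok_def, intro allI impI)
      fix a :: "'a \<Rightarrow> real" and \<tau> :: real
      assume A: "a \<one> \<le> 0" "\<forall>x\<in>carrier G. \<forall>y\<in>carrier G. a (x \<otimes> y) \<le> a x + a y"
        "\<forall>x\<in>carrier G. a (inv x) = a x" "\<forall>s\<in>S. a s \<le> \<tau>" "0 \<le> \<tau>"
      have "a (h1 \<otimes> h2) \<le> a h1 + a h2" using A h by blast
      also have "\<dots> \<le> real L1 * \<tau> + real L2 * \<tau>"
      proof (rule add_mono)
        show "a h1 \<le> real L1 * \<tau>"
          by (rule okD[OF L(1) A])
        show "a h2 \<le> real L2 * \<tau>"
          by (rule okD[OF L(2) A])
      qed
      finally show "a (h1 \<otimes> h2) \<le> real (L1 + L2) * \<tau>" by (simp add: algebra_simps)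
    qed
  qed
  define l where "l = (\<lambda>(S,k). SOME L. ok S k L)"
  define T where "T = Pow (carrier G) \<times> carrier G"
  have T: "finite T" using fin by (simp add: T_def)
  \<comment> \<open>A crude common bound: the sum dominates every \<open>l\<close>, and the
    successor makes it positive.\<close>
  define L where "L = Suc (\<Sum>x\<in>T. l x)"
  show thesis
  proof (rule that[of L])
    show "L > 0" by (simp add: L_def)
    fix S k and a :: "'a \<Rightarrow> real" and \<tau> :: real
    assume S: "S \<subseteq> carrier G" and k: "k \<in> generate G S" and A: "a \<one> \<le> 0"
      "(\<And>x y. x \<in> carrier G \<Longrightarrow> y \<in> carrier G \<Longrightarrow> a (x \<otimes> y) \<le> a x + a y)"
      "(\<And>x. x \<in> carrier G \<Longrightarrow> a (inv x) = a x)" "(\<And>s. s \<in> S \<Longrightarrow> a s \<le> \<tau>)" and tau: "\<tau> \<ge> 0"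
    have "ok S k (l (S,k))" unfolding l_def using someI_ex[OF ex[OF S k]] by simp
    then have "a k \<le> real (l (S,k)) * \<tau>" by (rule okD) (use A tau in auto)
    also have "l (S,k) \<le> L"
    proof -
      have "(S,k) \<in> T" using S k generate_in_carrier[OF S k] by (simp add: T_def)
      then have "l (S,k) \<le> (\<Sum>x\<in>T. l x)" using T by (intro member_le_sum) auto
      then show ?thesis by (simp add: L_def)
    qed
    then have "real (l (S,k)) * \<tau> \<le> real L * \<tau>" using tau by (intro mult_right_mono) auto
    finally show "a k \<le> real L * \<tau>" .
  qed
qed

section \<open>Energy loss under convolution\<close>

definition shift_norm :: "('a, 'b) monoid_scheme \<Rightarrow> ('a \<Rightarrow> real) \<Rightarrow> 'a \<Rightarrow> real" where
  "shift_norm G f k = L2_set (\<lambda>x. f x - f (x \<otimes>\<^bsub>G\<^esub> k)) (carrier G)"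

text \<open>One step of a walk, as convolution with the step law \<open>q\<close>. The argument
  \<open>f\<close> is an arbitrary real function because it will be a difference of two
  densities.\<close>

definition conv_step :: "('a, 'b) monoid_scheme \<Rightarrow> ('a \<Rightarrow> real) \<Rightarrow> ('a \<Rightarrow> real) \<Rightarrow> 'a \<Rightarrow> real" where
  "conv_step G q f x = (\<Sum>k\<in>carrier G. q k * f (x \<otimes>\<^bsub>G\<^esub> inv\<^bsub>G\<^esub> k))"

context group
begin

lemma sum_translate:
  assumes "k \<in> carrier G"
  shows "(\<Sum>x\<in>carrier G. h (x \<otimes> k)) = (\<Sum>x\<in>carrier G. h x)"
  using assms by (intro sum.reindex_bij_witness[of _ "\<lambda>x. x \<otimes> inv k" "\<lambda>x. x \<otimes> k"])
    (auto simp: m_assoc)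

lemma L2_set_translate:
  assumes "k \<in> carrier G"
  shows "L2_set (\<lambda>x. h (x \<otimes> k)) (carrier G) = L2_set h (carrier G)"
  unfolding L2_set_def using sum_translate[OF assms, of "\<lambda>x. (h x)\<^sup>2"] by simp

lemma shift_norm_one [simp]: "shift_norm G f \<one> = 0"
proof -
  have "L2_set (\<lambda>x. f x - f (x \<otimes> \<one>)) (carrier G) = L2_set (\<lambda>x. 0) (carrier G)"
    by (rule L2_set_cong) auto
  then show ?thesis by (simp add: shift_norm_def L2_set_def)
qed

lemma shift_norm_nonneg: "shift_norm G f k \<ge> 0"
  by (simp add: shift_norm_def)

text \<open>Translation by \<open>k\<close> leaves the norm alone, which gives the triangle
  inequality along a product. Together with \<open>shift_norm_inv\<close> it makes the shift norm a
  gauge to which \<open>word_length_bound\<close> applies.\<close>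

lemma shift_norm_mult:
  assumes "k \<in> carrier G" "l \<in> carrier G"
  shows "shift_norm G f (k \<otimes> l) \<le> shift_norm G f k + shift_norm G f l"
proof -
  have "shift_norm G f (k \<otimes> l) = L2_set (\<lambda>x. (f x - f (x \<otimes> k)) + (f (x \<otimes> k) - f (x \<otimes> k \<otimes> l))) (carrier G)"
    unfolding shift_norm_def by (rule L2_set_cong) (use assms in \<open>auto simp: m_assoc\<close>)
  also have "\<dots> \<le> shift_norm G f k + L2_set (\<lambda>x. f (x \<otimes> k) - f (x \<otimes> k \<otimes> l)) (carrier G)"
    unfolding shift_norm_def by (rule L2_set_triangle_ineq)
  also have "L2_set (\<lambda>x. f (x \<otimes> k) - f (x \<otimes> k \<otimes> l)) (carrier G) = shift_norm G f l"
    unfolding shift_norm_def using L2_set_translate[OF assms(1), of "\<lambda>x. f x - f (x \<otimes> l)"] by simp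
  finally show ?thesis .
qed

lemma shift_norm_inv:
  assumes "k \<in> carrier G"
  shows "shift_norm G f (inv k) = shift_norm G f k"
proof -
  have "shift_norm G f (inv k) = L2_set (\<lambda>x. f (x \<otimes> k) - f (x \<otimes> k \<otimes> inv k)) (carrier G)"
    unfolding shift_norm_def
    using L2_set_translate[OF assms, of "\<lambda>x. f x - f (x \<otimes> inv k)"] by simp
  also have "\<dots> = L2_set (\<lambda>x. f x - f (x \<otimes> k)) (carrier G)"
    unfolding L2_set_def
    by (intro arg_cong[of _ _ sqrt] sum.cong refl)
       (use assms in \<open>auto simp: m_assoc power2_commute\<close>)
  finally show ?thesis by (simp add: shift_norm_def)
qed

lemma shift_norm_pow:
  assumes "k \<in> carrier G"
  shows "shift_norm G f (k [^] (t::nat)) \<le> real t * shift_norm G f k"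
proof (induction t)
  case (Suc t)
  have "shift_norm G f (k [^] Suc t) \<le> shift_norm G f (k [^] t) + shift_norm G f k"
    using assms shift_norm_mult[of "k [^] t" k] by simp
  with Suc show ?case by (simp add: algebra_simps)
qed simp

text \<open>Variance as half the mean square difference of two independent copies.\<close>

lemma variance_identity:
  fixes q u :: "'c \<Rightarrow> real"
  assumes "finite A" "sum q A = 1"
  shows "(\<Sum>k\<in>A. q k * (u k)\<^sup>2) - (\<Sum>k\<in>A. q k * u k)\<^sup>2
       = (\<Sum>k\<in>A. \<Sum>l\<in>A. q k * q l * (u k - u l)\<^sup>2) / 2"
proof -
  have "(\<Sum>k\<in>A. \<Sum>l\<in>A. q k * q l * (u k - u l)\<^sup>2)
      = (\<Sum>k\<in>A. \<Sum>l\<in>A. (q k * (u k)\<^sup>2) * q l + q k * (q l * (u l)\<^sup>2) - 2 * ((q k * u k) * (q l * u l)))"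
    by (intro sum.cong refl) (simp add: power2_eq_square algebra_simps)
  also have "\<dots> = (\<Sum>k\<in>A. q k * (u k)\<^sup>2) * sum q A + sum q A * (\<Sum>k\<in>A. q k * (u k)\<^sup>2)
       - 2 * (\<Sum>k\<in>A. q k * u k)\<^sup>2"
  proof -
    have "(\<Sum>k\<in>A. q k * (u k)\<^sup>2) * sum q A = (\<Sum>k\<in>A. \<Sum>l\<in>A. (q k * (u k)\<^sup>2) * q l)"
      "sum q A * (\<Sum>k\<in>A. q k * (u k)\<^sup>2) = (\<Sum>k\<in>A. \<Sum>l\<in>A. q k * (q l * (u l)\<^sup>2))"
      "(\<Sum>k\<in>A. q k * u k)\<^sup>2 = (\<Sum>k\<in>A. \<Sum>l\<in>A. (q k * u k) * (q l * u l))"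
      by (simp_all only: sum_product power2_eq_square[of "sum _ _"])
    then show ?thesis by (simp only: sum.distrib sum_subtractf sum_distrib_left)
  qed
  finally show ?thesis using assms by simp
qed

text \<open>The variance identity for the values f (x / k) at each x, summed over x; translation
  turns the squared differences into shift norms. The identity is exact and takes the place of a
  spectral gap estimate by characters.\<close>

lemma conv_step_energy:
  assumes fin: "finite (carrier G)" and q: "sum q (carrier G) = 1"
  shows "(\<Sum>x\<in>carrier G. (f x)\<^sup>2) - (\<Sum>x\<in>carrier G. (conv_step G q f x)\<^sup>2)
       = (\<Sum>k\<in>carrier G. \<Sum>l\<in>carrier G. q k * q l * (shift_norm G f (k \<otimes> inv l))\<^sup>2) / 2"
proof -
  have eq: "(\<Sum>x\<in>carrier G. (f (x \<otimes> inv k) - f (x \<otimes> inv l))\<^sup>2) = (shift_norm G f (k \<otimes> inv l))\<^sup>2"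
    if "k \<in> carrier G" "l \<in> carrier G" for k l
  proof -
    have "(shift_norm G f (k \<otimes> inv l))\<^sup>2 = (\<Sum>x\<in>carrier G. (f x - f (x \<otimes> (k \<otimes> inv l)))\<^sup>2)"
      unfolding shift_norm_def L2_set_def by (simp add: sum_nonneg)
    also have "\<dots> = (\<Sum>x\<in>carrier G. (f (x \<otimes> inv k) - f (x \<otimes> inv k \<otimes> (k \<otimes> inv l)))\<^sup>2)"
      using sum_translate[of "inv k" "\<lambda>x. (f x - f (x \<otimes> (k \<otimes> inv l)))\<^sup>2"] that by simp
    also have "\<dots> = (\<Sum>x\<in>carrier G. (f (x \<otimes> inv k) - f (x \<otimes> inv l))\<^sup>2)"
    proof (intro sum.cong refl)
      fix x assume "x \<in> carrier G"
      then have "x \<otimes> inv k \<otimes> (k \<otimes> inv l) = x \<otimes> inv l"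
        using that by (metis inv_closed inv_solve_right m_assoc m_closed)
      then show "(f (x \<otimes> inv k) - f (x \<otimes> inv k \<otimes> (k \<otimes> inv l)))\<^sup>2 = (f (x \<otimes> inv k) - f (x \<otimes> inv l))\<^sup>2"
        by simp
    qed
    finally show ?thesis by simp
  qed
  have "(\<Sum>x\<in>carrier G. (f x)\<^sup>2) = (\<Sum>k\<in>carrier G. q k * (\<Sum>x\<in>carrier G. (f x)\<^sup>2))"
    using q by (simp add: sum_distrib_right[symmetric])
  also have "\<dots> = (\<Sum>k\<in>carrier G. q k * (\<Sum>x\<in>carrier G. (f (x \<otimes> inv k))\<^sup>2))"
    by (intro sum.cong refl) (use sum_translate[of "inv _" "\<lambda>x. (f x)\<^sup>2"] in simp)
  also have "\<dots> = (\<Sum>x\<in>carrier G. \<Sum>k\<in>carrier G. q k * (f (x \<otimes> inv k))\<^sup>2)"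
    by (subst sum.swap) (simp add: sum_distrib_left)
  finally have "(\<Sum>x\<in>carrier G. (f x)\<^sup>2) - (\<Sum>x\<in>carrier G. (conv_step G q f x)\<^sup>2)
     = (\<Sum>x\<in>carrier G. (\<Sum>k\<in>carrier G. q k * (f (x \<otimes> inv k))\<^sup>2) - (\<Sum>k\<in>carrier G. q k * f (x \<otimes> inv k))\<^sup>2)"
    by (simp add: sum_subtractf conv_step_def)
  also have "\<dots> = (\<Sum>x\<in>carrier G. (\<Sum>k\<in>carrier G. \<Sum>l\<in>carrier G. q k * q l * (f (x \<otimes> inv k) - f (x \<otimes> inv l))\<^sup>2) / 2)"
    by (intro sum.cong refl variance_identity fin q)
  also have "\<dots> = (\<Sum>k\<in>carrier G. \<Sum>l\<in>carrier G. q k * q l * (\<Sum>x\<in>carrier G. (f (x \<otimes> inv k) - f (x \<otimes> inv l))\<^sup>2)) / 2"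
  proof -
    have "(\<Sum>x\<in>carrier G. \<Sum>k\<in>carrier G. \<Sum>l\<in>carrier G. q k * q l * (f (x \<otimes> inv k) - f (x \<otimes> inv l))\<^sup>2)
       = (\<Sum>k\<in>carrier G. \<Sum>x\<in>carrier G. \<Sum>l\<in>carrier G. q k * q l * (f (x \<otimes> inv k) - f (x \<otimes> inv l))\<^sup>2)"
      by (rule sum.swap)
    also have "\<dots> = (\<Sum>k\<in>carrier G. \<Sum>l\<in>carrier G. \<Sum>x\<in>carrier G. q k * q l * (f (x \<otimes> inv k) - f (x \<otimes> inv l))\<^sup>2)"
      by (intro sum.cong refl sum.swap)
    finally show ?thesis by (simp add: sum_divide_distrib[symmetric] sum_distrib_left)
  qed
  also have "\<dots> = (\<Sum>k\<in>carrier G. \<Sum>l\<in>carrier G. q k * q l * (shift_norm G f (k \<otimes> inv l))\<^sup>2) / 2"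
    by (simp add: eq)
  finally show ?thesis .
qed

lemma conv_step_energy_le:
  assumes fin: "finite (carrier G)" and q: "sum q (carrier G) = 1" and "\<And>k. q k \<ge> 0"
  shows "(\<Sum>x\<in>carrier G. (conv_step G q f x)\<^sup>2) \<le> (\<Sum>x\<in>carrier G. (f x)\<^sup>2)"
proof -
  have "0 \<le> (\<Sum>k\<in>carrier G. \<Sum>l\<in>carrier G. q k * q l * (shift_norm G f (k \<otimes> inv l))\<^sup>2) / 2"
    using assms by (intro divide_nonneg_nonneg sum_nonneg) auto
  then show ?thesis using conv_step_energy[OF fin q, of f] by linarith
qed

text \<open>When the orbit sums vanish, averaging f x - f (x g^t) over t gives back f x, and each
  difference costs at most t single shifts. The order of the group serves as a common period for all
  \<open>g\<close>.\<close>

lemma poincare_orbit: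
  assumes fin: "finite (carrier G)" and g: "g \<in> carrier G"
    and zero: "\<And>x. x \<in> carrier G \<Longrightarrow> (\<Sum>t<Coset.order G. f (x \<otimes> g [^] (t::nat))) = 0"
  shows "L2_set f (carrier G) \<le> real (Coset.order G) * shift_norm G f g"
proof -
  let ?N = "Coset.order G"
  have N: "?N > 0" using fin order_gt_0_iff_finite by blast
  have sumset: "L2_set (\<lambda>x. \<Sum>t\<in>T. h t x) (carrier G) \<le> (\<Sum>t\<in>T. L2_set (h t) (carrier G))" if "finite T"
    for T :: "nat set" and h
    using that
  proof (induction T rule: finite_induct)
    case empty
    show ?case by (simp add: L2_set_def)
  next
    case (insert t T)
    have "L2_set (\<lambda>x. \<Sum>t\<in>insert t T. h t x) (carrier G) = L2_set (\<lambda>x. h t x + (\<Sum>t\<in>T. h t x)) (carrier G)"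
      using insert by simp
    also have "\<dots> \<le> L2_set (h t) (carrier G) + L2_set (\<lambda>x. \<Sum>t\<in>T. h t x) (carrier G)"
      by (rule L2_set_triangle_ineq)
    finally show ?case using insert by simp
  qed
  have "real ?N * L2_set f (carrier G) = L2_set (\<lambda>x. real ?N * f x) (carrier G)"
    by (simp add: L2_set_right_distrib)
  also have "\<dots> = L2_set (\<lambda>x. \<Sum>t<?N. f x - f (x \<otimes> g [^] t)) (carrier G)"
    by (rule L2_set_cong) (auto simp: sum_subtractf zero)
  also have "\<dots> \<le> (\<Sum>t<?N. shift_norm G f (g [^] t))"
    unfolding shift_norm_def by (rule sumset) simp
  also have "\<dots> \<le> (\<Sum>t<?N. real ?N * shift_norm G f g)"
  proof (rule sum_mono)
    fix t assume "t \<in> {..<?N}"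
    then have "real t * shift_norm G f g \<le> real ?N * shift_norm G f g"
      by (intro mult_right_mono shift_norm_nonneg) auto
    then show "shift_norm G f (g [^] t) \<le> real ?N * shift_norm G f g"
      using shift_norm_pow[OF g, of f t] by linarith
  qed
  also have "\<dots> = real ?N * (real ?N * shift_norm G f g)" by simp
  finally have "real ?N * L2_set f (carrier G) \<le> real ?N * (real ?N * shift_norm G f g)" .
  then show ?thesis using N by (simp only: mult_le_cancel_left_pos of_nat_0_less_iff)
qed


text \<open>The property of the law of \<open>g [^] d\<close> on which the contraction rests.
  Subgroups containing \<open>g\<close> are left out since they absorb every power of
  \<open>g\<close>.\<close>

definition coset_spread :: "real \<Rightarrow> 'a \<Rightarrow> ('a \<Rightarrow> real) \<Rightarrow> bool" where
  "coset_spread \<epsilon> g q \<longleftrightarrow> (\<forall>k. q k \<ge> 0) \<and> sum q (carrier G) = 1 \<and>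
     (\<forall>J c. subgroup J G \<longrightarrow> g \<notin> J \<longrightarrow> c \<in> carrier G \<longrightarrow> sum q (J #> c) \<le> 1 - \<epsilon>)"

text \<open>Points carrying mass at least \<epsilon>/N differ by elements that generate a subgroup
  containing \<open>g\<close>, so \<open>g\<close> is a word of bounded length in these differences.
  Hence one pair of such points has a shift norm comparable to that of \<open>g\<close>, which
  bounds the norm of \<open>f\<close> by the orbit inequality, and this pair alone forces a definite
  loss of energy. The factor depends only on the group and on \<epsilon>, not on \<open>g\<close>,
  \<open>q\<close> or \<open>f\<close>.\<close>

lemma conv_step_contract:
  assumes fin: "finite (carrier G)" and \<epsilon>: "0 < \<epsilon>" "\<epsilon> \<le> 1"
  obtains \<rho> :: real where "0 \<le> \<rho>" "\<rho> < 1"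
    "\<And>g q f. g \<in> carrier G \<Longrightarrow> coset_spread \<epsilon> g q \<Longrightarrow>
       (\<And>x. x \<in> carrier G \<Longrightarrow> (\<Sum>t<Coset.order G. f (x \<otimes> g [^] (t::nat))) = 0) \<Longrightarrow>
       (\<Sum>x\<in>carrier G. (conv_step G q f x)\<^sup>2) \<le> \<rho> * (\<Sum>x\<in>carrier G. (f x)\<^sup>2)"
proof -
  define N where "N = real (card (carrier G))"
  have N1: "N \<ge> 1" unfolding N_def using fin one_closed
    by (metis One_nat_def Suc_leI card_gt_0_iff empty_iff of_nat_1 of_nat_mono)
  obtain L :: nat where L: "L > 0" and Lw: 
    "\<And>S k a \<tau>. S \<subseteq> carrier G \<Longrightarrow> k \<in> generate G S \<Longrightarrow> a \<one> \<le> (0::real) \<Longrightarrow>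
      (\<And>x y. x \<in> carrier G \<Longrightarrow> y \<in> carrier G \<Longrightarrow> a (x \<otimes> y) \<le> a x + a y) \<Longrightarrow>
      (\<And>x. x \<in> carrier G \<Longrightarrow> a (inv x) = a x) \<Longrightarrow> (\<And>s. s \<in> S \<Longrightarrow> a s \<le> \<tau>) \<Longrightarrow> \<tau> \<ge> 0 \<Longrightarrow>
      a k \<le> real L * \<tau>"
    using word_length_bound[OF fin] by metis
  define M where "M = N * real L"
  have M1: "M \<ge> 1" unfolding M_def using N1 L by (metis One_nat_def Suc_leI mult_mono' mult_1 of_nat_1 of_nat_mono zero_le_one)
  \<comment> \<open>A pair of steps of mass at least \<epsilon>/N each and of shift norm \<tau>
    lowers the energy by at least (\<epsilon>/N)^2 \<tau>^2 / 2. The energy itself is at most (M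
    \<tau>)^2, where \<open>N\<close> comes from the orbit inequality and \<open>L\<close> from the
    word length of \<open>g\<close>.\<close>
  define \<rho> where "\<rho> = 1 - (\<epsilon> / N)\<^sup>2 / (2 * M\<^sup>2)"
  have eN: "0 < \<epsilon> / N" "\<epsilon> / N \<le> 1" using \<epsilon> N1 by (auto simp: field_simps)
  have "(\<epsilon> / N)\<^sup>2 / (2 * M\<^sup>2) > 0" using eN \<epsilon> N1 M1 by (intro divide_pos_pos zero_less_power mult_pos_pos) auto
  moreover have "(\<epsilon> / N)\<^sup>2 / (2 * M\<^sup>2) \<le> 1"
  proof -
    have "(\<epsilon> / N)\<^sup>2 \<le> 1" using eN by (simp add: power_le_one)
    moreover have "1 \<le> M\<^sup>2" using M1 by (simp add: one_le_power)
    ultimately have "(\<epsilon> / N)\<^sup>2 \<le> 2 * M\<^sup>2" by linarith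
    then show ?thesis using M1 by (simp add: divide_le_eq_1)
  qed
  ultimately have \<rho>: "0 \<le> \<rho>" "\<rho> < 1" unfolding \<rho>_def by auto
  show thesis
  proof (rule that[OF \<rho>])
    fix g and q f :: "'a \<Rightarrow> real"
    assume g: "g \<in> carrier G" and sp: "coset_spread \<epsilon> g q"
      and zero: "\<And>x. x \<in> carrier G \<Longrightarrow> (\<Sum>t<Coset.order G. f (x \<otimes> g [^] (t::nat))) = 0"
    have q0: "\<And>k. q k \<ge> 0" and q1: "sum q (carrier G) = 1" 
      using sp by (auto simp: coset_spread_def)
    define S where "S = {k \<in> carrier G. q k \<ge> \<epsilon> / N}"
    have big: "\<exists>k\<in>A. q k \<ge> \<epsilon> / N" if A: "A \<subseteq> carrier G" "sum q A \<ge> \<epsilon>" for A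
    proof (rule ccontr)
      assume "\<not> ?thesis"
      then have lt: "\<And>k. k \<in> A \<Longrightarrow> q k < \<epsilon> / N" by auto
      have fA: "finite A" using A fin finite_subset by blast
      have "A \<noteq> {}" using A(2) \<epsilon> by auto
      then have "sum q A < (\<Sum>k\<in>A. \<epsilon> / N)" using lt fA by (intro sum_strict_mono) auto
      also have "\<dots> = real (card A) * (\<epsilon> / N)" by simp
      also have "\<dots> \<le> N * (\<epsilon> / N)" unfolding N_def using A(1) fin eN(1) N_def
        by (intro mult_right_mono) (auto intro: card_mono)
      also have "\<dots> = \<epsilon>" using N1 by simp
      finally show False using A(2) by simp
    qed
    obtain s0 where s0: "s0 \<in> S" using big[of "carrier G"] q1 \<epsilon> unfolding S_def by auto
    have Sc: "S \<subseteq> carrier G" by (auto simp: S_def)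
    have finS: "finite S" using Sc fin finite_subset by blast
    define R where "R = (\<lambda>(k,l). k \<otimes> inv l) ` (S \<times> S)"
    have Rc: "R \<subseteq> carrier G" using Sc by (auto simp: R_def)
    define J where "J = generate G R"
    have J: "subgroup J G" unfolding J_def by (rule generate_is_subgroup[OF Rc])
    have SJ: "S \<subseteq> J #> s0"
    proof
      fix k assume k: "k \<in> S"
      then have "k \<otimes> inv s0 \<in> R" using s0 by (auto simp: R_def)
      then have "k \<otimes> inv s0 \<in> J" unfolding J_def by (rule generate.incl)
      then show "k \<in> J #> s0" using subgroup.rcos_module_rev[OF J is_group, of s0 k] k s0 Sc by auto
    qed
    \<comment> \<open>Otherwise mass at least \<epsilon> lies outside the coset
      \<open>J #> s0\<close>, so by pigeonhole a single point there has mass at least \<epsilon>/N;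
      but such a point belongs to \<open>S\<close> and hence to the coset.\<close>
    have gJ: "g \<in> J"
    proof (rule ccontr)
      assume "g \<notin> J"
      have s0c: "s0 \<in> carrier G" using s0 Sc by auto
      then have le: "sum q (J #> s0) \<le> 1 - \<epsilon>" using sp J \<open>g \<notin> J\<close> unfolding coset_spread_def by blast
      have sub: "J #> s0 \<subseteq> carrier G" using J s0c r_coset_subset_G subgroup.subset by blast
      have "sum q (carrier G - (J #> s0)) = 1 - sum q (J #> s0)"
        using q1 sum_diff[OF fin sub, of q] by simp
      then have "sum q (carrier G - (J #> s0)) \<ge> \<epsilon>" using le by simp
      then obtain k where "k \<in> carrier G - (J #> s0)" "q k \<ge> \<epsilon> / N" using big by blast
      then show False using SJ by (auto simp: S_def)
    qed
    define \<tau> where "\<tau> = Max (shift_norm G f ` R)"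
    have finR: "finite R" "R \<noteq> {}" using finS s0 by (auto simp: R_def)
    have "\<tau> \<in> shift_norm G f ` R" unfolding \<tau>_def using finR by (intro Max_in) auto
    then obtain k l where kl: "k \<in> S" "l \<in> S" "shift_norm G f (k \<otimes> inv l) = \<tau>"
      by (auto simp: R_def)
    have tau0: "\<tau> \<ge> 0" using kl(3) shift_norm_nonneg[of f "k \<otimes> inv l"] by simp
    have ag: "shift_norm G f g \<le> real L * \<tau>"
    proof (rule Lw[OF Rc gJ[unfolded J_def]])
      show "shift_norm G f s \<le> \<tau>" if "s \<in> R" for s unfolding \<tau>_def using that finR by (intro Max_ge) auto
    qed (fact tau0 | fact shift_norm_mult | fact shift_norm_inv | simp)+
    have "L2_set f (carrier G) \<le> N * shift_norm G f g"
      using poincare_orbit[OF fin g zero] unfolding N_def Coset.order_def .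
    also have "\<dots> \<le> N * (real L * \<tau>)" using ag N1 by (intro mult_left_mono) auto
    finally have fM: "L2_set f (carrier G) \<le> M * \<tau>" by (simp add: M_def)
    have "(\<Sum>x\<in>carrier G. (f x)\<^sup>2) = (L2_set f (carrier G))\<^sup>2" by (simp add: L2_set_def sum_nonneg)
    also have "\<dots> \<le> (M * \<tau>)\<^sup>2" using fM by (intro power_mono) auto
    finally have en: "(\<Sum>x\<in>carrier G. (f x)\<^sup>2) / M\<^sup>2 \<le> \<tau>\<^sup>2"
      using M1 by (simp add: divide_le_eq power_mult_distrib mult.commute)
    have klc: "k \<in> carrier G" "l \<in> carrier G" using kl Sc by auto
    have "(\<epsilon> / N)\<^sup>2 * \<tau>\<^sup>2 \<le> q k * q l * (shift_norm G f (k \<otimes> inv l))\<^sup>2"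
    proof -
      have "(\<epsilon> / N) * (\<epsilon> / N) \<le> q k * q l" using kl eN by (intro mult_mono) (auto simp: S_def q0)
      then show ?thesis unfolding kl(3) by (intro mult_right_mono) (auto simp: power2_eq_square)
    qed
    also have "\<dots> \<le> (\<Sum>l\<in>carrier G. q k * q l * (shift_norm G f (k \<otimes> inv l))\<^sup>2)"
      by (rule member_le_sum[of l, OF klc(2) _ fin]) (simp add: q0)
    also have "\<dots> \<le> (\<Sum>k\<in>carrier G. \<Sum>l\<in>carrier G. q k * q l * (shift_norm G f (k \<otimes> inv l))\<^sup>2)"
      by (rule member_le_sum[of k, OF klc(1) _ fin]) (simp add: q0 sum_nonneg)
    finally have drop: "(\<epsilon> / N)\<^sup>2 * \<tau>\<^sup>2 / 2 \<le> (\<Sum>x\<in>carrier G. (f x)\<^sup>2) - (\<Sum>x\<in>carrier G. (conv_step G q f x)\<^sup>2)"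
      unfolding conv_step_energy[OF fin q1] by simp
    have gap: "(\<epsilon> / N)\<^sup>2 * ((\<Sum>x\<in>carrier G. (f x)\<^sup>2) / M\<^sup>2) \<le> (\<epsilon> / N)\<^sup>2 * \<tau>\<^sup>2"
      using en by (intro mult_left_mono) auto
    have "w \<le> v - b / 2" if "a / 2 \<le> v - w" "b \<le> a" for a b v w :: real using that by linarith
    from this[OF drop gap] have "(\<Sum>x\<in>carrier G. (conv_step G q f x)\<^sup>2) 
        \<le> (\<Sum>x\<in>carrier G. (f x)\<^sup>2) - (\<epsilon> / N)\<^sup>2 * ((\<Sum>x\<in>carrier G. (f x)\<^sup>2) / M\<^sup>2) / 2" .
    also have "\<dots> = \<rho> * (\<Sum>x\<in>carrier G. (f x)\<^sup>2)" by (simp add: \<rho>_def field_simps)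
    finally show "(\<Sum>x\<in>carrier G. (conv_step G q f x)\<^sup>2) \<le> \<rho> * (\<Sum>x\<in>carrier G. (f x)\<^sup>2)" .
  qed
qed

lemma coset_spread_step:
  assumes bal: "residue_balanced \<epsilon> \<mu>" and \<epsilon>: "\<epsilon> \<le> 1" and fin: "finite (carrier G)" and g: "g \<in> carrier G"
  shows "coset_spread \<epsilon> g (pmf (map_pmf (\<lambda>d::nat. g [^] d) \<mu>))"
proof -
  have sub: "sum (pmf (map_pmf (\<lambda>d::nat. g [^] d) \<mu>)) A = measure_pmf.prob \<mu> {d. g [^] d \<in> A}"
    if "finite A" for A
    using that by (simp add: measure_measure_pmf_finite[symmetric] vimage_def)
  have "{d::nat. g [^] d \<in> carrier G} = UNIV" using g by auto
  then have "sum (pmf (map_pmf (\<lambda>d::nat. g [^] d) \<mu>)) (carrier G) = 1"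
    unfolding sub[OF fin] by simp
  moreover have "finite (J #> c)" if "subgroup J G" "c \<in> carrier G" for J c
    using that r_coset_subset_G[OF subgroup.subset[OF that(1)] that(2)] fin finite_subset by blast
  ultimately show ?thesis
    unfolding coset_spread_def using residue_balanced_coset[OF bal \<epsilon> g _ _ fin] sub by simp
qed

end

section \<open>Walks with independent steps\<close>

definition walk_pmf :: "('a, 'b) monoid_scheme \<Rightarrow> ('i \<Rightarrow> 'a) \<Rightarrow> ('i \<Rightarrow> nat pmf) \<Rightarrow> 'i set \<Rightarrow> 'a pmf" where
  "walk_pmf G g \<mu> I = map_pmf (\<lambda>D. finprod G (\<lambda>i. g i [^]\<^bsub>G\<^esub> D i) I) (Pi_pmf I 0 \<mu>)"

context comm_group
begin

lemma walk_pmf_carrier: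
  assumes "g \<in> I \<rightarrow> carrier G"
  shows "set_pmf (walk_pmf G g \<mu> I) \<subseteq> carrier G"
  using assms unfolding walk_pmf_def by (auto intro!: finprod_closed)

lemma walk_pmf_insert:
  assumes I: "finite I" "i \<notin> I" and g: "g \<in> insert i I \<rightarrow> carrier G"
  shows "walk_pmf G g \<mu> (insert i I) =
    map_pmf (\<lambda>(k,l). k \<otimes> l) (pair_pmf (map_pmf (\<lambda>d. g i [^] d) (\<mu> i)) (walk_pmf G g \<mu> I))"
proof -
  have gi: "g i \<in> carrier G" and gI: "g \<in> I \<rightarrow> carrier G" using g by auto
  have "walk_pmf G g \<mu> (insert i I) = map_pmf (\<lambda>(d, D). finprod G (\<lambda>j. g j [^] (D(i := d)) j) (insert i I))
      (pair_pmf (\<mu> i) (Pi_pmf I 0 \<mu>))"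
    unfolding walk_pmf_def Pi_pmf_insert[OF I] by (simp add: map_pmf_comp case_prod_unfold)
  also have "\<dots> = map_pmf (\<lambda>(d, D). g i [^] d \<otimes> finprod G (\<lambda>j. g j [^] D j) I) (pair_pmf (\<mu> i) (Pi_pmf I 0 \<mu>))"
  proof (intro map_pmf_cong refl, clarify)
    fix d :: nat and D :: "_ \<Rightarrow> nat"
    have "finprod G (\<lambda>j. g j [^] (D(i := d)) j) (insert i I) = g i [^] d \<otimes> finprod G (\<lambda>j. g j [^] (D(i := d)) j) I"
      using I gi gI by (subst finprod_insert) auto
    also have "finprod G (\<lambda>j. g j [^] (D(i := d)) j) I = finprod G (\<lambda>j. g j [^] D j) I"
      using I gI by (intro finprod_cong') auto
    finally show "finprod G (\<lambda>j. g j [^] (D(i := d)) j) (insert i I) = g i [^] d \<otimes> finprod G (\<lambda>j. g j [^] D j) I" .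
  qed
  finally show ?thesis
    unfolding walk_pmf_def by (simp add: map_pair[symmetric] map_pmf_comp case_prod_unfold)
qed

lemma pmf_mult_conv:
  assumes fin: "finite (carrier G)" and A: "set_pmf A \<subseteq> carrier G" and B: "set_pmf B \<subseteq> carrier G"
    and x: "x \<in> carrier G"
  shows "pmf (map_pmf (\<lambda>(k,l). k \<otimes> l) (pair_pmf A B)) x = conv_step G (pmf A) (pmf B) x"
proof -
  have "pmf (map_pmf (\<lambda>(k,l). k \<otimes> l) (pair_pmf A B)) x
      = measure_pmf.prob (pair_pmf A B) ((\<lambda>(k,l). k \<otimes> l) -` {x})"
    by (simp add: pmf_map)
  also have "\<dots> = measure_pmf.prob (pair_pmf A B) ((\<lambda>k. (k, x \<otimes> inv k)) ` carrier G)"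
  proof (rule measure_pmf.finite_measure_eq_AE)
    show "AE z in measure_pmf (pair_pmf A B). (z \<in> (\<lambda>(k,l). k \<otimes> l) -` {x}) = (z \<in> (\<lambda>k. (k, x \<otimes> inv k)) ` carrier G)"
    proof (rule AE_pmfI, clarify)
      fix k l assume "(k,l) \<in> set_pmf (pair_pmf A B)"
      then have kl: "k \<in> carrier G" "l \<in> carrier G" using A B by auto
      have "k \<otimes> l = x \<longleftrightarrow> l = x \<otimes> inv k" using kl x by (metis inv_solve_right m_comm)
      then show "((k,l) \<in> (\<lambda>(k,l). k \<otimes> l) -` {x}) = ((k,l) \<in> (\<lambda>k. (k, x \<otimes> inv k)) ` carrier G)"
        using kl by auto
    qed
  qed auto
  also have "\<dots> = (\<Sum>z\<in>(\<lambda>k. (k, x \<otimes> inv k)) ` carrier G. pmf (pair_pmf A B) z)"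
    using fin by (simp add: measure_measure_pmf_finite)
  also have "\<dots> = (\<Sum>k\<in>carrier G. pmf (pair_pmf A B) (k, x \<otimes> inv k))"
    by (subst sum.reindex) (auto intro!: inj_onI)
  finally show ?thesis by (simp add: pmf_pair conv_step_def)
qed

lemma pmf_walk_insert:
  assumes I: "finite I" "i \<notin> I" and g: "g \<in> insert i I \<rightarrow> carrier G" and fin: "finite (carrier G)"
    and x: "x \<in> carrier G"
  shows "pmf (walk_pmf G g \<mu> (insert i I)) x =
    conv_step G (pmf (map_pmf (\<lambda>d. g i [^] d) (\<mu> i))) (pmf (walk_pmf G g \<mu> I)) x"
  unfolding walk_pmf_insert[OF I g]
  by (rule pmf_mult_conv[OF fin _ walk_pmf_carrier x]) (use g in auto)

lemma conv_step_commute: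
  assumes x: "x \<in> carrier G"
  shows "conv_step G q f x = conv_step G f q x"
  unfolding conv_step_def
proof (rule sum.reindex_bij_witness[of _ "\<lambda>k. x \<otimes> inv k" "\<lambda>k. x \<otimes> inv k"])
  fix k assume k: "k \<in> carrier G"
  show 1: "x \<otimes> inv (x \<otimes> inv k) = k" using x k by (simp add: inv_mult m_assoc[symmetric])
  show "f (x \<otimes> inv k) * q (x \<otimes> inv (x \<otimes> inv k)) = q k * f (x \<otimes> inv k)" unfolding 1 by simp
qed (use x in \<open>simp_all add: inv_mult m_assoc[symmetric]\<close>)

text \<open>Conditioning on all steps but \<open>i\<close> leaves one power of \<open>g i\<close>
  that must fall in a coset of \<open>J\<close>, where \<open>coset_spread\<close> applies.
  Commutativity lets step \<open>i\<close> be separated from the others.\<close>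

lemma walk_coset_prob:
  assumes I: "finite I" "i \<in> I" and g: "g \<in> I \<rightarrow> carrier G" and fin: "finite (carrier G)"
    and bal: "residue_balanced \<epsilon> (\<mu> i)" and \<epsilon>: "\<epsilon> \<le> 1" and J: "subgroup J G" and gJ: "g i \<notin> J"
  shows "measure_pmf.prob (walk_pmf G g \<mu> I) J \<le> 1 - \<epsilon>"
proof -
  let ?A = "map_pmf (\<lambda>d. g i [^] d) (\<mu> i)" and ?B = "walk_pmf G g \<mu> (I - {i})"
  have I': "I = insert i (I - {i})" using I by auto
  have gi: "g i \<in> carrier G" using g I by auto
  have sp: "coset_spread \<epsilon> (g i) (pmf ?A)" by (rule coset_spread_step[OF bal \<epsilon> fin gi])
  have finJ: "finite J" using J fin subgroup.subset finite_subset by metis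
  have Jc: "J \<subseteq> carrier G" using J subgroup.subset by blast
  have "measure_pmf.prob (walk_pmf G g \<mu> I) J = (\<Sum>x\<in>J. pmf (walk_pmf G g \<mu> I) x)"
    by (rule measure_measure_pmf_finite[OF finJ])
  also have "\<dots> = (\<Sum>x\<in>J. \<Sum>l\<in>carrier G. pmf ?B l * pmf ?A (x \<otimes> inv l))"
  proof (rule sum.cong[OF refl])
    fix x assume "x \<in> J"
    then have x: "x \<in> carrier G" using Jc by auto
    have "pmf (walk_pmf G g \<mu> I) x = conv_step G (pmf ?A) (pmf ?B) x"
      using pmf_walk_insert[of "I - {i}" i g x \<mu>] gi I'[symmetric] I g fin x by simp
    also have "\<dots> = conv_step G (pmf ?B) (pmf ?A) x" by (rule conv_step_commute[OF x])
    finally show "pmf (walk_pmf G g \<mu> I) x = (\<Sum>l\<in>carrier G. pmf ?B l * pmf ?A (x \<otimes> inv l))"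
      by (simp add: conv_step_def)
  qed
  also have "\<dots> = (\<Sum>l\<in>carrier G. pmf ?B l * (\<Sum>x\<in>J. pmf ?A (x \<otimes> inv l)))"
    by (subst sum.swap) (simp add: sum_distrib_left)
  also have "\<dots> \<le> (\<Sum>l\<in>carrier G. pmf ?B l * (1 - \<epsilon>))"
  proof (intro sum_mono mult_left_mono pmf_nonneg)
    fix l assume l: "l \<in> carrier G"
    have "(\<Sum>x\<in>J. pmf ?A (x \<otimes> inv l)) = sum (pmf ?A) ((\<lambda>x. x \<otimes> inv l) ` J)"
      using l Jc by (subst sum.reindex) (auto intro!: inj_onI dest!: r_cancel simp: subset_iff)
    also have "(\<lambda>x. x \<otimes> inv l) ` J = J #> inv l" by (auto simp: r_coset_def)
    also have "sum (pmf ?A) (J #> inv l) \<le> 1 - \<epsilon>"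
      using sp J gJ l unfolding coset_spread_def by blast
    finally show "(\<Sum>x\<in>J. pmf ?A (x \<otimes> inv l)) \<le> 1 - \<epsilon>" .
  qed
  also have "\<dots> = (\<Sum>l\<in>carrier G. pmf ?B l) * (1 - \<epsilon>)" by (simp add: sum_distrib_right)
  also have "(\<Sum>l\<in>carrier G. pmf ?B l) = 1"
    by (rule sum_pmf_eq_1[OF fin walk_pmf_carrier]) (use g in auto)
  finally show ?thesis by simp
qed

text \<open>The difference between the density and its translate by \<open>h\<close> telescopes to
  zero along the orbits of \<open>h\<close>, so every step with \<open>g i = h\<close> contracts its
  energy by \<open>\<rho>\<close>, while any other step does not increase it. Thus only the
  multiplicity of \<open>h\<close> among the steps enters.\<close>

lemma walk_shift_energy:
  assumes fin: "finite (carrier G)"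
    and \<rho>: "0 \<le> \<rho>" "\<rho> < 1"
    "\<And>g q f. g \<in> carrier G \<Longrightarrow> coset_spread \<epsilon> g q \<Longrightarrow>
       (\<And>x. x \<in> carrier G \<Longrightarrow> (\<Sum>t<Coset.order G. f (x \<otimes> g [^] (t::nat))) = 0) \<Longrightarrow>
       (\<Sum>x\<in>carrier G. (conv_step G q f x)\<^sup>2) \<le> \<rho> * (\<Sum>x\<in>carrier G. (f x)\<^sup>2)"
    and \<epsilon>: "\<epsilon> \<le> 1" and h: "h \<in> carrier G" and I: "finite I"
    and g: "g \<in> I \<rightarrow> carrier G" and bal: "\<And>i. i \<in> I \<Longrightarrow> residue_balanced \<epsilon> (\<mu> i)"
  shows "(shift_norm G (pmf (walk_pmf G g \<mu> I)) h)\<^sup>2 \<le> real (card (carrier G)) * \<rho> ^ card {i\<in>I. g i = h}"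
proof -
  have sq: "(shift_norm G f h)\<^sup>2 = (\<Sum>x\<in>carrier G. (f x - f (x \<otimes> h))\<^sup>2)" for f
    unfolding shift_norm_def L2_set_def by (simp add: sum_nonneg)
  show ?thesis using I g bal unfolding sq
  proof (induction I rule: finite_induct)
    case empty
    have "(\<Sum>x\<in>carrier G. (pmf (walk_pmf G g \<mu> {}) x - pmf (walk_pmf G g \<mu> {}) (x \<otimes> h))\<^sup>2) \<le> (\<Sum>x\<in>carrier G. 1)"
    proof (rule sum_mono)
      fix x
      have "\<bar>pmf (walk_pmf G g \<mu> {}) x - pmf (walk_pmf G g \<mu> {}) (x \<otimes> h)\<bar> \<le> 1"
        using pmf_nonneg[of "walk_pmf G g \<mu> {}" x] pmf_nonneg[of "walk_pmf G g \<mu> {}" "x \<otimes> h"]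
          pmf_le_1[of "walk_pmf G g \<mu> {}" x] pmf_le_1[of "walk_pmf G g \<mu> {}" "x \<otimes> h"] by linarith
      then show "(pmf (walk_pmf G g \<mu> {}) x - pmf (walk_pmf G g \<mu> {}) (x \<otimes> h))\<^sup>2 \<le> 1"
        by (simp add: abs_square_le_1)
    qed
    then show ?case by simp
  next
    case (insert i I)
    let ?q = "pmf (map_pmf (\<lambda>d. g i [^] d) (\<mu> i))" and ?b = "pmf (walk_pmf G g \<mu> I)"
    define f where "f x = ?b x - ?b (x \<otimes> h)" for x
    have gi: "g i \<in> carrier G" and gI: "g \<in> I \<rightarrow> carrier G" using insert.prems by auto
    have sp: "coset_spread \<epsilon> (g i) ?q" by (rule coset_spread_step[OF _ \<epsilon> fin gi]) (use insert.prems in auto)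
    have q: "\<And>k. ?q k \<ge> 0" "sum ?q (carrier G) = 1" using sp by (auto simp: coset_spread_def)
    have eq: "pmf (walk_pmf G g \<mu> (insert i I)) x - pmf (walk_pmf G g \<mu> (insert i I)) (x \<otimes> h) = conv_step G ?q f x"
      if x: "x \<in> carrier G" for x
    proof -
      have "pmf (walk_pmf G g \<mu> (insert i I)) x - pmf (walk_pmf G g \<mu> (insert i I)) (x \<otimes> h)
          = conv_step G ?q ?b x - conv_step G ?q ?b (x \<otimes> h)"
        using x h insert by (simp add: pmf_walk_insert fin)
      also have "\<dots> = conv_step G ?q f x"
        unfolding conv_step_def sum_subtractf[symmetric] f_def
        by (intro sum.cong refl) (use x h in \<open>simp add: algebra_simps m_ac\<close>)
      finally show ?thesis .
    qed
    have IH: "(\<Sum>x\<in>carrier G. (f x)\<^sup>2) \<le> real (card (carrier G)) * \<rho> ^ card {i\<in>I. g i = h}"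
      unfolding f_def using insert by auto
    have "(\<Sum>x\<in>carrier G. (pmf (walk_pmf G g \<mu> (insert i I)) x - pmf (walk_pmf G g \<mu> (insert i I)) (x \<otimes> h))\<^sup>2)
       = (\<Sum>x\<in>carrier G. (conv_step G ?q f x)\<^sup>2)" by (intro sum.cong refl) (simp add: eq)
    also have "\<dots> \<le> real (card (carrier G)) * \<rho> ^ card {j\<in>insert i I. g j = h}"
    proof (cases "g i = h")
      case True
      have tele: "(\<Sum>t<m. f (x \<otimes> h [^] (t::nat))) = ?b x - ?b (x \<otimes> h [^] m)" if x: "x \<in> carrier G" for x m
        using x h by (induction m) (simp_all add: f_def m_assoc)
      have "(\<Sum>t<Coset.order G. f (x \<otimes> g i [^] t)) = 0" if x: "x \<in> carrier G" for x
        unfolding True tele[OF x] using pow_order_eq_1[OF h] x by simp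
      from \<rho>(3)[OF gi sp this] have "(\<Sum>x\<in>carrier G. (conv_step G ?q f x)\<^sup>2) \<le> \<rho> * (\<Sum>x\<in>carrier G. (f x)\<^sup>2)" .
      also have "\<dots> \<le> \<rho> * (real (card (carrier G)) * \<rho> ^ card {i\<in>I. g i = h})"
        using IH \<rho> by (intro mult_left_mono) auto
      also have "{j\<in>insert i I. g j = h} = insert i {i\<in>I. g i = h}" using True by auto
      then have "\<rho> * (real (card (carrier G)) * \<rho> ^ card {i\<in>I. g i = h}) = real (card (carrier G)) * \<rho> ^ card {j\<in>insert i I. g j = h}"
        using insert by simp
      finally show ?thesis .
    next
      case False
      then have "{j\<in>insert i I. g j = h} = {i\<in>I. g i = h}" by auto
      then show ?thesis using conv_step_energy_le[OF fin q(2,1), of f] IH by simp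
    qed
    finally show ?case .
  qed
qed

text \<open>The shift norm is small at every step value that occurs often, and the word length bound
  carries this to the subgroup generated by such values. Nothing is claimed across its cosets, where
  the rare steps need not mix.\<close>

lemma walk_oscillation:
  assumes fin: "finite (carrier G)" and \<epsilon>: "0 < \<epsilon>" "\<epsilon> \<le> 1"
  obtains C \<rho> :: real where "C > 0" "0 < \<rho>" "\<rho> < 1"
    "\<And>I g \<mu> S c x u. finite (I::'i set) \<Longrightarrow> g \<in> I \<rightarrow> carrier G \<Longrightarrow> (\<And>i. i \<in> I \<Longrightarrow> residue_balanced \<epsilon> (\<mu> i)) \<Longrightarrow>
       S \<subseteq> carrier G \<Longrightarrow> (\<And>s. s \<in> S \<Longrightarrow> c \<le> card {i\<in>I. g i = s}) \<Longrightarrow> x \<in> carrier G \<Longrightarrow> u \<in> generate G S \<Longrightarrow>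
       \<bar>pmf (walk_pmf G g \<mu> I) x - pmf (walk_pmf G g \<mu> I) (x \<otimes> u)\<bar> \<le> C * \<rho> ^ c"
proof -
  obtain \<rho>0 :: real where r0: "0 \<le> \<rho>0" "\<rho>0 < 1" and ctr:
    "\<And>g q f. g \<in> carrier G \<Longrightarrow> coset_spread \<epsilon> g q \<Longrightarrow>
       (\<And>x. x \<in> carrier G \<Longrightarrow> (\<Sum>t<Coset.order G. f (x \<otimes> g [^] (t::nat))) = 0) \<Longrightarrow>
       (\<Sum>x\<in>carrier G. (conv_step G q f x)\<^sup>2) \<le> \<rho>0 * (\<Sum>x\<in>carrier G. (f x)\<^sup>2)"
    using conv_step_contract[OF fin \<epsilon>] by metis
  obtain L :: nat where L: "L > 0" and Lw: 
    "\<And>S k a \<tau>. S \<subseteq> carrier G \<Longrightarrow> k \<in> generate G S \<Longrightarrow> a \<one> \<le> (0::real) \<Longrightarrow>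
      (\<And>x y. x \<in> carrier G \<Longrightarrow> y \<in> carrier G \<Longrightarrow> a (x \<otimes> y) \<le> a x + a y) \<Longrightarrow>
      (\<And>x. x \<in> carrier G \<Longrightarrow> a (inv x) = a x) \<Longrightarrow> (\<And>s. s \<in> S \<Longrightarrow> a s \<le> \<tau>) \<Longrightarrow> \<tau> \<ge> 0 \<Longrightarrow>
      a k \<le> real L * \<tau>"
    using word_length_bound[OF fin] by metis
  define N where "N = real (card (carrier G))"
  \<comment> \<open>The square root passes from energy to norm. The maximum with 1/2 keeps the rate
    positive when \<open>\<rho>0\<close> is 0, as is required once it is raised to real
    exponents.\<close>
  define \<rho> where "\<rho> = sqrt (max \<rho>0 (1/2))"
  define C where "C = real L * sqrt N"
  have "card (carrier G) > 0" using fin one_closed card_gt_0_iff by blast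
  then have N: "N > 0" by (simp add: N_def)
  have \<rho>: "0 < \<rho>" "\<rho> < 1" using r0 by (auto simp: \<rho>_def max_def)
  have C: "C > 0" using L N by (simp add: C_def)
  show thesis
  proof (rule that[OF C \<rho>])
    fix I :: "'i set" and g \<mu> S c x u
    assume I: "finite I" and g: "g \<in> I \<rightarrow> carrier G" and bal: "\<And>i. i \<in> I \<Longrightarrow> residue_balanced \<epsilon> (\<mu> i)"
      and S: "S \<subseteq> carrier G" and c: "\<And>s. s \<in> S \<Longrightarrow> c \<le> card {i\<in>I. g i = s}" and x: "x \<in> carrier G"
      and u: "u \<in> generate G S"
    let ?b = "pmf (walk_pmf G g \<mu> I)"
    have st: "shift_norm G ?b s \<le> sqrt N * \<rho> ^ c" if s: "s \<in> S" for s
    proof -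
      have "(shift_norm G ?b s)\<^sup>2 \<le> N * \<rho>0 ^ card {i\<in>I. g i = s}"
        unfolding N_def by (rule walk_shift_energy[OF fin r0 ctr \<epsilon>(2) _ I g bal]) (use s S in auto)
      also have "\<dots> \<le> N * (max \<rho>0 (1/2)) ^ card {i\<in>I. g i = s}"
        using N r0 by (intro mult_left_mono power_mono) auto
      also have "\<dots> \<le> N * (max \<rho>0 (1/2)) ^ c"
        using N r0 c[OF s] by (intro mult_left_mono power_decreasing) auto
      also have "\<dots> = (sqrt N * \<rho> ^ c)\<^sup>2"
      proof -
        have "(\<rho> ^ c)\<^sup>2 = (\<rho>\<^sup>2) ^ c" by (metis power_mult mult.commute)
        also have "\<rho>\<^sup>2 = max \<rho>0 (1/2)" using r0 by (simp add: \<rho>_def)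
        finally show ?thesis using N by (simp add: power_mult_distrib)
      qed
      finally have "(shift_norm G ?b s)\<^sup>2 \<le> (sqrt N * \<rho> ^ c)\<^sup>2" .
      then show ?thesis by (rule power2_le_imp_le) (use N \<rho> in simp)
    qed
    have "shift_norm G ?b u \<le> real L * (sqrt N * \<rho> ^ c)"
    proof (rule Lw[OF S u])
      show "0 \<le> sqrt N * \<rho> ^ c" using N \<rho> by simp
    qed (fact st | fact shift_norm_mult | fact shift_norm_inv | simp)+
    moreover have "\<bar>?b x - ?b (x \<otimes> u)\<bar> \<le> shift_norm G ?b u"
      unfolding shift_norm_def
      using member_le_L2_set[OF fin x, of "\<lambda>x. \<bar>?b x - ?b (x \<otimes> u)\<bar>"] by (simp add: L2_set_def)
    ultimately show "\<bar>?b x - ?b (x \<otimes> u)\<bar> \<le> C * \<rho> ^ c" by (simp add: C_def mult.assoc)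
  qed
qed

end

section \<open>Homomorphisms from the lattice of zero-sum vectors\<close>

text \<open>Extensionality makes each homomorphism of the carriers a single function, so that
  cardinalities of these sets are the intended counts.\<close>

definition Homs :: "('a, 'c) monoid_scheme \<Rightarrow> ('b, 'd) monoid_scheme \<Rightarrow> ('a \<Rightarrow> 'b) set" where
  "Homs G H = hom G H \<inter> extensional (carrier G)"

definition Surs :: "('a, 'c) monoid_scheme \<Rightarrow> ('b, 'd) monoid_scheme \<Rightarrow> ('a \<Rightarrow> 'b) set" where
  "Surs G H = {f \<in> Homs G H. f ` carrier G = carrier H}"

lemma Zn0_simps [simp]:
  "carrier (Zn0 n) = zero_sum_vecs n"
  "x \<otimes>\<^bsub>Zn0 n\<^esub> y = (\<lambda>i. x i + y i)"
  "\<one>\<^bsub>Zn0 n\<^esub> = (\<lambda>i. 0)"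
  by (simp_all add: Zn0_def)

lemma zero_sum_vecs_add:
  "x \<in> zero_sum_vecs n \<Longrightarrow> y \<in> zero_sum_vecs n \<Longrightarrow> (\<lambda>i. x i + y i) \<in> zero_sum_vecs n"
  by (simp add: zero_sum_vecs_def int_vecs_def sum.distrib)

lemma zero_sum_vecs_scale:
  "x \<in> zero_sum_vecs n \<Longrightarrow> (\<lambda>i. c * x i) \<in> zero_sum_vecs n"
  by (simp add: zero_sum_vecs_def int_vecs_def sum_distrib_left[symmetric])

lemma zero_sum_vecs_zero [simp]: "(\<lambda>i. 0) \<in> zero_sum_vecs n"
  by (simp add: zero_sum_vecs_def int_vecs_def)

lemma zero_sum_vecs_uminus: "x \<in> zero_sum_vecs n \<Longrightarrow> (\<lambda>i. - x i) \<in> zero_sum_vecs n"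
  using zero_sum_vecs_scale[of x n "-1"] by simp

lemma comm_group_Zn0: "comm_group (Zn0 n)"
proof (rule comm_groupI)
  fix x assume "x \<in> carrier (Zn0 n)"
  then show "\<exists>y\<in>carrier (Zn0 n). y \<otimes>\<^bsub>Zn0 n\<^esub> x = \<one>\<^bsub>Zn0 n\<^esub>"
    by (intro bexI[of _ "\<lambda>i. - x i"]) (auto simp: zero_sum_vecs_uminus)
qed (auto simp: zero_sum_vecs_add algebra_simps)

lemma inv_Zn0: "x \<in> zero_sum_vecs n \<Longrightarrow> inv\<^bsub>Zn0 n\<^esub> x = (\<lambda>i. - x i)"
  using comm_group.axioms(2)[OF comm_group_Zn0]
  by (intro group.inv_equality) (auto simp: zero_sum_vecs_uminus)

lemma nat_pow_Zn0: "x [^]\<^bsub>Zn0 n\<^esub> (k::nat) = (\<lambda>i. int k * x i)"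
  by (induction k) (auto simp: algebra_simps nat_pow_def)

lemma int_pow_Zn0:
  assumes "x \<in> zero_sum_vecs n"
  shows "x [^]\<^bsub>Zn0 n\<^esub> (k::int) = (\<lambda>i. k * x i)"
proof -
  interpret comm_group "Zn0 n" by (rule comm_group_Zn0)
  show ?thesis
  proof (cases "k \<ge> 0")
    case True
    then show ?thesis by (simp add: int_pow_def2 nat_pow_Zn0)
  next
    case False
    then have "x [^]\<^bsub>Zn0 n\<^esub> k = inv\<^bsub>Zn0 n\<^esub> (\<lambda>i. int (nat (- k)) * x i)"
      by (simp add: int_pow_def2 nat_pow_Zn0)
    also have "\<dots> = (\<lambda>i. k * x i)" using False
      by (simp add: inv_Zn0 zero_sum_vecs_scale[OF assms] zero_sum_vecs_uminus[OF zero_sum_vecs_scale[OF assms]])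
    finally show ?thesis .
  qed
qed

lemma zero_sum_vecs_sum:
  assumes "\<And>i. i \<in> I \<Longrightarrow> u i \<in> zero_sum_vecs n"
  shows "(\<lambda>k. \<Sum>i\<in>I. c i * u i k) \<in> zero_sum_vecs n"
  using assms
proof (induction I rule: infinite_finite_induct)
  case (insert i I)
  then have "(\<lambda>k. c i * u i k + (\<Sum>i\<in>I. c i * u i k)) \<in> zero_sum_vecs n"
    by (intro zero_sum_vecs_add zero_sum_vecs_scale) auto
  with insert show ?case by simp
qed auto

lemma hom_Zn0_sum:
  assumes K: "comm_group K" and F: "F \<in> hom (Zn0 n) K" and I: "finite I"
    and u: "\<And>i. i \<in> I \<Longrightarrow> u i \<in> zero_sum_vecs n"
  shows "F (\<lambda>k. \<Sum>i\<in>I. c i * u i k) = finprod K (\<lambda>i. F (u i) [^]\<^bsub>K\<^esub> (c i :: int)) I"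
proof -
  interpret K: comm_group K by (rule K)
  interpret Z: comm_group "Zn0 n" by (rule comm_group_Zn0)
  interpret h: group_hom "Zn0 n" K F
    using F by (simp add: group_hom_def group_hom_axioms_def K.is_group Z.is_group)
  show ?thesis using I u
  proof (induction I rule: finite_induct)
    case empty
    then show ?case using h.hom_one by simp
  next
    case (insert i I)
    have ui: "u i \<in> zero_sum_vecs n" using insert by auto
    have Fc: "F (u j) \<in> carrier K" if "j \<in> insert i I" for j using h.hom_closed insert.prems that by auto
    have "F (\<lambda>k. \<Sum>i\<in>insert i I. c i * u i k) = F ((\<lambda>k. c i * u i k) \<otimes>\<^bsub>Zn0 n\<^esub> (\<lambda>k. \<Sum>i\<in>I. c i * u i k))"
      using insert by simp
    also have "\<dots> = F (\<lambda>k. c i * u i k) \<otimes>\<^bsub>K\<^esub> F (\<lambda>k. \<Sum>i\<in>I. c i * u i k)"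
      using insert by (intro h.hom_mult) (auto intro: zero_sum_vecs_scale zero_sum_vecs_sum)
    also have "F (\<lambda>k. c i * u i k) = F (u i) [^]\<^bsub>K\<^esub> c i"
      using h.hom_int_pow[of "u i" "c i"] ui by (simp add: int_pow_Zn0)
    also have "F (\<lambda>k. \<Sum>i\<in>I. c i * u i k) = finprod K (\<lambda>i. F (u i) [^]\<^bsub>K\<^esub> c i) I"
      using insert by auto
    also have "F (u i) [^]\<^bsub>K\<^esub> c i \<otimes>\<^bsub>K\<^esub> finprod K (\<lambda>i. F (u i) [^]\<^bsub>K\<^esub> c i) I
       = finprod K (\<lambda>i. F (u i) [^]\<^bsub>K\<^esub> c i) (insert i I)"
      using insert Fc by (subst K.finprod_insert) auto
    finally show ?case .
  qed
qed

section \<open>Homomorphisms given by vertex labels\<close>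

definition edge_vec :: "nat \<Rightarrow> nat \<Rightarrow> nat \<Rightarrow> int" where
  "edge_vec i j = (\<lambda>k. (if k = i then 1 else 0) - (if k = j then 1 else 0))"

lemma edge_vec_mem: "i \<in> {1..n} \<Longrightarrow> j \<in> {1..n} \<Longrightarrow> edge_vec i j \<in> zero_sum_vecs n"
  by (auto simp: zero_sum_vecs_def int_vecs_def edge_vec_def sum_subtractf)

lemma zero_sum_vecs_expand:
  assumes v: "v \<in> zero_sum_vecs n"
  shows "v = (\<lambda>k. \<Sum>i\<in>{1..n}. v i * edge_vec i 1 k)"
proof
  fix k
  have "(\<Sum>i\<in>{1..n}. v i * edge_vec i 1 k) =
      (\<Sum>i\<in>{1..n}. if k = i then v i else 0) - (if k = 1 then (\<Sum>i\<in>{1..n}. v i) else 0)"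
  proof -
    have "v i * edge_vec i 1 k = (if k = i then v i else 0) - (if k = 1 then v i else 0)" for i
      by (simp add: edge_vec_def)
    then show ?thesis by (simp add: sum_subtractf)
  qed
  also have "\<dots> = v k" using v by (auto simp: zero_sum_vecs_def int_vecs_def)
  finally show "v k = (\<Sum>i\<in>{1..n}. v i * edge_vec i 1 k)" by simp
qed

text \<open>A labelling of the vertices defines a homomorphism on all integer vectors. Its
  restriction to zero-sum vectors does not change when all labels are multiplied by one element;
  \<open>pointed_maps\<close> removes this freedom by giving vertex 1 the label one.\<close>

definition vertex_hom :: "nat \<Rightarrow> ('b, 'd) monoid_scheme \<Rightarrow> (nat \<Rightarrow> 'b) \<Rightarrow> (nat \<Rightarrow> int) \<Rightarrow> 'b" where
  "vertex_hom n K f = (\<lambda>v\<in>zero_sum_vecs n. finprod K (\<lambda>i. f i [^]\<^bsub>K\<^esub> (v i)) {1..n})"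

definition pointed_maps :: "nat \<Rightarrow> ('b, 'd) monoid_scheme \<Rightarrow> (nat \<Rightarrow> 'b) set" where
  "pointed_maps n K = {f \<in> {1..n} \<rightarrow>\<^sub>E carrier K. f 1 = \<one>\<^bsub>K\<^esub>}"

lemma (in comm_group) vertex_hom_in_Homs:
  assumes f: "f \<in> {1..n} \<rightarrow> carrier G"
  shows "vertex_hom n G f \<in> Homs (Zn0 n) G"
proof -
  have "vertex_hom n G f \<in> hom (Zn0 n) G"
  proof (rule homI)
    fix v assume "v \<in> carrier (Zn0 n)"
    then show "vertex_hom n G f v \<in> carrier G" using f by (auto simp: vertex_hom_def intro!: finprod_closed)
  next
    fix v w assume v: "v \<in> carrier (Zn0 n)" "w \<in> carrier (Zn0 n)"
    then have "vertex_hom n G f (v \<otimes>\<^bsub>Zn0 n\<^esub> w) = finprod G (\<lambda>i. f i [^] (v i + w i)) {1..n}"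
      by (simp add: vertex_hom_def zero_sum_vecs_add)
    also have "\<dots> = finprod G (\<lambda>i. f i [^] (v i) \<otimes> f i [^] (w i)) {1..n}"
      using f by (intro finprod_cong') (auto simp: int_pow_mult Pi_iff)
    also have "\<dots> = vertex_hom n G f v \<otimes> vertex_hom n G f w"
      using f v by (subst finprod_multf) (auto simp: vertex_hom_def)
    finally show "vertex_hom n G f (v \<otimes>\<^bsub>Zn0 n\<^esub> w) = vertex_hom n G f v \<otimes> vertex_hom n G f w" .
  qed
  then show ?thesis by (simp add: Homs_def vertex_hom_def)
qed

lemma (in comm_group) vertex_hom_edge:
  assumes f: "f \<in> {1..n} \<rightarrow> carrier G" and ij: "i \<in> {1..n}" "j \<in> {1..n}"
  shows "vertex_hom n G f (edge_vec i j) = f i \<otimes> inv (f j)"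
proof (cases "i = j")
  case True
  have "finprod G (\<lambda>k. f k [^] edge_vec i j k) {1..n} = finprod G (\<lambda>k. \<one>) {1..n}"
    using f True by (intro finprod_cong') (auto simp: edge_vec_def)
  then show ?thesis using f ij edge_vec_mem[OF ij] True by (auto simp: vertex_hom_def Pi_iff)
next
  case False
  let ?g = "\<lambda>k. f k [^] edge_vec i j k"
  have fc: "f i \<in> carrier G" "f j \<in> carrier G" using f ij by auto
  have gc: "?g \<in> A \<rightarrow> carrier G" if "A \<subseteq> {1..n}" for A using f that by auto
  have "finprod G ?g {1..n} = finprod G ?g (insert i (insert j ({1..n} - {i,j})))"
    using ij by (intro arg_cong2[of _ _ _ _ "finprod G"]) auto
  also have "\<dots> = ?g i \<otimes> (?g j \<otimes> finprod G ?g ({1..n} - {i,j}))"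
    using False ij gc fc by (subst finprod_insert; (subst finprod_insert)?) auto
  also have "finprod G ?g ({1..n} - {i,j}) = finprod G (\<lambda>k. \<one>) ({1..n} - {i,j})"
    using f by (intro finprod_cong') (auto simp: edge_vec_def)
  finally show ?thesis using False fc edge_vec_mem[OF ij]
    by (simp add: vertex_hom_def edge_vec_def int_pow_neg)
qed

text \<open>The vectors \<open>edge_vec i 1\<close> span the lattice, so the values of
  \<open>F\<close> on them can be taken as labels.\<close>

lemma (in comm_group) Homs_Zn0_eq_vertex_hom:
  assumes F: "F \<in> Homs (Zn0 n) G"
  shows "F = vertex_hom n G (\<lambda>i\<in>{1..n}. F (edge_vec i 1))"
proof
  fix v
  show "F v = vertex_hom n G (\<lambda>i\<in>{1..n}. F (edge_vec i 1)) v"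
  proof (cases "v \<in> zero_sum_vecs n")
    case False
    then show ?thesis using F by (simp add: Homs_def vertex_hom_def extensional_def)
  next
    case True
    show ?thesis
    proof (cases "n = 0")
      case True
      interpret h: group_hom "Zn0 n" G F
        using F comm_group_Zn0[of n] by (simp add: group_hom_def group_hom_axioms_def Homs_def is_group comm_group_def)
      have "v = \<one>\<^bsub>Zn0 n\<^esub>" using \<open>v \<in> zero_sum_vecs n\<close> True by (auto simp: zero_sum_vecs_def int_vecs_def)
      then show ?thesis using h.hom_one True by (simp add: vertex_hom_def)
    next
      case False
      then have mem: "edge_vec i 1 \<in> zero_sum_vecs n" if "i \<in> {1..n}" for i using that by (intro edge_vec_mem) auto
      have Fc: "F (edge_vec i 1) \<in> carrier G" if "i \<in> {1..n}" for i
        using F mem[OF that] by (auto simp: Homs_def hom_def)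
      have "F v = F (\<lambda>k. \<Sum>i\<in>{1..n}. v i * edge_vec i 1 k)" using zero_sum_vecs_expand[OF True] by simp
      also have "\<dots> = finprod G (\<lambda>i. F (edge_vec i 1) [^] v i) {1..n}"
        using F mem by (intro hom_Zn0_sum[OF comm_group_axioms]) (auto simp: Homs_def)
      also have "\<dots> = finprod G (\<lambda>i. (\<lambda>i\<in>{1..n}. F (edge_vec i 1)) i [^] v i) {1..n}"
        using Fc by (intro finprod_cong') auto
      finally show ?thesis using True by (simp add: vertex_hom_def)
    qed
  qed
qed

lemma (in comm_group) bij_vertex_hom:
  assumes n: "n \<ge> 1"
  shows "bij_betw (vertex_hom n G) (pointed_maps n G) (Homs (Zn0 n) G)"
proof (rule bij_betw_byWitness[where f' = "\<lambda>F. \<lambda>i\<in>{1..n}. F (edge_vec i 1)"])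
  have n1: "1 \<in> {1..n}" using n by simp
  show "\<forall>f\<in>pointed_maps n G. (\<lambda>i\<in>{1..n}. vertex_hom n G f (edge_vec i 1)) = f"
  proof
    fix f assume f: "f \<in> pointed_maps n G"
    then have fc: "f \<in> {1..n} \<rightarrow> carrier G" by (auto simp: pointed_maps_def)
    show "(\<lambda>i\<in>{1..n}. vertex_hom n G f (edge_vec i 1)) = f"
    proof
      fix i show "(\<lambda>i\<in>{1..n}. vertex_hom n G f (edge_vec i 1)) i = f i"
      proof (cases "i \<in> {1..n}")
        case True
        then show ?thesis using f fc vertex_hom_edge[OF fc True n1]
          by (auto simp: pointed_maps_def Pi_iff)
      next
        case False
        then show ?thesis using f by (auto simp: pointed_maps_def PiE_def extensional_def)
      qed
    qed
  qed
  show "\<forall>F\<in>Homs (Zn0 n) G. vertex_hom n G (\<lambda>i\<in>{1..n}. F (edge_vec i 1)) = F"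
    using Homs_Zn0_eq_vertex_hom by simp
  show "vertex_hom n G ` pointed_maps n G \<subseteq> Homs (Zn0 n) G"
    using vertex_hom_in_Homs by (auto simp: pointed_maps_def)
  show "(\<lambda>F. \<lambda>i\<in>{1..n}. F (edge_vec i 1)) ` Homs (Zn0 n) G \<subseteq> pointed_maps n G"
  proof clarify
    fix F assume F: "F \<in> Homs (Zn0 n) G"
    interpret h: group_hom "Zn0 n" G F
      using F comm_group_Zn0[of n] by (simp add: group_hom_def group_hom_axioms_def Homs_def is_group comm_group_def)
    have "edge_vec 1 1 = \<one>\<^bsub>Zn0 n\<^esub>" by (auto simp: edge_vec_def)
    then have "F (edge_vec 1 1) = \<one>" using h.hom_one by simp
    moreover have "F (edge_vec i 1) \<in> carrier G" if "i \<in> {1..n}" for i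
      using h.hom_closed edge_vec_mem[OF that n1] by simp
    ultimately show "(\<lambda>i\<in>{1..n}. F (edge_vec i 1)) \<in> pointed_maps n G"
      using n1 by (auto simp: pointed_maps_def)
  qed
qed

lemma (in comm_group) card_pointed_maps:
  assumes n: "n \<ge> 1" and fin: "finite (carrier G)"
  shows "finite (pointed_maps n G)" "card (pointed_maps n G) = card (carrier G) ^ (n - 1)"
proof -
  have eq: "pointed_maps n G = PiE {1..n} (\<lambda>i. if i = 1 then {\<one>} else carrier G)"
    using n by (auto simp: pointed_maps_def PiE_iff extensional_def split: if_splits)
  show "finite (pointed_maps n G)" unfolding eq using fin by (intro finite_PiE) auto
  have "card (pointed_maps n G) = (\<Prod>i\<in>{1..n}. card (if i = 1 then {\<one>} else carrier G))"
    unfolding eq by (simp add: card_PiE)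
  also have "{1..n} = insert 1 {2..n}" using n by auto
  also have "(\<Prod>i\<in>insert 1 {2..n}. card (if i = 1 then {\<one>} else carrier G)) = (\<Prod>i\<in>{2..n}. card (carrier G))"
  proof -
    have "(\<Prod>i\<in>{2..n}. card (if i = 1 then {\<one>} else carrier G)) = (\<Prod>i\<in>{2..n}. card (carrier G))"
      by (intro prod.cong) auto
    then show ?thesis by simp
  qed
  also have "\<dots> = card (carrier G) ^ (n - 1)" using n by simp
  finally show "card (pointed_maps n G) = card (carrier G) ^ (n - 1)" .
qed

lemma (in comm_group) card_Homs_Zn0:
  assumes n: "n \<ge> 1" and fin: "finite (carrier G)"
  shows "finite (Homs (Zn0 n) G)" "card (Homs (Zn0 n) G) = card (carrier G) ^ (n - 1)"
  using card_pointed_maps[OF assms] bij_vertex_hom[OF n]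
  by (auto simp: bij_betw_same_card[symmetric] dest: bij_betw_finite)

section \<open>Columns of the Laplacian\<close>

definition laplacian_col :: "nat \<Rightarrow> (nat \<Rightarrow> nat \<Rightarrow> nat) \<Rightarrow> nat \<Rightarrow> nat \<Rightarrow> int" where
  "laplacian_col n D j = (\<lambda>k. \<Sum>i\<in>{1..n}-{j}. int (D j i) * edge_vec j i k)"

text \<open>Loops cancel between the out-degree and the diagonal correction, so only edges to other
  vertices remain. Written in the vectors \<open>edge_vec j i\<close>, column j is sent by a
  homomorphism to the endpoint of a walk whose step counts are the numbers of edges leaving
  j.\<close>

lemma laplacian_col_eq:
  assumes "k \<in> {1..n}" "j \<in> {1..n}"
  shows "laplacian_col n D j k = laplacian n D k j"
proof -
  have "laplacian_col n D j k = (\<Sum>i\<in>{1..n}-{j}. (if k = j then int (D j i) else 0) - (if i = k then int (D j i) else 0))"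
    unfolding laplacian_col_def edge_vec_def by (intro sum.cong) auto
  also have "\<dots> = (if k = j then (\<Sum>i\<in>{1..n}-{j}. int (D j i)) else 0) - (if k \<noteq> j then int (D j k) else 0)"
    unfolding sum_subtractf using assms by (auto simp: sum.delta)
  also have "\<dots> = laplacian n D k j"
    using assms by (auto simp: laplacian_def outdeg_def sum_diff1)
  finally show ?thesis .
qed

lemma laplacian_col_mem: "j \<in> {1..n} \<Longrightarrow> laplacian_col n D j \<in> zero_sum_vecs n"
  unfolding laplacian_col_def by (rule zero_sum_vecs_sum) (auto intro: edge_vec_mem)

lemma mat_vec_laplacian:
  "mat_vec n (laplacian n D) w = (\<lambda>k. \<Sum>j\<in>{1..n}. w j * laplacian_col n D j k)"
proof
  fix k
  show "mat_vec n (laplacian n D) w k = (\<Sum>j\<in>{1..n}. w j * laplacian_col n D j k)"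
  proof (cases "k \<in> {1..n}")
    case True
    then show ?thesis by (auto simp: mat_vec_def laplacian_col_eq mult.commute intro!: sum.cong)
  next
    case False
    then have "laplacian_col n D j k = 0" if "j \<in> {1..n}" for j
      using laplacian_col_mem[OF that, of D] by (auto simp: zero_sum_vecs_def int_vecs_def)
    with False show ?thesis by (auto simp: mat_vec_def)
  qed
qed

text \<open>The image is spanned by the columns, so these suffice as a test. The condition for
  column j involves only the edges leaving j, which later makes the n conditions
  independent.\<close>

lemma laplacian_image_subset_kernel_iff:
  assumes K: "comm_group K" and F: "F \<in> hom (Zn0 n) K"
  shows "laplacian_image n D \<subseteq> kernel (Zn0 n) K F \<longleftrightarrow>
     (\<forall>j\<in>{1..n}. finprod K (\<lambda>i. F (edge_vec j i) [^]\<^bsub>K\<^esub> D j i) ({1..n} - {j}) = \<one>\<^bsub>K\<^esub>)"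
proof -
  interpret K: comm_group K by (rule K)
  have Fc: "F v \<in> carrier K" if "v \<in> zero_sum_vecs n" for v using F that by (auto simp: hom_def)
  have col: "F (laplacian_col n D j) = finprod K (\<lambda>i. F (edge_vec j i) [^]\<^bsub>K\<^esub> D j i) ({1..n} - {j})"
    if j: "j \<in> {1..n}" for j
  proof -
    have "F (laplacian_col n D j) = finprod K (\<lambda>i. F (edge_vec j i) [^]\<^bsub>K\<^esub> int (D j i)) ({1..n} - {j})"
      unfolding laplacian_col_def by (rule hom_Zn0_sum[OF K F]) (use j in \<open>auto intro: edge_vec_mem\<close>)
    then show ?thesis by (simp add: int_pow_int)
  qed
  have "laplacian_image n D \<subseteq> kernel (Zn0 n) K F \<longleftrightarrow> (\<forall>j\<in>{1..n}. F (laplacian_col n D j) = \<one>\<^bsub>K\<^esub>)"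
  proof
    assume L: "laplacian_image n D \<subseteq> kernel (Zn0 n) K F"
    show "\<forall>j\<in>{1..n}. F (laplacian_col n D j) = \<one>\<^bsub>K\<^esub>"
    proof
      fix j assume j: "j \<in> {1..n}"
      let ?w = "\<lambda>i. if i = j then 1 else (0::int)"
      have "mat_vec n (laplacian n D) ?w = laplacian_col n D j"
      proof
        fix k
        have "(\<Sum>i\<in>{1..n}. ?w i * laplacian_col n D i k) = (\<Sum>i\<in>{1..n}. if i = j then laplacian_col n D i k else 0)"
          by (intro sum.cong) auto
        then show "mat_vec n (laplacian n D) ?w k = laplacian_col n D j k"
          unfolding mat_vec_laplacian using j by (simp add: sum.delta)
      qed
      moreover have "?w \<in> int_vecs n" using j unfolding int_vecs_def by simp
      ultimately have "laplacian_col n D j \<in> laplacian_image n D"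
        unfolding laplacian_image_def by (intro image_eqI[of _ _ ?w]) simp_all
      then show "F (laplacian_col n D j) = \<one>\<^bsub>K\<^esub>" using L by (auto simp: kernel_def)
    qed
  next
    assume c: "\<forall>j\<in>{1..n}. F (laplacian_col n D j) = \<one>\<^bsub>K\<^esub>"
    show "laplacian_image n D \<subseteq> kernel (Zn0 n) K F"
    proof
      fix v assume "v \<in> laplacian_image n D"
      then obtain w where v: "v = (\<lambda>k. \<Sum>j\<in>{1..n}. w j * laplacian_col n D j k)"
        unfolding laplacian_image_def mat_vec_laplacian by auto
      have "F v = finprod K (\<lambda>j. F (laplacian_col n D j) [^]\<^bsub>K\<^esub> w j) {1..n}"
        unfolding v by (rule hom_Zn0_sum[OF K F]) (auto intro: laplacian_col_mem)
      also have "\<dots> = finprod K (\<lambda>j. \<one>\<^bsub>K\<^esub>) {1..n}" using c by (intro K.finprod_cong') auto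
      finally have "F v = \<one>\<^bsub>K\<^esub>" by simp
      moreover have "v \<in> zero_sum_vecs n" unfolding v by (rule zero_sum_vecs_sum) (rule laplacian_col_mem)
      ultimately show "v \<in> kernel (Zn0 n) K F" by (simp add: kernel_def)
    qed
  qed
  then show ?thesis using col by simp
qed

lemma subgroup_laplacian_image: "subgroup (laplacian_image n D) (Zn0 n)"
proof -
  interpret comm_group "Zn0 n" by (rule comm_group_Zn0)
  have mv: "mat_vec n M (\<lambda>i. x i + y i) = (\<lambda>i. mat_vec n M x i + mat_vec n M y i)"
    "mat_vec n M (\<lambda>i. - x i) = (\<lambda>i. - mat_vec n M x i)" for M x y
    by (auto simp: mat_vec_def algebra_simps sum.distrib sum_negf)
  have sub: "laplacian_image n D \<subseteq> zero_sum_vecs n"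
    unfolding laplacian_image_def mat_vec_laplacian by (auto intro!: zero_sum_vecs_sum laplacian_col_mem)
  show ?thesis
  proof (rule subgroupI)
    show "laplacian_image n D \<subseteq> carrier (Zn0 n)" using sub by simp
    show "laplacian_image n D \<noteq> {}" by (auto simp: laplacian_image_def int_vecs_def)
  next
    fix a assume a: "a \<in> laplacian_image n D"
    then obtain x where "x \<in> int_vecs n" "a = mat_vec n (laplacian n D) x" by (auto simp: laplacian_image_def)
    then have "(\<lambda>i. - a i) = mat_vec n (laplacian n D) (\<lambda>i. - x i)" "(\<lambda>i. - x i) \<in> int_vecs n"
      by (auto simp: mv int_vecs_def)
    then have "(\<lambda>i. - a i) \<in> laplacian_image n D" unfolding laplacian_image_def by (rule image_eqI)
    then show "inv\<^bsub>Zn0 n\<^esub> a \<in> laplacian_image n D" using inv_Zn0 a sub by auto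
  next
    fix a b assume "a \<in> laplacian_image n D" "b \<in> laplacian_image n D"
    then obtain x y where "x \<in> int_vecs n" "a = mat_vec n (laplacian n D) x"
      "y \<in> int_vecs n" "b = mat_vec n (laplacian n D) y" by (auto simp: laplacian_image_def)
    then have "(\<lambda>i. a i + b i) = mat_vec n (laplacian n D) (\<lambda>i. x i + y i)" "(\<lambda>i. x i + y i) \<in> int_vecs n"
      by (auto simp: mv int_vecs_def)
    then have "(\<lambda>i. a i + b i) \<in> laplacian_image n D" unfolding laplacian_image_def by (rule image_eqI)
    then show "a \<otimes>\<^bsub>Zn0 n\<^esub> b \<in> laplacian_image n D" by simp
  qed
qed

section \<open>Moments of the sandpile group\<close>

text \<open>A prime generates a maximal ideal of the integers, by Bezout, and a residue class is
  contained in one coset of this ideal.\<close>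

lemma eps_balanced_rv_residue_balanced:
  assumes "eps_balanced_rv \<Z> P (\<lambda>w. int (y w)) eps"
  shows "residue_balanced eps (map_pmf y P)"
  unfolding residue_balanced_def
proof (intro allI impI)
  fix p r :: nat assume p: "Factorial_Ring.prime p"
  let ?I = "Idl\<^bsub>\<Z>\<^esub> {int p}"
  have mem: "z \<in> ?I \<longleftrightarrow> int p dvd z" for z
    by (auto simp: int_Idl dvd_def mult.commute)
  have "maximalideal ?I \<Z>"
  proof (rule maximalidealI)
    show "ideal ?I \<Z>" by (rule int.genideal_ideal) auto
    have "1 \<notin> ?I" using p by (auto simp: mem not_prime_1 dest: prime_gt_1_nat)
    then show "carrier \<Z> \<noteq> ?I" by auto
    fix J assume J: "ideal J \<Z>" "?I \<subseteq> J"
    show "J = ?I \<or> J = carrier \<Z>"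
    proof (cases "J \<subseteq> ?I")
      case False
      then obtain z where z: "z \<in> J" "\<not> int p dvd z" using mem by auto
      have "coprime (int p) z" using p z(2) prime_imp_coprime[of "int p" z] by auto
      then obtain u v where uv: "u * int p + v * z = 1" using bezout_int[of "int p" z] by auto
      interpret J: ideal J \<Z> by (rule J)
      have "u * int p \<in> J" using J(2) mem[of "u * int p"] by auto
      moreover have "v * z \<in> J" using J.I_l_closed[OF z(1), of v] by simp
      ultimately have "1 \<in> J" using J.a_closed[of "u * int p" "v * z"] uv by simp
      then show ?thesis using J.one_imp_carrier by simp
    qed (use J in auto)
  qed
  then have "measure_pmf.prob P {w. int (y w) \<in> ?I +>\<^bsub>\<Z>\<^esub> int r} \<le> 1 - eps"
    using assms unfolding eps_balanced_rv_def by auto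
  moreover have "{w. y w mod p = r} \<subseteq> {w. int (y w) \<in> ?I +>\<^bsub>\<Z>\<^esub> int r}"
  proof clarify
    fix w assume r: "r = y w mod p"
    have "int (y w) = int (y w div p) * int p + int (y w mod p)"
      by (metis div_mult_mod_eq of_nat_add of_nat_mult)
    moreover have "int (y w div p) * int p \<in> ?I" using mem by auto
    ultimately show "int (y w) \<in> ?I +>\<^bsub>\<Z>\<^esub> int (y w mod p)"
      by (auto simp: a_r_coset_def r_coset_def)
  qed
  then have "measure_pmf.prob P {w. y w mod p = r} \<le> measure_pmf.prob P {w. int (y w) \<in> ?I +>\<^bsub>\<Z>\<^esub> int r}"
    by (intro measure_pmf.finite_measure_mono) auto
  ultimately show "measure_pmf.prob (map_pmf y P) {d. d mod p = r} \<le> 1 - eps"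
    by (simp add: vimage_def)
qed

lemma residue_balanced_mono: "residue_balanced e \<mu> \<Longrightarrow> e' \<le> e \<Longrightarrow> residue_balanced e' \<mu>"
  unfolding residue_balanced_def by (meson diff_left_mono order_trans)

text \<open>Rows of out-edges are functions of disjoint blocks of the independent family, and inside
  one row independence is the product law \<open>Pi_pmf\<close>. Loops do not belong to the family;
  the entry (j, j) is replaced by 0.\<close>

lemma digraph_rows_independent:
  assumes bal: "eps_balanced_digraph n eps P" and n: "n \<ge> 1"
  shows "measure_pmf.prob P {D. \<forall>j\<in>{1..n}. E j (\<lambda>i. if i \<in> {1..n}-{j} then D j i else 0)} =
    (\<Prod>j\<in>{1..n}. measure_pmf.prob (Pi_pmf ({1..n}-{j}) 0 (\<lambda>i. map_pmf (\<lambda>D. D j i) P)) {r. E j r})"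
proof -
  define V where "V = {(i, j). i \<in> {1..n} \<and> j \<in> {1..n} \<and> i \<noteq> j}"
  define K where "K j = {j} \<times> ({1..n} - {j})" for j
  define row where "row j D = (\<lambda>i. if i \<in> {1..n}-{j} then D j i else 0)" for j and D :: "nat \<Rightarrow> nat \<Rightarrow> nat"
  let ?X = "\<lambda>(i, j) D. (D i j :: nat)"
  have ind: "prob_space.indep_vars (measure_pmf P) (\<lambda>_. count_space UNIV) ?X V"
    using bal unfolding eps_balanced_digraph_def V_def by simp
  have KV: "K j \<subseteq> V" if "j \<in> {1..n}" for j using that by (auto simp: K_def V_def)
  have finK: "finite (K j)" for j by (simp add: K_def)
  have law: "map_pmf (row j) P = Pi_pmf ({1..n}-{j}) 0 (\<lambda>i. map_pmf (\<lambda>D. D j i) P)" if j: "j \<in> {1..n}" for j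
  proof (rule pmf_eqI)
    fix h :: "nat \<Rightarrow> nat"
    let ?S = "{1..n} - {j}"
    show "pmf (map_pmf (row j) P) h = pmf (Pi_pmf ?S 0 (\<lambda>i. map_pmf (\<lambda>D. D j i) P)) h"
    proof (cases "\<forall>i. i \<notin> ?S \<longrightarrow> h i = 0")
      case False
      then obtain i where i: "i \<notin> ?S" "h i \<noteq> 0" by blast
      have "row j D i = 0" for D using i(1) unfolding row_def by (simp only: if_False)
      then have "h \<notin> row j ` set_pmf P" using i(2) by auto
      then have "pmf (map_pmf (row j) P) h = 0" by (simp add: pmf_eq_0_set_pmf)
      moreover have "pmf (Pi_pmf ?S 0 (\<lambda>i. map_pmf (\<lambda>D. D j i) P)) h = 0"
        using i by (intro pmf_Pi_outside) auto
      ultimately show ?thesis by simp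
    next
      case True
      have eq: "row j D = h \<longleftrightarrow> (\<forall>i\<in>?S. D j i = h i)" for D
        using True by (auto simp: row_def fun_eq_iff)
      have "pmf (map_pmf (row j) P) h = measure_pmf.prob P {D. \<forall>i\<in>?S. D j i = h i}"
        by (simp add: pmf_map vimage_def eq)
      also have "\<dots> = (\<Prod>i\<in>?S. measure_pmf.prob P {D. D j i = h i})"
      \<comment> \<open>\<open>indep_varsD\<close> is applied to a nonempty index set, hence the
        separate case of a row without off-diagonal entries.\<close>
      proof (cases "?S = {}")
        case True
        then show ?thesis unfolding True by simp
      next
        case False
        have "measure_pmf.prob P (\<Inter>x\<in>K j. ?X x -` {h (snd x)} \<inter> space (measure_pmf P))
          = (\<Prod>x\<in>K j. measure_pmf.prob P (?X x -` {h (snd x)} \<inter> space (measure_pmf P)))"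
          using False KV[OF j] finK
          by (intro prob_space.indep_varsD[OF _ ind]) (auto simp: prob_space_measure_pmf K_def)
        also have "(\<Inter>x\<in>K j. ?X x -` {h (snd x)} \<inter> space (measure_pmf P)) = {D. \<forall>i\<in>?S. D j i = h i}"
        proof -
          have "\<And>D. (D \<in> (\<Inter>x\<in>K j. ?X x -` {h (snd x)} \<inter> space (measure_pmf P))) = (\<forall>i\<in>?S. D j i = h i)"
            using False unfolding K_def by simp
          then show ?thesis by blast
        qed
        also have "(\<Prod>x\<in>K j. measure_pmf.prob P (?X x -` {h (snd x)} \<inter> space (measure_pmf P)))
           = (\<Prod>i\<in>?S. measure_pmf.prob P {D. D j i = h i})"
          by (rule prod.reindex_bij_witness[of _ "\<lambda>i. (j,i)" snd]) (auto simp: K_def vimage_def)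
        finally show ?thesis .
      qed
      also have "\<dots> = pmf (Pi_pmf ?S 0 (\<lambda>i. map_pmf (\<lambda>D. D j i) P)) h"
        using True by (subst pmf_Pi') (auto simp: pmf_map vimage_def)
      finally show ?thesis .
    qed
  qed
  let ?Y = "\<lambda>j D. restrict (\<lambda>x. ?X x D) (K j)"
  have ind2: "prob_space.indep_vars (measure_pmf P) (\<lambda>j. PiM (K j) (\<lambda>_. count_space UNIV)) ?Y {1..n}"
    by (rule prob_space.indep_vars_restrict[OF prob_space_measure_pmf ind KV])
       (auto simp: disjoint_family_on_def K_def)
  \<comment> \<open>An event on row j as a set of points of a finite product of countable discrete
    spaces; this product is again discrete, which settles measurability.\<close>
  define A where "A j = {r \<in> PiE (K j) (\<lambda>_. UNIV). E j (\<lambda>i. if i \<in> {1..n}-{j} then r (j,i) else 0)}" for j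
  have Aeq: "?Y j -` A j \<inter> space (measure_pmf P) = {D. E j (row j D)}" if j: "j \<in> {1..n}" for j
  proof -
    have "(\<lambda>i. if i \<in> {1..n}-{j} then ?Y j D (j,i) else 0) = row j D" for D
      by (auto simp: row_def K_def fun_eq_iff)
    then show ?thesis by (auto simp: A_def)
  qed
  have "measure_pmf.prob P (\<Inter>j\<in>{1..n}. ?Y j -` A j \<inter> space (measure_pmf P))
      = (\<Prod>j\<in>{1..n}. measure_pmf.prob P (?Y j -` A j \<inter> space (measure_pmf P)))"
  proof (rule prob_space.indep_varsD_finite[OF prob_space_measure_pmf ind2])
    fix j assume "j \<in> {1..n}"
    have "PiM (K j) (\<lambda>_. count_space (UNIV :: nat set)) = count_space (PiE (K j) (\<lambda>_. UNIV))"
      by (rule count_space_PiM_finite[OF finK]) auto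
    then show "A j \<in> sets (PiM (K j) (\<lambda>_. count_space UNIV))" by (auto simp: A_def)
  qed (use n in auto)
  also have "(\<Inter>j\<in>{1..n}. ?Y j -` A j \<inter> space (measure_pmf P)) = {D. \<forall>j\<in>{1..n}. E j (row j D)}"
    using Aeq n by (subst INF_cong[OF refl Aeq]) auto
  also have "(\<Prod>j\<in>{1..n}. measure_pmf.prob P (?Y j -` A j \<inter> space (measure_pmf P)))
     = (\<Prod>j\<in>{1..n}. measure_pmf.prob P {D. E j (row j D)})"
    using Aeq by (intro prod.cong) auto
  also have "\<dots> = (\<Prod>j\<in>{1..n}. measure_pmf.prob (map_pmf (row j) P) {r. E j r})"
    by (simp add: vimage_def)
  also have "\<dots> = (\<Prod>j\<in>{1..n}. measure_pmf.prob (Pi_pmf ({1..n}-{j}) 0 (\<lambda>i. map_pmf (\<lambda>D. D j i) P)) {r. E j r})"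
    using law by (intro prod.cong) auto
  finally show ?thesis by (simp add: row_def)
qed

text \<open>The chance that column j is sent to the identity: an edge from j to i contributes the
  step f j / f i, the value of \<open>vertex_hom\<close> at \<open>edge_vec j i\<close>.\<close>

definition row_return_prob ::
  "('b, 'd) monoid_scheme \<Rightarrow> nat \<Rightarrow> (nat \<Rightarrow> nat \<Rightarrow> nat) pmf \<Rightarrow> (nat \<Rightarrow> 'b) \<Rightarrow> nat \<Rightarrow> real" where
  "row_return_prob K n P f j =
     pmf (walk_pmf K (\<lambda>i. f j \<otimes>\<^bsub>K\<^esub> inv\<^bsub>K\<^esub> f i) (\<lambda>i. map_pmf (\<lambda>D. D j i) P) ({1..n}-{j})) \<one>\<^bsub>K\<^esub>"

lemma (in comm_group) prob_laplacian_in_kernel: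
  assumes bal: "eps_balanced_digraph n eps P" and n: "n \<ge> 1" and f: "f \<in> {1..n} \<rightarrow> carrier G"
  shows "measure_pmf.prob P {D. laplacian_image n D \<subseteq> kernel (Zn0 n) G (vertex_hom n G f)}
       = (\<Prod>j\<in>{1..n}. row_return_prob G n P f j)"
proof -
  let ?F = "vertex_hom n G f"
  let ?E = "\<lambda>j (r::nat \<Rightarrow> nat). finprod G (\<lambda>i. (f j \<otimes> inv f i) [^] r i) ({1..n} - {j}) = \<one>"
  have F: "?F \<in> hom (Zn0 n) G" using vertex_hom_in_Homs[OF f] by (simp add: Homs_def)
  have fc: "f i \<in> carrier G" if "i \<in> {1..n}" for i using f that by auto
  have "laplacian_image n D \<subseteq> kernel (Zn0 n) G ?F \<longleftrightarrow>
      (\<forall>j\<in>{1..n}. ?E j (\<lambda>i. if i \<in> {1..n}-{j} then D j i else 0))" for D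
    unfolding laplacian_image_subset_kernel_iff[OF comm_group_axioms F]
  proof (intro ball_cong refl arg_cong[of _ _ "\<lambda>x. x = \<one>"] finprod_cong')
    fix j i assume "j \<in> {1..n}" "i \<in> {1..n} - {j}"
    then show "?F (edge_vec j i) [^] D j i = (f j \<otimes> inv f i) [^] (if i \<in> {1..n} - {j} then D j i else 0)"
      using vertex_hom_edge[OF f, of j i] by auto
  qed (use fc in auto)
  then have "measure_pmf.prob P {D. laplacian_image n D \<subseteq> kernel (Zn0 n) G ?F} =
     measure_pmf.prob P {D. \<forall>j\<in>{1..n}. ?E j (\<lambda>i. if i \<in> {1..n}-{j} then D j i else 0)}" by simp
  also have "\<dots> = (\<Prod>j\<in>{1..n}. measure_pmf.prob (Pi_pmf ({1..n}-{j}) 0 (\<lambda>i. map_pmf (\<lambda>D. D j i) P)) {r. ?E j r})"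
    by (rule digraph_rows_independent[OF bal n])
  finally show ?thesis
    by (simp add: row_return_prob_def walk_pmf_def pmf_map vimage_def)
qed

section \<open>Frequent labels and the subgroup they span\<close>

context comm_group
begin

definition heavy_values :: "real \<Rightarrow> nat \<Rightarrow> (nat \<Rightarrow> 'a) \<Rightarrow> 'a set" where
  "heavy_values \<delta> n f = {k \<in> carrier G. \<delta> * real n \<le> real (card {i\<in>{1..n}. f i = k})}"

text \<open>The smallest subgroup with a coset containing all frequent labels. Differences are used
  because labels matter only up to a common factor.\<close>

definition heavy_subgroup :: "real \<Rightarrow> nat \<Rightarrow> (nat \<Rightarrow> 'a) \<Rightarrow> 'a set" where
  "heavy_subgroup \<delta> n f = generate G ((\<lambda>(a,b). a \<otimes> inv b) ` (heavy_values \<delta> n f \<times> heavy_values \<delta> n f))"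

lemma subgroup_heavy_subgroup: "subgroup (heavy_subgroup \<delta> n f) G"
  unfolding heavy_subgroup_def by (rule generate_is_subgroup) (auto simp: heavy_values_def)

lemma sum_card_fibres:
  assumes "finite A" "\<And>i. i \<in> I \<Longrightarrow> P i \<Longrightarrow> f i \<in> A" "finite I"
  shows "(\<Sum>k\<in>A. card {i\<in>I. P i \<and> f i = k}) = card {i\<in>I. P i}"
proof -
  have "{i\<in>I. P i} = (\<Union>k\<in>A. {i\<in>I. P i \<and> f i = k})" using assms(2) by blast
  moreover have "card (\<Union>k\<in>A. {i\<in>I. P i \<and> f i = k}) = (\<Sum>k\<in>A. card {i\<in>I. P i \<and> f i = k})"
    using assms(1,3) by (intro card_UN_disjoint) auto
  ultimately show ?thesis by metis
qed

text \<open>Pigeonhole: if every label occurred fewer than \<delta> n times, fewer than n vertices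
  would be labelled.\<close>

lemma heavy_values_nonempty:
  assumes fin: "finite (carrier G)" and f: "f \<in> {1..n} \<rightarrow> carrier G" and \<delta>: "\<delta> * real (card (carrier G)) \<le> 1"
    and n: "n \<ge> 1"
  shows "heavy_values \<delta> n f \<noteq> {}"
proof
  assume e: "heavy_values \<delta> n f = {}"
  have N: "card (carrier G) > 0" using fin one_closed card_gt_0_iff by blast
  have "real n = (\<Sum>k\<in>carrier G. real (card {i\<in>{1..n}. f i = k}))"
  proof -
    have "(\<Sum>k\<in>carrier G. card {i\<in>{1..n}. True \<and> f i = k}) = card {i\<in>{1..n}. True}"
      by (rule sum_card_fibres[OF fin]) (use f in auto)
    also have "{i\<in>{1..n}. True} = {1..n}" by auto
    finally have "(\<Sum>k\<in>carrier G. card {i\<in>{1..n}. f i = k}) = n" by simp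
    then show ?thesis by (metis of_nat_sum)
  qed
  also have "\<dots> < (\<Sum>k\<in>carrier G. \<delta> * real n)"
    using e fin by (intro sum_strict_mono) (auto simp: heavy_values_def not_le)
  also have "\<dots> = (\<delta> * real (card (carrier G))) * real n" by simp
  also have "\<dots> \<le> 1 * real n" using \<delta> by (intro mult_right_mono) auto
  finally show False by simp
qed

lemma heavy_values_in_coset:
  assumes x: "x \<in> heavy_values \<delta> n f" and k: "k \<in> heavy_values \<delta> n f"
  shows "k \<in> heavy_subgroup \<delta> n f #> x"
proof -
  have "k \<otimes> inv x \<in> heavy_subgroup \<delta> n f"
    unfolding heavy_subgroup_def using assms by (intro generate.incl) auto
  then show ?thesis using subgroup.rcos_module_rev[OF subgroup_heavy_subgroup is_group, of x k] assms
    by (auto simp: heavy_values_def)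
qed

text \<open>A label outside the coset is not heavy, so it occurs fewer than \<delta> n times, and
  there are at most |G| labels.\<close>

lemma card_exceptional_le:
  assumes fin: "finite (carrier G)" and f: "f \<in> {1..n} \<rightarrow> carrier G" and x: "x \<in> heavy_values \<delta> n f"
    and \<delta>: "\<delta> \<ge> 0"
  shows "real (card {i\<in>{1..n}. f i \<notin> heavy_subgroup \<delta> n f #> x}) \<le> \<delta> * real (card (carrier G)) * real n"
proof -
  let ?P = "\<lambda>i. f i \<notin> heavy_subgroup \<delta> n f #> x"
  have "real (card {i\<in>{1..n}. ?P i}) = (\<Sum>k\<in>carrier G. real (card {i\<in>{1..n}. ?P i \<and> f i = k}))"
    using sum_card_fibres[OF fin, of "{1..n}" ?P f] f by (simp add: Pi_iff flip: of_nat_sum)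
  also have "\<dots> \<le> (\<Sum>k\<in>carrier G. \<delta> * real n)"
  proof (rule sum_mono)
    fix k assume k: "k \<in> carrier G"
    show "real (card {i\<in>{1..n}. ?P i \<and> f i = k}) \<le> \<delta> * real n"
    proof (cases "k \<in> heavy_values \<delta> n f")
      case True
      then have "{i\<in>{1..n}. ?P i \<and> f i = k} = {}" using heavy_values_in_coset[OF x] by auto
      then have c: "card {i\<in>{1..n}. ?P i \<and> f i = k} = 0" by (simp only: card.empty)
      show ?thesis unfolding c using \<delta> by simp
    next
      case False
      have "card {i\<in>{1..n}. ?P i \<and> f i = k} \<le> card {i\<in>{1..n}. f i = k}" by (intro card_mono) auto
      then show ?thesis using False k by (auto simp: heavy_values_def)
    qed
  qed
  finally show ?thesis by (simp add: mult_ac)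
qed

text \<open>At a vertex labelled \<open>y\<close> the steps are the quotients y / a, and for
  frequent a and b the element a / b is the quotient of y / b by y / a. So the frequent steps
  generate at least \<open>heavy_subgroup\<close>, whatever \<open>y\<close> is.\<close>

lemma heavy_subgroup_subset:
  assumes y: "y \<in> carrier G"
  shows "heavy_subgroup \<delta> n f \<subseteq> generate G ((\<lambda>a. y \<otimes> inv a) ` heavy_values \<delta> n f)"
  unfolding heavy_subgroup_def
proof (rule generate_subgroup_incl)
  let ?S = "(\<lambda>a. y \<otimes> inv a) ` heavy_values \<delta> n f"
  have S: "?S \<subseteq> carrier G" using y by (auto simp: heavy_values_def)
  show sg: "subgroup (generate G ?S) G" by (rule generate_is_subgroup[OF S])
  show "(\<lambda>(a,b). a \<otimes> inv b) ` (heavy_values \<delta> n f \<times> heavy_values \<delta> n f) \<subseteq> generate G ?S"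
  proof clarify
    fix a b assume ab: "a \<in> heavy_values \<delta> n f" "b \<in> heavy_values \<delta> n f"
    then have c: "a \<in> carrier G" "b \<in> carrier G" by (auto simp: heavy_values_def)
    have "(y \<otimes> inv b) \<otimes> inv (y \<otimes> inv a) \<in> generate G ?S"
      using ab sg by (intro subgroup.m_closed[OF sg] subgroup.m_inv_closed[OF sg] generate.incl) auto
    moreover have "(y \<otimes> inv b) \<otimes> inv (y \<otimes> inv a) = a \<otimes> inv b"
    proof -
      have "(y \<otimes> inv b) \<otimes> inv (y \<otimes> inv a) = (y \<otimes> inv b) \<otimes> (inv y \<otimes> a)"
        using y c by (simp add: inv_mult)
      also have "\<dots> = (y \<otimes> inv y) \<otimes> (a \<otimes> inv b)" by (simp only: m_ac m_closed inv_closed y c)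
      finally show ?thesis using y c by simp
    qed
    ultimately show "a \<otimes> inv b \<in> generate G ?S" by simp
  qed
qed

text \<open>By the oscillation bound the return probability differs by at most \<eta> from the
  probability of any other point of \<open>H\<close>, so up to \<eta> it is the mean of the law over
  \<open>H\<close>. The three estimates use that \<open>H\<close> has mass at most 1, exactly 1 if
  it is the whole group, and at most 1 - \<epsilon> if some vertex is labelled off the coset of
  \<open>f j\<close>, since its step then lies outside \<open>H\<close>.\<close>

lemma row_return_prob_bounds:
  fixes C \<rho> \<delta> :: real
  assumes fin: "finite (carrier G)" and f: "f \<in> {1..n} \<rightarrow> carrier G" and j: "j \<in> {1..n}"
    and \<epsilon>: "\<epsilon> \<le> 1"
    and bal: "\<And>i. i \<in> {1..n}-{j} \<Longrightarrow> residue_balanced \<epsilon> (map_pmf (\<lambda>D. D j i) P)"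
    and osc: "\<And>I g \<mu> S c x u. finite (I::nat set) \<Longrightarrow> g \<in> I \<rightarrow> carrier G \<Longrightarrow> (\<And>i. i \<in> I \<Longrightarrow> residue_balanced \<epsilon> (\<mu> i)) \<Longrightarrow>
       S \<subseteq> carrier G \<Longrightarrow> (\<And>s. s \<in> S \<Longrightarrow> c \<le> card {i\<in>I. g i = s}) \<Longrightarrow> x \<in> carrier G \<Longrightarrow> u \<in> generate G S \<Longrightarrow>
       \<bar>pmf (walk_pmf G g \<mu> I) x - pmf (walk_pmf G g \<mu> I) (x \<otimes> u)\<bar> \<le> C * \<rho> ^ c"
  defines "\<eta> \<equiv> C * \<rho> ^ (nat \<lceil>\<delta> * real n\<rceil> - 1)"
    and "H \<equiv> heavy_subgroup \<delta> n f"
  shows "row_return_prob G n P f j \<le> 1 / real (card H) + \<eta>"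
    and "H = carrier G \<Longrightarrow> \<bar>row_return_prob G n P f j - 1 / real (card (carrier G))\<bar> \<le> \<eta>"
    and "x \<in> carrier G \<Longrightarrow> f j \<in> H #> x \<Longrightarrow> i \<in> {1..n} \<Longrightarrow> f i \<notin> H #> x \<Longrightarrow>
       row_return_prob G n P f j \<le> (1 - \<epsilon>) / real (card H) + \<eta>"
proof -
  let ?I = "{1..n} - {j}" and ?g = "\<lambda>i. f j \<otimes> inv f i" and ?\<mu> = "\<lambda>i. map_pmf (\<lambda>D. D j i) P"
  define W where "W = walk_pmf G ?g ?\<mu> ?I"
  have fc: "f i \<in> carrier G" if "i \<in> {1..n}" for i using f that by auto
  have g: "?g \<in> ?I \<rightarrow> carrier G" using fc j by auto
  have Hs: "subgroup H G" unfolding H_def by (rule subgroup_heavy_subgroup)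
  have Hc: "H \<subseteq> carrier G" using Hs subgroup.subset by blast
  have finH: "finite H" using Hc fin finite_subset by blast
  have cH: "card H > 0" using finH subgroup.one_closed[OF Hs] card_gt_0_iff by blast
  have near: "\<bar>pmf W \<one> - pmf W u\<bar> \<le> \<eta>" if u: "u \<in> H" for u
  proof -
    let ?S = "(\<lambda>a. f j \<otimes> inv a) ` heavy_values \<delta> n f"
    have "\<bar>pmf W \<one> - pmf W (\<one> \<otimes> u)\<bar> \<le> \<eta>"
      unfolding W_def \<eta>_def
    proof (rule osc[OF _ g bal])
      show "?S \<subseteq> carrier G" using fc[OF j] by (auto simp: heavy_values_def)
      show "u \<in> generate G ?S" using u heavy_subgroup_subset[OF fc[OF j]] unfolding H_def by blast
      fix s assume "s \<in> ?S"
      then obtain a where a: "a \<in> heavy_values \<delta> n f" "s = f j \<otimes> inv a" by auto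
      then have ac: "a \<in> carrier G" by (auto simp: heavy_values_def)
      have "{i\<in>?I. ?g i = s} = {i\<in>{1..n}. f i = a} - {j}"
      proof -
        have "f j \<otimes> inv f i = f j \<otimes> inv a \<longleftrightarrow> f i = a" if "i \<in> {1..n}" for i
          using fc[OF j] fc[OF that] ac by (metis inv_inv inv_closed l_cancel)
        then show ?thesis using a by auto
      qed
      \<comment> \<open>Vertex j takes no part in its own walk; its removal costs at most one
        occurrence, which is the -1 in the exponent of \<eta>.\<close>
      then have "card {i\<in>?I. ?g i = s} \<ge> card {i\<in>{1..n}. f i = a} - 1"
        by (metis card_Diff_singleton_if diff_le_self le_refl)
      moreover have "nat \<lceil>\<delta> * real n\<rceil> \<le> card {i\<in>{1..n}. f i = a}"
        using a(1) by (auto simp: heavy_values_def nat_le_iff ceiling_le_iff)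
      ultimately show "nat \<lceil>\<delta> * real n\<rceil> - 1 \<le> card {i\<in>?I. ?g i = s}" by linarith
    qed auto
    moreover have "\<one> \<otimes> u = u" using u Hc by auto
    ultimately show ?thesis by simp
  qed
  have row: "row_return_prob G n P f j = pmf W \<one>" by (simp add: row_return_prob_def W_def)
  have avg: "\<bar>real (card H) * pmf W \<one> - measure_pmf.prob W H\<bar> \<le> real (card H) * \<eta>"
  proof -
    have "real (card H) * pmf W \<one> - measure_pmf.prob W H = (\<Sum>u\<in>H. pmf W \<one> - pmf W u)"
      using finH by (simp add: measure_measure_pmf_finite sum_subtractf)
    also have "\<bar>\<dots>\<bar> \<le> (\<Sum>u\<in>H. \<eta>)" using near by (intro order_trans[OF sum_abs] sum_mono) auto
    finally show ?thesis by simp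
  qed
  have up: "pmf W \<one> \<le> q / real (card H) + \<eta>" if "measure_pmf.prob W H \<le> q" for q
  proof -
    have "real (card H) * pmf W \<one> \<le> q + real (card H) * \<eta>" using avg that by linarith
    then show ?thesis using cH by (simp add: field_simps)
  qed
  show "row_return_prob G n P f j \<le> 1 / real (card H) + \<eta>"
    unfolding row by (rule up) simp
  show "\<bar>row_return_prob G n P f j - 1 / real (card (carrier G))\<bar> \<le> \<eta>" if HG: "H = carrier G"
  proof -
    have "measure_pmf.prob W (carrier G) = 1"
      using walk_pmf_carrier[OF g] unfolding W_def by (simp add: measure_pmf.prob_eq_1 AE_measure_pmf_iff subset_iff)
    then have "\<bar>real (card H) * pmf W \<one> - 1\<bar> \<le> real (card H) * \<eta>" using avg HG by simp
    moreover have "real (card H) * pmf W \<one> - 1 = real (card H) * (pmf W \<one> - 1 / real (card H))"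
      using cH by (simp add: field_simps)
    ultimately have "real (card H) * \<bar>pmf W \<one> - 1 / real (card H)\<bar> \<le> real (card H) * \<eta>"
      by (simp add: abs_mult)
    then show ?thesis unfolding row using cH HG by (simp only: mult_le_cancel_left_pos of_nat_0_less_iff)
  qed
  show "row_return_prob G n P f j \<le> (1 - \<epsilon>) / real (card H) + \<eta>"
    if x: "x \<in> carrier G" "f j \<in> H #> x" and i: "i \<in> {1..n}" "f i \<notin> H #> x"
    unfolding row
  proof (rule up)
    have ij: "i \<noteq> j" using x i by auto
    have "?g i \<notin> H"
    proof
      assume gi: "?g i \<in> H"
      have "f j \<otimes> inv x \<in> H" using subgroup.rcos_module_imp[OF Hs is_group x(1) x(2)] .
      then have "inv (?g i) \<otimes> (f j \<otimes> inv x) \<in> H"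
        using gi subgroup.m_closed[OF Hs] subgroup.m_inv_closed[OF Hs] by blast
      moreover have "inv (?g i) \<otimes> (f j \<otimes> inv x) = f i \<otimes> inv x"
      proof -
        have "inv (?g i) \<otimes> (f j \<otimes> inv x) = (f j \<otimes> inv f j) \<otimes> (f i \<otimes> inv x)"
          by (simp only: inv_mult inv_inv m_ac m_closed inv_closed fc[OF j] fc[OF i(1)] x(1))
        then show ?thesis using fc[OF j] fc[OF i(1)] x(1) by simp
      qed
      ultimately have "f i \<in> H #> x" using subgroup.rcos_module_rev[OF Hs is_group x(1) fc[OF i(1)]] by simp
      then show False using i by simp
    qed
    then show "measure_pmf.prob W H \<le> 1 - \<epsilon>"
      unfolding W_def using i ij bal by (intro walk_coset_prob[OF _ _ g fin _ \<epsilon> Hs, of i]) auto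
  qed
qed

text \<open>An exponential Chebyshev inequality: a map with at most m exceptional vertices satisfies
  1 \<le> t^(-m) t^e, where e is their number, and the sum of the weighted products over all maps
  factorises over the vertices.\<close>

lemma exceptional_sum_bound:
  assumes fin: "finite (carrier G)" and t: "0 < t" "t \<le> (1::real)" and w: "\<And>k. k \<in> carrier G \<Longrightarrow> w k \<ge> (0::real)"
    and T: "T \<subseteq> {f \<in> {1..n} \<rightarrow>\<^sub>E carrier G. real (card {i\<in>{1..n}. f i \<notin> B}) \<le> m}"
  shows "(\<Sum>f\<in>T. \<Prod>j\<in>{1..n}. w (f j)) \<le>
     t powr (- m) * (\<Sum>k\<in>carrier G. w k * (if k \<in> B then 1 else t)) ^ n"
proof -
  let ?v = "\<lambda>k. w k * (if k \<in> B then 1 else t)"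
  have finP: "finite ({1..n} \<rightarrow>\<^sub>E carrier G)" using fin by (intro finite_PiE) auto
  have nonneg: "(\<Prod>j\<in>{1..n}. ?v (f j)) \<ge> 0" if "f \<in> {1..n} \<rightarrow>\<^sub>E carrier G" for f
    using that w t by (intro prod_nonneg) (auto simp: PiE_iff)
  have "(\<Sum>f\<in>T. \<Prod>j\<in>{1..n}. w (f j)) \<le> (\<Sum>f\<in>T. t powr (- m) * (\<Prod>j\<in>{1..n}. ?v (f j)))"
  proof (rule sum_mono)
    fix f assume "f \<in> T"
    then have f: "f \<in> {1..n} \<rightarrow>\<^sub>E carrier G" "real (card {i\<in>{1..n}. f i \<notin> B}) \<le> m" using T by auto
    have "(\<Prod>j\<in>{1..n}. if f j \<in> B then 1 else t) = t ^ card {i\<in>{1..n}. f i \<notin> B}"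
      by (simp add: prod.If_cases Int_def conj_commute)
    also have "\<dots> = t powr real (card {i\<in>{1..n}. f i \<notin> B})" using t by (simp add: powr_realpow)
    also have "\<dots> \<ge> t powr m" using t f(2) by (intro powr_mono') auto
    finally have "t powr (- m) * t powr m \<le> t powr (- m) * (\<Prod>j\<in>{1..n}. if f j \<in> B then 1 else t)"
      by (intro mult_left_mono) auto
    then have 1: "1 \<le> t powr (- m) * (\<Prod>j\<in>{1..n}. if f j \<in> B then 1 else t)"
      using t by (simp add: powr_add[symmetric])
    have "(\<Prod>j\<in>{1..n}. w (f j)) * 1 \<le> (\<Prod>j\<in>{1..n}. w (f j)) * (t powr (- m) * (\<Prod>j\<in>{1..n}. if f j \<in> B then 1 else t))"
      using f w 1 by (intro mult_left_mono prod_nonneg) (auto simp: PiE_iff)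
    also have "\<dots> = t powr (- m) * (\<Prod>j\<in>{1..n}. ?v (f j))"
      unfolding prod.distrib by (simp add: mult_ac)
    finally show "(\<Prod>j\<in>{1..n}. w (f j)) \<le> t powr (- m) * (\<Prod>j\<in>{1..n}. ?v (f j))" by simp
  qed
  also have "\<dots> \<le> (\<Sum>f\<in>{1..n} \<rightarrow>\<^sub>E carrier G. t powr (- m) * (\<Prod>j\<in>{1..n}. ?v (f j)))"
    using T nonneg by (intro sum_mono2[OF finP]) auto
  also have "\<dots> = t powr (- m) * (\<Prod>j\<in>{1..n}. \<Sum>k\<in>carrier G. ?v k)"
    by (subst prod_sum_PiE) (use fin in \<open>auto simp: sum_distrib_left\<close>)
  also have "\<dots> = t powr (- m) * (\<Sum>k\<in>carrier G. ?v k) ^ n" by simp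
  finally show ?thesis .
qed


text \<open>Relative to the label of vertex 1 all labels lie in \<open>H\<close>, and the value at a
  zero-sum vector is a product of powers of these quotients.\<close>

lemma vertex_hom_image_subset:
  assumes f: "f \<in> {1..n} \<rightarrow> carrier G" and H: "subgroup H G" and x: "x \<in> carrier G"
    and fH: "\<And>i. i \<in> {1..n} \<Longrightarrow> f i \<in> H #> x" and v: "v \<in> zero_sum_vecs n" and n: "n \<ge> 1"
  shows "vertex_hom n G f v \<in> H"
proof -
  have n1: "1 \<in> {1..n}" using n by simp
  have fc: "f i \<in> carrier G" if "i \<in> {1..n}" for i using f that by auto
  have F: "vertex_hom n G f \<in> hom (Zn0 n) G" using vertex_hom_in_Homs[OF f] by (simp add: Homs_def)
  have "vertex_hom n G f v = vertex_hom n G f (\<lambda>k. \<Sum>i\<in>{1..n}. v i * edge_vec i 1 k)"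
    using zero_sum_vecs_expand[OF v] by simp
  also have "\<dots> = finprod G (\<lambda>i. vertex_hom n G f (edge_vec i 1) [^] v i) {1..n}"
    by (rule hom_Zn0_sum[OF comm_group_axioms F]) (use n1 edge_vec_mem in auto)
  also have "\<dots> = finprod G (\<lambda>i. (f i \<otimes> inv f 1) [^] v i) {1..n}"
    using vertex_hom_edge[OF f _ n1] fc n1 by (intro finprod_cong') auto
  also have "\<dots> \<in> H"
  proof -
    have mem: "f i \<otimes> inv f 1 \<in> H" if i: "i \<in> {1..n}" for i
    proof -
      have "H #> x = H #> f 1" using fH[OF n1] H x repr_independence by metis
      then show ?thesis using fH[OF i] fc[OF n1] subgroup.rcos_module_imp[OF H is_group] by metis
    qed
    have "finprod G (\<lambda>i. (f i \<otimes> inv f 1) [^] v i) I \<in> H" if "finite I" "I \<subseteq> {1..n}" for I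
      using that
    proof (induction I rule: finite_induct)
      case empty
      then show ?case using subgroup.one_closed[OF H] by simp
    next
      case (insert i I)
      have "finprod G (\<lambda>i. (f i \<otimes> inv f 1) [^] v i) (insert i I)
          = (f i \<otimes> inv f 1) [^] v i \<otimes> finprod G (\<lambda>i. (f i \<otimes> inv f 1) [^] v i) I"
        using insert fc n1 by (subst finprod_insert) auto
      also have "\<dots> \<in> H"
        using insert mem[of i] subgroup_int_pow_closed[OF H] by (intro subgroup.m_closed[OF H]) auto
      finally show ?case .
    qed
    then show ?thesis by auto
  qed
  finally show ?thesis .
qed

text \<open>A heavy value is attained because \<delta> n > 0, so the generators of
  \<open>heavy_subgroup\<close> are values at edge vectors.\<close>

lemma vertex_hom_surj_if_heavy:
  assumes f: "f \<in> {1..n} \<rightarrow> carrier G" and H: "heavy_subgroup \<delta> n f = carrier G" and \<delta>: "\<delta> > 0" and n: "n \<ge> 1"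
  shows "vertex_hom n G f ` zero_sum_vecs n = carrier G"
proof -
  have Fh: "vertex_hom n G f \<in> hom (Zn0 n) G" using vertex_hom_in_Homs[OF f] by (simp add: Homs_def)
  interpret h: group_hom "Zn0 n" G "vertex_hom n G f"
    using Fh comm_group_Zn0[of n] by (simp add: group_hom_def group_hom_axioms_def is_group comm_group_def)
  have "subgroup (vertex_hom n G f ` zero_sum_vecs n) G"
    using h.img_is_subgroup by simp
  moreover have "(\<lambda>(a,b). a \<otimes> inv b) ` (heavy_values \<delta> n f \<times> heavy_values \<delta> n f) \<subseteq> vertex_hom n G f ` zero_sum_vecs n"
  proof clarify
    fix a b assume ab: "a \<in> heavy_values \<delta> n f" "b \<in> heavy_values \<delta> n f"
    have ex: "\<exists>i\<in>{1..n}. f i = k" if "k \<in> heavy_values \<delta> n f" for k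
    proof (rule ccontr)
      assume "\<not> ?thesis"
      then have "{i\<in>{1..n}. f i = k} = {}" by auto
      then have c: "card {i\<in>{1..n}. f i = k} = 0" by (simp only: card.empty)
      have "\<delta> * real n \<le> real (card {i\<in>{1..n}. f i = k})" using that unfolding heavy_values_def by blast
      then have "\<delta> * real n \<le> 0" unfolding c by simp
      then show False using \<delta> n by (simp add: mult_le_0_iff)
    qed
    obtain i j where ij: "i \<in> {1..n}" "f i = a" "j \<in> {1..n}" "f j = b" using ex ab by metis
    then have "a \<otimes> inv b = vertex_hom n G f (edge_vec i j)" using vertex_hom_edge[OF f ij(1,3)] by simp
    then show "a \<otimes> inv b \<in> vertex_hom n G f ` zero_sum_vecs n" using edge_vec_mem[OF ij(1,3)] by blast
  qed
  ultimately have "heavy_subgroup \<delta> n f \<subseteq> vertex_hom n G f ` zero_sum_vecs n"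
    unfolding heavy_subgroup_def by (intro generate_subgroup_incl)
  moreover have "vertex_hom n G f ` zero_sum_vecs n \<subseteq> carrier G" using h.hom_closed by auto
  ultimately show ?thesis using H by auto
qed

lemma subgroup_proper_card_le:
  assumes fin: "finite (carrier G)" and H: "subgroup H G" and ne: "H \<noteq> carrier G"
  shows "2 * card H \<le> card (carrier G)"
proof -
  have l: "card (rcosets H) * card H = card (carrier G)" using lagrange[OF H] by (simp add: Coset.order_def)
  have "card (carrier G) > 0" using fin one_closed card_gt_0_iff by blast
  then have pos: "card (rcosets H) > 0" using l by (metis gr0I mult_0)
  have "card (rcosets H) \<noteq> 1"
  proof
    assume "card (rcosets H) = 1"
    then have "card H = card (carrier G)" using l by simp
    then show False using ne fin subgroup.subset[OF H] card_subset_eq by metis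
  qed
  then have "2 \<le> card (rcosets H)" using pos by linarith
  then show ?thesis unfolding l[symmetric] by (rule mult_le_mono1)
qed

end

section \<open>The estimate of one surjection moment\<close>

context comm_group
begin

text \<open>The logarithmic slack between the decay rates 1 - \<epsilon>/2 and 1 - \<epsilon>/4. It
  pays for the factor t^(-\<gamma>) per vertex in the exponential Chebyshev bound.\<close>

definition chern_exp :: "real \<Rightarrow> real" where
  "chern_exp \<epsilon> = ln ((1 - \<epsilon>/4) / (1 - \<epsilon>/2))"

text \<open>For a typical labelling the frequent labels span the whole group: each column returns
  with probability 1/N up to \<eta>, so all columns return with probability close to N^(-n), and
  nearly all N^(n - 1) pointed labellings are typical. The term 2 Z (1 - \<epsilon>/4)^n accounts
  for the exceptional labellings twice: for their own contribution as surjections, and for their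
  absence from the typical ones.\<close>

lemma sur_moment_laplacian_bound:
  assumes fin: "finite (carrier G)" and \<epsilon>: "0 < \<epsilon>" "\<epsilon> \<le> 1/2"
  obtains C \<rho> \<delta> Z :: real where "C > 0" "0 < \<rho>" "\<rho> < 1" "0 < \<delta>" "Z \<ge> 0"
    "\<And>n eps P. n \<ge> 1 \<Longrightarrow> eps_balanced_digraph n eps P \<Longrightarrow> eps \<ge> \<epsilon> \<Longrightarrow>
       real (card (carrier G)) * (C * \<rho> ^ (nat \<lceil>\<delta> * real n\<rceil> - 1)) \<le> \<epsilon> / 8 \<Longrightarrow>
       \<bar>(\<Sum>F\<in>Surs (Zn0 n) G. measure_pmf.prob P {D. laplacian_image n D \<subseteq> kernel (Zn0 n) G F}) - 1 / real (card (carrier G))\<bar>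
         \<le> 2 * Z * (1 - \<epsilon>/4) ^ n + ((1 + real (card (carrier G)) * (C * \<rho> ^ (nat \<lceil>\<delta> * real n\<rceil> - 1))) ^ n - 1)"
proof -
  define N where "N = real (card (carrier G))"
  have "card (carrier G) > 0" using fin one_closed card_gt_0_iff by blast
  then have N1: "N \<ge> 1" unfolding N_def by linarith
  have e1: "\<epsilon> \<le> 1" using \<epsilon> by simp
  obtain C \<rho> :: real where C: "C > 0" "0 < \<rho>" "\<rho> < 1" and osc:
    "\<And>I g \<mu> S c x u. finite (I::nat set) \<Longrightarrow> g \<in> I \<rightarrow> carrier G \<Longrightarrow> (\<And>i. i \<in> I \<Longrightarrow> residue_balanced \<epsilon> (\<mu> i)) \<Longrightarrow>
       S \<subseteq> carrier G \<Longrightarrow> (\<And>s. s \<in> S \<Longrightarrow> c \<le> card {i\<in>I. g i = s}) \<Longrightarrow> x \<in> carrier G \<Longrightarrow> u \<in> generate G S \<Longrightarrow>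
       \<bar>pmf (walk_pmf G g \<mu> I) x - pmf (walk_pmf G g \<mu> I) (x \<otimes> u)\<bar> \<le> C * \<rho> ^ c"
  proof (rule walk_oscillation[OF fin \<epsilon>(1) e1, where ?'i = nat], goal_cases)
    case (1 C \<rho>)
    show ?case by (rule 1(1)[OF 1(2-4)]) (fact 1(5))
  qed
  \<comment> \<open>Vertices off the coset will contribute at most 2 N t = \<epsilon>/4 per vertex,
    less than the gain \<epsilon> of the vertices on it.\<close>
  define t where "t = \<epsilon> / (8 * N)"
  have t: "0 < t" "t < 1" "N * t = \<epsilon> / 8" using \<epsilon> N1 by (auto simp: t_def field_simps)
  define \<theta> where "\<theta> = 1 - \<epsilon>/4"
  \<comment> \<open>The tolerated proportion of exceptional vertices, small enough for t^(-\<gamma>)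
    to fit into the slack of \<open>chern_exp\<close>. The minimum with 1 ensures \<delta> N \<le>
    1, so that some label is heavy.\<close>
  define \<gamma> where "\<gamma> = min 1 (chern_exp \<epsilon> / ln (1/t))"
  have lnt: "ln (1/t) > 0" using t by simp
  have ch: "chern_exp \<epsilon> > 0" unfolding chern_exp_def using \<epsilon> by (intro ln_gt_zero) (simp add: field_simps)
  have \<gamma>: "0 < \<gamma>" "\<gamma> \<le> 1" using lnt ch by (auto simp: \<gamma>_def)
  have tg: "t powr (- \<gamma>) * (1 - \<epsilon>/2) \<le> \<theta>"
  proof -
    have "t powr (- \<gamma>) = exp (\<gamma> * ln (1/t))" using t by (simp add: powr_def ln_div)
    also have "\<gamma> * ln (1/t) \<le> chern_exp \<epsilon> / ln (1/t) * ln (1/t)"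
      using lnt by (intro mult_right_mono) (auto simp: \<gamma>_def)
    also have "\<dots> = chern_exp \<epsilon>" using lnt by simp
    also have "exp (chern_exp \<epsilon>) = (1 - \<epsilon>/4) / (1 - \<epsilon>/2)"
      unfolding chern_exp_def using \<epsilon> by (intro exp_ln divide_pos_pos) auto
    finally have "t powr (- \<gamma>) \<le> (1 - \<epsilon>/4) / (1 - \<epsilon>/2)" by simp
    then show ?thesis using \<epsilon> by (simp add: \<theta>_def field_simps)
  qed
  \<comment> \<open>With this threshold \<open>card_exceptional_le\<close> leaves at most \<gamma> n
    exceptional vertices.\<close>
  define \<delta> where "\<delta> = \<gamma> / N"
  have \<delta>: "0 < \<delta>" "\<delta> * N = \<gamma>" using \<gamma> N1 by (auto simp: \<delta>_def)
  \<comment> \<open>The possible types of an exceptional labelling: the proper subgroup spanned by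
    its heavy labels, and one heavy label that fixes the coset.\<close>
  define Q where "Q = {H. subgroup H G \<and> H \<noteq> carrier G} \<times> carrier G"
  have finQ: "finite Q" unfolding Q_def using fin
    by (intro finite_cartesian_product finite_subset[of "{H. subgroup H G \<and> H \<noteq> carrier G}" "Pow (carrier G)"])
       (auto dest: subgroup.subset)
  define Z where "Z = real (card Q)"
  show thesis
  proof (rule that[OF C \<delta>(1)])
    show "Z \<ge> 0" by (simp add: Z_def)
    fix n :: nat and eps P
    assume n: "n \<ge> 1" and bal: "eps_balanced_digraph n eps P" and eps: "eps \<ge> \<epsilon>"
      and small: "real (card (carrier G)) * (C * \<rho> ^ (nat \<lceil>\<delta> * real n\<rceil> - 1)) \<le> \<epsilon> / 8"
    define \<eta> where "\<eta> = C * \<rho> ^ (nat \<lceil>\<delta> * real n\<rceil> - 1)"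
    have \<eta>0: "\<eta> \<ge> 0" using C by (simp add: \<eta>_def)
    have N\<eta>: "N * \<eta> \<le> \<epsilon> / 8" using small by (simp add: \<eta>_def N_def)
    have N\<eta>0: "N * \<eta> \<ge> 0" using N1 \<eta>0 by simp
    have rb: "residue_balanced \<epsilon> (map_pmf (\<lambda>D. D j i) P)" if "j \<in> {1..n}" "i \<in> {1..n} - {j}" for j i
    proof -
      have "eps_balanced_rv \<Z> P (\<lambda>D. int (D j i)) eps"
        using bal that unfolding eps_balanced_digraph_def by auto
      from eps_balanced_rv_residue_balanced[OF this] show ?thesis by (rule residue_balanced_mono[OF _ eps])
    qed
    define p where "p f = (\<Prod>j\<in>{1..n}. row_return_prob G n P f j)" for f
    define Ph where "Ph = pointed_maps n G"
    define H where "H f = heavy_subgroup \<delta> n f" for f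
    define Ty where "Ty = {f \<in> Ph. H f = carrier G}"
    define Su where "Su = {f \<in> Ph. vertex_hom n G f ` zero_sum_vecs n = carrier G}"
    have finPh: "finite Ph" "card Ph = card (carrier G) ^ (n - 1)" 
      unfolding Ph_def using card_pointed_maps[OF n fin] by auto
    have Phc: "f \<in> {1..n} \<rightarrow> carrier G" "f \<in> {1..n} \<rightarrow>\<^sub>E carrier G" if "f \<in> Ph" for f 
      using that by (auto simp: Ph_def pointed_maps_def)
    have TySu: "Ty \<subseteq> Su" unfolding Ty_def Su_def H_def using vertex_hom_surj_if_heavy[OF Phc(1) _ \<delta>(1) n] by auto
    have r0: "row_return_prob G n P f j \<ge> 0" for f j by (simp add: row_return_prob_def)
    have p0: "p f \<ge> 0" for f unfolding p_def by (intro prod_nonneg) (simp add: r0)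
    have row1: "row_return_prob G n P f j \<le> 1 / real (card (H f)) + \<eta>" if "f \<in> Ph" "j \<in> {1..n}" for f j
      unfolding H_def \<eta>_def
      by (rule row_return_prob_bounds(1)[OF fin Phc(1)[OF that(1)] that(2) e1]) (fact rb[OF that(2)] | fact osc)+
    have row2: "\<bar>row_return_prob G n P f j - 1 / N\<bar> \<le> \<eta>" if "f \<in> Ph" "j \<in> {1..n}" "H f = carrier G" for f j
      unfolding N_def \<eta>_def
      by (rule row_return_prob_bounds(2)[OF fin Phc(1)[OF that(1)] that(2) e1])
         (fact rb[OF that(2)] | fact osc | fact that(3)[unfolded H_def])+
    have row3: "row_return_prob G n P f j \<le> (1 - \<epsilon>) / real (card (H f)) + \<eta>"
      if "f \<in> Ph" "j \<in> {1..n}" "x \<in> carrier G" "f j \<in> H f #> x" "i \<in> {1..n}" "f i \<notin> H f #> x" for f j i x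
      unfolding H_def \<eta>_def
      by (rule row_return_prob_bounds(3)[OF fin Phc(1)[OF that(1)] that(2) e1])
         (fact rb[OF that(2)] | fact osc | fact that(3-6)[unfolded H_def])+
    have sum_eq: "(\<Sum>F\<in>Surs (Zn0 n) G. measure_pmf.prob P {D. laplacian_image n D \<subseteq> kernel (Zn0 n) G F}) = (\<Sum>f\<in>Su. p f)"
    proof -
      have bij: "bij_betw (vertex_hom n G) Su (Surs (Zn0 n) G)"
      proof -
        have b: "bij_betw (vertex_hom n G) Ph (Homs (Zn0 n) G)" unfolding Ph_def by (rule bij_vertex_hom[OF n])
        have "vertex_hom n G ` Su = Surs (Zn0 n) G"
        proof
          show "vertex_hom n G ` Su \<subseteq> Surs (Zn0 n) G"
            using b by (auto simp: Su_def Surs_def bij_betw_def)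
          show "Surs (Zn0 n) G \<subseteq> vertex_hom n G ` Su"
          proof
            fix F assume F: "F \<in> Surs (Zn0 n) G"
            then obtain f where "f \<in> Ph" "F = vertex_hom n G f" using b by (auto simp: Surs_def bij_betw_def)
            with F show "F \<in> vertex_hom n G ` Su" by (auto simp: Su_def Surs_def)
          qed
        qed
        moreover have "inj_on (vertex_hom n G) Su" using b by (auto simp: Su_def bij_betw_def inj_on_def)
        ultimately show ?thesis by (simp add: bij_betw_def)
      qed
      have "(\<Sum>f\<in>Su. p f) = (\<Sum>f\<in>Su. measure_pmf.prob P {D. laplacian_image n D \<subseteq> kernel (Zn0 n) G (vertex_hom n G f)})"
        using prob_laplacian_in_kernel[OF bal n Phc(1)] by (intro sum.cong) (auto simp: p_def Su_def)
      also have "\<dots> = (\<Sum>F\<in>Surs (Zn0 n) G. measure_pmf.prob P {D. laplacian_image n D \<subseteq> kernel (Zn0 n) G F})"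
        by (rule sum.reindex_bij_betw[OF bij])
      finally show ?thesis by simp
    qed
    define Ex where "Ex = (\<lambda>(K,x). {f \<in> Ph - Ty. H f = K \<and> x \<in> heavy_values \<delta> n f})"
    have heavy_ne: "heavy_values \<delta> n f \<noteq> {}" if "f \<in> Ph" for f
      using heavy_values_nonempty[OF fin Phc(1)[OF that] _ n] \<delta>(2) \<gamma>(2) unfolding N_def by auto
    have cover: "Ph - Ty \<subseteq> (\<Union>q\<in>Q. Ex q)"
    proof
      fix f assume f: "f \<in> Ph - Ty"
      then obtain x where "x \<in> heavy_values \<delta> n f" using heavy_ne by blast
      then have "f \<in> Ex (H f, x)" "(H f, x) \<in> Q" 
        using f subgroup_heavy_subgroup by (auto simp: Ex_def Q_def H_def Ty_def heavy_values_def)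
      then show "f \<in> (\<Union>q\<in>Q. Ex q)" by blast
    qed
    have Exsub: "Ex (K,x) \<subseteq> {f \<in> {1..n} \<rightarrow>\<^sub>E carrier G. real (card {i\<in>{1..n}. f i \<notin> K #> x}) \<le> \<gamma> * real n}" for K x
    proof
      fix f assume f: "f \<in> Ex (K,x)"
      then have "real (card {i\<in>{1..n}. f i \<notin> H f #> x}) \<le> \<delta> * real (card (carrier G)) * real n"
        unfolding H_def by (intro card_exceptional_le[OF fin]) (use Phc \<delta> in \<open>auto simp: Ex_def\<close>)
      then show "f \<in> {f \<in> {1..n} \<rightarrow>\<^sub>E carrier G. real (card {i\<in>{1..n}. f i \<notin> K #> x}) \<le> \<gamma> * real n}"
        using f Phc(2) \<delta>(2) by (auto simp: Ex_def N_def)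
    qed
    have tpow: "t powr (- (\<gamma> * real n)) * y ^ n \<le> \<theta> ^ n" if "0 \<le> y" "y \<le> 1 - \<epsilon>/2" for y
    proof -
      have "t powr (- (\<gamma> * real n)) = (t powr (- \<gamma>)) ^ n" using t
        by (simp add: powr_realpow[symmetric] powr_powr)
      then have "t powr (- (\<gamma> * real n)) * y ^ n = (t powr (- \<gamma>) * y) ^ n" by (simp add: power_mult_distrib)
      also have "\<dots> \<le> \<theta> ^ n"
      proof (rule power_mono)
        have "t powr (- \<gamma>) * y \<le> t powr (- \<gamma>) * (1 - \<epsilon>/2)" using that by (intro mult_left_mono) auto
        then show "t powr (- \<gamma>) * y \<le> \<theta>" using tg by linarith
      qed (use that in simp)
      finally show ?thesis .
    qed
    have wsum: "(\<Sum>k\<in>carrier G. (if k \<in> K #> x then a else b) * (if k \<in> K #> x then 1 else t)) 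
        = real (card K) * a + (N - real (card K)) * (b * t)" if "(K,x) \<in> Q" for K x a b
    proof -
      have K: "subgroup K G" "x \<in> carrier G" using that by (auto simp: Q_def)
      have sub: "K #> x \<subseteq> carrier G" using K r_coset_subset_G subgroup.subset by blast
      have "K #> x \<in> rcosets K" using K rcosetsI subgroup.subset by blast
      then have "\<exists>f. bij_betw f K (K #> x)" using card_cosets_equal K(1) subgroup.subset by blast
      then have cK: "card (K #> x) = card K" using bij_betw_same_card by metis
      have "(\<Sum>k\<in>carrier G. (if k \<in> K #> x then a else b) * (if k \<in> K #> x then 1 else t)) =
          (\<Sum>k\<in>carrier G. if k \<in> K #> x then a else b * t)" by (intro sum.cong) auto
      also have "\<dots> = real (card (carrier G \<inter> (K #> x))) * a + real (card (carrier G \<inter> - (K #> x))) * (b * t)"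
        using fin by (simp add: sum.If_cases)
      also have "carrier G \<inter> (K #> x) = K #> x" using sub by auto
      also have "carrier G \<inter> - (K #> x) = carrier G - (K #> x)" by auto
      also have "real (card (carrier G - (K #> x))) = N - real (card K)"
      proof -
        have "card K \<le> card (carrier G)" using card_mono[OF fin sub] cK by simp
        moreover have "card (carrier G - (K #> x)) = card (carrier G) - card K"
          using card_Diff_subset[OF finite_subset[OF sub fin] sub] cK by simp
        ultimately show ?thesis by (simp add: N_def of_nat_diff)
      qed
      finally show ?thesis using cK by simp
    qed
    have Kbd: "1 \<le> card K" "2 * real (card K) \<le> N" "subgroup K G" if "(K,x) \<in> Q" for K x
    proof -
      show s: "subgroup K G" using that by (auto simp: Q_def)
      show "2 * real (card K) \<le> N" using subgroup_proper_card_le[OF fin s] that unfolding N_def Q_def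
        by (metis (mono_tags, lifting) mem_Collect_eq mem_Sigma_iff of_nat_le_iff of_nat_mult of_nat_numeral)
      have "finite K" using finite_subset[OF subgroup.subset[OF s] fin] .
      moreover have "K \<noteq> {}" using subgroup.one_closed[OF s] by blast
      ultimately show "1 \<le> card K" by (simp add: Suc_leI card_gt_0_iff)
    qed
    \<comment> \<open>Plain counting is the case of constant weight 1. A proper subgroup has at most
      half the elements, so the sum at one vertex is at most N (1 - \<epsilon>/2).\<close>
    have cntEx: "real (card (Ex (K,x))) \<le> N ^ n * \<theta> ^ n" if q: "(K,x) \<in> Q" for K x
    proof -
      have "real (card (Ex (K,x))) = (\<Sum>f\<in>Ex (K,x). \<Prod>j\<in>{1..n}. 1)" by simp
      also have "\<dots> \<le> t powr (- (\<gamma> * real n)) * (\<Sum>k\<in>carrier G. 1 * (if k \<in> K #> x then 1 else t)) ^ n"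
        by (rule exceptional_sum_bound[OF fin t(1) _ _ Exsub]) (use t in auto)
      also have "(\<Sum>k\<in>carrier G. 1 * (if k \<in> K #> x then 1 else t)) = real (card K) + (N - real (card K)) * t"
        using wsum[OF q, of 1 1] by simp
      also have "t powr (- (\<gamma> * real n)) * (real (card K) + (N - real (card K)) * t) ^ n
          = N ^ n * (t powr (- (\<gamma> * real n)) * ((real (card K) + (N - real (card K)) * t) / N) ^ n)"
        using N1 by (simp add: power_divide)
      also have "\<dots> \<le> N ^ n * \<theta> ^ n"
      proof (intro mult_left_mono tpow)
        have "(N - real (card K)) * t \<le> N * t" using t by (intro mult_right_mono) auto
        then have le: "real (card K) + (N - real (card K)) * t \<le> N / 2 + \<epsilon> / 8" using Kbd(2)[OF q] t by linarith
        have "\<epsilon> / 8 \<le> N * (\<epsilon> / 8)" using N1 \<epsilon> by simp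
        then have "N / 2 + \<epsilon> / 8 \<le> N * (1/2 + \<epsilon> / 8)" by (simp add: algebra_simps)
        also have "\<dots> \<le> N * (1 - \<epsilon> / 2)" using N1 \<epsilon> by (intro mult_left_mono) auto
        finally show "(real (card K) + (N - real (card K)) * t) / N \<le> 1 - \<epsilon> / 2"
          using le N1 by (simp add: divide_le_eq mult.commute)
        have "0 \<le> (N - real (card K)) * t" using t Kbd(2)[OF q] Kbd(1)[OF q] by (intro mult_nonneg_nonneg) auto
        then show "0 \<le> (real (card K) + (N - real (card K)) * t) / N" using N1 by simp
      qed (use N1 in auto)
      finally show ?thesis .
    qed
    have sumEx: "(\<Sum>f\<in>Ex (K,x) \<inter> Su. p f) \<le> \<theta> ^ n" if q: "(K,x) \<in> Q" for K x
    proof -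
      \<comment> \<open>The row bounds over the common denominator |K|, using \<eta> \<le> N \<eta>
        / |K|. On the coset the |K| labels cancel the denominator and the gain \<epsilon> remains;
        off the coset there is no gain, but the factor t suppresses these labels.\<close>
      define w where "w k = ((if k \<in> K #> x then 1 - \<epsilon> + N * \<eta> else 1 + N * \<eta>)) / real (card K)" for k
      have cK: "real (card K) \<ge> 1" "real (card K) \<le> N" using Kbd[OF q] by auto
      have w0: "w k \<ge> 0" for k using \<epsilon> N\<eta>0 cK by (auto simp: w_def)
      have pw: "p f \<le> (\<Prod>j\<in>{1..n}. w (f j))" if f: "f \<in> Ex (K,x) \<inter> Su" for f
        unfolding p_def
      proof (intro prod_mono conjI r0)
        fix j assume j: "j \<in> {1..n}"
        have fP: "f \<in> Ph" and HK: "H f = K" and xh: "x \<in> heavy_values \<delta> n f" and fS: "f \<in> Su"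
          using f by (auto simp: Ex_def)
        have xc: "x \<in> carrier G" using xh by (simp add: heavy_values_def)
        have \<eta>le: "\<eta> \<le> N * \<eta> / real (card K)"
        proof -
          have "real (card K) * \<eta> \<le> N * \<eta>" using cK \<eta>0 by (intro mult_right_mono) auto
          then show ?thesis using cK by (simp add: le_divide_eq mult.commute)
        qed
        \<comment> \<open>Surjectivity enters here: a labelling inside a single coset would map
          everything into the proper subgroup \<open>K\<close>.\<close>
        have "\<exists>i\<in>{1..n}. f i \<notin> K #> x"
        proof (rule ccontr)
          assume "\<not> ?thesis"
          then have all: "\<And>i. i \<in> {1..n} \<Longrightarrow> f i \<in> K #> x" by auto
          have "vertex_hom n G f ` zero_sum_vecs n \<subseteq> K"
            using vertex_hom_image_subset[OF Phc(1)[OF fP] Kbd(3)[OF q] xc all _ n] by blast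
          then have "carrier G \<subseteq> K" using fS by (simp add: Su_def)
          then show False using q Kbd(3)[OF q] subgroup.subset by (fastforce simp: Q_def)
        qed
        then obtain i where i: "i \<in> {1..n}" "f i \<notin> K #> x" by blast
        show "row_return_prob G n P f j \<le> w (f j)"
        proof (cases "f j \<in> K #> x")
          case True
          have "row_return_prob G n P f j \<le> (1 - \<epsilon>) / real (card K) + \<eta>"
            using row3[OF fP j xc _ i(1)] True i(2) HK by simp
          also have "\<dots> \<le> (1 - \<epsilon>) / real (card K) + N * \<eta> / real (card K)" using \<eta>le by simp
          finally show ?thesis using True by (simp add: w_def add_divide_distrib)
        next
          case False
          have "row_return_prob G n P f j \<le> 1 / real (card K) + \<eta>"
            using row1[OF fP j] HK by simp
          also have "\<dots> \<le> 1 / real (card K) + N * \<eta> / real (card K)" using \<eta>le by simp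
          finally show ?thesis using False by (simp add: w_def add_divide_distrib)
        qed
      qed
      have "(\<Sum>f\<in>Ex (K,x) \<inter> Su. p f) \<le> (\<Sum>f\<in>Ex (K,x) \<inter> Su. \<Prod>j\<in>{1..n}. w (f j))" by (rule sum_mono[OF pw])
      also have "\<dots> \<le> t powr (- (\<gamma> * real n)) * (\<Sum>k\<in>carrier G. w k * (if k \<in> K #> x then 1 else t)) ^ n"
        by (rule exceptional_sum_bound[OF fin t(1)]) (use t w0 Exsub[of K x] in auto)
      also have "\<dots> \<le> \<theta> ^ n"
      proof (rule tpow)
        have eq: "(\<Sum>k\<in>carrier G. w k * (if k \<in> K #> x then 1 else t)) 
           = real (card K) * ((1 - \<epsilon> + N * \<eta>) / real (card K)) + (N - real (card K)) * ((1 + N * \<eta>) / real (card K) * t)"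
          using wsum[OF q, of "(1 - \<epsilon> + N * \<eta>) / real (card K)" "(1 + N * \<eta>) / real (card K)"]
          by (simp add: w_def if_distrib[of "\<lambda>y. y / _"])
        show "0 \<le> (\<Sum>k\<in>carrier G. w k * (if k \<in> K #> x then 1 else t))"
          using w0 t by (intro sum_nonneg) auto
        have a: "(1 + N * \<eta>) / real (card K) \<le> 2"
        proof -
          have "1 + N * \<eta> \<le> 2" using N\<eta> \<epsilon> by linarith
          also have "2 \<le> 2 * real (card K)" using cK by linarith
          finally show ?thesis using cK by (simp add: divide_le_eq)
        qed
        have "(N - real (card K)) * ((1 + N * \<eta>) / real (card K) * t) \<le> N * (2 * t)"
          using a cK t N\<eta>0 by (intro mult_mono) auto
        then have "(N - real (card K)) * ((1 + N * \<eta>) / real (card K) * t) \<le> \<epsilon> / 4" using t(3) by linarith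
        moreover have "real (card K) * ((1 - \<epsilon> + N * \<eta>) / real (card K)) = 1 - \<epsilon> + N * \<eta>" using cK by simp
        ultimately show "(\<Sum>k\<in>carrier G. w k * (if k \<in> K #> x then 1 else t)) \<le> 1 - \<epsilon> / 2"
          unfolding eq using N\<eta> \<epsilon> by linarith
      qed
      finally show ?thesis .
    qed
    have finEx: "finite (Ex q)" for q using finPh by (cases q) (auto simp: Ex_def)
    have nonty: "real (card (Ph - Ty)) \<le> Z * (N ^ n * \<theta> ^ n)"
    proof -
      have "card (Ph - Ty) \<le> card (\<Union>q\<in>Q. Ex q)" using cover finEx finQ by (intro card_mono) auto
      also have "\<dots> \<le> (\<Sum>q\<in>Q. card (Ex q))" by (rule card_UN_le[OF finQ])
      finally have "real (card (Ph - Ty)) \<le> (\<Sum>q\<in>Q. real (card (Ex q)))" by (simp flip: of_nat_sum)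
      also have "\<dots> \<le> (\<Sum>q\<in>Q. N ^ n * \<theta> ^ n)" using cntEx by (intro sum_mono) auto
      finally show ?thesis by (simp add: Z_def)
    qed
    have sumnt: "(\<Sum>f\<in>Su - Ty. p f) \<le> Z * \<theta> ^ n"
    proof -
      have "(\<Sum>f\<in>Su - Ty. p f) \<le> (\<Sum>f\<in>(\<Union>q\<in>Q. Ex q \<inter> Su). p f)"
        using cover finEx finQ p0 by (intro sum_mono2) (auto simp: Su_def)
      also have "\<dots> \<le> (\<Sum>q\<in>Q. \<Sum>f\<in>Ex q \<inter> Su. p f)"
        using finQ
      proof (induction Q rule: finite_induct)
        case (insert q Q)
        have "(\<Sum>f\<in>(\<Union>q\<in>insert q Q. Ex q \<inter> Su). p f) \<le> (\<Sum>f\<in>Ex q \<inter> Su. p f) + (\<Sum>f\<in>(\<Union>q\<in>Q. Ex q \<inter> Su). p f)"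
          using insert finEx sum_nonneg[of "(Ex q \<inter> Su) \<inter> (\<Union>q\<in>Q. Ex q \<inter> Su)" p] p0
          by (simp add: sum_Un)
        with insert show ?case by simp
      qed simp
      also have "\<dots> \<le> (\<Sum>q\<in>Q. \<theta> ^ n)" using sumEx by (intro sum_mono) auto
      finally show ?thesis by (simp add: Z_def)
    qed
    have sumnt0: "(\<Sum>f\<in>Su - Ty. p f) \<ge> 0" using p0 by (intro sum_nonneg) auto
    have pty: "\<bar>p f - 1 / N ^ n\<bar> \<le> ((1 + N * \<eta>) ^ n - 1) / N ^ n" if f: "f \<in> Ty" for f
    proof -
      have fP: "f \<in> Ph" "H f = carrier G" using f by (auto simp: Ty_def)
      have rj: "\<bar>row_return_prob G n P f j - 1 / N\<bar> \<le> \<eta>" if "j \<in> {1..n}" for j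
        using row2[OF fP(1) that fP(2)] .
      have b: "(1 - N * \<eta>) / N \<le> row_return_prob G n P f j" "row_return_prob G n P f j \<le> (1 + N * \<eta>) / N" if "j \<in> {1..n}" for j
        using rj[OF that] N1 by (auto simp: abs_le_iff field_simps)
      have "p f \<le> (\<Prod>j\<in>{1..n}. (1 + N * \<eta>) / N)" unfolding p_def using b r0 by (intro prod_mono) auto
      then have up: "p f \<le> (1 + N * \<eta>) ^ n / N ^ n" by (simp add: power_divide)
      have "(\<Prod>j\<in>{1..n}. (1 - N * \<eta>) / N) \<le> p f" unfolding p_def using b N\<eta> \<epsilon> N1 by (intro prod_mono) auto
      then have lo: "(1 - N * \<eta>) ^ n / N ^ n \<le> p f" by (simp add: power_divide)
      \<comment> \<open>Two uses of Bernoulli's inequality bound the loss 1 - (1 - y)^n by the gain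
        (1 + y)^n - 1, with y = N \<eta>, so one error term serves both sides.\<close>
      have "1 + real n * (- (N * \<eta>)) \<le> (1 + (- (N * \<eta>))) ^ n" using N\<eta> \<epsilon> by (intro Bernoulli_inequality) auto
      moreover have "1 + real n * (N * \<eta>) \<le> (1 + N * \<eta>) ^ n" using N\<eta>0 by (intro Bernoulli_inequality) auto
      ultimately have "1 - ((1 + N * \<eta>) ^ n - 1) \<le> (1 - N * \<eta>) ^ n" by simp
      then have "(1 - ((1 + N * \<eta>) ^ n - 1)) / N ^ n \<le> (1 - N * \<eta>) ^ n / N ^ n" using N1 by (intro divide_right_mono) auto
      then have lo': "1 / N ^ n - ((1 + N * \<eta>) ^ n - 1) / N ^ n \<le> p f" using lo by (simp add: diff_divide_distrib)
      show ?thesis using lo' up by (simp add: abs_le_iff diff_divide_distrib)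
    qed
    have cPh: "real (card Ph) = N ^ n / N"
    proof -
      have "N ^ n = N * N ^ (n - 1)" using n by (cases n) auto
      moreover have "real (card Ph) = N ^ (n - 1)" unfolding finPh(2) N_def by simp
      ultimately show ?thesis using N1 by simp
    qed
    have finTy: "finite Ty" "Ty \<subseteq> Ph" using finPh by (auto simp: Ty_def)
    have pw1: "(1 + N * \<eta>) ^ n - 1 \<ge> 0" using N\<eta>0 by simp
    have main: "\<bar>(\<Sum>f\<in>Ty. p f) - real (card Ty) / N ^ n\<bar> \<le> (1 + N * \<eta>) ^ n - 1"
    proof -
      have "(\<Sum>f\<in>Ty. p f) - real (card Ty) / N ^ n = (\<Sum>f\<in>Ty. p f - 1 / N ^ n)" by (simp add: sum_subtractf)
      also have "\<bar>\<dots>\<bar> \<le> (\<Sum>f\<in>Ty. ((1 + N * \<eta>) ^ n - 1) / N ^ n)"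
        by (intro order_trans[OF sum_abs] sum_mono pty)
      also have "\<dots> = real (card Ty) / N ^ n * ((1 + N * \<eta>) ^ n - 1)" by simp
      also have "\<dots> \<le> 1 * ((1 + N * \<eta>) ^ n - 1)"
      proof (intro mult_right_mono pw1)
        have "real (card Ty) \<le> real (card Ph)" using card_mono[OF finPh(1) finTy(2)] by (simp only: of_nat_le_iff)
        also have "\<dots> \<le> N ^ n" unfolding cPh using N1 by (simp add: divide_le_eq)
        finally show "real (card Ty) / N ^ n \<le> 1" using N1 by (simp add: divide_le_eq)
      qed
      finally show ?thesis by simp
    qed
    have "real (card Ty) = real (card Ph) - real (card (Ph - Ty))"
    proof -
      have "card (Ph - Ty) = card Ph - card Ty" by (rule card_Diff_subset[OF finTy])
      then show ?thesis using card_mono[OF finPh(1) finTy(2)] by (simp only: of_nat_diff diff_diff_cancel)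
    qed
    then have "real (card Ty) / N ^ n = 1 / N - real (card (Ph - Ty)) / N ^ n"
      unfolding cPh using N1 by (simp add: diff_divide_distrib)
    moreover have "real (card (Ph - Ty)) / N ^ n \<le> Z * \<theta> ^ n"
      using nonty N1 by (simp add: divide_le_eq mult_ac)
    moreover have "real (card (Ph - Ty)) / N ^ n \<ge> 0" using N1 by simp
    ultimately have ty: "\<bar>real (card Ty) / N ^ n - 1 / N\<bar> \<le> Z * \<theta> ^ n" by simp
    have "(\<Sum>f\<in>Su. p f) = (\<Sum>f\<in>Ty. p f) + (\<Sum>f\<in>Su - Ty. p f)"
      using sum.subset_diff[OF TySu, of p] finPh by (simp add: Su_def)
    then have "\<bar>(\<Sum>f\<in>Su. p f) - 1 / N\<bar> \<le> 2 * Z * \<theta> ^ n + ((1 + N * \<eta>) ^ n - 1)"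
      using sumnt sumnt0 main ty by linarith
    then show "\<bar>(\<Sum>F\<in>Surs (Zn0 n) G. measure_pmf.prob P {D. laplacian_image n D \<subseteq> kernel (Zn0 n) G F}) - 1 / real (card (carrier G))\<bar>
         \<le> 2 * Z * (1 - \<epsilon>/4) ^ n + ((1 + real (card (carrier G)) * (C * \<rho> ^ (nat \<lceil>\<delta> * real n\<rceil> - 1))) ^ n - 1)"
      unfolding sum_eq by (simp add: \<theta>_def \<eta>_def N_def)
  qed
qed


text \<open>The error of a single column decays geometrically in n, so the product of n of them is
  still 1 + o(1).\<close>

theorem sur_moment_laplacian:
  assumes fin: "finite (carrier G)" and eps: "eps > 0"
    and bal: "\<And>n. n \<ge> 1 \<Longrightarrow> eps_balanced_digraph n eps (\<Gamma> n)"
  shows "(\<lambda>n. \<Sum>F\<in>Surs (Zn0 n) G. measure_pmf.prob (\<Gamma> n) {D. laplacian_image n D \<subseteq> kernel (Zn0 n) G F})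
     \<longlonglongrightarrow> 1 / real (card (carrier G))"
proof -
  \<comment> \<open>The estimate is stated for constants up to 1/2; balance with \<open>eps\<close>
    implies balance with any smaller constant.\<close>
  define \<epsilon> where "\<epsilon> = min eps (1/2)"
  have \<epsilon>: "0 < \<epsilon>" "\<epsilon> \<le> 1/2" "eps \<ge> \<epsilon>" using eps by (auto simp: \<epsilon>_def)
  define N where "N = real (card (carrier G))"
  define S where "S n = (\<Sum>F\<in>Surs (Zn0 n) G. measure_pmf.prob (\<Gamma> n) {D. laplacian_image n D \<subseteq> kernel (Zn0 n) G F})" for n
  obtain C \<rho> \<delta> Z :: real where C: "C > 0" "0 < \<rho>" "\<rho> < 1" "0 < \<delta>" and Z: "Z \<ge> 0" and bound:
    "\<And>n eps P. n \<ge> 1 \<Longrightarrow> eps_balanced_digraph n eps P \<Longrightarrow> eps \<ge> \<epsilon> \<Longrightarrow>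
       real (card (carrier G)) * (C * \<rho> ^ (nat \<lceil>\<delta> * real n\<rceil> - 1)) \<le> \<epsilon> / 8 \<Longrightarrow>
       \<bar>(\<Sum>F\<in>Surs (Zn0 n) G. measure_pmf.prob P {D. laplacian_image n D \<subseteq> kernel (Zn0 n) G F}) - 1 / real (card (carrier G))\<bar>
         \<le> 2 * Z * (1 - \<epsilon>/4) ^ n + ((1 + real (card (carrier G)) * (C * \<rho> ^ (nat \<lceil>\<delta> * real n\<rceil> - 1))) ^ n - 1)"
  proof (rule sur_moment_laplacian_bound[OF fin \<epsilon>(1,2)], goal_cases)
    case (1 C \<rho> \<delta> Z)
    show ?case by (rule 1(1)[OF 1(2-6)]) (fact 1(7))
  qed
  define y where "y n = N * (C * \<rho> ^ (nat \<lceil>\<delta> * real n\<rceil> - 1))" for n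
  have y0: "y n \<ge> 0" for n using C by (simp add: y_def N_def)
  define q where "q = \<rho> powr \<delta>"
  have q: "0 < q" "q < 1" using C by (auto simp: q_def powr_def mult_less_0_iff)
  \<comment> \<open>Rounding \<delta> n up and removing one occurrence costs at most a factor
    1/\<rho>.\<close>
  have yle: "y n \<le> (N * C / \<rho>) * q ^ n" for n
  proof -
    have "\<rho> ^ (nat \<lceil>\<delta> * real n\<rceil> - 1) = \<rho> powr real (nat \<lceil>\<delta> * real n\<rceil> - 1)" using C by (simp add: powr_realpow)
    also have "\<dots> \<le> \<rho> powr (\<delta> * real n - 1)"
    proof (rule powr_mono')
      have "\<delta> * real n \<le> real (nat \<lceil>\<delta> * real n\<rceil>)" by (rule real_nat_ceiling_ge)
      then show "\<delta> * real n - 1 \<le> real (nat \<lceil>\<delta> * real n\<rceil> - 1)" by linarith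
    qed (use C in auto)
    also have "\<dots> = q ^ n / \<rho>" using C by (simp add: q_def powr_diff powr_powr powr_realpow[symmetric])
    finally have "N * C * \<rho> ^ (nat \<lceil>\<delta> * real n\<rceil> - 1) \<le> N * C * (q ^ n / \<rho>)"
      using C by (intro mult_left_mono) (auto simp: N_def)
    then show ?thesis by (simp add: y_def mult_ac)
  qed
  have ny: "(\<lambda>n. real n * y n) \<longlonglongrightarrow> 0"
  proof (rule tendsto_sandwich[of "\<lambda>_. 0" _ _ "\<lambda>n. (N * C / \<rho>) * (real n * q ^ n)"])
    have "(\<lambda>n. real n * q ^ n) \<longlonglongrightarrow> 0" using powser_times_n_limit_0[of q] q by simp
    then show "(\<lambda>n. (N * C / \<rho>) * (real n * q ^ n)) \<longlonglongrightarrow> 0" by (rule tendsto_mult_right_zero)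
    show "\<forall>\<^sub>F n in sequentially. real n * y n \<le> (N * C / \<rho>) * (real n * q ^ n)"
    proof (rule always_eventually, rule allI)
      fix n have "real n * y n \<le> real n * ((N * C / \<rho>) * q ^ n)" using yle by (intro mult_left_mono) auto
      then show "real n * y n \<le> (N * C / \<rho>) * (real n * q ^ n)" by (simp add: mult_ac)
    qed
  qed (use y0 in auto)
  have y_lim: "y \<longlonglongrightarrow> 0"
  proof (rule tendsto_sandwich[of "\<lambda>_. 0" _ _ "\<lambda>n. (N * C / \<rho>) * q ^ n"])
    have "(\<lambda>n. q ^ n) \<longlonglongrightarrow> 0" using q by (intro LIMSEQ_realpow_zero) auto
    then show "(\<lambda>n. (N * C / \<rho>) * q ^ n) \<longlonglongrightarrow> 0" by (rule tendsto_mult_right_zero)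
  qed (use y0 yle in auto)
  have "((\<lambda>n. S n - 1 / N) \<longlongrightarrow> 0) sequentially"
  proof (rule tendsto_0_le[where K = 1])
    have "(\<lambda>n. 2 * Z * (1 - \<epsilon>/4) ^ n + (exp (real n * y n) - 1)) \<longlonglongrightarrow> 2 * Z * 0 + (exp 0 - 1)"
      by (intro tendsto_intros ny LIMSEQ_realpow_zero) (use \<epsilon> in auto)
    then show "(\<lambda>n. 2 * Z * (1 - \<epsilon>/4) ^ n + (exp (real n * y n) - 1)) \<longlonglongrightarrow> 0" by simp
    have "\<forall>\<^sub>F n in sequentially. y n < \<epsilon> / 8" using y_lim \<epsilon> by (intro order_tendstoD) auto
    then show "\<forall>\<^sub>F n in sequentially. norm (S n - 1 / N) \<le> norm (2 * Z * (1 - \<epsilon>/4) ^ n + (exp (real n * y n) - 1)) * 1"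
      using eventually_ge_at_top[of 1]
    proof eventually_elim
      case (elim n)
      have "\<bar>S n - 1 / N\<bar> \<le> 2 * Z * (1 - \<epsilon>/4) ^ n + ((1 + y n) ^ n - 1)"
        unfolding S_def N_def y_def by (rule bound[OF elim(2) bal[OF elim(2)] \<epsilon>(3)]) (use elim in \<open>simp add: y_def N_def\<close>)
      also have "(1 + y n) ^ n \<le> exp (y n) ^ n" using y0[of n] exp_ge_add_one_self[of "y n"] by (intro power_mono) auto
      also have "exp (y n) ^ n = exp (real n * y n)" by (simp add: exp_of_nat_mult)
      finally show ?case by simp
    qed
  qed
  then show ?thesis unfolding S_def N_def[symmetric] by (rule LIM_zero_cancel)
qed

end

section \<open>Zeta values and the normalising constant\<close>

definition recip_pow :: "nat \<Rightarrow> nat \<Rightarrow> real" where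
  "recip_pow k n = 1 / real n ^ k"

definition zeta_nat :: "nat \<Rightarrow> real" where
  "zeta_nat k = infsum (recip_pow k) {1..}"

definition rough :: "nat \<Rightarrow> nat set" where
  "rough x = {n. n \<ge> 1 \<and> (\<forall>p. Factorial_Ring.prime p \<longrightarrow> p < x \<longrightarrow> \<not> p dvd n)}"

lemma recip_pow_nonneg [simp]: "recip_pow k n \<ge> 0"
  by (simp add: recip_pow_def)

lemma recip_pow_summable: "k \<ge> 2 \<Longrightarrow> recip_pow k summable_on A"
proof -
  assume k: "k \<ge> 2"
  have "summable (\<lambda>n. norm (recip_pow k n))"
    using inverse_power_summable[OF k, where ?'a = real] by (simp add: recip_pow_def inverse_eq_divide power_one_over)
  then have "recip_pow k summable_on UNIV" by (rule norm_summable_imp_summable_on)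
  then show ?thesis by (rule summable_on_subset_banach) simp
qed

lemma rough_Suc_not_prime: "\<not> Factorial_Ring.prime x \<Longrightarrow> rough (Suc x) = rough x"
  unfolding rough_def by (auto simp: less_Suc_eq)

text \<open>One step of the sieve of Eratosthenes: an \<open>x\<close>-rough number is either not
  divisible by the prime \<open>x\<close> or is \<open>x\<close> times an \<open>x\<close>-rough
  number.\<close>

lemma infsum_rough_Suc:
  assumes x: "Factorial_Ring.prime x" and k: "k \<ge> 2"
  shows "infsum (recip_pow k) (rough (Suc x)) = (1 - recip_pow k x) * infsum (recip_pow k) (rough x)"
proof -
  have x0: "x > 0" using x prime_gt_0_nat by blast
  have un: "rough x = rough (Suc x) \<union> (\<lambda>m. x * m) ` rough x"
  proof
    show "rough (Suc x) \<union> (\<lambda>m. x * m) ` rough x \<subseteq> rough x"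
    proof
      fix n assume "n \<in> rough (Suc x) \<union> (\<lambda>m. x * m) ` rough x"
      then show "n \<in> rough x"
      proof
        assume "n \<in> (\<lambda>m. x * m) ` rough x"
        then obtain m where m: "m \<in> rough x" "n = x * m" by blast
        have "\<not> p dvd n" if p: "Factorial_Ring.prime p" "p < x" for p
        proof
          assume "p dvd n"
          then have "p dvd x \<or> p dvd m" using p m prime_dvd_mult_iff by auto
          then have "p = x" using p x m by (auto simp: rough_def primes_dvd_imp_eq)
          then show False using p by simp
        qed
        then show "n \<in> rough x" using m x0 by (auto simp: rough_def)
      qed (auto simp: rough_def)
    qed
    show "rough x \<subseteq> rough (Suc x) \<union> (\<lambda>m. x * m) ` rough x"
    proof
      fix n assume n: "n \<in> rough x"
      show "n \<in> rough (Suc x) \<union> (\<lambda>m. x * m) ` rough x"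
      proof (cases "x dvd n")
        case True
        then obtain m where m: "n = x * m" by auto
        then have "m \<in> rough x" using n by (auto simp: rough_def)
        then show ?thesis using m by auto
      next
        case False
        then show ?thesis using n by (auto simp: rough_def less_Suc_eq)
      qed
    qed
  qed
  have disj: "rough (Suc x) \<inter> (\<lambda>m. x * m) ` rough x = {}" using x by (auto simp: rough_def)
  have "infsum (recip_pow k) (rough x) = infsum (recip_pow k) (rough (Suc x)) + infsum (recip_pow k) ((\<lambda>m. x * m) ` rough x)"
    using infsum_Un_disjoint[OF recip_pow_summable[OF k] recip_pow_summable[OF k] disj] un by simp
  also have "infsum (recip_pow k) ((\<lambda>m. x * m) ` rough x) = infsum (recip_pow k \<circ> (\<lambda>m. x * m)) (rough x)"
    using x0 by (intro infsum_reindex) (auto simp: inj_on_def)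
  also have "recip_pow k \<circ> (\<lambda>m. x * m) = (\<lambda>m. recip_pow k x * recip_pow k m)"
    by (auto simp: recip_pow_def power_mult_distrib)
  also have "infsum (\<lambda>m. recip_pow k x * recip_pow k m) (rough x) = recip_pow k x * infsum (recip_pow k) (rough x)"
    by (rule infsum_cmult_right')
  finally have "infsum (recip_pow k) (rough (Suc x)) = infsum (recip_pow k) (rough x) - recip_pow k x * infsum (recip_pow k) (rough x)"
    by linarith
  then show ?thesis by (simp only: left_diff_distrib mult_1)
qed

text \<open>Primes below \<open>x\<close> are sieved out one at a time, so the rough sum is what the
  Euler product of zeta(k) leaves after finitely many factors.\<close>

lemma infsum_rough:
  assumes k: "k \<ge> 2"
  shows "infsum (recip_pow k) (rough x) =
    zeta_nat k * (\<Prod>p<x. if Factorial_Ring.prime p then 1 - recip_pow k p else 1)"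
proof (induction x)
  case 0
  have "rough 0 = {1..}" by (auto simp: rough_def)
  then show ?case by (simp add: zeta_nat_def)
next
  case (Suc x)
  then show ?case
    using infsum_rough_Suc[OF _ k, of x] rough_Suc_not_prime[of x] by (auto simp: mult_ac)
qed

text \<open>Comparison of 1/n^2 with the telescoping terms 1/(n - 1) - 1/n.\<close>

lemma infsum_tail_sq:
  assumes x: "x \<ge> 2"
  shows "infsum (recip_pow 2) {x..} \<le> 1 / (real x - 1)"
proof -
  let ?f = "\<lambda>i. 1 / (real (x + i) - 1) - 1 / real (x + i)"
  have lim: "(\<lambda>i. 1 / (real (x + i) - 1)) \<longlonglongrightarrow> 0" by real_asymp
  have "(\<lambda>i. 1 / (real (x + i) - 1) - 1 / (real (x + Suc i) - 1)) sums (1 / (real (x + 0) - 1) - 0)"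
    by (rule telescope_sums'[OF lim])
  then have "?f sums (1 / (real x - 1))" by (simp add: algebra_simps)
  moreover have "?f i \<ge> 0" for i using x by (simp add: frac_le)
  ultimately have hs: "(?f has_sum (1 / (real x - 1))) UNIV" by (rule sums_nonneg_imp_has_sum)
  have bij: "bij_betw (\<lambda>i. x + i) UNIV {x..}"
    by (rule bij_betw_byWitness[where f' = "\<lambda>n. n - x"]) auto
  have "infsum (recip_pow 2) {x..} = infsum (\<lambda>i. recip_pow 2 (x + i)) UNIV"
    using infsum_reindex_bij_betw[OF bij, of "recip_pow 2"] by simp
  also have "\<dots> \<le> infsum ?f UNIV"
  proof (rule infsum_mono)
    show "(\<lambda>i. recip_pow 2 (x + i)) summable_on UNIV"
      using summable_on_reindex_bij_betw[OF bij, of "recip_pow 2"] recip_pow_summable[of 2] by simp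
    show "?f summable_on UNIV" using hs by (rule has_sum_imp_summable)
    fix i
    have "real (x + i) > 1" using x by simp
    then have "?f i = 1 / ((real (x + i) - 1) * real (x + i))" by (simp add: field_simps)
    moreover have "1 / real (x + i) ^ 2 \<le> 1 / ((real (x + i) - 1) * real (x + i))"
    proof (rule divide_left_mono)
      show "(real (x + i) - 1) * real (x + i) \<le> real (x + i) ^ 2" by (simp add: power2_eq_square left_diff_distrib)
      show "0 < (real (x + i)) ^ 2 * ((real (x + i) - 1) * real (x + i))"
        using \<open>real (x + i) > 1\<close> by (intro mult_pos_pos zero_less_power) linarith+
    qed simp
    ultimately show "recip_pow 2 (x + i) \<le> ?f i" by (simp add: recip_pow_def)
  qed
  also have "\<dots> = 1 / (real x - 1)" using hs by (rule infsumI)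
  finally show ?thesis .
qed

text \<open>As n \<ge> 2, each further factor 1/n is at most 1/2. The decay in \<open>k\<close>
  keeps the later product over all exponents bounded.\<close>

lemma infsum_tail:
  assumes x: "x \<ge> 2" and k: "k \<ge> 2"
  shows "infsum (recip_pow k) {x..} \<le> (1/2) ^ (k - 2) * (1 / (real x - 1))"
proof -
  have "infsum (recip_pow k) {x..} \<le> infsum (\<lambda>n. (1/2) ^ (k - 2) * recip_pow 2 n) {x..}"
  proof (rule infsum_mono[OF recip_pow_summable[OF k]])
    show "(\<lambda>n. (1/2) ^ (k - 2) * recip_pow 2 n) summable_on {x..}"
      by (intro summable_on_cmult_right recip_pow_summable) simp
    fix n assume n: "n \<in> {x..}"
    obtain l where l: "k = l + 2" using k by (metis add.commute le_Suc_ex)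
    have "(1 / real n) ^ l \<le> (1/2) ^ l" using n x by (intro power_mono) (auto simp: field_simps)
    then have "(1 / real n) ^ l * (1 / real n ^ 2) \<le> (1/2) ^ l * (1 / real n ^ 2)" by (intro mult_right_mono) auto
    moreover have "recip_pow k n = (1 / real n) ^ l * (1 / real n ^ 2)"
      unfolding recip_pow_def l power_add by (simp add: power_divide)
    ultimately show "recip_pow k n \<le> (1/2) ^ (k - 2) * recip_pow 2 n"
      by (simp add: recip_pow_def l)
  qed
  also have "\<dots> = (1/2) ^ (k - 2) * infsum (recip_pow 2) {x..}"
    by (rule infsum_cmult_right')
  also have "\<dots> \<le> (1/2) ^ (k - 2) * (1 / (real x - 1))"
    using infsum_tail_sq[OF x] by (intro mult_left_mono) auto
  finally show ?thesis .
qed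

text \<open>A rough number other than 1 has all its prime factors at least \<open>x\<close>, hence
  is itself at least \<open>x\<close>.\<close>

lemma infsum_rough_bounds:
  assumes x: "x \<ge> 2" and k: "k \<ge> 2"
  shows "1 \<le> infsum (recip_pow k) (rough x)"
    "infsum (recip_pow k) (rough x) \<le> 1 + (1/2) ^ (k - 2) * (1 / (real x - 1))"
proof -
  have one: "1 \<in> rough x" by (auto simp: rough_def)
  have "infsum (recip_pow k) {1} \<le> infsum (recip_pow k) (rough x)"
    using one by (intro infsum_mono2) (auto intro: recip_pow_summable k)
  then show "1 \<le> infsum (recip_pow k) (rough x)" by (simp add: recip_pow_def)
  have sub: "rough x \<subseteq> {1} \<union> {x..}"
  proof
    fix n assume n: "n \<in> rough x"
    show "n \<in> {1} \<union> {x..}"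
    proof (cases "n = 1")
      case False
      then obtain p where p: "Factorial_Ring.prime p" "p dvd n" using prime_factor_nat by blast
      then have "p \<ge> x" using n by (auto simp: rough_def not_less[symmetric])
      moreover have "p \<le> n" using p n by (intro dvd_imp_le) (auto simp: rough_def)
      ultimately show ?thesis by simp
    qed simp
  qed
  have "infsum (recip_pow k) (rough x) \<le> infsum (recip_pow k) ({1} \<union> {x..})"
    using sub by (intro infsum_mono2) (auto intro: recip_pow_summable k)
  also have "\<dots> = infsum (recip_pow k) {1} + infsum (recip_pow k) {x..}"
    using x by (intro infsum_Un_disjoint recip_pow_summable k) auto
  also have "\<dots> \<le> 1 + (1/2) ^ (k - 2) * (1 / (real x - 1))"
    using infsum_tail[OF x k] by (simp add: recip_pow_def)
  finally show "infsum (recip_pow k) (rough x) \<le> 1 + (1/2) ^ (k - 2) * (1 / (real x - 1))" .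
qed

definition zeta_prod :: "nat \<Rightarrow> real" where
  "zeta_prod m = (\<Prod>k<m. zeta_nat (k + 2))"

text \<open>Exchanging the two finite products leaves one rough sum for each exponent. The bounds do
  not involve \<open>m\<close>, so \<open>m\<close> can tend to infinity before \<open>x\<close>;
  the 2 is the sum of the geometric series of the factors (1/2)^k.\<close>

lemma zeta_prod_sieved_bounds:
  assumes x: "x \<ge> 2"
  shows "1 \<le> zeta_prod m * (\<Prod>p<x. if Factorial_Ring.prime p then (\<Prod>k<m. 1 - 1 / real p ^ (k + 2)) else 1)"
    "zeta_prod m * (\<Prod>p<x. if Factorial_Ring.prime p then (\<Prod>k<m. 1 - 1 / real p ^ (k + 2)) else 1) \<le> exp (2 / (real x - 1))"
proof -
  have "(\<Prod>p<x. if Factorial_Ring.prime p then (\<Prod>k<m. 1 - 1 / real p ^ (k + 2)) else 1)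
      = (\<Prod>p<x. \<Prod>k<m. if Factorial_Ring.prime p then 1 - recip_pow (k + 2) p else 1)"
    by (intro prod.cong) (auto simp: recip_pow_def)
  also have "\<dots> = (\<Prod>k<m. \<Prod>p<x. if Factorial_Ring.prime p then 1 - recip_pow (k + 2) p else 1)"
    by (rule prod.swap)
  finally have e: "(\<Prod>p<x. if Factorial_Ring.prime p then (\<Prod>k<m. 1 - 1 / real p ^ (k + 2)) else 1)
      = (\<Prod>k<m. \<Prod>p<x. if Factorial_Ring.prime p then 1 - recip_pow (k + 2) p else 1)" .
  have eq: "zeta_prod m * (\<Prod>p<x. if Factorial_Ring.prime p then (\<Prod>k<m. 1 - 1 / real p ^ (k + 2)) else 1)
     = (\<Prod>k<m. infsum (recip_pow (k + 2)) (rough x))"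
  proof -
    have "(\<Prod>k<m. infsum (recip_pow (k + 2)) (rough x))
        = (\<Prod>k<m. zeta_nat (k + 2) * (\<Prod>p<x. if Factorial_Ring.prime p then 1 - recip_pow (k + 2) p else 1))"
      by (intro prod.cong refl infsum_rough) simp
    then show ?thesis unfolding e zeta_prod_def prod.distrib by simp
  qed
  show "1 \<le> zeta_prod m * (\<Prod>p<x. if Factorial_Ring.prime p then (\<Prod>k<m. 1 - 1 / real p ^ (k + 2)) else 1)"
    unfolding eq using infsum_rough_bounds(1)[OF x] by (intro prod_ge_1) auto
  have "(\<Prod>k<m. infsum (recip_pow (k + 2)) (rough x)) \<le> (\<Prod>k<m. exp ((1/2) ^ k * (1 / (real x - 1))))"
  proof (intro prod_mono conjI)
    fix k
    show "0 \<le> infsum (recip_pow (k + 2)) (rough x)" by (rule infsum_nonneg) simp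
    have "infsum (recip_pow (k + 2)) (rough x) \<le> 1 + (1/2) ^ k * (1 / (real x - 1))"
      using infsum_rough_bounds(2)[OF x, of "k + 2"] by simp
    also have "\<dots> \<le> exp ((1/2) ^ k * (1 / (real x - 1)))" by (rule exp_ge_add_one_self)
    finally show "infsum (recip_pow (k + 2)) (rough x) \<le> exp ((1/2) ^ k * (1 / (real x - 1)))" .
  qed
  also have "\<dots> = exp ((\<Sum>k<m. (1/2) ^ k) * (1 / (real x - 1)))"
    by (simp add: exp_sum[symmetric] sum_distrib_right sum_divide_distrib)
  also have "\<dots> \<le> exp (2 * (1 / (real x - 1)))"
  proof -
    have "(\<Sum>k<m. (1/2::real) ^ k) \<le> 2" by (simp add: geometric_sum)
    then have "(\<Sum>k<m. (1/2::real) ^ k) * (1 / (real x - 1)) \<le> 2 * (1 / (real x - 1))"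
      using x by (intro mult_right_mono) auto
    then show ?thesis by simp
  qed
  finally show "zeta_prod m * (\<Prod>p<x. if Factorial_Ring.prime p then (\<Prod>k<m. 1 - 1 / real p ^ (k + 2)) else 1) \<le> exp (2 / (real x - 1))"
    unfolding eq by simp
qed

lemma Q_p_tendsto:
  assumes p: "Factorial_Ring.prime p"
  shows "(\<lambda>m. \<Prod>k<m. 1 - 1 / real p ^ (k + 2)) \<longlonglongrightarrow> Q_p p" "Q_p p \<noteq> 0"
proof -
  let ?f = "\<lambda>k. 1 - 1 / real p ^ (k + 2)"
  have p2: "p \<ge> 2" using p prime_ge_2_nat by blast
  have lt: "1 / real p ^ (k + 2) < 1" for k
  proof -
    have "1 < real p ^ (k + 2)" using p2 by (intro one_less_power) auto
    then show ?thesis by simp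
  qed
  have "summable (\<lambda>k. (1 / real p) ^ k)" using p2 by (intro summable_geometric) auto
  then have "summable (\<lambda>k. (1 / real p) ^ (k + 2))" by (rule summable_ignore_initial_segment)
  then have "summable (\<lambda>k. norm (?f k - 1))" by (simp add: power_divide)
  then have "abs_convergent_prod ?f" by (rule summable_imp_abs_convergent_prod)
  then have c: "convergent_prod ?f" by (rule abs_convergent_prod_imp_convergent_prod)
  have nz: "?f k \<noteq> 0" for k
  proof -
    have "0 < ?f k" using lt[of k] by linarith
    then show ?thesis by (rule less_imp_neq[THEN not_sym])
  qed
  show "Q_p p \<noteq> 0" unfolding Q_p_def by (rule prodinf_nonzero[OF c nz])
  have "(\<lambda>m. \<Prod>k\<le>m. ?f k) \<longlonglongrightarrow> Q_p p" unfolding Q_p_def by (rule convergent_prod_LIMSEQ[OF c])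
  then show "(\<lambda>m. \<Prod>k<m. ?f k) \<longlonglongrightarrow> Q_p p"
    by (subst filterlim_sequentially_Suc[symmetric]) (simp add: lessThan_Suc_atMost)
qed

text \<open>This is Q = 1 / (zeta(2) zeta(3) ...), obtained without rearranging an infinite double
  product. The zeta products increase to a limit W; W times the product of the \<open>Q_p\<close>
  over p < x lies between 1 and exp (2 / (x - 1)), so the product over the primes converges to
  1/W.\<close>

theorem Q_const_zeta_prod: "(\<lambda>m. Q_const * zeta_prod m) \<longlonglongrightarrow> 1" "Q_const \<ge> 0"
proof -
  let ?F = "\<lambda>p. if Factorial_Ring.prime p then Q_p p else 1"
  have z1: "zeta_nat k \<ge> 1" if "k \<ge> 2" for k
  proof -
    have "infsum (recip_pow k) {1} \<le> infsum (recip_pow k) {1..}"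
      by (intro infsum_mono2) (auto intro: recip_pow_summable that)
    then show ?thesis by (simp add: zeta_nat_def recip_pow_def)
  qed
  have inc: "incseq zeta_prod"
  proof (rule incseq_SucI)
    fix m
    have "zeta_prod m \<ge> 0" unfolding zeta_prod_def using z1[of "_ + 2"] by (intro prod_nonneg) (auto intro: order_trans[of 0 1])
    then have "zeta_prod m * 1 \<le> zeta_prod m * zeta_nat (m + 2)" by (intro mult_left_mono z1) auto
    then show "zeta_prod m \<le> zeta_prod (Suc m)" by (simp add: zeta_prod_def)
  qed
  \<comment> \<open>At x = 2 no prime has been sieved out, and the uniform bound reads exp
    2.\<close>
  have bd: "zeta_prod m \<le> exp 2" for m
  proof -
    have "(\<Prod>p<2. if Factorial_Ring.prime p then (\<Prod>k<m. 1 - 1 / real p ^ (k + 2)) else 1) = (\<Prod>p<(2::nat). (1::real))"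
      by (intro prod.cong refl) (auto dest: prime_ge_2_nat)
    then show ?thesis using zeta_prod_sieved_bounds(2)[of 2 m] by simp
  qed
  obtain W where W: "zeta_prod \<longlonglongrightarrow> W" using incseq_convergent[OF inc, of "exp 2"] bd by blast
  have "zeta_prod 0 \<le> W" by (rule incseq_le[OF inc W])
  then have W1: "W \<ge> 1" by (simp add: zeta_prod_def)
  have fac: "(\<lambda>m. if Factorial_Ring.prime p then (\<Prod>k<m. 1 - 1 / real p ^ (k + 2)) else 1) \<longlonglongrightarrow> ?F p" for p
    using Q_p_tendsto(1)[of p] by (cases "Factorial_Ring.prime p") (simp_all only: if_True if_False tendsto_const)
  have lim: "(\<lambda>m. zeta_prod m * (\<Prod>p<x. if Factorial_Ring.prime p then (\<Prod>k<m. 1 - 1 / real p ^ (k + 2)) else 1))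
      \<longlonglongrightarrow> W * (\<Prod>p<x. ?F p)" for x
    by (intro tendsto_mult W tendsto_prod fac)
  have bounds: "1 \<le> W * (\<Prod>p<x. ?F p)" "W * (\<Prod>p<x. ?F p) \<le> exp (2 / (real x - 1))" if x: "x \<ge> 2" for x
    using LIMSEQ_le_const[OF lim[of x], of 1] LIMSEQ_le_const2[OF lim[of x], of "exp (2 / (real x - 1))"]
      zeta_prod_sieved_bounds[OF x] by blast+
  have "(\<lambda>x. W * (\<Prod>p<x. ?F p)) \<longlonglongrightarrow> 1"
  proof (rule tendsto_sandwich[of "\<lambda>_. 1" _ _ "\<lambda>x. exp (2 / (real x - 1))"])
    show "\<forall>\<^sub>F x in sequentially. 1 \<le> W * (\<Prod>p<x. ?F p)"
      using bounds(1) eventually_sequentially by blast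
    show "\<forall>\<^sub>F x in sequentially. W * (\<Prod>p<x. ?F p) \<le> exp (2 / (real x - 1))"
      using bounds(2) eventually_sequentially by blast
    show "(\<lambda>x. exp (2 / (real x - 1))) \<longlonglongrightarrow> 1" by real_asymp
  qed simp
  then have "(\<lambda>x. W * (\<Prod>p<x. ?F p) / W) \<longlonglongrightarrow> 1 / W" using W1 by (intro tendsto_divide) auto
  then have pl: "(\<lambda>x. \<Prod>p<x. ?F p) \<longlonglongrightarrow> 1 / W" using W1 by simp
  then have pl': "(\<lambda>x. \<Prod>p\<le>x. ?F p) \<longlonglongrightarrow> 1 / W"
    by (subst (asm) filterlim_sequentially_Suc[symmetric]) (simp add: lessThan_Suc_atMost)
  have nz: "?F p \<noteq> 0" for p using Q_p_tendsto(2) by auto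
  have "convergent_prod ?F" using pl' W1 convergent_prod_iff_nz_lim[of ?F] nz by (metis divide_eq_0_iff not_one_le_zero zero_neq_one)
  then have "(\<lambda>x. \<Prod>p\<le>x. ?F p) \<longlonglongrightarrow> Q_const" unfolding Q_const_def by (rule convergent_prod_LIMSEQ)
  then have Q: "Q_const = 1 / W" using pl' LIMSEQ_unique by blast
  have "(\<lambda>m. Q_const * zeta_prod m) \<longlonglongrightarrow> Q_const * W" by (intro tendsto_mult W tendsto_const)
  moreover have "Q_const * W = 1" unfolding Q using W1 by simp
  ultimately show "(\<lambda>m. Q_const * zeta_prod m) \<longlonglongrightarrow> 1" by (simp only:)
  show "Q_const \<ge> 0" unfolding Q using W1 by simp
qed

section \<open>Counting finite-index sublattices\<close>

text \<open>Subgroups are handled as plain sets of integer vectors with pointwise operations, so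
  that the lattice arguments need no group records; \<open>subgroup_Zn0_iff\<close> translates
  back.\<close>

definition addsub :: "(nat \<Rightarrow> int) set \<Rightarrow> bool" where
  "addsub S \<longleftrightarrow> 0 \<in> S \<and> (\<forall>x\<in>S. \<forall>y\<in>S. x - y \<in> S)"

definition smul :: "int \<Rightarrow> (nat \<Rightarrow> int) \<Rightarrow> nat \<Rightarrow> int" where
  "smul z x = (\<lambda>k. z * x k)"

definition coset_of :: "(nat \<Rightarrow> int) set \<Rightarrow> (nat \<Rightarrow> int) \<Rightarrow> (nat \<Rightarrow> int) set" where
  "coset_of N x = {y. y - x \<in> N}"

definition idx :: "(nat \<Rightarrow> int) set \<Rightarrow> (nat \<Rightarrow> int) set \<Rightarrow> nat" where
  "idx M N = card (coset_of N ` M)"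

definition fisub :: "(nat \<Rightarrow> int) set \<Rightarrow> (nat \<Rightarrow> int) set set" where
  "fisub M = {N. addsub N \<and> N \<subseteq> M \<and> finite (coset_of N ` M)}"

definition transversal :: "(nat \<Rightarrow> int) set \<Rightarrow> (nat \<Rightarrow> int) set \<Rightarrow> (nat \<Rightarrow> int) set \<Rightarrow> bool" where
  "transversal S M R \<longleftrightarrow> R \<subseteq> M \<and> (\<forall>x\<in>M. \<exists>r\<in>R. x - r \<in> S) \<and> (\<forall>r\<in>R. \<forall>r'\<in>R. r - r' \<in> S \<longrightarrow> r = r')"

lemma transversalD:
  assumes "transversal S M R"
  shows "R \<subseteq> M" "\<And>x. x \<in> M \<Longrightarrow> \<exists>r\<in>R. x - r \<in> S" "\<And>r r'. r \<in> R \<Longrightarrow> r' \<in> R \<Longrightarrow> r - r' \<in> S \<Longrightarrow> r = r'"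
  using assms unfolding transversal_def by blast+

lemma smul_simps:
  "smul (a + b) x = smul a x + smul b x" "smul (a - b) x = smul a x - smul b x"
  "smul a (x + y) = smul a x + smul a y" "smul a (x - y) = smul a x - smul a y"
  "smul 1 x = x" "smul 0 x = 0" "smul a 0 = 0" "smul (- a) x = - smul a x" "smul a (smul b x) = smul (a * b) x"
  by (auto simp: smul_def fun_eq_iff algebra_simps)

context
  fixes S assumes S: "addsub S"
begin

lemma addsub_0: "0 \<in> S" using S by (simp add: addsub_def)
lemma addsub_diff: "x \<in> S \<Longrightarrow> y \<in> S \<Longrightarrow> x - y \<in> S" using S by (simp add: addsub_def)
lemma addsub_uminus: "x \<in> S \<Longrightarrow> - x \<in> S" using addsub_diff[OF addsub_0, of x] by simp
lemma addsub_add: "x \<in> S \<Longrightarrow> y \<in> S \<Longrightarrow> x + y \<in> S"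
  using addsub_diff[of x "- y"] addsub_uminus[of y] by simp

lemma addsub_smul:
  assumes x: "x \<in> S"
  shows "smul z x \<in> S"
proof -
  have nat: "smul (int k) x \<in> S" for k
  proof (induction k)
    case 0
    show ?case using addsub_0 by (simp only: of_nat_0 smul_simps)
  next
    case (Suc k)
    have "smul (int (Suc k)) x = x + smul (int k) x" by (simp only: of_nat_Suc smul_simps)
    then show ?case using addsub_add[OF x Suc] by (simp only:)
  qed
  show ?thesis
  proof (cases "z \<ge> 0")
    case True
    then show ?thesis using nat[of "nat z"] by simp
  next
    case False
    then have "- smul (int (nat (- z))) x \<in> S" using nat addsub_uminus by blast
    then show ?thesis using False by (simp add: smul_simps)
  qed
qed

lemma coset_of_eq_iff: "coset_of S x = coset_of S y \<longleftrightarrow> x - y \<in> S"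
proof
  assume "coset_of S x = coset_of S y"
  moreover have "x \<in> coset_of S x" using addsub_0 by (simp add: coset_of_def)
  ultimately show "x - y \<in> S" by (auto simp: coset_of_def)
next
  assume xy: "x - y \<in> S"
  have "z - x \<in> S \<longleftrightarrow> z - y \<in> S" for z
    using addsub_add[OF _ xy, of "z - x"] addsub_diff[OF _ xy, of "z - y"] by auto
  then show "coset_of S x = coset_of S y" by (auto simp: coset_of_def)
qed

lemma transversal_bij:
  assumes "R \<subseteq> M" "\<And>x. x \<in> M \<Longrightarrow> \<exists>r\<in>R. x - r \<in> S" "\<And>r r'. r \<in> R \<Longrightarrow> r' \<in> R \<Longrightarrow> r - r' \<in> S \<Longrightarrow> r = r'"
  shows "bij_betw (coset_of S) R (coset_of S ` M)"
proof -
  have "coset_of S ` M \<subseteq> coset_of S ` R"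
  proof clarify
    fix x assume "x \<in> M"
    then obtain r where "r \<in> R" "x - r \<in> S" using assms(2) by blast
    then show "coset_of S x \<in> coset_of S ` R" using coset_of_eq_iff by blast
  qed
  then show ?thesis using assms by (auto simp: bij_betw_def inj_on_def coset_of_eq_iff)
qed

lemma transversal_exists:
  obtains R where "transversal S M R"
proof -
  define h where "h c = (SOME r. r \<in> M \<and> coset_of S r = c)" for c
  have h: "h c \<in> M" "coset_of S (h c) = c" if "c \<in> coset_of S ` M" for c
    using someI_ex[of "\<lambda>r. r \<in> M \<and> coset_of S r = c"] that unfolding h_def by auto
  show thesis
  proof (rule that[of "h ` coset_of S ` M"], unfold transversal_def, intro conjI ballI impI)
    show "h ` coset_of S ` M \<subseteq> M" using h by auto
    fix x assume x: "x \<in> M"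
    then have "x - h (coset_of S x) \<in> S" using h(2)[of "coset_of S x"] coset_of_eq_iff[of x "h (coset_of S x)"] by auto
    then show "\<exists>r\<in>h ` coset_of S ` M. x - r \<in> S" using x by blast
  next
    fix r r' assume r: "r \<in> h ` coset_of S ` M" "r' \<in> h ` coset_of S ` M" "r - r' \<in> S"
    then obtain c c' where c: "c \<in> coset_of S ` M" "c' \<in> coset_of S ` M" "r = h c" "r' = h c'" by blast
    then have "c = c'" using h(2) r(3) coset_of_eq_iff by metis
    then show "r = r'" using c by simp
  qed
qed

end

lemma idx_transversal:
  assumes "addsub S" "R \<subseteq> M" "\<And>x. x \<in> M \<Longrightarrow> \<exists>r\<in>R. x - r \<in> S" "\<And>r r'. r \<in> R \<Longrightarrow> r' \<in> R \<Longrightarrow> r - r' \<in> S \<Longrightarrow> r = r'"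
  shows "idx M S = card R" "finite (coset_of S ` M) \<longleftrightarrow> finite R"
  using transversal_bij[OF assms] by (auto simp: idx_def bij_betw_same_card[symmetric] dest: bij_betw_finite)

lemma idx_pos: "N \<in> fisub M \<Longrightarrow> M \<noteq> {} \<Longrightarrow> idx M N > 0"
  by (simp add: fisub_def idx_def card_gt_0_iff)

text \<open>Sums of a representative of F modulo M and one of M modulo N represent F modulo
  N.\<close>

lemma idx_tower:
  assumes M: "M \<in> fisub F" and N: "addsub N" "N \<subseteq> M" and F: "addsub F"
  shows "finite (coset_of N ` F) \<longleftrightarrow> finite (coset_of N ` M)" "idx F N = idx F M * idx M N"
proof -
  have M': "addsub M" "M \<subseteq> F" "finite (coset_of M ` F)" using M by (auto simp: fisub_def)
  obtain R where R0: "transversal M F R" using transversal_exists[OF M'(1)] by metis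
  note R = transversalD[OF R0]
  obtain T where T0: "transversal N M T" using transversal_exists[OF N(1)] by metis
  note T = transversalD[OF T0]
  have iR: "idx F M = card R" "finite R" using idx_transversal[OF M'(1) R] M'(3) by auto
  have iT: "idx M N = card T" "finite (coset_of N ` M) \<longleftrightarrow> finite T" using idx_transversal[OF N(1) T] by auto
  let ?U = "(\<lambda>(r,t). r + t) ` (R \<times> T)"
  have uniq: "r = r' \<and> t = t'" if "r \<in> R" "r' \<in> R" "t \<in> T" "t' \<in> T" "(r + t) - (r' + t') \<in> N" for r r' t t'
  proof -
    have "t - t' \<in> M" using that T(1) addsub_diff[OF M'(1)] by blast
    then have "((r + t) - (r' + t')) - (t - t') \<in> M" using that(5) N(2) addsub_diff[OF M'(1)] by blast
    then have "r - r' \<in> M" by (simp add: algebra_simps)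
    then have rr: "r = r'" using R(3) that by blast
    then have "t - t' \<in> N" using that(5) by (simp add: algebra_simps)
    then show ?thesis using rr T(3) that by blast
  qed
  have U: "?U \<subseteq> F" "\<And>x. x \<in> F \<Longrightarrow> \<exists>r\<in>?U. x - r \<in> N" "\<And>r r'. r \<in> ?U \<Longrightarrow> r' \<in> ?U \<Longrightarrow> r - r' \<in> N \<Longrightarrow> r = r'"
  proof -
    show "?U \<subseteq> F"
    proof clarify
      fix r t assume "r \<in> R" "t \<in> T"
      then show "r + t \<in> F" using R(1) T(1) M'(2) by (intro addsub_add[OF F]) blast+
    qed
    fix x assume "x \<in> F"
    then obtain r where r: "r \<in> R" "x - r \<in> M" using R by blast
    then obtain t where t: "t \<in> T" "x - r - t \<in> N" using T by blast
    then have "x - (r + t) \<in> N" by (simp add: algebra_simps)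
    then show "\<exists>r\<in>?U. x - r \<in> N"
      by (intro bexI[of _ "r + t"] image_eqI[of _ _ "(r,t)"]) (use r t in simp_all)
  next
    fix u u' assume u: "u \<in> ?U" "u' \<in> ?U" "u - u' \<in> N"
    obtain r t where rt: "r \<in> R" "t \<in> T" "u = r + t" using u(1) by (elim imageE SigmaE) simp
    obtain r' t' where rt': "r' \<in> R" "t' \<in> T" "u' = r' + t'" using u(2) by (elim imageE SigmaE) simp
    show "u = u'" using uniq[OF rt(1) rt'(1) rt(2) rt'(2)] u(3) rt(3) rt'(3) by simp
  qed
  have "inj_on (\<lambda>(r,t). r + t) (R \<times> T)"
  proof (rule inj_onI, clarify)
    fix r t r' t' assume "r \<in> R" "t \<in> T" "r' \<in> R" "t' \<in> T" "r + t = r' + t'"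
    then show "r = r' \<and> t = t'" using uniq[of r r' t t'] addsub_0[OF N(1)] by simp
  qed
  then have cU: "card ?U = card R * card T" "finite ?U \<longleftrightarrow> finite (R \<times> T)"
    by (simp_all add: card_image card_cartesian_product finite_image_iff)
  have iU: "idx F N = card ?U" "finite (coset_of N ` F) \<longleftrightarrow> finite ?U" using idx_transversal[OF N(1) U] by auto
  show "idx F N = idx F M * idx M N" using iU iR iT cU by simp
  have "R \<noteq> {}" using R(2)[OF addsub_0[OF F]] by blast
  then show "finite (coset_of N ` F) \<longleftrightarrow> finite (coset_of N ` M)"
    using iU(2) cU(2) iT(2) iR(2) by (auto simp: finite_cartesian_product_iff)
qed

lemma fisub_trans_iff:
  assumes M: "M \<in> fisub F" and F: "addsub F"
  shows "N \<in> fisub M \<longleftrightarrow> N \<in> fisub F \<and> N \<subseteq> M"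
  using idx_tower(1)[OF M _ _ F, of N] M by (auto simp: fisub_def)

section \<open>Splitting a lattice along a surjection to the integers\<close>

lemma int_subgroup_generator:
  fixes T :: "int set"
  assumes T: "0 \<in> T" "\<And>x y. x \<in> T \<Longrightarrow> y \<in> T \<Longrightarrow> x - y \<in> T" and ne: "T \<noteq> {0}"
  obtains d :: nat where "d \<ge> 1" "T = {z. int d dvd z}"
proof -
  have neg: "- x \<in> T" if "x \<in> T" for x using T(2)[OF T(1) that] by simp
  have add: "x + y \<in> T" if "x \<in> T" "y \<in> T" for x y using T(2)[OF that(1) neg[OF that(2)]] by simp
  have mul: "k * x \<in> T" if x: "x \<in> T" for k x
  proof -
    have "int m * x \<in> T" for m by (induction m) (auto simp: T(1) algebra_simps intro: add x)
    then show ?thesis using neg by (cases k rule: int_cases2) force+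
  qed
  obtain x where x: "x \<in> T" "x \<noteq> 0" using ne T(1) by blast
  define Pd where "Pd d \<longleftrightarrow> d \<ge> 1 \<and> int d \<in> T" for d :: nat
  have "Pd (nat \<bar>x\<bar>)" using x neg[of x] by (auto simp: Pd_def abs_if)
  then have L: "Pd (LEAST d. Pd d)" by (rule LeastI)
  define d where "d = (LEAST d. Pd d)"
  have d: "d \<ge> 1" "int d \<in> T" using L by (auto simp: d_def Pd_def)
  have "T = {z. int d dvd z}"
  proof
    show "{z. int d dvd z} \<subseteq> T" using mul[OF d(2)] by (auto simp: dvd_def mult.commute)
    show "T \<subseteq> {z. int d dvd z}"
    proof
      fix z assume z: "z \<in> T"
      have "z - (z div int d) * int d \<in> T" using z mul[OF d(2)] T(2) by blast
      then have r: "z mod int d \<in> T" by (simp add: minus_div_mult_eq_mod)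
      obtain m where m: "z mod int d = int m" using d(1)
        by (metis nonneg_int_cases of_nat_0_less_iff pos_mod_sign less_le_trans zero_less_one)
      have "int m < int d" unfolding m[symmetric] using d(1) by (intro pos_mod_bound) simp
      then have "\<not> Pd m" unfolding d_def by (intro not_less_Least) (simp add: d_def)
      then have "m = 0" using r m by (simp add: Pd_def)
      then have "z mod int d = 0" using m by simp
      then show "z \<in> {z. int d dvd z}" by auto
    qed
  qed
  then show thesis using that d by blast
qed

text \<open>Rank is encoded by repeatedly splitting off a surjection onto the integers. No basis is
  mentioned, the notion passes to finite-index subgroups, and its recursion is the one by which
  sublattices are counted.\<close>

primrec free_rank :: "nat \<Rightarrow> (nat \<Rightarrow> int) set \<Rightarrow> bool" where
  "free_rank 0 M \<longleftrightarrow> M = {0}"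
| "free_rank (Suc r) M \<longleftrightarrow> addsub M \<and> (\<exists>\<pi>::(nat \<Rightarrow> int) \<Rightarrow> int.
     (\<forall>x\<in>M. \<forall>y\<in>M. \<pi> (x - y) = \<pi> x - \<pi> y) \<and> \<pi> ` M = UNIV \<and> free_rank r {x\<in>M. \<pi> x = 0})"

lemma free_rank_addsub: "free_rank r M \<Longrightarrow> addsub M"
  by (cases r) (auto simp: addsub_def)

text \<open>One step of that recursion. With \<open>\<tau>\<close> chosen over 1, the lattice is the
  direct sum of the kernel \<open>M1\<close> and the multiples of \<open>\<tau>\<close>.\<close>

locale lattice_split =
  fixes M :: "(nat \<Rightarrow> int) set" and \<pi> :: "(nat \<Rightarrow> int) \<Rightarrow> int"
  assumes M: "addsub M" and \<pi>diff: "\<And>x y. x \<in> M \<Longrightarrow> y \<in> M \<Longrightarrow> \<pi> (x - y) = \<pi> x - \<pi> y"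
    and surj: "\<pi> ` M = UNIV"
begin

definition M1 where "M1 = {x\<in>M. \<pi> x = 0}"
definition \<tau> where "\<tau> = (SOME x. x \<in> M \<and> \<pi> x = 1)"

lemma \<tau>: "\<tau> \<in> M" "\<pi> \<tau> = 1"
proof -
  have "\<exists>x. x \<in> M \<and> \<pi> x = 1" using surj by (metis UNIV_I imageE)
  from someI_ex[OF this] show "\<tau> \<in> M" "\<pi> \<tau> = 1" by (auto simp: \<tau>_def)
qed

lemma \<pi>0: "\<pi> 0 = 0" using \<pi>diff[OF addsub_0[OF M] addsub_0[OF M]] by simp
lemma \<pi>uminus: "x \<in> M \<Longrightarrow> \<pi> (- x) = - \<pi> x" using \<pi>diff[OF addsub_0[OF M], of x] \<pi>0 by simp
lemma \<pi>add: "x \<in> M \<Longrightarrow> y \<in> M \<Longrightarrow> \<pi> (x + y) = \<pi> x + \<pi> y"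
  using \<pi>diff[of x "- y"] \<pi>uminus[of y] addsub_uminus[OF M, of y] by simp

lemma \<pi>smul:
  assumes x: "x \<in> M" shows "\<pi> (smul z x) = z * \<pi> x"
proof -
  have nat: "\<pi> (smul (int k) x) = int k * \<pi> x" for k
  proof (induction k)
    case 0
    show ?case using \<pi>0 by (simp only: of_nat_0 smul_simps mult_zero_left)
  next
    case (Suc k)
    have "smul (int (Suc k)) x = x + smul (int k) x" by (simp only: of_nat_Suc smul_simps)
    then have "\<pi> (smul (int (Suc k)) x) = \<pi> x + int k * \<pi> x"
      using \<pi>add[OF x addsub_smul[OF M x]] Suc by (simp only:)
    then show ?case by (simp add: algebra_simps)
  qed
  show ?thesis
  proof (cases "z \<ge> 0")
    case True
    then show ?thesis using nat[of "nat z"] by simp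
  next
    case False
    have "\<pi> (- smul (int (nat (- z))) x) = - (int (nat (- z)) * \<pi> x)"
      using nat \<pi>uminus[OF addsub_smul[OF M x]] by (simp only:)
    moreover have "- smul (int (nat (- z))) x = smul z x" using False by (simp add: smul_simps)
    ultimately show ?thesis using False by simp
  qed
qed

lemma addsub_M1: "addsub M1"
  using M \<pi>0 \<pi>diff by (auto simp: M1_def addsub_def)

lemma M1_sub: "M1 \<subseteq> M" by (auto simp: M1_def)

text \<open>Were the image zero, distinct multiples of \<open>\<tau>\<close> would lie in distinct
  cosets of \<open>N\<close>, contrary to finite index.\<close>

lemma fisub_image:
  assumes N: "N \<in> fisub M"
  obtains d :: nat where "d \<ge> 1" "\<pi> ` N = {z. int d dvd z}"
proof -
  have N': "addsub N" "N \<subseteq> M" "finite (coset_of N ` M)" using N by (auto simp: fisub_def)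
  have "\<pi> ` N \<noteq> {0}"
  proof
    assume z: "\<pi> ` N = {0}"
    have "inj (\<lambda>k::int. coset_of N (smul k \<tau>))"
    proof (rule injI)
      fix k l assume "coset_of N (smul k \<tau>) = coset_of N (smul l \<tau>)"
      then have "smul (k - l) \<tau> \<in> N" using coset_of_eq_iff[OF N'(1)] by (simp add: smul_simps)
      then have "\<pi> (smul (k - l) \<tau>) = 0" using z by auto
      then show "k = l" using \<pi>smul[OF \<tau>(1)] \<tau>(2) by simp
    qed
    then have "infinite (range (\<lambda>k::int. coset_of N (smul k \<tau>)))" using range_inj_infinite finite_imageD infinite_UNIV_int by blast
    moreover have "range (\<lambda>k::int. coset_of N (smul k \<tau>)) \<subseteq> coset_of N ` M" using addsub_smul[OF M \<tau>(1)] by auto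
    ultimately show False using N'(3) finite_subset by blast
  qed
  moreover have "0 \<in> \<pi> ` N" using addsub_0[OF N'(1)] \<pi>0 by force
  moreover have "x - y \<in> \<pi> ` N" if xy: "x \<in> \<pi> ` N" "y \<in> \<pi> ` N" for x y
  proof -
    obtain a b where ab: "a \<in> N" "b \<in> N" "x = \<pi> a" "y = \<pi> b" using xy by blast
    then have "\<pi> (a - b) = x - y" using \<pi>diff[of a b] N'(2) by auto
    then show ?thesis using ab addsub_diff[OF N'(1)] by (metis image_eqI)
  qed
  ultimately show thesis using int_subgroup_generator[of "\<pi> ` N"] that by metis
qed

lemma fisub_kernel:
  assumes N: "N \<in> fisub M"
  shows "{x\<in>N. \<pi> x = 0} \<in> fisub M1"
proof -
  have N': "addsub N" "N \<subseteq> M" "finite (coset_of N ` M)" using N by (auto simp: fisub_def)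
  let ?K = "{x\<in>N. \<pi> x = 0}"
  have K: "addsub ?K"
    unfolding addsub_def
  proof (intro conjI ballI)
    show "0 \<in> ?K" using addsub_0[OF N'(1)] \<pi>0 by simp
    fix x y assume xy: "x \<in> ?K" "y \<in> ?K"
    then have "x \<in> M" "y \<in> M" using N'(2) by blast+
    then show "x - y \<in> ?K" using xy addsub_diff[OF N'(1)] \<pi>diff by simp
  qed
  obtain R where R0: "transversal ?K M1 R" using transversal_exists[OF K] by metis
  note R = transversalD[OF R0]
  have "inj_on (coset_of N) R"
  proof (rule inj_onI)
    fix r r' assume r: "r \<in> R" "r' \<in> R" "coset_of N r = coset_of N r'"
    then have "r - r' \<in> N" using coset_of_eq_iff[OF N'(1)] by blast
    moreover have "r \<in> M1" "r' \<in> M1" using r R(1) by blast+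
    then have "\<pi> (r - r') = 0" using \<pi>diff[of r r'] by (simp add: M1_def)
    ultimately show "r = r'" using R(3)[OF r(1,2)] by simp
  qed
  moreover have "coset_of N ` R \<subseteq> coset_of N ` M" using R(1) M1_sub by auto
  ultimately have "finite R" using N'(3) finite_subset finite_imageD by metis
  then have "finite (coset_of ?K ` M1)" using idx_transversal(2)[OF K R] by simp
  moreover have "?K \<subseteq> M1" using N' by (auto simp: M1_def)
  ultimately show ?thesis using K by (simp add: fisub_def)
qed

text \<open>The sublattice spanned by \<open>N1\<close> and one vector d \<tau> + t, the recursive
  form of a Hermite normal form. Only the coset \<open>c\<close> of t modulo \<open>N1\<close>
  matters, so the triples of \<open>N1\<close>, \<open>d\<close> and \<open>c\<close> describe
  sublattices without repetition.\<close>

definition glue :: "(nat \<Rightarrow> int) set \<Rightarrow> nat \<Rightarrow> (nat \<Rightarrow> int) set \<Rightarrow> (nat \<Rightarrow> int) set" where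
  "glue N1 d c = {x. \<exists>k. \<exists>t\<in>c. x - smul k (smul (int d) \<tau> + t) \<in> N1}"

lemma glue_eq:
  assumes N1: "N1 \<in> fisub M1" and t: "t \<in> M1"
  shows "glue N1 d (coset_of N1 t) = {x. \<exists>k. x - smul k (smul (int d) \<tau> + t) \<in> N1}"
proof -
  have N: "addsub N1" using N1 by (simp add: fisub_def)
  show ?thesis
  proof (intro subset_antisym subsetI)
    fix x assume "x \<in> glue N1 d (coset_of N1 t)"
    then obtain k s where s: "s - t \<in> N1" "x - smul k (smul (int d) \<tau> + s) \<in> N1" by (auto simp: glue_def coset_of_def)
    then have "(x - smul k (smul (int d) \<tau> + s)) + smul k (s - t) \<in> N1" using addsub_add[OF N] addsub_smul[OF N] by blast
    then have "x - smul k (smul (int d) \<tau> + t) \<in> N1" by (simp add: smul_simps algebra_simps)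
    then show "x \<in> {x. \<exists>k. x - smul k (smul (int d) \<tau> + t) \<in> N1}" by blast
  next
    fix x assume "x \<in> {x. \<exists>k. x - smul k (smul (int d) \<tau> + t) \<in> N1}"
    moreover have "t \<in> coset_of N1 t" using addsub_0[OF N] by (simp add: coset_of_def)
    ultimately show "x \<in> glue N1 d (coset_of N1 t)" by (auto simp: glue_def)
  qed
qed

text \<open>The vectors j \<tau> + r with 0 \<le> j < d and r running over representatives of M1
  modulo N1 represent the quotient, which gives the index. The last three parts recover
  \<open>N1\<close>, \<open>d\<close> and \<open>c\<close> from the glued lattice.\<close>

lemma glue_props:
  assumes N1: "N1 \<in> fisub M1" and c: "c \<in> coset_of N1 ` M1" and d: "d \<ge> 1"
  shows "glue N1 d c \<in> fisub M" "idx M (glue N1 d c) = d * idx M1 N1"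
    "{x\<in>glue N1 d c. \<pi> x = 0} = N1" "\<pi> ` glue N1 d c = {z. int d dvd z}"
    "{x - smul (int d) \<tau> | x. x \<in> glue N1 d c \<and> \<pi> x = int d} = c"
proof -
  obtain t where t: "t \<in> M1" "c = coset_of N1 t" using c by auto
  have N: "addsub N1" "N1 \<subseteq> M1" "finite (coset_of N1 ` M1)" using N1 by (auto simp: fisub_def)
  define w where "w = smul (int d) \<tau> + t"
  define G where "G = glue N1 d c"
  have G: "G = {x. \<exists>k. x - smul k w \<in> N1}" unfolding G_def t(2) w_def by (rule glue_eq[OF N1 t(1)])
  have tM: "t \<in> M" "\<pi> t = 0" using t by (auto simp: M1_def)
  have wM: "w \<in> M" unfolding w_def using addsub_add[OF M addsub_smul[OF M \<tau>(1)] tM(1)] .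
  have \<pi>w: "\<pi> w = int d" unfolding w_def using \<pi>add[OF addsub_smul[OF M \<tau>(1)] tM(1)] \<pi>smul[OF \<tau>(1)] \<tau>(2) tM(2) by simp
  have N1M: "x \<in> M" "\<pi> x = 0" if "x \<in> N1" for x using that N(2) by (auto simp: M1_def)
  have GM: "x \<in> M" "\<pi> x = k * int d" if "x - smul k w \<in> N1" for x k
  proof -
    have "(x - smul k w) + smul k w \<in> M" by (intro addsub_add[OF M] N1M(1) that addsub_smul[OF M wM])
    then show xM: "x \<in> M" by simp
    have "\<pi> (x - smul k w) = \<pi> x - \<pi> (smul k w)" by (intro \<pi>diff xM addsub_smul[OF M wM])
    then show "\<pi> x = k * int d" using N1M(2)[OF that] \<pi>smul[OF wM] \<pi>w by simp
  qed
  have GsubM: "G \<subseteq> M" using GM(1) unfolding G by blast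
  have Gs: "addsub G"
    unfolding addsub_def
  proof (intro conjI ballI)
    have "0 - smul 0 w \<in> N1" using addsub_0[OF N(1)] by (simp add: smul_simps)
    then show "0 \<in> G" unfolding G by blast
    fix x y assume "x \<in> G" "y \<in> G"
    then obtain k l where "x - smul k w \<in> N1" "y - smul l w \<in> N1" unfolding G by blast
    then have "(x - smul k w) - (y - smul l w) \<in> N1" by (rule addsub_diff[OF N(1)])
    then have "(x - y) - smul (k - l) w \<in> N1" by (simp add: smul_simps algebra_simps)
    then show "x - y \<in> G" unfolding G by blast
  qed
  have ker: "x \<in> N1" if x: "x \<in> G" "\<pi> x = 0" for x
  proof -
    obtain k where k: "x - smul k w \<in> N1" using x(1) unfolding G by blast
    then have "k = 0" using GM(2)[OF k] x(2) d by simp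
    then show ?thesis using k by (simp add: smul_simps)
  qed
  have N1G: "N1 \<subseteq> G"
  proof
    fix x assume "x \<in> N1"
    then have "x - smul 0 w \<in> N1" by (simp add: smul_simps)
    then show "x \<in> G" unfolding G by blast
  qed
  have wG: "smul k w \<in> G" for k
  proof -
    have "smul k w - smul k w \<in> N1" using addsub_0[OF N(1)] by simp
    then show ?thesis unfolding G by blast
  qed
  have kerG: "{x\<in>G. \<pi> x = 0} = N1" using ker N1G N1M by auto
  then show "{x\<in>glue N1 d c. \<pi> x = 0} = N1" by (simp add: G_def)
  have "\<pi> ` G = {z. int d dvd z}"
  proof (intro subset_antisym subsetI)
    fix z assume "z \<in> \<pi> ` G"
    then show "z \<in> {z. int d dvd z}" unfolding G using GM(2) by auto
  next
    fix z assume "z \<in> {z. int d dvd z}"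
    then obtain k where "z = int d * k" by (auto simp: dvd_def)
    then have "\<pi> (smul k w) = z" using \<pi>smul[OF wM] \<pi>w by simp
    then show "z \<in> \<pi> ` G" using wG[of k] by (metis image_eqI)
  qed
  then show "\<pi> ` glue N1 d c = {z. int d dvd z}" by (simp add: G_def)
  have "{x - smul (int d) \<tau> | x. x \<in> G \<and> \<pi> x = int d} = c"
  proof (intro subset_antisym subsetI)
    fix y assume "y \<in> {x - smul (int d) \<tau> | x. x \<in> G \<and> \<pi> x = int d}"
    then obtain x where x: "y = x - smul (int d) \<tau>" "x \<in> G" "\<pi> x = int d" by blast
    then obtain k where k: "x - smul k w \<in> N1" unfolding G by blast
    then have "k = 1" using GM(2)[OF k] x(3) d by simp
    then have "x - smul k w = y - t" using x(1) by (simp add: smul_simps w_def algebra_simps)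
    then have "y - t \<in> N1" using k by (simp only:)
    then show "y \<in> c" by (simp add: t coset_of_def)
  next
    fix y assume "y \<in> c"
    then have y: "y - t \<in> N1" by (simp add: t coset_of_def)
    let ?x = "y + smul (int d) \<tau>"
    have k: "?x - smul 1 w \<in> N1" using y by (simp add: smul_simps w_def algebra_simps)
    then have "?x \<in> G" "\<pi> ?x = int d" using GM(2)[OF k] unfolding G by (blast, simp)
    moreover have "y = ?x - smul (int d) \<tau>" by simp
    ultimately show "y \<in> {x - smul (int d) \<tau> | x. x \<in> G \<and> \<pi> x = int d}" by blast
  qed
  then show "{x - smul (int d) \<tau> | x. x \<in> glue N1 d c \<and> \<pi> x = int d} = c" by (simp add: G_def)
  obtain R where R0: "transversal N1 M1 R" using transversal_exists[OF N(1)] by metis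
  note R = transversalD[OF R0]
  have iR: "idx M1 N1 = card R" "finite R" using idx_transversal[OF N(1) R] N(3) by auto
  let ?f = "\<lambda>(j::int,r). smul j \<tau> + r"
  let ?U = "?f ` ({0..<int d} \<times> R)"
  have fM: "smul j \<tau> + r \<in> M" "\<pi> (smul j \<tau> + r) = j" if "r \<in> R" for j r
  proof -
    have r: "r \<in> M" "\<pi> r = 0" using that R(1) by (auto simp: M1_def)
    show "smul j \<tau> + r \<in> M" by (intro addsub_add[OF M] addsub_smul[OF M] \<tau> r)
    show "\<pi> (smul j \<tau> + r) = j" using \<pi>add[OF addsub_smul[OF M \<tau>(1)] r(1)] \<pi>smul[OF \<tau>(1)] \<tau>(2) r(2) by simp
  qed
  have uniq: "j = j' \<and> r = r'" if as: "j \<in> {0..<int d}" "j' \<in> {0..<int d}" "r \<in> R" "r' \<in> R" "(smul j \<tau> + r) - (smul j' \<tau> + r') \<in> G" for j j' r r'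
  proof -
    obtain k where k: "((smul j \<tau> + r) - (smul j' \<tau> + r')) - smul k w \<in> N1" using as(5) unfolding G by blast
    have "\<pi> ((smul j \<tau> + r) - (smul j' \<tau> + r')) = j - j'" using \<pi>diff[OF fM(1) fM(1)] fM(2) that by simp
    then have e: "j - j' = k * int d" using GM(2)[OF k] by simp
    have "j = j'"
    proof -
      have "\<bar>j - j'\<bar> < int d" using that(1,2) by auto
      then have "\<bar>k\<bar> * int d < 1 * int d" using e by (simp add: abs_mult)
      then have "\<bar>k\<bar> < 1" by (rule mult_right_less_imp_less) simp
      then show ?thesis using e by simp
    qed
    then have "r - r' \<in> G" using that(5) by simp
    moreover have "r \<in> M1" "r' \<in> M1" using that R(1) by blast+
    then have "\<pi> (r - r') = 0" using \<pi>diff[of r r'] by (simp add: M1_def)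
    ultimately have "r - r' \<in> N1" using ker by blast
    then show ?thesis using \<open>j = j'\<close> R(3) that by blast
  qed
  have U: "?U \<subseteq> M" "\<And>x. x \<in> M \<Longrightarrow> \<exists>u\<in>?U. x - u \<in> G" "\<And>u u'. u \<in> ?U \<Longrightarrow> u' \<in> ?U \<Longrightarrow> u - u' \<in> G \<Longrightarrow> u = u'"
  proof -
    show "?U \<subseteq> M" using fM(1) by auto
    show "u = u'" if u: "u \<in> ?U" "u' \<in> ?U" "u - u' \<in> G" for u u'
    proof -
      obtain j r where jr: "j \<in> {0..<int d}" "r \<in> R" "u = smul j \<tau> + r" using u(1) by (elim imageE SigmaE) simp
      obtain j' r' where jr': "j' \<in> {0..<int d}" "r' \<in> R" "u' = smul j' \<tau> + r'" using u(2) by (elim imageE SigmaE) simp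
      show ?thesis using uniq[OF jr(1) jr'(1) jr(2) jr'(2)] u(3) jr(3) jr'(3) by simp
    qed
    show "\<exists>u\<in>?U. x - u \<in> G" if x: "x \<in> M" for x
    proof -
      define j where "j = \<pi> x mod int d"
      define k where "k = \<pi> x div int d"
      define y where "y = x - smul j \<tau> - smul k w"
      have yM: "y \<in> M" unfolding y_def by (intro addsub_diff[OF M] x addsub_smul[OF M] \<tau> wM)
      have "\<pi> y = \<pi> x - j - k * int d"
        unfolding y_def using \<pi>diff \<pi>smul \<tau> wM \<pi>w x addsub_smul[OF M] addsub_diff[OF M] by simp
      also have "\<dots> = 0" unfolding j_def k_def by (simp add: minus_div_mult_eq_mod algebra_simps)
      finally have "y \<in> M1" using yM by (simp add: M1_def)
      then obtain r where r: "r \<in> R" "y - r \<in> N1" using R(2) by blast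
      have "x - (smul j \<tau> + r) - smul k w \<in> N1" using r(2) by (simp add: y_def algebra_simps)
      then have "x - (smul j \<tau> + r) \<in> G" unfolding G by blast
      moreover have "j \<in> {0..<int d}" unfolding j_def using d by simp
      ultimately show ?thesis
        by (intro bexI[of _ "smul j \<tau> + r"] image_eqI[of _ _ "(j,r)"]) (use r(1) in simp_all)
    qed
  qed
  have "inj_on ?f ({0..<int d} \<times> R)"
  proof (rule inj_onI, clarify)
    fix j r j' r' assume a: "j \<in> {0..<int d}" "r \<in> R" "j' \<in> {0..<int d}" "r' \<in> R" "smul j \<tau> + r = smul j' \<tau> + r'"
    show "j = j' \<and> r = r'" using uniq[OF a(1,3,2,4)] a(5) addsub_0[OF Gs] by simp
  qed
  then have cU: "card ?U = d * card R" "finite ?U" using iR(2) by (auto simp: card_image card_cartesian_product)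
  have iU: "idx M G = card ?U" "finite (coset_of G ` M) \<longleftrightarrow> finite ?U" using idx_transversal[OF Gs U] by auto
  then show "idx M (glue N1 d c) = d * idx M1 N1" using cU iR by (simp add: G_def)
  show "glue N1 d c \<in> fisub M" using Gs GsubM iU(2) cU(2) by (simp add: fisub_def G_def)
qed

text \<open>Any element lying over the generator d of the image supplies the vector t; another
  choice changes it by an element of the kernel.\<close>

lemma unglue:
  assumes N: "N \<in> fisub M" and d: "d \<ge> 1" "\<pi> ` N = {z. int d dvd z}"
  shows "glue {x\<in>N. \<pi> x = 0} d {x - smul (int d) \<tau> | x. x \<in> N \<and> \<pi> x = int d} = N"
    "{x - smul (int d) \<tau> | x. x \<in> N \<and> \<pi> x = int d} \<in> coset_of {x\<in>N. \<pi> x = 0} ` M1"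
proof -
  have N': "addsub N" "N \<subseteq> M" using N by (auto simp: fisub_def)
  let ?K = "{x\<in>N. \<pi> x = 0}" and ?c = "{x - smul (int d) \<tau> | x. x \<in> N \<and> \<pi> x = int d}"
  have "int d \<in> \<pi> ` N" unfolding d(2) by simp
  then obtain w where w: "w \<in> N" "\<pi> w = int d" by (metis imageE)
  let ?t = "w - smul (int d) \<tau>"
  have wM: "w \<in> M" using w N' by auto
  have tM1: "?t \<in> M1" using \<pi>diff[OF wM addsub_smul[OF M \<tau>(1)]] \<pi>smul[OF \<tau>(1)] \<tau>(2) w addsub_diff[OF M wM addsub_smul[OF M \<tau>(1)]]
    by (simp add: M1_def)
  have c: "?c = coset_of ?K ?t"
  proof (intro subset_antisym subsetI)
    fix y assume "y \<in> ?c"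
    then obtain x where x: "y = x - smul (int d) \<tau>" "x \<in> N" "\<pi> x = int d" by blast
    then have "x - w \<in> N" "\<pi> (x - w) = 0" using addsub_diff[OF N'(1)] w \<pi>diff[of x w] N'(2) by auto
    moreover have e: "y - ?t = x - w" using x by simp
    ultimately show "y \<in> coset_of ?K ?t" unfolding coset_of_def mem_Collect_eq e by blast
  next
    fix y assume "y \<in> coset_of ?K ?t"
    then have y: "y - ?t \<in> N" "\<pi> (y - ?t) = 0" by (auto simp: coset_of_def)
    have yM: "y - ?t \<in> M" using y N' by blast
    have "(y - ?t) + w \<in> N" "\<pi> ((y - ?t) + w) = int d" using addsub_add[OF N'(1) y(1) w(1)] \<pi>add[OF yM wM] y w by auto
    moreover have "y = ((y - ?t) + w) - smul (int d) \<tau>" by (simp add: algebra_simps)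
    ultimately show "y \<in> ?c" by blast
  qed
  then show "?c \<in> coset_of ?K ` M1" using tM1 by blast
  have K: "?K \<in> fisub M1" by (rule fisub_kernel[OF N])
  have "glue ?K d ?c = {x. \<exists>k. x - smul k (smul (int d) \<tau> + ?t) \<in> ?K}" unfolding c by (rule glue_eq[OF K tM1])
  also have "smul (int d) \<tau> + ?t = w" by simp
  also have "{x. \<exists>k. x - smul k w \<in> ?K} = N"
  proof (intro subset_antisym subsetI)
    fix x assume "x \<in> {x. \<exists>k. x - smul k w \<in> ?K}"
    then obtain k where "x - smul k w \<in> N" by blast
    then have "(x - smul k w) + smul k w \<in> N" using addsub_add[OF N'(1)] addsub_smul[OF N'(1) w(1)] by blast
    then show "x \<in> N" by simp
  next
    fix x assume x: "x \<in> N"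
    then have "int d dvd \<pi> x" using d(2) by blast
    then obtain k where k: "\<pi> x = int d * k" by (auto simp: dvd_def)
    have "x - smul k w \<in> N" using addsub_diff[OF N'(1) x] addsub_smul[OF N'(1) w(1)] by blast
    moreover have "\<pi> (x - smul k w) = 0" using \<pi>diff[of x "smul k w"] x N'(2) addsub_smul[OF M wM] \<pi>smul[OF wM] w k by auto
    ultimately show "x \<in> {x. \<exists>k. x - smul k w \<in> ?K}" by blast
  qed
  finally show "glue ?K d ?c = N" .
qed

end

text \<open>Dividing \<open>\<pi>\<close> by the generator of its image on \<open>N\<close> gives a
  surjection of \<open>N\<close> onto the integers, whose kernel has finite index in the kernel on
  \<open>M\<close>.\<close>

lemma free_rank_fisub:
  assumes "free_rank r M" "N \<in> fisub M"
  shows "free_rank r N"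
  using assms
proof (induction r arbitrary: M N)
  case 0
  then show ?case by (auto simp: fisub_def addsub_def)
next
  case (Suc r)
  then obtain \<pi> :: "(nat \<Rightarrow> int) \<Rightarrow> int" where M: "addsub M"
    and \<pi>: "\<forall>x\<in>M. \<forall>y\<in>M. \<pi> (x - y) = \<pi> x - \<pi> y" "\<pi> ` M = UNIV" "free_rank r {x\<in>M. \<pi> x = 0}"
    by auto
  interpret lattice_split M \<pi> using M \<pi> by unfold_locales auto
  have N': "addsub N" "N \<subseteq> M" using Suc.prems(2) by (auto simp: fisub_def)
  obtain d :: nat where d: "d \<ge> 1" "\<pi> ` N = {z. int d dvd z}" using fisub_image[OF Suc.prems(2)] by metis
  define \<sigma> where "\<sigma> x = \<pi> x div int d" for x
  have dv: "int d dvd \<pi> x" if "x \<in> N" for x using d(2) that by blast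
  have diff: "\<sigma> (x - y) = \<sigma> x - \<sigma> y" if xy: "x \<in> N" "y \<in> N" for x y
  proof -
    obtain k l where kl: "\<pi> x = int d * k" "\<pi> y = int d * l" using dv[OF xy(1)] dv[OF xy(2)] by (auto elim!: dvdE)
    have "x \<in> M" "y \<in> M" using xy N'(2) by blast+
    then have "\<pi> (x - y) = int d * (k - l)" using \<pi>diff[of x y] kl by (simp add: right_diff_distrib)
    then show ?thesis using kl d(1) by (simp add: \<sigma>_def)
  qed
  have ker: "{x\<in>N. \<sigma> x = 0} = {x\<in>N. \<pi> x = 0}"
  proof -
    have "\<sigma> x = 0 \<longleftrightarrow> \<pi> x = 0" if x: "x \<in> N" for x
    proof -
      obtain k where "\<pi> x = int d * k" using dv[OF x] by (auto elim!: dvdE)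
      then show ?thesis using d(1) by (simp add: \<sigma>_def)
    qed
    then show ?thesis by blast
  qed
  have "\<sigma> ` N = UNIV"
  proof -
    have "z \<in> \<sigma> ` N" for z
    proof -
      have "int d * z \<in> \<pi> ` N" unfolding d(2) by simp
      then obtain x where "x \<in> N" "\<pi> x = int d * z" by (metis imageE)
      then have "\<sigma> x = z" using d(1) by (simp add: \<sigma>_def)
      then show ?thesis using \<open>x \<in> N\<close> by blast
    qed
    then show ?thesis by blast
  qed
  moreover have "free_rank r {x\<in>N. \<sigma> x = 0}"
    unfolding ker using Suc.IH[OF \<pi>(3)] fisub_kernel[OF Suc.prems(2)] by (simp add: M1_def)
  ultimately show ?case using N'(1) diff by auto
qed

text \<open>Generation is stated as an induction principle: a subgroup containing the generators
  contains everything. In this form it applies directly to the set where two homomorphisms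
  agree.\<close>

lemma free_rank_generators:
  assumes "free_rank r M"
  obtains g :: "nat \<Rightarrow> nat \<Rightarrow> int" where "\<And>i. i < r \<Longrightarrow> g i \<in> M"
    "\<And>S. addsub S \<Longrightarrow> (\<And>i. i < r \<Longrightarrow> g i \<in> S) \<Longrightarrow> M \<subseteq> S"
proof -
  have "\<exists>g :: nat \<Rightarrow> nat \<Rightarrow> int. (\<forall>i<r. g i \<in> M) \<and> (\<forall>S. addsub S \<longrightarrow> (\<forall>i<r. g i \<in> S) \<longrightarrow> M \<subseteq> S)"
    using assms
  proof (induction r arbitrary: M)
    case 0
    then show ?case by (auto simp: addsub_def)
  next
    case (Suc r)
    then obtain \<pi> :: "(nat \<Rightarrow> int) \<Rightarrow> int" where M: "addsub M"
      and \<pi>: "\<forall>x\<in>M. \<forall>y\<in>M. \<pi> (x - y) = \<pi> x - \<pi> y" "\<pi> ` M = UNIV" "free_rank r {x\<in>M. \<pi> x = 0}"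
      by auto
    interpret lattice_split M \<pi> using M \<pi> by unfold_locales auto
    obtain g where g: "\<forall>i<r. g i \<in> M1" "\<forall>S. addsub S \<longrightarrow> (\<forall>i<r. g i \<in> S) \<longrightarrow> M1 \<subseteq> S"
      using Suc.IH[OF \<pi>(3)] unfolding M1_def by blast
    show ?case
    proof (intro exI[of _ "g(r := \<tau>)"] conjI allI impI)
      fix i assume "i < Suc r"
      then show "(g(r := \<tau>)) i \<in> M" using g(1) M1_sub \<tau>(1) by (auto simp: less_Suc_eq)
    next
      fix S assume S: "addsub S" "\<forall>i<Suc r. (g(r := \<tau>)) i \<in> S"
      have "\<tau> \<in> S" using S(2) by (metis fun_upd_same lessI)
      have "g i \<in> S" if "i < r" for i
      proof -
        have "(g(r := \<tau>)) i \<in> S" using S(2) that by (metis less_SucI)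
        then show ?thesis using that by simp
      qed
      then have sub: "M1 \<subseteq> S" using g(2) S(1) by blast
      show "M \<subseteq> S"
      proof
        fix x assume x: "x \<in> M"
        have "x - smul (\<pi> x) \<tau> \<in> M" by (intro addsub_diff[OF M] x addsub_smul[OF M] \<tau>)
        moreover have "\<pi> (x - smul (\<pi> x) \<tau>) = 0"
          using \<pi>diff[OF x addsub_smul[OF M \<tau>(1)]] \<pi>smul[OF \<tau>(1)] \<tau>(2) by simp
        ultimately have "x - smul (\<pi> x) \<tau> \<in> S" using sub by (auto simp: M1_def)
        then have "(x - smul (\<pi> x) \<tau>) + smul (\<pi> x) \<tau> \<in> S"
          using addsub_add[OF S(1)] addsub_smul[OF S(1) \<open>\<tau> \<in> S\<close>] by blast
        then show "x \<in> S" by simp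
      qed
    qed
  qed
  then show thesis using that by blast
qed

text \<open>A sublattice is a triple of N1, d and a coset. With i = [M1 : N1] there are i cosets,
  each contributing (d i)^(-(r + 2)), together i^(-(r + 1)) d^(-(r + 2)); summing over d splits off
  the factor zeta(r + 2).\<close>

lemma (in lattice_split) fisub_weight_step:
  assumes W: "((\<lambda>N. (1 / real (idx M1 N)) ^ Suc r) has_sum W) (fisub M1)"
  shows "((\<lambda>N. (1 / real (idx M N)) ^ Suc (Suc r)) has_sum (W * zeta_nat (r + 2))) (fisub M)"
proof -
  define A where "A = Sigma (fisub M1) (\<lambda>N1. Sigma {1::nat..} (\<lambda>d. coset_of N1 ` M1))"
  define \<Phi> where "\<Phi> = (\<lambda>(N1, d, c). glue N1 d c)"
  define dg where "dg N = (SOME d::nat. d \<ge> 1 \<and> \<pi> ` N = {z. int d dvd z})" for N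
  define \<Psi> where "\<Psi> N = ({x\<in>N. \<pi> x = 0}, dg N, {x - smul (int (dg N)) \<tau> | x. x \<in> N \<and> \<pi> x = int (dg N)})" for N
  have dg: "dg N \<ge> 1 \<and> \<pi> ` N = {z. int (dg N) dvd z}" if N: "N \<in> fisub M" for N
  proof -
    have "\<exists>d::nat. d \<ge> 1 \<and> \<pi> ` N = {z. int d dvd z}" by (rule fisub_image[OF N]) (intro exI conjI)
    from someI_ex[OF this] show ?thesis unfolding dg_def .
  qed
  have dguniq: "d = e" if "d \<ge> 1" "e \<ge> 1" "{z. int d dvd z} = {z. int e dvd z}" for d e :: nat
  proof -
    have "int d \<in> {z. int d dvd z}" "int e \<in> {z. int e dvd z}" by simp_all
    then have "int d \<in> {z. int e dvd z}" "int e \<in> {z. int d dvd z}" by (simp_all only: that(3))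
    then have "int d dvd int e" "int e dvd int d" by simp_all
    then show ?thesis by (simp add: dvd_antisym)
  qed
  have bij: "bij_betw \<Phi> A (fisub M)"
  proof (rule bij_betw_byWitness[where f' = \<Psi>])
    show "\<forall>a\<in>A. \<Psi> (\<Phi> a) = a"
    proof (rule ballI)
      fix a assume "a \<in> A"
      then obtain N1 d c where a: "a = (N1,d,c)" "N1 \<in> fisub M1" "d \<ge> 1" "c \<in> coset_of N1 ` M1"
        by (auto simp: A_def)
      note gp = glue_props[OF a(2,4,3)]
      have "dg (glue N1 d c) = d" using dguniq dg[OF gp(1)] gp(4) a(3) by metis
      then show "\<Psi> (\<Phi> a) = a" using gp(3,5) by (simp add: \<Psi>_def \<Phi>_def a(1))
    qed
    show "\<forall>N\<in>fisub M. \<Phi> (\<Psi> N) = N"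
      using unglue(1) dg by (auto simp: \<Phi>_def \<Psi>_def)
    show "\<Phi> ` A \<subseteq> fisub M" using glue_props(1) by (auto simp: A_def \<Phi>_def)
    show "\<Psi> ` fisub M \<subseteq> A"
    proof (rule image_subsetI)
      fix N assume N: "N \<in> fisub M"
      then show "\<Psi> N \<in> A" using fisub_kernel[OF N] unglue(2)[OF N] dg[OF N] by (auto simp: A_def \<Psi>_def)
    qed
  qed
  have pos: "idx M1 N > 0" if "N \<in> fisub M1" for N
    using idx_pos[OF that] addsub_0[OF addsub_M1] by auto
  let ?h = "\<lambda>(N1, d, c). (1 / real (idx M (glue N1 d c))) ^ Suc (Suc r)"
  have inner: "((\<lambda>y. ?h (N1, y)) has_sum ((1 / real (idx M1 N1)) ^ Suc r * zeta_nat (r + 2))) (Sigma {1::nat..} (\<lambda>d. coset_of N1 ` M1))"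
    if N1: "N1 \<in> fisub M1" for N1
  proof -
    let ?i = "idx M1 N1"
    have fin: "finite (coset_of N1 ` M1)" using N1 by (simp add: fisub_def)
    have val: "(\<Sum>c\<in>coset_of N1 ` M1. ?h (N1, d, c)) = (1 / real ?i) ^ Suc r * recip_pow (r + 2) d" if d: "d \<in> {1..}" for d
    proof -
      have "(\<Sum>c\<in>coset_of N1 ` M1. ?h (N1, d, c)) = (\<Sum>c\<in>coset_of N1 ` M1. (1 / (real d * real ?i)) ^ Suc (Suc r))"
        using glue_props(2)[OF N1] d by (intro sum.cong) auto
      also have "\<dots> = real ?i * (1 / (real d * real ?i)) ^ Suc (Suc r)" by (simp add: idx_def)
      also have "\<dots> = (1 / real ?i) ^ Suc r * recip_pow (r + 2) d"
        using pos[OF N1] by (simp add: recip_pow_def power_divide power_mult_distrib)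
      finally show ?thesis .
    qed
    have in1: "((\<lambda>c. ?h (N1, d, c)) has_sum ((1 / real ?i) ^ Suc r * recip_pow (r + 2) d)) (coset_of N1 ` M1)" if d: "d \<in> {1..}" for d
      using has_sum_finite[OF fin, of "\<lambda>c. ?h (N1, d, c)"] val[OF d] by simp
    have in2: "((\<lambda>d. (1 / real ?i) ^ Suc r * recip_pow (r + 2) d) has_sum ((1 / real ?i) ^ Suc r * zeta_nat (r + 2))) {1..}"
      unfolding zeta_nat_def by (intro has_sum_cmult_right has_sum_infsum recip_pow_summable) simp
    show ?thesis
    proof (rule has_sum_SigmaI[where g = "\<lambda>d. (1 / real ?i) ^ Suc r * recip_pow (r + 2) d"])
      show "(\<lambda>y. ?h (N1, y)) summable_on Sigma {1..} (\<lambda>d. coset_of N1 ` M1)"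
        by (rule summable_on_SigmaI[OF _ has_sum_imp_summable[OF in2]]) (use in1 in auto)
    qed (use in1 in2 in auto)
  qed
  have outer: "((\<lambda>N1. (1 / real (idx M1 N1)) ^ Suc r * zeta_nat (r + 2)) has_sum (W * zeta_nat (r + 2))) (fisub M1)"
    by (rule has_sum_cmult_left[OF W])
  have "(?h has_sum (W * zeta_nat (r + 2))) A"
    unfolding A_def
  proof (rule has_sum_SigmaI[OF inner outer])
    show "?h summable_on Sigma (fisub M1) (\<lambda>N1. Sigma {1::nat..} (\<lambda>d. coset_of N1 ` M1))"
      by (rule summable_on_SigmaI[OF inner has_sum_imp_summable[OF outer]]) auto
  qed
  moreover have "?h = (\<lambda>a. (1 / real (idx M (\<Phi> a))) ^ Suc (Suc r))" by (auto simp: \<Phi>_def)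
  ultimately show ?thesis using has_sum_reindex_bij_betw[OF bij, of "\<lambda>N. (1 / real (idx M N)) ^ Suc (Suc r)"] by simp
qed

text \<open>The subgroup zeta function zeta(s) zeta(s - 1) ... zeta(s - r + 1) of a free abelian
  group of rank r, at s = r + 1.\<close>

lemma fisub_weight_sum:
  assumes "free_rank r M"
  shows "((\<lambda>N. (1 / real (idx M N)) ^ Suc r) has_sum zeta_prod r) (fisub M)"
  using assms
proof (induction r arbitrary: M)
  case 0
  then have M: "M = {0}" by simp
  have f: "fisub {0} = {{0}}" by (auto simp: fisub_def addsub_def)
  have "idx {0} {0} = 1" by (simp add: idx_def)
  then show ?case unfolding M f using has_sum_finite[of "{{0::nat \<Rightarrow> int}}" "\<lambda>N. (1 / real (idx {0} N)) ^ Suc 0"]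
    by (simp add: zeta_prod_def)
next
  case (Suc r)
  then obtain \<pi> :: "(nat \<Rightarrow> int) \<Rightarrow> int" where M: "addsub M"
    and \<pi>: "\<forall>x\<in>M. \<forall>y\<in>M. \<pi> (x - y) = \<pi> x - \<pi> y" "\<pi> ` M = UNIV" "free_rank r {x\<in>M. \<pi> x = 0}"
    by auto
  interpret lattice_split M \<pi> using M \<pi> by unfold_locales auto
  have "((\<lambda>N. (1 / real (idx M1 N)) ^ Suc r) has_sum zeta_prod r) (fisub M1)"
    using Suc.IH[OF \<pi>(3)] by (simp add: M1_def)
  from fisub_weight_step[OF this] show ?case by (simp add: zeta_prod_def)
qed

text \<open>A finite-index subgroup is again free of the same rank and indices multiply, so the sum
  over the subgroups of \<open>M\<close> is the full sum scaled by a power of [F : M]. This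
  self-similarity is the reason for power weights.\<close>

lemma fisub_weight_sum_below:
  assumes F: "free_rank r F" and M: "M \<in> fisub F"
  shows "((\<lambda>N. (1 / real (idx F N)) ^ Suc r) has_sum ((1 / real (idx F M)) ^ Suc r * zeta_prod r)) {N \<in> fisub F. N \<subseteq> M}"
proof -
  have Fa: "addsub F" using free_rank_addsub[OF F] .
  have eq: "{N \<in> fisub F. N \<subseteq> M} = fisub M" using fisub_trans_iff[OF M Fa] by auto
  have "((\<lambda>N. (1 / real (idx F M)) ^ Suc r * (1 / real (idx M N)) ^ Suc r) has_sum ((1 / real (idx F M)) ^ Suc r * zeta_prod r)) (fisub M)"
    by (rule has_sum_cmult_right[OF fisub_weight_sum[OF free_rank_fisub[OF F M]]])
  moreover have "(1 / real (idx F M)) ^ Suc r * (1 / real (idx M N)) ^ Suc r = (1 / real (idx F N)) ^ Suc r" if "N \<in> fisub M" for N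
    using idx_tower(2)[OF M _ _ Fa, of N] that by (simp add: fisub_def power_mult_distrib power_divide)
  ultimately show ?thesis unfolding eq by (subst (asm) has_sum_cong) auto
qed

section \<open>The zero-sum lattice and the random sublattice of the explicit model\<close>

lemma addsub_zero_sum_vecs: "addsub (zero_sum_vecs n)"
  by (auto simp: addsub_def zero_sum_vecs_def int_vecs_def sum_subtractf)

text \<open>The last coordinate is the surjection, and its kernel is the lattice with one vertex
  fewer.\<close>

lemma free_rank_zero_sum_vecs: "free_rank n (zero_sum_vecs (Suc n))"
proof (induction n)
  case 0
  have "v = 0" if "v \<in> zero_sum_vecs (Suc 0)" for v
  proof
    fix i show "v i = (0 :: nat \<Rightarrow> int) i" using that by (cases "i = 1") (auto simp: zero_sum_vecs_def int_vecs_def)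
  qed
  then show ?case using addsub_0[OF addsub_zero_sum_vecs[of "Suc 0"]] by auto
next
  case (Suc n)
  let ?M = "zero_sum_vecs (Suc (Suc n))"
  let ?\<pi> = "\<lambda>v::nat \<Rightarrow> int. v (Suc (Suc n))"
  have "?\<pi> ` ?M = UNIV"
  proof -
    have "z \<in> ?\<pi> ` ?M" for z
    proof -
      have "(\<lambda>i. z * edge_vec (Suc (Suc n)) 1 i) \<in> ?M" by (intro zero_sum_vecs_scale edge_vec_mem) auto
      then show ?thesis by (rule rev_image_eqI) (simp add: edge_vec_def)
    qed
    then show ?thesis by blast
  qed
  moreover have "{x\<in>?M. ?\<pi> x = 0} = zero_sum_vecs (Suc n)"
  proof (intro subset_antisym subsetI)
    fix v assume "v \<in> {x\<in>?M. ?\<pi> x = 0}"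
    then have v: "\<forall>i. i \<notin> {1..Suc (Suc n)} \<longrightarrow> v i = 0" "(\<Sum>i\<in>{1..Suc (Suc n)}. v i) = 0" "v (Suc (Suc n)) = 0"
      by (auto simp: zero_sum_vecs_def int_vecs_def)
    then have "(\<Sum>i\<in>{1..Suc n}. v i) = 0" by simp
    moreover have "v i = 0" if "i \<notin> {1..Suc n}" for i using v that by (cases "i = Suc (Suc n)") auto
    ultimately show "v \<in> zero_sum_vecs (Suc n)" by (simp add: zero_sum_vecs_def int_vecs_def)
  next
    fix v assume "v \<in> zero_sum_vecs (Suc n)"
    then show "v \<in> {x\<in>?M. ?\<pi> x = 0}" by (auto simp: zero_sum_vecs_def int_vecs_def)
  qed
  ultimately show ?case using Suc addsub_zero_sum_vecs[of "Suc (Suc n)"] by (auto simp only: free_rank.simps fun_diff_def intro!: exI[of _ ?\<pi>])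
qed

lemma subgroup_Zn0_iff: "subgroup M (Zn0 n) \<longleftrightarrow> addsub M \<and> M \<subseteq> zero_sum_vecs n"
proof
  assume s: "subgroup M (Zn0 n)"
  interpret comm_group "Zn0 n" by (rule comm_group_Zn0)
  have sub: "M \<subseteq> zero_sum_vecs n" using subgroup.subset[OF s] by simp
  have "x - y \<in> M" if "x \<in> M" "y \<in> M" for x y
  proof -
    have "x \<otimes>\<^bsub>Zn0 n\<^esub> inv\<^bsub>Zn0 n\<^esub> y \<in> M" using subgroup.m_closed[OF s] subgroup.m_inv_closed[OF s] that by blast
    moreover have "x \<otimes>\<^bsub>Zn0 n\<^esub> inv\<^bsub>Zn0 n\<^esub> y = x - y" using inv_Zn0[of y n] that sub by (auto simp: fun_eq_iff)
    ultimately show ?thesis by simp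
  qed
  moreover have "0 \<in> M" using subgroup.one_closed[OF s] by (simp add: zero_fun_def)
  ultimately show "addsub M \<and> M \<subseteq> zero_sum_vecs n" using sub by (simp add: addsub_def)
next
  assume M: "addsub M \<and> M \<subseteq> zero_sum_vecs n"
  interpret comm_group "Zn0 n" by (rule comm_group_Zn0)
  show "subgroup M (Zn0 n)"
  proof (rule subgroupI)
    show "M \<subseteq> carrier (Zn0 n)" using M by simp
    show "M \<noteq> {}" using M addsub_0 by auto
    fix a assume a: "a \<in> M"
    have "inv\<^bsub>Zn0 n\<^esub> a = - a" using inv_Zn0[of a n] a M by (auto simp: fun_eq_iff)
    then show "inv\<^bsub>Zn0 n\<^esub> a \<in> M" using addsub_uminus[of M a] a M by simp
    fix b assume "b \<in> M"
    then have "a + b \<in> M" using addsub_add[of M] a M by blast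
    moreover have "a \<otimes>\<^bsub>Zn0 n\<^esub> b = a + b" by (auto simp: fun_eq_iff)
    ultimately show "a \<otimes>\<^bsub>Zn0 n\<^esub> b \<in> M" by simp
  qed
qed

lemma carrier_Zn0_Mod: "carrier (Zn0 n Mod M) = coset_of M ` zero_sum_vecs n"
proof -
  have "M #>\<^bsub>Zn0 n\<^esub> x = coset_of M x" for x
  proof -
    have "y \<in> coset_of M x \<longleftrightarrow> (\<exists>h\<in>M. y = (\<lambda>i. h i + x i))" for y
    proof -
      have "y = (\<lambda>i. h i + x i) \<longleftrightarrow> y - x = h" for h by (auto simp: fun_eq_iff algebra_simps)
      then have "(\<exists>h\<in>M. y = (\<lambda>i. h i + x i)) \<longleftrightarrow> (\<exists>h\<in>M. y - x = h)" by simp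
      then show ?thesis by (auto simp: coset_of_def)
    qed
    then show ?thesis by (auto simp: r_coset_def)
  qed
  then show ?thesis by (simp add: carrier_FactGroup)
qed

lemma card_Zn0_Mod: "card (carrier (Zn0 n Mod M)) = idx (zero_sum_vecs n) M"
  by (simp add: carrier_Zn0_Mod idx_def)

lemma fisub_Zn0_iff: "M \<in> fisub (zero_sum_vecs n) \<longleftrightarrow> subgroup M (Zn0 n) \<and> finite (carrier (Zn0 n Mod M))"
  by (auto simp: fisub_def subgroup_Zn0_iff carrier_Zn0_Mod)

text \<open>The rank is n - 1, so the exponent n is the \<open>Suc r\<close> of
  \<open>fisub_weight_sum\<close> and the normaliser is zeta(2) ... zeta(n).\<close>

definition subgroup_weight :: "nat \<Rightarrow> (nat \<Rightarrow> int) set \<Rightarrow> real" where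
  "subgroup_weight n N = (if N \<in> fisub (zero_sum_vecs n) then (1 / real (idx (zero_sum_vecs n) N)) ^ n / zeta_prod (n - 1) else 0)"

definition subgroup_pmf :: "nat \<Rightarrow> (nat \<Rightarrow> int) set pmf" where
  "subgroup_pmf n = embed_pmf (subgroup_weight n)"

lemma zeta_prod_pos: "zeta_prod m > 0"
proof -
  have "zeta_nat (k + 2) > 0" for k
  proof -
    have "infsum (recip_pow (k + 2)) {1} \<le> infsum (recip_pow (k + 2)) {1..}"
      by (intro infsum_mono2) (auto intro: recip_pow_summable)
    then show ?thesis by (simp add: zeta_nat_def recip_pow_def)
  qed
  then show ?thesis by (auto simp: zeta_prod_def intro: prod_pos)
qed

lemma subgroup_weight_has_sum:
  assumes n: "n \<ge> 1" and M: "M \<in> fisub (zero_sum_vecs n)"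
  shows "(subgroup_weight n has_sum (1 / real (idx (zero_sum_vecs n) M)) ^ n) {N. N \<subseteq> M}"
proof -
  have fr: "free_rank (n - 1) (zero_sum_vecs n)" using free_rank_zero_sum_vecs[of "n - 1"] n by simp
  have sn: "Suc (n - 1) = n" using n by simp
  have "((\<lambda>N. (1 / real (idx (zero_sum_vecs n) N)) ^ n / zeta_prod (n - 1)) has_sum
      ((1 / real (idx (zero_sum_vecs n) M)) ^ n * zeta_prod (n - 1)) / zeta_prod (n - 1)) {N \<in> fisub (zero_sum_vecs n). N \<subseteq> M}"
    using has_sum_cmult_left[OF fisub_weight_sum_below[OF fr M], of "inverse (zeta_prod (n - 1))"]
    unfolding sn divide_inverse by blast
  then show ?thesis
    by (subst (asm) has_sum_cong_neutral[where g = "subgroup_weight n" and T = "{N. N \<subseteq> M}"])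
       (use zeta_prod_pos[of "n - 1"] in \<open>auto simp: subgroup_weight_def\<close>)
qed

lemma full_fisub: "addsub F \<Longrightarrow> F \<in> fisub F" "addsub F \<Longrightarrow> idx F F = 1"
proof -
  assume F: "addsub F"
  have "coset_of F ` F = {F}"
  proof -
    have "coset_of F x = F" if "x \<in> F" for x
    proof -
      have "coset_of F x = coset_of F 0" using coset_of_eq_iff[OF F] that by simp
      then show ?thesis by (simp add: coset_of_def)
    qed
    then show ?thesis using addsub_0[OF F] by auto
  qed
  then show "F \<in> fisub F" "idx F F = 1" using F by (auto simp: fisub_def idx_def)
qed

lemma subgroup_weight_nonneg: "subgroup_weight n N \<ge> 0"
  using zeta_prod_pos[of "n - 1"] by (simp add: subgroup_weight_def)

text \<open>Total mass 1 is the sum over the subgroups of M in the case that M is the whole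
  lattice.\<close>

lemma pmf_subgroup_pmf:
  assumes n: "n \<ge> 1"
  shows "pmf (subgroup_pmf n) N = subgroup_weight n N"
proof -
  let ?F = "zero_sum_vecs n"
  have "(subgroup_weight n has_sum (1 / real (idx ?F ?F)) ^ n) {N. N \<subseteq> ?F}"
    by (rule subgroup_weight_has_sum[OF n full_fisub(1)[OF addsub_zero_sum_vecs]])
  then have "(subgroup_weight n has_sum 1) {N. N \<subseteq> ?F}" by (simp add: full_fisub(2)[OF addsub_zero_sum_vecs])
  then have hs: "(subgroup_weight n has_sum 1) UNIV"
    by (subst (asm) has_sum_cong_neutral[where g = "subgroup_weight n" and T = UNIV]) (auto simp: subgroup_weight_def fisub_def)
  have "(\<integral>\<^sup>+ N. ennreal (subgroup_weight n N) \<partial>count_space UNIV) = ennreal 1"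
  proof -
    have "Infinite_Sum.abs_summable_on (subgroup_weight n) UNIV"
      using hs has_sum_imp_summable summable_on_iff_abs_summable_on_real by blast
    then have ab: "Infinite_Set_Sum.abs_summable_on (subgroup_weight n) UNIV" by (rule iffD1[OF abs_summable_equivalent])
    show ?thesis
      using nn_integral_conv_infsetsum[OF ab subgroup_weight_nonneg] infsetsum_infsum[OF ab] infsumI[OF hs] by simp
  qed
  then show ?thesis unfolding subgroup_pmf_def
    by (subst pmf_embed_pmf) (auto simp: subgroup_weight_nonneg)
qed

lemma prob_subgroup_pmf:
  assumes n: "n \<ge> 1" and M: "M \<in> fisub (zero_sum_vecs n)"
  shows "measure_pmf.prob (subgroup_pmf n) {N. N \<subseteq> M} = (1 / real (idx (zero_sum_vecs n) M)) ^ n"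
proof -
  have "measure_pmf.prob (subgroup_pmf n) {N. N \<subseteq> M} = infsum (pmf (subgroup_pmf n)) {N. N \<subseteq> M}"
    by (simp add: measure_pmf_conv_infsetsum infsetsum_infsum[OF pmf_abs_summable])
  also have "\<dots> = infsum (subgroup_weight n) {N. N \<subseteq> M}"
    by (intro infsum_cong) (simp add: pmf_subgroup_pmf[OF n])
  also have "\<dots> = (1 / real (idx (zero_sum_vecs n) M)) ^ n"
    by (rule infsumI[OF subgroup_weight_has_sum[OF n M]])
  finally show ?thesis .
qed

section \<open>Quotients and tuples of homomorphisms\<close>

definition quot_subs :: "('a, 'c) monoid_scheme \<Rightarrow> ('b, 'd) monoid_scheme \<Rightarrow> 'a set set" where
  "quot_subs F K = {M. subgroup M F \<and> F Mod M \<cong> K}"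

lemma group_homI: "group G \<Longrightarrow> group H \<Longrightarrow> f \<in> hom G H \<Longrightarrow> group_hom G H f"
  by (simp add: group_hom_def group_hom_axioms_def)

lemma Surs_kernel:
  assumes F: "comm_group F" and K: "group K" and f: "f \<in> Surs F K"
  shows "kernel F K f \<in> quot_subs F K"
proof -
  interpret F: comm_group F by (rule F)
  interpret K: group K by (rule K)
  have fh: "f \<in> hom F K" and im: "f ` carrier F = carrier K" using f by (auto simp: Surs_def Homs_def)
  interpret h: group_hom F K f by (rule group_homI[OF F.is_group K fh])
  show ?thesis using h.FactGroup_iso[OF im] h.subgroup_kernel by (simp add: quot_subs_def)
qed

lemma quot_subs_Surs:
  assumes F: "comm_group F" and K: "group K" and M: "M \<in> quot_subs F K"
  obtains f where "f \<in> Surs F K" "kernel F K f = M"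
proof -
  interpret F: comm_group F by (rule F)
  have Ms: "subgroup M F" using M by (simp add: quot_subs_def)
  interpret N: normal M F using F.normal_iff_subgroup Ms by blast
  obtain h where h: "h \<in> iso (F Mod M) K" using M by (auto simp: quot_subs_def is_iso_def)
  then have hh: "h \<in> hom (F Mod M) K" and hb: "bij_betw h (carrier (F Mod M)) (carrier K)" by (auto simp: iso_def)
  define f where "f = (\<lambda>x\<in>carrier F. h (M #>\<^bsub>F\<^esub> x))"
  have cos: "M #>\<^bsub>F\<^esub> x \<in> carrier (F Mod M)" if "x \<in> carrier F" for x using that by (auto simp: carrier_FactGroup)
  have fh: "f \<in> hom F K"
  proof (rule homI)
    fix x assume "x \<in> carrier F"
    then show "f x \<in> carrier K" using cos hh by (auto simp: f_def hom_def)
  next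
    fix x y assume xy: "x \<in> carrier F" "y \<in> carrier F"
    then have "M #>\<^bsub>F\<^esub> (x \<otimes>\<^bsub>F\<^esub> y) = (M #>\<^bsub>F\<^esub> x) \<otimes>\<^bsub>F Mod M\<^esub> (M #>\<^bsub>F\<^esub> y)"
      using N.rcos_sum by simp
    then show "f (x \<otimes>\<^bsub>F\<^esub> y) = f x \<otimes>\<^bsub>K\<^esub> f y" using xy hom_mult[OF hh cos cos] by (simp add: f_def)
  qed
  have im: "f ` carrier F = carrier K"
  proof -
    have "f ` carrier F = h ` carrier (F Mod M)" by (force simp: f_def carrier_FactGroup)
    then show ?thesis using hb by (simp add: bij_betw_def)
  qed
  have ker: "kernel F K f = M"
  proof -
    interpret Q: group "F Mod M" by (rule N.factorgroup_is_group)
    interpret hq: group_hom "F Mod M" K h by (rule group_homI[OF Q.is_group K hh])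
    have "f x = \<one>\<^bsub>K\<^esub> \<longleftrightarrow> x \<in> M" if x: "x \<in> carrier F" for x
    proof -
      have "f x = \<one>\<^bsub>K\<^esub> \<longleftrightarrow> h (M #>\<^bsub>F\<^esub> x) = h (\<one>\<^bsub>F Mod M\<^esub>)" using x hq.hom_one by (simp add: f_def)
      also have "\<dots> \<longleftrightarrow> M #>\<^bsub>F\<^esub> x = \<one>\<^bsub>F Mod M\<^esub>"
        using hb cos[OF x] Q.one_closed by (metis bij_betw_def inj_on_eq_iff)
      also have "\<dots> \<longleftrightarrow> x \<in> M" using x Ms F.coset_join2[OF x Ms] F.coset_join1[OF _ x Ms]
        by (metis one_FactGroup subgroup.subset)
      finally show ?thesis .
    qed
    then show ?thesis using N.subset by (auto simp: kernel_def)
  qed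
  show thesis by (rule that[OF _ ker]) (use fh im in \<open>auto simp: Surs_def Homs_def f_def\<close>)
qed

lemma quot_subs_eq: 
  assumes "comm_group F" "group K"
  shows "quot_subs F K = kernel F K ` Surs F K"
  using Surs_kernel[OF assms] quot_subs_Surs[OF assms] by (blast intro: sym)

lemma hom_eq_iff_kernel:
  assumes "group_hom F K f" "x \<in> carrier F" "y \<in> carrier F"
  shows "f x = f y \<longleftrightarrow> x \<otimes>\<^bsub>F\<^esub> inv\<^bsub>F\<^esub> y \<in> kernel F K f"
proof -
  interpret group_hom F K f by (rule assms)
  have "f (x \<otimes>\<^bsub>F\<^esub> inv\<^bsub>F\<^esub> y) = \<one>\<^bsub>K\<^esub> \<longleftrightarrow> f x \<otimes>\<^bsub>K\<^esub> inv\<^bsub>K\<^esub> (f y) = \<one>\<^bsub>K\<^esub>"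
    using assms(2,3) by simp
  also have "\<dots> \<longleftrightarrow> f x = f y" using assms(2,3) hom_closed
    by (metis H.inv_closed H.inv_equality H.inv_inv H.r_inv)
  finally show ?thesis using assms(2,3) by (simp add: kernel_def)
qed

text \<open>Automorphisms of \<open>K\<close> act simply transitively on the surjections with a
  given kernel. This is the origin of the factor 1 / |Aut K| whenever subgroups are counted in place
  of surjections.\<close>

lemma card_Surs_kernel:
  assumes F: "comm_group F" and K: "comm_group K" and M: "M \<in> quot_subs F K"
  shows "card {f \<in> Surs F K. kernel F K f = M} = card (auto K)"
proof -
  interpret F: comm_group F by (rule F)
  interpret K: comm_group K by (rule K)
  obtain g where g: "g \<in> Surs F K" "kernel F K g = M" using quot_subs_Surs[OF F K.is_group M] by blast
  have gh: "g \<in> hom F K" and gim: "g ` carrier F = carrier K" using g by (auto simp: Surs_def Homs_def)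
  interpret g: group_hom F K g by (rule group_homI[OF F.is_group K.is_group gh])
  let ?\<Phi> = "\<lambda>\<alpha>. \<lambda>x\<in>carrier F. \<alpha> (g x)"
  have "bij_betw ?\<Phi> (auto K) {f \<in> Surs F K. kernel F K f = M}"
    unfolding bij_betw_def
  proof
    show "inj_on ?\<Phi> (auto K)"
    proof (rule inj_onI)
      fix \<alpha> \<beta> assume a: "\<alpha> \<in> auto K" "\<beta> \<in> auto K" "?\<Phi> \<alpha> = ?\<Phi> \<beta>"
      show "\<alpha> = \<beta>"
      proof (rule extensionalityI[where A = "carrier K"])
        show "\<alpha> \<in> extensional (carrier K)" "\<beta> \<in> extensional (carrier K)" using a by (auto simp: auto_def Bij_def)
        fix k assume "k \<in> carrier K"
        then obtain x where x: "x \<in> carrier F" "k = g x" using gim by blast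
        then show "\<alpha> k = \<beta> k" using fun_cong[OF a(3), of x] by simp
      qed
    qed
    show "?\<Phi> ` auto K = {f \<in> Surs F K. kernel F K f = M}"
    proof (intro subset_antisym subsetI)
      fix f assume "f \<in> ?\<Phi> ` auto K"
      then obtain \<alpha> where \<alpha>: "\<alpha> \<in> auto K" "f = ?\<Phi> \<alpha>" by blast
      have ah: "\<alpha> \<in> hom K K" and ab: "bij_betw \<alpha> (carrier K) (carrier K)" using \<alpha>(1) by (auto simp: auto_def Bij_def)
      have "f \<in> hom F K"
        unfolding \<alpha>(2) using ah by (intro homI) (auto simp: hom_def)
      moreover have "f ` carrier F = carrier K"
      proof -
        have "f ` carrier F = \<alpha> ` (g ` carrier F)" unfolding \<alpha>(2) by force
        then show ?thesis using gim ab by (simp add: bij_betw_def)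
      qed
      moreover have "kernel F K f = M"
      proof -
        interpret a: group_hom K K \<alpha> by (rule group_homI[OF K.is_group K.is_group ah])
        have "\<alpha> (g x) = \<one>\<^bsub>K\<^esub> \<longleftrightarrow> g x = \<one>\<^bsub>K\<^esub>" if "x \<in> carrier F" for x
          using ab a.hom_one that g.hom_closed[OF that] by (metis K.one_closed bij_betw_def inj_on_eq_iff)
        then show ?thesis unfolding g(2)[symmetric] \<alpha>(2) by (auto simp: kernel_def)
      qed
      ultimately show "f \<in> {f \<in> Surs F K. kernel F K f = M}" by (auto simp: Surs_def Homs_def \<alpha>(2))
    next
      fix f assume "f \<in> {f \<in> Surs F K. kernel F K f = M}"
      then have f: "f \<in> Surs F K" "kernel F K f = M" by auto
      have fh: "f \<in> hom F K" and fim: "f ` carrier F = carrier K" and fe: "f \<in> extensional (carrier F)"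
        using f by (auto simp: Surs_def Homs_def)
      interpret f: group_hom F K f by (rule group_homI[OF F.is_group K.is_group fh])
      have fg: "f x = f y \<longleftrightarrow> g x = g y" if "x \<in> carrier F" "y \<in> carrier F" for x y
        unfolding hom_eq_iff_kernel[OF f.group_hom_axioms that] hom_eq_iff_kernel[OF g.group_hom_axioms that] f(2) g(2) by (rule refl)
      define pre where "pre k = (SOME x. x \<in> carrier F \<and> g x = k)" for k
      have pre: "pre k \<in> carrier F" "g (pre k) = k" if "k \<in> carrier K" for k
      proof -
        have "k \<in> g ` carrier F" unfolding gim by (rule that)
        then have "\<exists>x. x \<in> carrier F \<and> g x = k" by (elim imageE) (intro exI conjI, assumption, rule sym)
        from someI_ex[OF this] show "pre k \<in> carrier F" "g (pre k) = k" by (auto simp: pre_def)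
      qed
      define \<alpha> where "\<alpha> = (\<lambda>k\<in>carrier K. f (pre k))"
      have \<alpha>g: "\<alpha> (g x) = f x" if "x \<in> carrier F" for x
        using that pre[of "g x"] fg[of "pre (g x)" x] g.hom_closed[OF that] by (simp add: \<alpha>_def)
      have "\<alpha> \<in> hom K K"
      proof (rule homI)
        fix k assume "k \<in> carrier K"
        then show "\<alpha> k \<in> carrier K" using pre f.hom_closed by (simp add: \<alpha>_def)
      next
        fix k l assume "k \<in> carrier K" "l \<in> carrier K"
        then obtain x y where xy: "x \<in> carrier F" "k = g x" "y \<in> carrier F" "l = g y" using gim by blast
        then have "\<alpha> (k \<otimes>\<^bsub>K\<^esub> l) = \<alpha> (g (x \<otimes>\<^bsub>F\<^esub> y))" by simp
        also have "\<dots> = f (x \<otimes>\<^bsub>F\<^esub> y)" using xy by (intro \<alpha>g) simp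
        finally show "\<alpha> (k \<otimes>\<^bsub>K\<^esub> l) = \<alpha> k \<otimes>\<^bsub>K\<^esub> \<alpha> l" using xy \<alpha>g by simp
      qed
      moreover have "bij_betw \<alpha> (carrier K) (carrier K)"
      proof -
        have "inj_on \<alpha> (carrier K)"
        proof (rule inj_onI)
          fix k l assume kl: "k \<in> carrier K" "l \<in> carrier K" "\<alpha> k = \<alpha> l"
          then obtain x y where xy: "x \<in> carrier F" "k = g x" "y \<in> carrier F" "l = g y" using gim by blast
          then show "k = l" using kl \<alpha>g fg by simp
        qed
        moreover have "\<alpha> ` carrier K = carrier K"
        proof -
          have "\<alpha> ` carrier K = \<alpha> ` (g ` carrier F)" using gim by simp
          also have "\<dots> = f ` carrier F" using \<alpha>g by force
          finally show ?thesis using fim by simp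
        qed
        ultimately show ?thesis by (simp add: bij_betw_def)
      qed
      ultimately have "\<alpha> \<in> auto K" by (auto simp: auto_def Bij_def \<alpha>_def)
      moreover have "f = ?\<Phi> \<alpha>"
        by (rule extensionalityI[OF fe]) (auto simp: \<alpha>g)
      ultimately show "f \<in> ?\<Phi> ` auto K" by blast
    qed
  qed
  then show ?thesis by (rule bij_betw_same_card[symmetric])
qed

lemma sum_Surs_kernel:
  assumes F: "comm_group F" and K: "comm_group K" and fin: "finite (Surs F K)"
  shows "(\<Sum>f\<in>Surs F K. u (kernel F K f)) = real (card (auto K)) * (\<Sum>M\<in>quot_subs F K. u M)"
proof -
  have Kg: "group K" using K comm_group.axioms(2) by blast
  have finq: "finite (quot_subs F K)" using quot_subs_eq[OF F Kg] fin by simp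
  have "(\<Sum>f\<in>Surs F K. u (kernel F K f)) = (\<Sum>M\<in>quot_subs F K. \<Sum>f\<in>{f \<in> Surs F K. kernel F K f = M}. u (kernel F K f))"
    by (rule sum.group[OF fin finq, symmetric]) (use quot_subs_eq[OF F Kg] in auto)
  also have "\<dots> = (\<Sum>M\<in>quot_subs F K. real (card (auto K)) * u M)"
    by (intro sum.cong refl) (use card_Surs_kernel[OF F K] in auto)
  finally show ?thesis by (simp add: sum_distrib_left)
qed

section \<open>Homomorphisms to cyclic groups and their joint kernels\<close>

definition sub_homs :: "('a, 'c) monoid_scheme \<Rightarrow> 'a set \<Rightarrow> nat \<Rightarrow> ('a \<Rightarrow> int) set" where
  "sub_homs F M p = Homs (F\<lparr>carrier := M\<rparr>) (integer_mod_group p)"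

definition joint_kernel :: "'a set \<Rightarrow> nat list \<Rightarrow> (nat \<Rightarrow> 'a \<Rightarrow> int) \<Rightarrow> 'a set" where
  "joint_kernel M q \<Psi> = {x\<in>M. \<forall>i<length q. \<Psi> i x = 0}"

text \<open>Grouping such pairs by the joint kernel turns mixed moments into moments of quotients of bounded order.\<close>
definition hom_pairs :: "('a, 'c) monoid_scheme \<Rightarrow> ('b, 'd) monoid_scheme \<Rightarrow> nat list \<Rightarrow> ('a set \<times> (nat \<Rightarrow> 'a \<Rightarrow> int)) set" where
  "hom_pairs F G q = Sigma (quot_subs F G) (\<lambda>M. PiE {..<length q} (\<lambda>i. sub_homs F M (q ! i)))"

definition hom_pairs_at where
  "hom_pairs_at F G q M' = {(M, \<Psi>) \<in> hom_pairs F G q. joint_kernel M q \<Psi> = M'}"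

lemma sub_homs_iff:
  assumes p: "p > 0"
  shows "\<psi> \<in> sub_homs F M p \<longleftrightarrow> \<psi> \<in> extensional M \<and> (\<forall>x\<in>M. 0 \<le> \<psi> x \<and> \<psi> x < int p) \<and>
     (\<forall>x\<in>M. \<forall>y\<in>M. \<psi> (x \<otimes>\<^bsub>F\<^esub> y) = (\<psi> x + \<psi> y) mod int p)"
  using p by (auto simp: sub_homs_def Homs_def hom_def integer_mod_group_def Pi_iff)

text \<open>Pullback along \<open>\<pi>\<close>: subgroups and homomorphisms of F whose joint kernel
  is the kernel of \<open>\<pi>\<close> are exactly those of K with trivial joint kernel. The number
  of pairs over a joint kernel therefore depends only on the quotient, and not on n when F is the
  zero-sum lattice.\<close>

lemma bij_hom_pairs_at:
  assumes F: "comm_group F" and K: "comm_group K" and G: "group G" and \<pi>: "\<pi> \<in> Surs F K" and q: "\<forall>p\<in>set q. p > 0"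
  shows "\<exists>R. bij_betw R (hom_pairs_at K G q {\<one>\<^bsub>K\<^esub>}) (hom_pairs_at F G q (kernel F K \<pi>))"
proof -
  interpret F: comm_group F by (rule F)
  interpret K: comm_group K by (rule K)
  have \<pi>h: "\<pi> \<in> hom F K" and \<pi>im: "\<pi> ` carrier F = carrier K" using \<pi> by (auto simp: Surs_def Homs_def)
  interpret \<pi>: group_hom F K \<pi> by (rule group_homI[OF F.is_group K.is_group \<pi>h])
  define pb where "pb L = {x\<in>carrier F. \<pi> x \<in> L}" for L
  define pbh where "pbh L \<Phi> = (\<lambda>i\<in>{..<length q}. \<lambda>x\<in>pb L. (\<Phi> i (\<pi> x) :: int))" for L \<Phi>
  define R where "R = (\<lambda>(L, \<Phi>). (pb L, pbh L \<Phi>))"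
  have qi: "q ! i > 0" if "i < length q" for i using q that by simp
  have pb_img: "\<pi> ` pb L = L" if "L \<subseteq> carrier K" for L
  proof (intro subset_antisym subsetI)
    fix y assume "y \<in> \<pi> ` pb L"
    then show "y \<in> L" by (auto simp: pb_def)
  next
    fix y assume y: "y \<in> L"
    then have "y \<in> \<pi> ` carrier F" using that \<pi>im by blast
    then obtain x where x: "x \<in> carrier F" "y = \<pi> x" by blast
    then have "x \<in> pb L" using y by (simp add: pb_def)
    then show "y \<in> \<pi> ` pb L" using x(2) by blast
  qed
  have pb_sub: "subgroup (pb L) F" if L: "subgroup L K" for L
  proof (rule F.subgroupI)
    show "pb L \<subseteq> carrier F" by (auto simp: pb_def)
    show "pb L \<noteq> {}" using subgroup.one_closed[OF L] \<pi>.hom_one F.one_closed by (force simp: pb_def)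
    fix x assume "x \<in> pb L"
    then show "inv\<^bsub>F\<^esub> x \<in> pb L" using subgroup.m_inv_closed[OF L] by (auto simp: pb_def)
    fix y assume "y \<in> pb L"
    then show "x \<otimes>\<^bsub>F\<^esub> y \<in> pb L" using \<open>x \<in> pb L\<close> subgroup.m_closed[OF L] by (auto simp: pb_def)
  qed
  have pb_quot: "F Mod pb L \<cong> K Mod L" if L: "subgroup L K" for L
  proof -
    interpret L: normal L K using K.normal_iff_subgroup L by blast
    let ?h = "\<lambda>x. L #>\<^bsub>K\<^esub> \<pi> x"
    have hh: "?h \<in> hom F (K Mod L)"
      using hom_compose[OF \<pi>h L.r_coset_hom_Mod] by (simp add: o_def)
    interpret h: group_hom F "K Mod L" ?h by (rule group_homI[OF F.is_group L.factorgroup_is_group hh])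
    have "?h ` carrier F = carrier (K Mod L)"
    proof -
      have "?h ` carrier F = (\<lambda>y. L #>\<^bsub>K\<^esub> y) ` (\<pi> ` carrier F)" by (simp add: image_image)
      then show ?thesis unfolding \<pi>im carrier_FactGroup .
    qed
    then have "F Mod kernel F (K Mod L) ?h \<cong> K Mod L" by (rule h.FactGroup_iso)
    moreover have "kernel F (K Mod L) ?h = pb L"
    proof -
      have "L #>\<^bsub>K\<^esub> y = L \<longleftrightarrow> y \<in> L" if "y \<in> carrier K" for y
        using K.coset_join2[OF that L] K.coset_join1[OF _ that L] by (metis subgroup.subset[OF L])
      then have "x \<in> carrier F \<Longrightarrow> L #>\<^bsub>K\<^esub> \<pi> x = L \<longleftrightarrow> \<pi> x \<in> L" for x by simp
      then show ?thesis unfolding kernel_def pb_def one_FactGroup by blast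
    qed
    ultimately show ?thesis by simp
  qed
  have quot_iff: "pb L \<in> quot_subs F G \<longleftrightarrow> L \<in> quot_subs K G" if L: "subgroup L K" for L
  proof -
    interpret L: normal L K using K.normal_iff_subgroup L by blast
    interpret pL: normal "pb L" F using F.normal_iff_subgroup pb_sub[OF L] by blast
    have g1: "group (F Mod pb L)" "group (K Mod L)" using pL.factorgroup_is_group L.factorgroup_is_group by auto
    have "K Mod L \<cong> F Mod pb L" using group.iso_sym[OF g1(1) pb_quot[OF L]] .
    then have "K Mod L \<cong> G \<longleftrightarrow> F Mod pb L \<cong> G" using pb_quot[OF L] iso_trans by metis
    then show ?thesis using pb_sub[OF L] L unfolding quot_subs_def by simp
  qed
  have pbh_hom: "pbh L \<Phi> \<in> PiE {..<length q} (\<lambda>i. sub_homs F (pb L) (q ! i))"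
    if L: "subgroup L K" and \<Phi>: "\<Phi> \<in> PiE {..<length q} (\<lambda>i. sub_homs K L (q ! i))" for L \<Phi>
  proof (rule PiE_I)
    fix i assume i: "i \<in> {..<length q}"
    then have "\<Phi> i \<in> sub_homs K L (q ! i)" using \<Phi> by auto
    then show "pbh L \<Phi> i \<in> sub_homs F (pb L) (q ! i)"
      using i qi[of i] subgroup.m_closed[OF pb_sub[OF L]] by (auto simp: sub_homs_iff pbh_def pb_def)
  qed (auto simp: pbh_def)
  have jk: "joint_kernel (pb L) q (pbh L \<Phi>) = {x\<in>carrier F. \<pi> x \<in> joint_kernel L q \<Phi>}" for L \<Phi>
    by (auto simp: joint_kernel_def pbh_def pb_def)
  have "bij_betw R (hom_pairs_at K G q {\<one>\<^bsub>K\<^esub>}) (hom_pairs_at F G q (kernel F K \<pi>))"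
    unfolding bij_betw_def
  proof
    have Lsub: "subgroup L K" if "(L, \<Phi>) \<in> hom_pairs_at K G q {\<one>\<^bsub>K\<^esub>}" for L \<Phi>
      using that by (auto simp: hom_pairs_at_def hom_pairs_def quot_subs_def)
    show "inj_on R (hom_pairs_at K G q {\<one>\<^bsub>K\<^esub>})"
    proof (rule inj_onI, clarify)
      fix L \<Phi> L' \<Phi>' assume a: "(L, \<Phi>) \<in> hom_pairs_at K G q {\<one>\<^bsub>K\<^esub>}" "(L', \<Phi>') \<in> hom_pairs_at K G q {\<one>\<^bsub>K\<^esub>}"
        "R (L, \<Phi>) = R (L', \<Phi>')"
      have LL: "L = L'" using a(3) pb_img subgroup.subset[OF Lsub[OF a(1)]] subgroup.subset[OF Lsub[OF a(2)]]
        unfolding R_def by (metis (no_types, lifting) case_prod_conv prod.inject)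
      have mem: "\<Phi> \<in> PiE {..<length q} (\<lambda>i. sub_homs K L (q ! i))" "\<Phi>' \<in> PiE {..<length q} (\<lambda>i. sub_homs K L (q ! i))"
        using a LL by (auto simp: hom_pairs_at_def hom_pairs_def)
      have "\<Phi> = \<Phi>'"
      proof (rule PiE_ext[OF mem])
        fix i assume i: "i \<in> {..<length q}"
        have e: "\<Phi> i \<in> extensional L" "\<Phi>' i \<in> extensional L"
          using mem i qi[of i] PiE_mem[OF mem(1) i] PiE_mem[OF mem(2) i] by (auto simp: sub_homs_iff)
        show "\<Phi> i = \<Phi>' i"
        proof (rule extensionalityI[OF e])
          fix y assume y: "y \<in> L"
          then obtain x where x: "x \<in> pb L" "y = \<pi> x" using pb_img[OF subgroup.subset[OF Lsub[OF a(1)]]] by blast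
          have "pbh L \<Phi> = pbh L \<Phi>'" using a(3) LL by (simp add: R_def)
          then have "pbh L \<Phi> i x = pbh L \<Phi>' i x" by simp
          then show "\<Phi> i y = \<Phi>' i y" using i x by (simp add: pbh_def)
        qed
      qed
      then show "L = L' \<and> \<Phi> = \<Phi>'" using LL by simp
    qed
    show "R ` hom_pairs_at K G q {\<one>\<^bsub>K\<^esub>} = hom_pairs_at F G q (kernel F K \<pi>)"
    proof (intro subset_antisym subsetI)
      fix z assume "z \<in> R ` hom_pairs_at K G q {\<one>\<^bsub>K\<^esub>}"
      then obtain L \<Phi> where z: "z = (pb L, pbh L \<Phi>)" and l: "(L, \<Phi>) \<in> hom_pairs_at K G q {\<one>\<^bsub>K\<^esub>}"
        by (auto simp: R_def)
      have Ls: "subgroup L K" by (rule Lsub[OF l])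
      have l': "L \<in> quot_subs K G" "\<Phi> \<in> PiE {..<length q} (\<lambda>i. sub_homs K L (q ! i))" "joint_kernel L q \<Phi> = {\<one>\<^bsub>K\<^esub>}"
        using l by (auto simp: hom_pairs_at_def hom_pairs_def)
      have "joint_kernel (pb L) q (pbh L \<Phi>) = kernel F K \<pi>" unfolding jk l'(3) by (auto simp: kernel_def)
      then show "z \<in> hom_pairs_at F G q (kernel F K \<pi>)"
        unfolding z hom_pairs_at_def hom_pairs_def using quot_iff[OF Ls] l'(1) pbh_hom[OF Ls l'(2)] by auto
    next
      fix z assume "z \<in> hom_pairs_at F G q (kernel F K \<pi>)"
      then obtain M \<Psi> where z: "z = (M, \<Psi>)" and M: "M \<in> quot_subs F G"
        and \<Psi>: "\<Psi> \<in> PiE {..<length q} (\<lambda>i. sub_homs F M (q ! i))" and jkM: "joint_kernel M q \<Psi> = kernel F K \<pi>"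
        by (auto simp: hom_pairs_at_def hom_pairs_def)
      have Ms: "subgroup M F" using M by (simp add: quot_subs_def)
      have Mc: "M \<subseteq> carrier F" using subgroup.subset[OF Ms] .
      have kM: "kernel F K \<pi> \<subseteq> M" using jkM by (auto simp: joint_kernel_def)
      define L where "L = \<pi> ` M"
      have Ls: "subgroup L K" unfolding L_def using \<pi>.subgroup_img_is_subgroup[OF Ms] .
      have pbL: "pb L = M"
      proof
        show "M \<subseteq> pb L" using Mc by (auto simp: pb_def L_def)
        show "pb L \<subseteq> M"
        proof
          fix x assume "x \<in> pb L"
          then obtain m where m: "x \<in> carrier F" "m \<in> M" "\<pi> x = \<pi> m" by (auto simp: pb_def L_def)
          then have "x \<otimes>\<^bsub>F\<^esub> inv\<^bsub>F\<^esub> m \<in> M" using hom_eq_iff_kernel[OF \<pi>.group_hom_axioms, of x m] Mc kM by auto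
          then have "x \<otimes>\<^bsub>F\<^esub> inv\<^bsub>F\<^esub> m \<otimes>\<^bsub>F\<^esub> m \<in> M" using subgroup.m_closed[OF Ms] m by blast
          moreover have "x \<otimes>\<^bsub>F\<^esub> inv\<^bsub>F\<^esub> m \<otimes>\<^bsub>F\<^esub> m = x" using m Mc by (simp add: F.m_assoc subset_iff)
          ultimately show "x \<in> M" by simp
        qed
      qed
      have \<Psi>i: "\<Psi> i \<in> sub_homs F M (q ! i)" if "i < length q" for i using \<Psi> that by auto
      \<comment> \<open>Elements with the same image under \<open>\<pi>\<close> differ by an element
        of the joint kernel, so every homomorphism of the tuple descends to K.\<close>
      have wd: "\<Psi> i x = \<Psi> i y" if i: "i < length q" and xy: "x \<in> M" "y \<in> M" "\<pi> x = \<pi> y" for i x y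
      proof -
        let ?k = "x \<otimes>\<^bsub>F\<^esub> inv\<^bsub>F\<^esub> y"
        have k: "?k \<in> kernel F K \<pi>" using hom_eq_iff_kernel[OF \<pi>.group_hom_axioms, of x y] xy Mc by auto
        have "?k \<in> M" "\<Psi> i ?k = 0" using k jkM i by (auto simp: joint_kernel_def)
        moreover have xk: "?k \<otimes>\<^bsub>F\<^esub> y = x"
        proof -
          have c: "x \<in> carrier F" "y \<in> carrier F" using xy Mc by blast+
          then show ?thesis by (simp add: F.m_assoc)
        qed
        moreover have "\<Psi> i (?k \<otimes>\<^bsub>F\<^esub> y) = (\<Psi> i ?k + \<Psi> i y) mod int (q ! i)"
          using \<Psi>i[OF i] calculation(1) xy(2) unfolding sub_homs_iff[OF qi[OF i]] by blast
        ultimately have "\<Psi> i x = (0 + \<Psi> i y) mod int (q ! i)" by (simp only:)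
        also have "\<dots> = \<Psi> i y" using \<Psi>i[OF i] qi[OF i] xy by (simp add: sub_homs_iff)
        finally show ?thesis .
      qed
      define pre where "pre y = (SOME x. x \<in> M \<and> \<pi> x = y)" for y
      have pre: "pre y \<in> M" "\<pi> (pre y) = y" if "y \<in> L" for y
      proof -
        have "\<exists>x. x \<in> M \<and> \<pi> x = y" using that unfolding L_def by blast
        from someI_ex[OF this] show "pre y \<in> M" "\<pi> (pre y) = y" by (auto simp: pre_def)
      qed
      define \<Phi> where "\<Phi> = (\<lambda>i\<in>{..<length q}. \<lambda>y\<in>L. \<Psi> i (pre y))"
      have \<Phi>\<pi>: "\<Phi> i (\<pi> x) = \<Psi> i x" if "i < length q" "x \<in> M" for i x
        using that wd[OF that(1), of "pre (\<pi> x)" x] pre[of "\<pi> x"] by (simp add: \<Phi>_def L_def)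
      have \<Phi>h: "\<Phi> \<in> PiE {..<length q} (\<lambda>i. sub_homs K L (q ! i))"
      proof (rule PiE_I)
        fix i assume "i \<in> {..<length q}"
        then have i: "i < length q" by simp
        have "\<Phi> i \<in> extensional L" using i by (simp add: \<Phi>_def)
        moreover have "\<forall>y\<in>L. 0 \<le> \<Phi> i y \<and> \<Phi> i y < int (q ! i)"
          using \<Phi>\<pi>[OF i] \<Psi>i[OF i] qi[OF i] unfolding L_def by (auto simp: sub_homs_iff)
        moreover have "\<Phi> i (y \<otimes>\<^bsub>K\<^esub> y') = (\<Phi> i y + \<Phi> i y') mod int (q ! i)" if yy: "y \<in> L" "y' \<in> L" for y y'
        proof -
          obtain x x' where x: "x \<in> M" "y = \<pi> x" "x' \<in> M" "y' = \<pi> x'" using yy unfolding L_def by blast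
          have "y \<otimes>\<^bsub>K\<^esub> y' = \<pi> (x \<otimes>\<^bsub>F\<^esub> x')" using x Mc by (simp add: subset_iff)
          then show ?thesis using \<Phi>\<pi>[OF i] x subgroup.m_closed[OF Ms] \<Psi>i[OF i] qi[OF i] by (simp add: sub_homs_iff)
        qed
        ultimately show "\<Phi> i \<in> sub_homs K L (q ! i)" using qi[OF i] by (simp add: sub_homs_iff)
      qed (simp add: \<Phi>_def)
      have pbh\<Phi>: "pbh L \<Phi> = \<Psi>"
      proof (rule PiE_ext[where k = "{..<length q}" and s = "\<lambda>i. sub_homs F M (q ! i)"])
        show "pbh L \<Phi> \<in> PiE {..<length q} (\<lambda>i. sub_homs F M (q ! i))" using pbh_hom[OF Ls \<Phi>h] pbL by simp
        show "\<Psi> \<in> PiE {..<length q} (\<lambda>i. sub_homs F M (q ! i))" by (rule \<Psi>)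
        fix i assume "i \<in> {..<length q}"
        then have i: "i < length q" by simp
        show "pbh L \<Phi> i = \<Psi> i"
        proof (rule extensionalityI[where A = M])
          show "pbh L \<Phi> i \<in> extensional M" using i pbL by (simp add: pbh_def)
          show "\<Psi> i \<in> extensional M" using \<Psi>i[OF i] qi[OF i] by (simp add: sub_homs_iff)
          fix x assume "x \<in> M"
          then show "pbh L \<Phi> i x = \<Psi> i x" using \<Phi>\<pi>[OF i] i pbL by (simp add: pbh_def)
        qed
      qed
      have "joint_kernel L q \<Phi> = {\<one>\<^bsub>K\<^esub>}"
      proof (intro subset_antisym subsetI)
        fix y assume "y \<in> joint_kernel L q \<Phi>"
        then obtain x where x: "x \<in> M" "y = \<pi> x" "\<forall>i<length q. \<Phi> i y = 0" by (auto simp: joint_kernel_def L_def)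
        then have "x \<in> joint_kernel M q \<Psi>" using \<Phi>\<pi> by (auto simp: joint_kernel_def)
        then show "y \<in> {\<one>\<^bsub>K\<^esub>}" using x jkM by (simp add: kernel_def)
      next
        fix y assume "y \<in> {\<one>\<^bsub>K\<^esub>}"
        then have y: "y = \<pi> \<one>\<^bsub>F\<^esub>" by simp
        have "\<one>\<^bsub>F\<^esub> \<in> joint_kernel M q \<Psi>" unfolding jkM by (simp add: kernel_def)
        then have o: "\<one>\<^bsub>F\<^esub> \<in> M" "\<forall>i<length q. \<Psi> i \<one>\<^bsub>F\<^esub> = 0" by (auto simp: joint_kernel_def)
        have "\<pi> \<one>\<^bsub>F\<^esub> \<in> L" unfolding L_def using o(1) by (rule imageI)
        moreover have "\<forall>i<length q. \<Phi> i (\<pi> \<one>\<^bsub>F\<^esub>) = 0" using \<Phi>\<pi>[OF _ o(1)] o(2) by simp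
        ultimately show "y \<in> joint_kernel L q \<Phi>" unfolding y joint_kernel_def by blast
      qed
      then have "(L, \<Phi>) \<in> hom_pairs_at K G q {\<one>\<^bsub>K\<^esub>}"
        using quot_iff[OF Ls] pbL M \<Phi>h by (simp add: hom_pairs_at_def hom_pairs_def)
      then show "z \<in> R ` hom_pairs_at K G q {\<one>\<^bsub>K\<^esub>}" using pbL pbh\<Phi> z by (force simp: R_def)
    qed
  qed
  then show ?thesis by blast
qed

lemma mod_add_right_cancel_iff: "(x + c) mod m = (y + c) mod m \<longleftrightarrow> x mod m = y mod (m::int)"
  by (simp add: mod_eq_dvd_iff)

section \<open>Isomorphism classes of finite abelian groups\<close>

definition class_rep :: "nat monoid set \<Rightarrow> nat monoid" where
  "class_rep C = (SOME H. H \<in> C)"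

abbreviation iso_rel :: "(nat monoid \<times> nat monoid) set" where
  "iso_rel \<equiv> {(H, K). H \<in> fin_ab_groups \<and> K \<in> fin_ab_groups \<and> H \<cong> K}"

lemma fin_ab_groupsD:
  assumes "H \<in> fin_ab_groups"
  shows "comm_group H" "group H" "finite (carrier H)"
  using assms comm_group.axioms(2) by (auto simp: fin_ab_groups_def)

lemma equiv_iso_rel: "equiv fin_ab_groups iso_rel"
proof (rule equivI)
  show "iso_rel \<subseteq> fin_ab_groups \<times> fin_ab_groups" by auto
  show "refl_on fin_ab_groups iso_rel" by (auto simp: refl_on_def iso_refl)
  show "sym iso_rel" using group.iso_sym fin_ab_groupsD(2) by (auto simp: sym_def)
  show "trans iso_rel" using iso_trans by (auto simp: trans_def)
qed

text \<open>The representative is chosen by the same term as in \<open>prob_Y_tensor\<close>, so the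
  summands there are functions of \<open>class_rep\<close>.\<close>

lemma class_rep:
  assumes C: "C \<in> fin_ab_iso_classes"
  shows "class_rep C \<in> C" "class_rep C \<in> fin_ab_groups"
proof -
  have "C \<noteq> {}" using C equiv_iso_rel in_quotient_imp_non_empty unfolding fin_ab_iso_classes_def by blast
  then show m: "class_rep C \<in> C" unfolding class_rep_def by (simp add: some_in_eq)
  have "C \<subseteq> fin_ab_groups" using C equiv_iso_rel in_quotient_imp_subset unfolding fin_ab_iso_classes_def by blast
  then show "class_rep C \<in> fin_ab_groups" using m by blast
qed

lemma class_rep_iso_iff:
  assumes "C \<in> fin_ab_iso_classes" "D \<in> fin_ab_iso_classes"
  shows "class_rep C \<cong> class_rep D \<longleftrightarrow> C = D"
proof -
  have "C = D \<longleftrightarrow> (class_rep C, class_rep D) \<in> iso_rel"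
    using quotient_eq_iff[OF equiv_iso_rel] assms class_rep unfolding fin_ab_iso_classes_def by blast
  then show ?thesis using class_rep assms by auto
qed

lemma class_of_mem:
  assumes "H \<in> fin_ab_groups"
  shows "iso_rel `` {H} \<in> fin_ab_iso_classes" "H \<cong> class_rep (iso_rel `` {H})"
proof -
  show m: "iso_rel `` {H} \<in> fin_ab_iso_classes" unfolding fin_ab_iso_classes_def using assms by (rule quotientI)
  show "H \<cong> class_rep (iso_rel `` {H})" using class_rep(1)[OF m] by auto
qed

text \<open>Multiplication tables on initial segments of the naturals. They provide a member of
  \<open>fin_ab_groups\<close> isomorphic to a group with any carrier type, and there are finitely
  many of each order.\<close>

definition table_group :: "nat \<Rightarrow> (nat \<times> nat \<Rightarrow> nat) \<Rightarrow> nat \<Rightarrow> nat monoid" where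
  "table_group k t e = \<lparr>carrier = {..<k}, Group.monoid.mult = (\<lambda>i j. t (i, j)), Group.monoid.one = e\<rparr>"

lemma finite_comm_group_table:
  assumes Y: "comm_group Y" and fin: "finite (carrier Y)"
  obtains t e where "t \<in> PiE ({..<card (carrier Y)} \<times> {..<card (carrier Y)}) (\<lambda>_. {..<card (carrier Y)})"
    "e < card (carrier Y)" "table_group (card (carrier Y)) t e \<in> fin_ab_groups" "Y \<cong> table_group (card (carrier Y)) t e"
proof -
  interpret Y: comm_group Y by (rule Y)
  define k where "k = card (carrier Y)"
  obtain b where b: "bij_betw b (carrier Y) {..<k}"
    using ex_bij_betw_finite_nat[OF fin] unfolding k_def by (auto simp: atLeast0LessThan)
  define c where "c = the_inv_into (carrier Y) b"
  have c: "bij_betw c {..<k} (carrier Y)" unfolding c_def by (rule bij_betw_the_inv_into[OF b])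
  have bc: "b (c i) = i" if "i < k" for i unfolding c_def using f_the_inv_into_f_bij_betw[OF b] that by auto
  have cb: "c (b x) = x" if "x \<in> carrier Y" for x unfolding c_def using the_inv_into_f_f[of b "carrier Y"] b that by (auto simp: bij_betw_def)
  have cm: "c i \<in> carrier Y" if "i < k" for i using c that by (auto simp: bij_betw_def)
  have bm: "b x < k" if "x \<in> carrier Y" for x using b that by (auto simp: bij_betw_def)
  define t where "t = restrict (\<lambda>(i,j). b (c i \<otimes>\<^bsub>Y\<^esub> c j)) ({..<k} \<times> {..<k})"
  define e where "e = b \<one>\<^bsub>Y\<^esub>"
  let ?H = "table_group k t e"
  have tv: "t (i,j) = b (c i \<otimes>\<^bsub>Y\<^esub> c j)" if "i < k" "j < k" for i j using that by (simp add: t_def)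
  have H: "comm_group ?H"
  proof (rule comm_groupI)
    fix x y assume "x \<in> carrier ?H" "y \<in> carrier ?H"
    then show "x \<otimes>\<^bsub>?H\<^esub> y \<in> carrier ?H" by (simp add: table_group_def tv bm cm)
  next
    show "\<one>\<^bsub>?H\<^esub> \<in> carrier ?H" by (simp add: table_group_def e_def bm)
  next
    fix x y z assume "x \<in> carrier ?H" "y \<in> carrier ?H" "z \<in> carrier ?H"
    then show "(x \<otimes>\<^bsub>?H\<^esub> y) \<otimes>\<^bsub>?H\<^esub> z = x \<otimes>\<^bsub>?H\<^esub> (y \<otimes>\<^bsub>?H\<^esub> z)"
      by (simp add: table_group_def tv bm cm cb Y.m_assoc)
  next
    fix x y assume "x \<in> carrier ?H" "y \<in> carrier ?H"
    then show "x \<otimes>\<^bsub>?H\<^esub> y = y \<otimes>\<^bsub>?H\<^esub> x" by (simp add: table_group_def tv cm Y.m_comm)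
  next
    fix x assume "x \<in> carrier ?H"
    then show "\<one>\<^bsub>?H\<^esub> \<otimes>\<^bsub>?H\<^esub> x = x" by (simp add: table_group_def tv e_def bm cm cb bc)
  next
    fix x assume x: "x \<in> carrier ?H"
    then have "b (inv\<^bsub>Y\<^esub> (c x)) \<in> carrier ?H" "b (inv\<^bsub>Y\<^esub> (c x)) \<otimes>\<^bsub>?H\<^esub> x = \<one>\<^bsub>?H\<^esub>"
      by (simp_all add: table_group_def tv e_def bm cm cb)
    then show "\<exists>y\<in>carrier ?H. y \<otimes>\<^bsub>?H\<^esub> x = \<one>\<^bsub>?H\<^esub>" by blast
  qed
  have "b \<in> iso Y ?H"
    using b by (auto simp: iso_def hom_def table_group_def tv bm cb bij_betw_def)
  then have "Y \<cong> ?H" by (rule is_isoI)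
  moreover have "t \<in> PiE ({..<k} \<times> {..<k}) (\<lambda>_. {..<k})" by (auto simp: t_def bm cm)
  moreover have "e < k" by (simp add: e_def bm)
  moreover have "?H \<in> fin_ab_groups" using H by (simp add: fin_ab_groups_def table_group_def)
  ultimately show thesis using that unfolding k_def by blast
qed

lemma class_exists:
  assumes Y: "comm_group Y" and fin: "finite (carrier Y)"
  obtains C where "C \<in> fin_ab_iso_classes" "Y \<cong> class_rep C"
proof -
  let ?k = "card (carrier Y)"
  obtain t e where te: "t \<in> PiE ({..<?k} \<times> {..<?k}) (\<lambda>_. {..<?k})" "e < ?k"
    "table_group ?k t e \<in> fin_ab_groups" "Y \<cong> table_group ?k t e"
    by (rule finite_comm_group_table[OF assms])
  show thesis
    by (rule that[OF class_of_mem(1)[OF te(3)] iso_trans[OF te(4) class_of_mem(2)[OF te(3)]]])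
qed

lemma class_unique:
  assumes "group Y" "C \<in> fin_ab_iso_classes" "D \<in> fin_ab_iso_classes" "Y \<cong> class_rep C" "Y \<cong> class_rep D"
  shows "C = D"
proof -
  have "class_rep C \<cong> Y" using group.iso_sym[OF assms(1,4)] .
  then have "class_rep C \<cong> class_rep D" using iso_trans assms(5) by blast
  then show ?thesis using class_rep_iso_iff assms by blast
qed

definition small_classes :: "nat \<Rightarrow> nat monoid set set" where
  "small_classes B = {C \<in> fin_ab_iso_classes. card (carrier (class_rep C)) \<le> B}"

lemma finite_small_classes: "finite (small_classes B)"
proof -
  define T where "T k = PiE ({..<k} \<times> {..<k}) (\<lambda>_. {..<k}) \<times> {..<k}" for k :: nat
  have "small_classes B \<subseteq> (\<Union>k\<in>{..B}. (\<lambda>(t,e). iso_rel `` {table_group k t e}) ` T k)"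
  proof
    fix C assume C: "C \<in> small_classes B"
    then have C': "C \<in> fin_ab_iso_classes" "card (carrier (class_rep C)) \<le> B" by (auto simp: small_classes_def)
    note cr = class_rep(2)[OF C'(1)]
    define k where "k = card (carrier (class_rep C))"
    obtain t e where te: "t \<in> PiE ({..<k} \<times> {..<k}) (\<lambda>_. {..<k})" "e < k" "table_group k t e \<in> fin_ab_groups"
      "class_rep C \<cong> table_group k t e"
      using finite_comm_group_table[OF fin_ab_groupsD(1,3)[OF cr]] unfolding k_def by metis
    have "class_rep C \<cong> class_rep (iso_rel `` {table_group k t e})"
      using te(4) class_of_mem(2)[OF te(3)] iso_trans by blast
    then have "C = iso_rel `` {table_group k t e}"
      using class_rep_iso_iff[OF C'(1) class_of_mem(1)[OF te(3)]] by simp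
    moreover have "(t,e) \<in> T k" using te by (simp add: T_def)
    moreover have "k \<in> {..B}" using C' by (simp add: k_def)
    ultimately show "C \<in> (\<Union>k\<in>{..B}. (\<lambda>(t,e). iso_rel `` {table_group k t e}) ` T k)" by blast
  qed
  moreover have "finite (\<Union>k\<in>{..B}. (\<lambda>(t,e). iso_rel `` {table_group k t e}) ` T k)"
    by (intro finite_UN_I finite_imageI) (auto simp: T_def intro!: finite_PiE)
  ultimately show ?thesis by (rule finite_subset)
qed

lemma card_image_factor_le:
  assumes "finite (g ` A)" "\<And>x y. x \<in> A \<Longrightarrow> y \<in> A \<Longrightarrow> g x = g y \<Longrightarrow> h x = h y"
  shows "finite (h ` A)" "card (h ` A) \<le> card (g ` A)"
proof -
  have eq: "h ` A = (\<lambda>z. h (inv_into A g z)) ` (g ` A)"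
  proof -
    have "h x = h (inv_into A g (g x))" if "x \<in> A" for x
      by (rule assms(2)[OF that inv_into_into]) (use that in \<open>auto simp: f_inv_into_f\<close>)
    then show ?thesis by (force simp: image_image)
  qed
  show "finite (h ` A)" unfolding eq using assms(1) by (rule finite_imageI)
  show "card (h ` A) \<le> card (g ` A)" unfolding eq using assms(1) by (rule card_image_le)
qed

context comm_group
begin

lemma sub_homs_one:
  assumes M: "subgroup M G" and p: "p > 0" and \<psi>: "\<psi> \<in> sub_homs G M p"
  shows "\<psi> \<one> = 0"
proof -
  have o: "\<one> \<in> M" using subgroup.one_closed[OF M] .
  have "\<psi> \<one> = (\<psi> \<one> + \<psi> \<one>) mod int p" using \<psi> p o by (metis r_one one_closed sub_homs_iff)
  moreover have "0 \<le> \<psi> \<one>" "\<psi> \<one> < int p" using \<psi> p o by (auto simp: sub_homs_iff)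
  ultimately have "(\<psi> \<one> + \<psi> \<one>) mod int p = (0 + \<psi> \<one>) mod int p" by simp
  then have "\<psi> \<one> mod int p = 0 mod int p" by (simp only: mod_add_right_cancel_iff)
  then show ?thesis using \<open>0 \<le> \<psi> \<one>\<close> \<open>\<psi> \<one> < int p\<close> by simp
qed

lemma subgroup_joint_kernel:
  assumes M: "subgroup M G" and q: "\<forall>p\<in>set q. p > 0" and \<Psi>: "\<Psi> \<in> PiE {..<length q} (\<lambda>i. sub_homs G M (q ! i))"
  shows "subgroup (joint_kernel M q \<Psi>) G"
proof (rule subgroupI)
  have qi: "q ! i > 0" if "i < length q" for i using q that by simp
  have \<Psi>i: "\<Psi> i \<in> sub_homs G M (q ! i)" if "i < length q" for i using \<Psi> that by auto
  show "joint_kernel M q \<Psi> \<subseteq> carrier G" using subgroup.subset[OF M] by (auto simp: joint_kernel_def)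
  have "\<one> \<in> joint_kernel M q \<Psi>"
    using subgroup.one_closed[OF M] sub_homs_one[OF M qi \<Psi>i] by (simp add: joint_kernel_def)
  then show "joint_kernel M q \<Psi> \<noteq> {}" by blast
  fix x assume x: "x \<in> joint_kernel M q \<Psi>"
  then have xM: "x \<in> M" "x \<in> carrier G" using subgroup.subset[OF M] by (auto simp: joint_kernel_def)
  have iM: "inv x \<in> M" using subgroup.m_inv_closed[OF M] xM by blast
  have "\<Psi> i (inv x) = 0" if i: "i < length q" for i
  proof -
    have "\<Psi> i (x \<otimes> inv x) = (\<Psi> i x + \<Psi> i (inv x)) mod int (q ! i)"
      using \<Psi>i[OF i] xM(1) iM unfolding sub_homs_iff[OF qi[OF i]] by blast
    then have "\<Psi> i (inv x) mod int (q ! i) = 0" using x i xM sub_homs_one[OF M qi[OF i] \<Psi>i[OF i]] by (simp add: joint_kernel_def)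
    moreover have "0 \<le> \<Psi> i (inv x)" "\<Psi> i (inv x) < int (q ! i)" using \<Psi>i[OF i] qi[OF i] iM by (auto simp: sub_homs_iff)
    ultimately show ?thesis by simp
  qed
  then show "inv x \<in> joint_kernel M q \<Psi>" using iM by (simp add: joint_kernel_def)
  fix y assume y: "y \<in> joint_kernel M q \<Psi>"
  then show "x \<otimes> y \<in> joint_kernel M q \<Psi>"
    using x subgroup.m_closed[OF M] \<Psi>i qi by (auto simp: joint_kernel_def sub_homs_iff)
qed

text \<open>A coset of the joint kernel is determined by its coset of \<open>M\<close> and the
  values of the homomorphisms at the difference from a representative, which leaves at most |H|
  times the product of the moduli.\<close>

lemma card_Mod_joint_kernel:
  assumes M: "M \<in> quot_subs G H" and fin: "finite (carrier H)" and q: "\<forall>p\<in>set q. p > 0"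
    and \<Psi>: "\<Psi> \<in> PiE {..<length q} (\<lambda>i. sub_homs G M (q ! i))"
  shows "finite (carrier (G Mod joint_kernel M q \<Psi>))"
    "card (carrier (G Mod joint_kernel M q \<Psi>)) \<le> card (carrier H) * (\<Prod>i<length q. q ! i)"
proof -
  have Ms: "subgroup M G" and iso: "G Mod M \<cong> H" using M by (auto simp: quot_subs_def)
  have finM: "finite (carrier (G Mod M))" "card (carrier (G Mod M)) = card (carrier H)"
    using iso fin iso_finite iso_same_card by auto
  let ?J = "joint_kernel M q \<Psi>"
  have Js: "subgroup ?J G" by (rule subgroup_joint_kernel[OF Ms q \<Psi>])
  have qi: "q ! i > 0" if "i < length q" for i using q that by simp
  have \<Psi>i: "\<Psi> i \<in> sub_homs G M (q ! i)" if "i < length q" for i using \<Psi> that by auto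
  \<comment> \<open>The representative depends on the coset alone, so for two elements of one coset
    of \<open>M\<close> it cancels from the quotient of their differences.\<close>
  define rp where "rp c = (SOME r. r \<in> c)" for c :: "'a set"
  define d where "d x = x \<otimes> inv (rp (M #> x))" for x
  have rp: "rp (M #> x) \<in> carrier G" "d x \<in> M" if x: "x \<in> carrier G" for x
  proof -
    have "x \<in> M #> x" using rcos_self[OF x Ms] .
    then have r: "rp (M #> x) \<in> M #> x" unfolding rp_def by (rule someI)
    then show rc: "rp (M #> x) \<in> carrier G" using r_coset_subset_G[OF subgroup.subset[OF Ms] x] by blast
    have "M #> x = M #> rp (M #> x)" using repr_independence[OF r x Ms] .
    then have "x \<in> M #> rp (M #> x)" using rcos_self[OF x Ms] by simp
    then show "d x \<in> M" unfolding d_def using subgroup.rcos_module_imp[OF Ms is_group rc] by blast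
  qed
  define g where "g x = (M #> x, \<lambda>i\<in>{..<length q}. \<Psi> i (d x))" for x
  let ?T = "carrier (G Mod M) \<times> PiE {..<length q} (\<lambda>i. {0..<int (q ! i)})"
  have gT: "g ` carrier G \<subseteq> ?T"
  proof (rule image_subsetI)
    fix x assume x: "x \<in> carrier G"
    then show "g x \<in> ?T" using rp(2)[OF x] \<Psi>i qi by (auto simp: g_def carrier_FactGroup sub_homs_iff)
  qed
  have finT: "finite ?T" using finM by (intro finite_cartesian_product finite_PiE) auto
  have cT: "card ?T = card (carrier H) * (\<Prod>i<length q. q ! i)"
    using finM by (simp add: card_cartesian_product card_PiE)
  have fact: "?J #> x = ?J #> y" if x: "x \<in> carrier G" and y: "y \<in> carrier G" and gg: "g x = g y" for x y
  proof -
    have c: "M #> x = M #> y" and e: "\<And>i. i < length q \<Longrightarrow> \<Psi> i (d x) = \<Psi> i (d y)"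
      using gg by (auto simp: g_def restrict_def fun_eq_iff split: if_splits) 
    let ?r = "rp (M #> x)"
    have rc: "?r \<in> carrier G" using rp(1)[OF x] .
    have dc: "d x \<in> carrier G" "d y \<in> carrier G" using rp(2) x y subgroup.subset[OF Ms] by auto
    have xy: "x \<otimes> inv y = d x \<otimes> inv (d y)"
    proof -
      have "d x \<otimes> inv (d y) = (x \<otimes> inv ?r) \<otimes> (inv y \<otimes> ?r)" unfolding d_def c using x y rp(1)[OF y] by (simp add: inv_mult)
      also have "\<dots> = (x \<otimes> inv y) \<otimes> (inv ?r \<otimes> ?r)" using x y rc by (simp only: m_ac m_closed inv_closed)
      finally show ?thesis using x y rc by simp
    qed
    have "x \<otimes> inv y \<in> ?J"
      unfolding joint_kernel_def
    proof (clarify, intro conjI allI impI)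
      have m: "d x \<otimes> inv (d y) \<in> M" "inv (d y) \<in> M" using rp(2) x y subgroup.m_closed[OF Ms] subgroup.m_inv_closed[OF Ms] by auto
      then show "x \<otimes> inv y \<in> M" unfolding xy by simp
      fix i assume i: "i < length q"
      have "d x = (d x \<otimes> inv (d y)) \<otimes> d y" using dc by (simp add: m_assoc)
      then have "\<Psi> i (d x) = (\<Psi> i (d x \<otimes> inv (d y)) + \<Psi> i (d y)) mod int (q ! i)"
        using \<Psi>i[OF i] qi[OF i] m rp(2)[OF y] by (metis sub_homs_iff)
      then have "(\<Psi> i (d x \<otimes> inv (d y)) + \<Psi> i (d y)) mod int (q ! i) = (0 + \<Psi> i (d y)) mod int (q ! i)"
        using e[OF i] \<Psi>i[OF i] qi[OF i] rp(2)[OF y] by (simp add: sub_homs_iff)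
      then have "\<Psi> i (d x \<otimes> inv (d y)) mod int (q ! i) = 0 mod int (q ! i)" by (simp only: mod_add_right_cancel_iff)
      then show "\<Psi> i (x \<otimes> inv y) = 0" unfolding xy using \<Psi>i[OF i] qi[OF i] m(1) by (simp add: sub_homs_iff)
    qed
    then have "x \<in> ?J #> y" using subgroup.rcos_module_rev[OF Js is_group y x] by blast
    then show ?thesis using repr_independence[OF _ y Js] by metis
  qed
  have fg: "finite (g ` carrier G)" using gT finT finite_subset by blast
  note fl = card_image_factor_le[OF fg fact]
  show "finite (carrier (G Mod ?J))" unfolding carrier_FactGroup by (rule fl(1))
  have "card (carrier (G Mod ?J)) \<le> card (g ` carrier G)" unfolding carrier_FactGroup by (rule fl(2))
  also have "\<dots> \<le> card ?T" by (rule card_mono[OF finT gT])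
  finally show "card (carrier (G Mod ?J)) \<le> card (carrier H) * (\<Prod>i<length q. q ! i)" unfolding cT .
qed

end

section \<open>Homomorphisms to prime fields\<close>

lemma sub_homs_Zn0_iff:
  assumes p: "p > 0"
  shows "\<psi> \<in> sub_homs (Zn0 n) M p \<longleftrightarrow> \<psi> \<in> extensional M \<and> (\<forall>x\<in>M. 0 \<le> \<psi> x \<and> \<psi> x < int p) \<and>
     (\<forall>x\<in>M. \<forall>y\<in>M. \<psi> (x + y) = (\<psi> x + \<psi> y) mod int p)"
proof -
  have e: "(\<lambda>i. x i + y i) = x + y" for x y :: "nat \<Rightarrow> int" by (simp add: plus_fun_def)
  show ?thesis unfolding sub_homs_iff[OF p] Zn0_simps(2) e by (rule refl)
qed

text \<open>For a subgroup U of M these are the homomorphisms from M / U to \<int>/p, kept as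
  functions on M so that no quotient group has to be formed.\<close>

definition killed_homs :: "('a, 'c) monoid_scheme \<Rightarrow> 'a set \<Rightarrow> nat \<Rightarrow> 'a set \<Rightarrow> ('a \<Rightarrow> int) set" where
  "killed_homs F M p U = {\<psi> \<in> sub_homs F M p. \<forall>u\<in>U. \<psi> u = 0}"

definition list_kernel :: "'a set \<Rightarrow> ('a \<Rightarrow> int) list \<Rightarrow> 'a set" where
  "list_kernel M l = {x\<in>M. \<forall>\<psi>\<in>set l. \<psi> x = 0}"

text \<open>Linearly independent lists in a space of homomorphisms to \<int>/p, built from the tail.
  Independence of a new head is expressed by its being nonzero on the common kernel of the tail, in
  place of a linear combination condition.\<close>

primrec indep_lists :: "'a set \<Rightarrow> ('a \<Rightarrow> int) set \<Rightarrow> nat \<Rightarrow> ('a \<Rightarrow> int) list set" where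
  "indep_lists M V 0 = {[]}"
| "indep_lists M V (Suc k) = {\<psi> # l | \<psi> l. l \<in> indep_lists M V k \<and> \<psi> \<in> V \<and> (\<exists>x\<in>list_kernel M l. \<psi> x \<noteq> 0)}"

lemma indep_lists_set: "l \<in> indep_lists M V k \<Longrightarrow> set l \<subseteq> V \<and> length l = k"
proof (induction k arbitrary: l)
  case (Suc k)
  then obtain \<psi> l' where l: "l = \<psi> # l'" "l' \<in> indep_lists M V k" "\<psi> \<in> V" by auto
  show ?case using Suc.IH[OF l(2)] l by simp
qed simp

text \<open>The independence condition does not involve U, so killing U is just the condition that
  every entry, and hence the common kernel, respects it.\<close>

lemma indep_lists_killed:
  assumes U: "U \<subseteq> M"
  shows "indep_lists M {\<psi>\<in>V. \<forall>u\<in>U. \<psi> u = 0} k = {l \<in> indep_lists M V k. U \<subseteq> list_kernel M l}"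
proof (induction k)
  case 0
  then show ?case using U by (auto simp: list_kernel_def)
next
  case (Suc k)
  show ?case
  proof (intro subset_antisym subsetI)
    fix l assume "l \<in> indep_lists M {\<psi>\<in>V. \<forall>u\<in>U. \<psi> u = 0} (Suc k)"
    then show "l \<in> {l \<in> indep_lists M V (Suc k). U \<subseteq> list_kernel M l}"
      using Suc by (fastforce simp: list_kernel_def)
  next
    fix l assume "l \<in> {l \<in> indep_lists M V (Suc k). U \<subseteq> list_kernel M l}"
    then obtain \<psi> l' where l: "l = \<psi> # l'" "l' \<in> indep_lists M V k" "\<psi> \<in> V" "\<exists>x\<in>list_kernel M l'. \<psi> x \<noteq> 0" "U \<subseteq> list_kernel M (\<psi> # l')"
      by auto
    have "l' \<in> indep_lists M {\<psi>\<in>V. \<forall>u\<in>U. \<psi> u = 0} k" using Suc l(2,5) by (auto simp: list_kernel_def)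
    moreover have "\<forall>u\<in>U. \<psi> u = 0" using l(5) by (auto simp: list_kernel_def)
    ultimately show "l \<in> indep_lists M {\<psi>\<in>V. \<forall>u\<in>U. \<psi> u = 0} (Suc k)" using l by auto
  qed
qed

text \<open>For a subgroup U the set \<open>V\<close> is a vector space over the field with p
  elements, namely the dual of M / (U + p M). Its linear algebra is done through kernels inside
  M.\<close>

locale mod_p_homs =
  fixes n p :: nat and M U :: "(nat \<Rightarrow> int) set"
  assumes p: "Factorial_Ring.prime p" and M: "addsub M" and UM: "U \<subseteq> M"
    and finV: "finite (killed_homs (Zn0 n) M p U)"
begin

definition V where "V = killed_homs (Zn0 n) M p U"

lemma p0: "p > 0" using p prime_gt_0_nat by blast

lemma VD:
  assumes "\<psi> \<in> V"
  shows "\<psi> \<in> extensional M" "\<And>x. x \<in> M \<Longrightarrow> 0 \<le> \<psi> x" "\<And>x. x \<in> M \<Longrightarrow> \<psi> x < int p"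
    "\<And>x y. x \<in> M \<Longrightarrow> y \<in> M \<Longrightarrow> \<psi> (x + y) = (\<psi> x + \<psi> y) mod int p" "\<And>u. u \<in> U \<Longrightarrow> \<psi> u = 0"
  using assms p0 by (auto simp: V_def killed_homs_def sub_homs_Zn0_iff)

lemma VI:
  assumes "\<psi> \<in> extensional M" "\<And>x. x \<in> M \<Longrightarrow> 0 \<le> \<psi> x \<and> \<psi> x < int p"
    "\<And>x y. x \<in> M \<Longrightarrow> y \<in> M \<Longrightarrow> \<psi> (x + y) = (\<psi> x + \<psi> y) mod int p" "\<And>u. u \<in> U \<Longrightarrow> \<psi> u = 0"
  shows "\<psi> \<in> V"
  using assms p0 by (auto simp: V_def killed_homs_def sub_homs_Zn0_iff)

lemma V_mod: "\<psi> \<in> V \<Longrightarrow> x \<in> M \<Longrightarrow> \<psi> x mod int p = \<psi> x"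
  using VD(2,3) by simp

lemma V_smul:
  assumes \<psi>: "\<psi> \<in> V" and x: "x \<in> M"
  shows "\<psi> (smul (int k) x) = (int k * \<psi> x) mod int p"
proof (induction k)
  case 0
  have "\<psi> (0 + 0) = (\<psi> 0 + \<psi> 0) mod int p" using VD(4)[OF \<psi>] addsub_0[OF M] by blast
  then have "(\<psi> 0 + \<psi> 0) mod int p = (0 + \<psi> 0) mod int p" using V_mod[OF \<psi> addsub_0[OF M]] by simp
  then have "\<psi> 0 mod int p = 0 mod int p" by (simp only: mod_add_right_cancel_iff)
  then have "\<psi> 0 = 0" using V_mod[OF \<psi> addsub_0[OF M]] by simp
  then show ?case by (simp only: of_nat_0 smul_simps mult_zero_left mod_0)
next
  case (Suc k)
  have "smul (int (Suc k)) x = x + smul (int k) x" by (simp only: of_nat_Suc smul_simps)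
  then have "\<psi> (smul (int (Suc k)) x) = (\<psi> x + (int k * \<psi> x) mod int p) mod int p"
    using VD(4)[OF \<psi> x addsub_smul[OF M x]] Suc by (simp only:)
  then show ?case by (simp add: mod_simps algebra_simps)
qed

lemma V_0: "\<psi> \<in> V \<Longrightarrow> \<psi> 0 = 0"
  using V_smul[of \<psi> 0 0] addsub_0[OF M] by (simp add: smul_simps)

lemma V_diff:
  assumes \<psi>: "\<psi> \<in> V" and x: "x \<in> M" "y \<in> M"
  shows "\<psi> (x - y) = (\<psi> x - \<psi> y) mod int p"
proof -
  have d: "x - y \<in> M" using addsub_diff[OF M x] .
  have "\<psi> ((x - y) + y) = (\<psi> (x - y) + \<psi> y) mod int p" using VD(4)[OF \<psi> d x(2)] .
  then have "\<psi> x = (\<psi> (x - y) + \<psi> y) mod int p" by simp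
  then have "(\<psi> x - \<psi> y) mod int p = \<psi> (x - y) mod int p" by (simp add: mod_simps)
  then show ?thesis using V_mod[OF \<psi> d] by simp
qed

lemma addsub_kernel:
  assumes "set l \<subseteq> V"
  shows "addsub (list_kernel M l)"
  unfolding addsub_def
proof (intro conjI ballI)
  show "0 \<in> list_kernel M l" using assms V_0 addsub_0[OF M] by (auto simp: list_kernel_def)
  fix x y assume xy: "x \<in> list_kernel M l" "y \<in> list_kernel M l"
  then have m: "x \<in> M" "y \<in> M" by (auto simp: list_kernel_def)
  have "\<psi> (x - y) = 0" if "\<psi> \<in> set l" for \<psi>
  proof -
    have "\<psi> x = 0" "\<psi> y = 0" using xy that unfolding list_kernel_def by blast+
    then show ?thesis using V_diff[OF subsetD[OF assms that] m] by simp
  qed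
  then show "x - y \<in> list_kernel M l" using addsub_diff[OF M m] by (simp add: list_kernel_def)
qed

text \<open>A nonzero value modulo a prime is invertible, so a multiple of the argument takes the
  value 1.\<close>

lemma unit_value:
  assumes l: "set l \<subseteq> V" and \<phi>: "\<phi> \<in> V" and x: "x \<in> list_kernel M l" "\<phi> x \<noteq> 0"
  obtains z where "z \<in> list_kernel M l" "z \<in> M" "\<phi> z = 1"
proof -
  have xM: "x \<in> M" using x by (simp add: list_kernel_def)
  have r: "0 < \<phi> x" "\<phi> x < int p" using VD(2,3)[OF \<phi> xM] x(2) by auto
  have "\<not> int p dvd \<phi> x" using r zdvd_not_zless by blast
  then have "coprime (int p) (\<phi> x)" using p prime_imp_coprime[of "int p" "\<phi> x"] by auto
  then obtain u v where "u * int p + v * \<phi> x = 1" using bezout_int[of "int p" "\<phi> x"] by auto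
  then have v: "(v * \<phi> x) mod int p = 1 mod int p" by (metis mod_mult_self3 add.commute)
  define k where "k = nat (v mod int p)"
  have k: "int k = v mod int p" using p0 by (simp add: k_def)
  have "\<phi> (smul (int k) x) = (int k * \<phi> x) mod int p" by (rule V_smul[OF \<phi> xM])
  also have "\<dots> = (v * \<phi> x) mod int p" unfolding k by (rule mod_mult_left_eq)
  also have "\<dots> = 1" unfolding v using p prime_gt_1_nat by simp
  finally have "\<phi> (smul (int k) x) = 1" .
  moreover have "smul (int k) x \<in> list_kernel M l" using addsub_smul[OF addsub_kernel[OF l] x(1)] .
  ultimately show thesis using that addsub_smul[OF M xM] by blast
qed

lemma residual:
  assumes \<phi>: "\<phi> \<in> V" and z: "z \<in> list_kernel M l" "z \<in> M" "\<phi> z = 1" and l: "set l \<subseteq> V" and y: "y \<in> list_kernel M l"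
  shows "y - smul (\<phi> y) z \<in> list_kernel M (\<phi> # l)" 
proof -
  have yM: "y \<in> M" using y by (simp add: list_kernel_def)
  have k: "int (nat (\<phi> y)) = \<phi> y" using VD(2)[OF \<phi> yM] by simp
  have m: "y - smul (\<phi> y) z \<in> list_kernel M l"
    using addsub_diff[OF addsub_kernel[OF l] y] addsub_smul[OF addsub_kernel[OF l] z(1)] by blast
  have "\<phi> (smul (\<phi> y) z) = \<phi> y mod int p" using V_smul[OF \<phi> z(2), of "nat (\<phi> y)"] z(3) k by simp
  then have "\<phi> (y - smul (\<phi> y) z) = 0" using V_diff[OF \<phi> yM addsub_smul[OF M z(2)]] by (simp add: mod_simps)
  then show ?thesis using m by (auto simp: list_kernel_def)
qed

text \<open>Duality: a homomorphism vanishing on the common kernel of k independent ones is a linear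
  combination of them, and the p^k combinations are distinct.\<close>

lemma card_vanishing:
  assumes "l \<in> indep_lists M V k"
  shows "card {\<psi>\<in>V. \<forall>x\<in>list_kernel M l. \<psi> x = 0} = p ^ k"
  using assms
proof (induction k arbitrary: l)
  case 0
  have "{\<psi>\<in>V. \<forall>x\<in>list_kernel M []. \<psi> x = 0} = {\<lambda>x\<in>M. 0}"
  proof (intro subset_antisym subsetI)
    fix \<psi> assume \<psi>: "\<psi> \<in> {\<psi>\<in>V. \<forall>x\<in>list_kernel M []. \<psi> x = 0}"
    have "\<psi> = (\<lambda>x\<in>M. 0)"
      by (rule extensionalityI[where A = M]) (use \<psi> VD(1) in \<open>auto simp: list_kernel_def\<close>)
    then show "\<psi> \<in> {\<lambda>x\<in>M. 0}" by simp
  next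
    fix \<psi> :: "(nat \<Rightarrow> int) \<Rightarrow> int" assume "\<psi> \<in> {\<lambda>x\<in>M. 0}"
    then have e: "\<psi> = (\<lambda>x\<in>M. 0)" by simp
    have "\<psi> \<in> V" unfolding e by (rule VI) (use p0 UM addsub_add[OF M] in auto)
    then show "\<psi> \<in> {\<psi>\<in>V. \<forall>x\<in>list_kernel M []. \<psi> x = 0}" using e by (simp add: list_kernel_def)
  qed
  then show ?case using 0 by simp
next
  case (Suc k)
  then obtain \<phi> l' where l: "l = \<phi> # l'" "l' \<in> indep_lists M V k" "\<phi> \<in> V" "\<exists>x\<in>list_kernel M l'. \<phi> x \<noteq> 0" by auto
  have l': "set l' \<subseteq> V" using indep_lists_set[OF l(2)] by simp
  obtain w where w: "w \<in> list_kernel M l'" "\<phi> w \<noteq> 0" using l(4) by blast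
  obtain z where z: "z \<in> list_kernel M l'" "z \<in> M" "\<phi> z = 1" by (rule unit_value[OF l' l(3) w])
  let ?A = "{\<psi>\<in>V. \<forall>x\<in>list_kernel M l'. \<psi> x = 0}" and ?B = "{\<psi>\<in>V. \<forall>x\<in>list_kernel M l. \<psi> x = 0}"
  let ?f = "\<lambda>(c, \<psi>). \<lambda>x\<in>M. (\<psi> x + c * \<phi> x) mod int p"
  have comb: "(\<lambda>x\<in>M. (\<psi> x + c * \<phi> x) mod int p) \<in> V" if \<psi>: "\<psi> \<in> V" for \<psi> c
  proof (rule VI)
    fix x y assume xy: "x \<in> M" "y \<in> M"
    then have "x + y \<in> M" using addsub_add[OF M] by blast
    moreover have "((\<psi> x + \<psi> y) mod int p + c * ((\<phi> x + \<phi> y) mod int p)) mod int p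
       = ((\<psi> x + c * \<phi> x) mod int p + (\<psi> y + c * \<phi> y) mod int p) mod int p"
    proof -
      have "((\<psi> x + \<psi> y) mod int p + c * ((\<phi> x + \<phi> y) mod int p)) mod int p = ((\<psi> x + \<psi> y) + c * (\<phi> x + \<phi> y)) mod int p"
        by (metis mod_add_left_eq mod_add_right_eq mod_mult_right_eq)
      also have "(\<psi> x + \<psi> y) + c * (\<phi> x + \<phi> y) = (\<psi> x + c * \<phi> x) + (\<psi> y + c * \<phi> y)" by (simp add: algebra_simps)
      finally show ?thesis by (simp only: mod_add_eq)
    qed
    ultimately show "(\<lambda>x\<in>M. (\<psi> x + c * \<phi> x) mod int p) (x + y)
        = ((\<lambda>x\<in>M. (\<psi> x + c * \<phi> x) mod int p) x + (\<lambda>x\<in>M. (\<psi> x + c * \<phi> x) mod int p) y) mod int p"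
      using xy VD(4)[OF \<psi> xy] VD(4)[OF l(3) xy] by simp
  next
    fix u assume u: "u \<in> U"
    then show "(\<lambda>x\<in>M. (\<psi> x + c * \<phi> x) mod int p) u = 0"
      using VD(5)[OF \<psi> u] VD(5)[OF l(3) u] UM by auto
  qed (use p0 in auto)
  have "bij_betw ?f ({0..<int p} \<times> ?A) ?B"
    unfolding bij_betw_def
  proof
    show "inj_on ?f ({0..<int p} \<times> ?A)"
    proof (rule inj_onI, clarify)
      fix c \<psi> c' \<psi>' assume c: "c \<in> {0..<int p}" "c' \<in> {0..<int p}" and \<psi>: "\<psi> \<in> V" "\<forall>x\<in>list_kernel M l'. \<psi> x = 0"
        and \<psi>': "\<psi>' \<in> V" "\<forall>x\<in>list_kernel M l'. \<psi>' x = 0"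
        and eq: "(\<lambda>x\<in>M. (\<psi> x + c * \<phi> x) mod int p) = (\<lambda>x\<in>M. (\<psi>' x + c' * \<phi> x) mod int p)"
      have "c mod int p = c' mod int p" using fun_cong[OF eq, of z] z \<psi>(2) \<psi>'(2) by simp
      then have cc: "c = c'" using c by simp
      have "\<psi> = \<psi>'"
      proof (rule extensionalityI[OF VD(1)[OF \<psi>(1)] VD(1)[OF \<psi>'(1)]])
        fix x assume x: "x \<in> M"
        have "(\<psi> x + c * \<phi> x) mod int p = (\<psi>' x + c * \<phi> x) mod int p" using fun_cong[OF eq, of x] x cc by simp
        then have "\<psi> x mod int p = \<psi>' x mod int p" by (simp only: mod_add_right_cancel_iff)
        then show "\<psi> x = \<psi>' x" using V_mod[OF \<psi>(1) x] V_mod[OF \<psi>'(1) x] by simp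
      qed
      then show "c = c' \<and> \<psi> = \<psi>'" using cc by simp
    qed
    show "?f ` ({0..<int p} \<times> ?A) = ?B"
    proof (intro subset_antisym subsetI)
      fix \<eta> assume "\<eta> \<in> ?f ` ({0..<int p} \<times> ?A)"
      then obtain c \<psi> where \<eta>: "\<eta> = (\<lambda>x\<in>M. (\<psi> x + c * \<phi> x) mod int p)" and \<psi>: "\<psi> \<in> V" "\<forall>x\<in>list_kernel M l'. \<psi> x = 0"
        by auto
      have "\<eta> x = 0" if "x \<in> list_kernel M l" for x
        using that \<psi>(2) unfolding \<eta> l(1) by (auto simp: list_kernel_def)
      then show "\<eta> \<in> ?B" using comb[OF \<psi>(1)] \<eta> by auto
    next
      fix \<eta> assume "\<eta> \<in> ?B"
      then have \<eta>: "\<eta> \<in> V" "\<forall>x\<in>list_kernel M l. \<eta> x = 0" by auto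
      \<comment> \<open>The coefficient of \<open>\<phi>\<close> can be read off at
        \<open>z\<close>, where \<open>\<phi>\<close> is 1 and all entries of \<open>l'\<close>
        vanish.\<close>
      define c where "c = \<eta> z"
      define \<psi> where "\<psi> = (\<lambda>x\<in>M. (\<eta> x + (- c) * \<phi> x) mod int p)"
      have cr: "c \<in> {0..<int p}" using VD(2,3)[OF \<eta>(1) z(2)] by (simp add: c_def)
      have "\<psi> \<in> V" unfolding \<psi>_def by (rule comb[OF \<eta>(1)])
      moreover have "\<psi> y = 0" if y: "y \<in> list_kernel M l'" for y
      proof -
        have yM: "y \<in> M" using y by (simp add: list_kernel_def)
        have k: "int (nat (\<phi> y)) = \<phi> y" using VD(2)[OF l(3) yM] by simp
        have "y - smul (\<phi> y) z \<in> list_kernel M l" unfolding l(1) by (rule residual[OF l(3) z l' y])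
        then have "\<eta> (y - smul (\<phi> y) z) = 0" using \<eta>(2) by blast
        then have "(\<eta> y - \<eta> (smul (\<phi> y) z)) mod int p = 0" using V_diff[OF \<eta>(1) yM addsub_smul[OF M z(2)]] by simp
        then have "(\<eta> y - (\<phi> y * c) mod int p) mod int p = 0" using V_smul[OF \<eta>(1) z(2), of "nat (\<phi> y)"] k by (simp add: c_def)
        then have "(\<eta> y - \<phi> y * c) mod int p = 0" by (simp add: mod_simps)
        then show ?thesis using yM by (simp add: \<psi>_def algebra_simps)
      qed
      moreover have "\<eta> = ?f (c, \<psi>)"
      proof -
        have "\<eta> = (\<lambda>x\<in>M. (\<psi> x + c * \<phi> x) mod int p)"
        proof (rule extensionalityI[OF VD(1)[OF \<eta>(1)]])
          fix x assume x: "x \<in> M"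
          have "(\<psi> x + c * \<phi> x) mod int p = \<eta> x mod int p" using x by (simp add: \<psi>_def mod_simps)
          then show "\<eta> x = (\<lambda>x\<in>M. (\<psi> x + c * \<phi> x) mod int p) x" using x V_mod[OF \<eta>(1) x] by simp
        qed simp
        then show ?thesis by simp
      qed
      ultimately show "\<eta> \<in> ?f ` ({0..<int p} \<times> ?A)" using cr by (intro image_eqI[of _ _ "(c, \<psi>)"]) auto
    qed
  qed
  then have "card ({0..<int p} \<times> ?A) = card ?B" by (rule bij_betw_same_card)
  then have "card ?B = p * card ?A" unfolding card_cartesian_product by simp
  then show ?case using Suc.IH[OF l(2)] by simp
qed

lemma finite_indep_lists: "finite (indep_lists M V k)"
proof (induction k)
  case (Suc k)
  have "indep_lists M V (Suc k) \<subseteq> (\<lambda>(\<psi>, l). \<psi> # l) ` (V \<times> indep_lists M V k)" by auto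
  moreover have "finite ((\<lambda>(\<psi>, l). \<psi> # l) ` (V \<times> indep_lists M V k))"
    using Suc finV unfolding V_def[symmetric] by (intro finite_imageI finite_cartesian_product)
  ultimately show ?case by (rule finite_subset)
qed simp

text \<open>The admissible heads are the elements of \<open>V\<close> outside the span of the list,
  and this span has p^k elements by \<open>card_vanishing\<close>.\<close>

lemma card_indep_lists_Suc: "card (indep_lists M V (Suc k)) = card (indep_lists M V k) * (card V - p ^ k)"
proof -
  have finV': "finite V" using finV by (simp add: V_def)
  let ?B = "\<lambda>l. V - {\<psi>\<in>V. \<forall>x\<in>list_kernel M l. \<psi> x = 0}"
  have "indep_lists M V (Suc k) = (\<lambda>(l, \<psi>). \<psi> # l) ` (Sigma (indep_lists M V k) ?B)" by force
  then have "card (indep_lists M V (Suc k)) = card (Sigma (indep_lists M V k) ?B)"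
    by (simp add: card_image inj_on_def)
  also have "\<dots> = (\<Sum>l\<in>indep_lists M V k. card (?B l))"
    using finV' finite_indep_lists by (intro card_SigmaI) auto
  also have "\<dots> = (\<Sum>l\<in>indep_lists M V k. card V - p ^ k)"
    using finV' by (intro sum.cong refl) (subst card_Diff_subset, auto simp: card_vanishing)
  finally show ?thesis by simp
qed

lemma card_indep_lists_le: "l \<in> indep_lists M V k \<Longrightarrow> p ^ k \<le> card V"
  using card_vanishing[of l k] card_mono[of V "{\<psi>\<in>V. \<forall>x\<in>list_kernel M l. \<psi> x = 0}"] finV by (simp add: V_def)

lemma card_indep_lists: "real (card (indep_lists M V k)) = (\<Prod>i<k. real (card V) - real p ^ i)"
proof (induction k)
  case (Suc k)
  show ?case
  \<comment> \<open>Without lists of length k the natural subtraction may differ from the real one,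
    but then both products vanish already.\<close>
  proof (cases "indep_lists M V k = {}")
    case True
    then have z: "(\<Prod>i<k. real (card V) - real p ^ i) = 0" using Suc by simp
    have "card (indep_lists M V (Suc k)) = 0" using card_indep_lists_Suc[of k] True by simp
    then show ?thesis unfolding prod.lessThan_Suc z by simp
  next
    case False
    then have "p ^ k \<le> card V" using card_indep_lists_le by blast
    then have "real (card V - p ^ k) = real (card V) - real p ^ k" by (simp add: of_nat_diff)
    then show ?thesis unfolding card_indep_lists_Suc prod.lessThan_Suc Suc[symmetric] by (simp only: of_nat_mult)
  qed
qed simp

text \<open>The product formula counts lists, so it is never negative. If |V| lay strictly between
  two consecutive powers of p, cutting the product after its first negative factor would make it
  negative.\<close>

lemma card_V_power: "\<exists>r. card V = p ^ r"
proof (rule ccontr)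
  assume no: "\<nexists>r. card V = p ^ r"
  have "card V < p ^ card V" by (rule power_gt_expt) (use prime_gt_1_nat[OF p] in simp)
  then have ex: "\<exists>i. card V < p ^ i" by blast
  define i where "i = (LEAST i. card V < p ^ i)"
  have i: "card V < p ^ i" unfolding i_def using LeastI_ex[OF ex] .
  have lt: "p ^ j < card V" if "j < i" for j
  proof -
    have "\<not> card V < p ^ j" using not_less_Least that unfolding i_def by blast
    then show ?thesis using no by (metis linorder_neqE_nat)
  qed
  have "0 < (\<Prod>j<i. real (card V) - real p ^ j)"
  proof (rule prod_pos)
    fix j assume "j \<in> {..<i}"
    then have "real (p ^ j) < real (card V)" using lt by (simp only: of_nat_less_iff lessThan_iff)
    then show "0 < real (card V) - real p ^ j" by simp
  qed
  moreover have "real (card V) - real p ^ i < 0" using i by (metis diff_less_0_iff_less of_nat_less_iff of_nat_power)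
  ultimately have "(\<Prod>j<Suc i. real (card V) - real p ^ j) < 0" by (simp add: mult_pos_neg)
  then show False using card_indep_lists[of "Suc i"] by (metis not_less of_nat_0_le_iff)
qed

text \<open>A homomorphism independent of the previous ones maps their common kernel onto \<int>/p,
  so each entry multiplies the index by p.\<close>

lemma idx_list_kernel:
  assumes "l \<in> indep_lists M V k"
  shows "list_kernel M l \<in> fisub M \<and> idx M (list_kernel M l) = p ^ k"
  using assms
proof (induction k arbitrary: l)
  case 0
  then show ?case using full_fisub[OF M] by (simp add: list_kernel_def)
next
  case (Suc k)
  then obtain \<phi> l' where l: "l = \<phi> # l'" "l' \<in> indep_lists M V k" "\<phi> \<in> V" "\<exists>x\<in>list_kernel M l'. \<phi> x \<noteq> 0" by auto
  have l': "set l' \<subseteq> V" using indep_lists_set[OF l(2)] by simp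
  obtain w where w: "w \<in> list_kernel M l'" "\<phi> w \<noteq> 0" using l(4) by blast
  obtain z where z: "z \<in> list_kernel M l'" "z \<in> M" "\<phi> z = 1" by (rule unit_value[OF l' l(3) w])
  let ?K = "list_kernel M l'" and ?L = "list_kernel M l"
  have K: "addsub ?K" by (rule addsub_kernel[OF l'])
  have L: "addsub ?L" by (rule addsub_kernel) (use l l' in auto)
  have sub: "?L \<subseteq> ?K" "?K \<subseteq> M" using l(1) by (auto simp: list_kernel_def)
  define R where "R = (\<lambda>j. smul (int j) z) ` {..<p}"
  have \<phi>z: "\<phi> (smul (int j) z) = int j mod int p" for j using V_smul[OF l(3) z(2)] z(3) by simp
  have R: "R \<subseteq> ?K" "\<And>x. x \<in> ?K \<Longrightarrow> \<exists>r\<in>R. x - r \<in> ?L" "\<And>r r'. r \<in> R \<Longrightarrow> r' \<in> R \<Longrightarrow> r - r' \<in> ?L \<Longrightarrow> r = r'"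
  proof -
    show "R \<subseteq> ?K" unfolding R_def using addsub_smul[OF K z(1)] by blast
    fix x assume x: "x \<in> ?K"
    then have xM: "x \<in> M" using sub by blast
    have rng: "0 \<le> \<phi> x" "\<phi> x < int p" using VD(2,3)[OF l(3) xM] by auto
    then have "smul (\<phi> x) z \<in> R" unfolding R_def by (intro image_eqI[of _ _ "nat (\<phi> x)"]) auto
    then show "\<exists>r\<in>R. x - r \<in> ?L" using residual[OF l(3) z l' x] l(1) by blast
  next
    fix r r' assume r: "r \<in> R" "r' \<in> R" "r - r' \<in> ?L"
    then obtain j j' where j: "j < p" "j' < p" "r = smul (int j) z" "r' = smul (int j') z" by (auto simp: R_def)
    have "\<phi> (r - r') = 0" using r(3) l(1) by (simp add: list_kernel_def)
    then have "(int j mod int p - int j' mod int p) mod int p = 0"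
      using V_diff[OF l(3) addsub_smul[OF M z(2)] addsub_smul[OF M z(2)]] j \<phi>z by simp
    then have "int p dvd int j - int j'" by (simp add: mod_simps dvd_eq_mod_eq_0)
    then have "int j mod int p = int j' mod int p" by (simp add: mod_eq_dvd_iff)
    then have "j = j'" using j by simp
    then show "r = r'" using j by simp
  qed
  have "inj_on (\<lambda>j. smul (int j) z) {..<p}"
  proof (rule inj_onI)
    fix j j' assume j: "j \<in> {..<p}" "j' \<in> {..<p}" "smul (int j) z = smul (int j') z"
    then have "int j mod int p = int j' mod int p" using \<phi>z by metis
    then show "j = j'" using j by simp
  qed
  then have "card R = p" "finite R" by (auto simp: R_def card_image)
  then have iK: "idx ?K ?L = p" "finite (coset_of ?L ` ?K)" using idx_transversal[OF L R] by auto
  have IH: "?K \<in> fisub M" "idx M ?K = p ^ k" using Suc.IH[OF l(2)] by auto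
  have "idx M ?L = p ^ Suc k" using idx_tower(2)[OF IH(1) L sub(1) M] IH(2) iK(1) by simp
  moreover have "finite (coset_of ?L ` M)" using idx_tower(1)[OF IH(1) L sub(1) M] iK(2) by simp
  ultimately show ?case using L sub by (auto simp: fisub_def)
qed

end

text \<open>A proper subgroup \<open>U\<close> lies in a maximal proper one, whose quotient is cyclic of prime order.\<close>
lemma exists_mod_p_hom:
  assumes M: "addsub M" and U: "U \<in> fisub M" and ne: "U \<noteq> M" and a: "a > 0" and aU: "\<And>x. x \<in> M \<Longrightarrow> smul (int a) x \<in> U"
  obtains p \<psi> where "Factorial_Ring.prime p" "p dvd a" "\<psi> \<in> killed_homs (Zn0 n) M p U" "\<exists>x\<in>M. \<psi> x \<noteq> 0"
proof -
  have U': "addsub U" "U \<subseteq> M" "finite (coset_of U ` M)" using U by (auto simp: fisub_def)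
  define \<J> where "\<J> = {J. addsub J \<and> U \<subseteq> J \<and> J \<subseteq> M \<and> J \<noteq> M}"
  \<comment> \<open>A subgroup between U and M is determined by the cosets of U in it. Finite index
    leaves finitely many such subgroups, so a maximal proper one exists.\<close>
  have inj: "inj_on (\<lambda>J. coset_of U ` J) \<J>"
  proof (rule inj_onI)
    fix J J' assume J: "J \<in> \<J>" "J' \<in> \<J>" "coset_of U ` J = coset_of U ` J'"
    have sub: "A \<subseteq> B" if AB: "A \<in> \<J>" "B \<in> \<J>" "coset_of U ` A \<subseteq> coset_of U ` B" for A B
    proof
      fix x assume "x \<in> A"
      then obtain y where y: "y \<in> B" "coset_of U x = coset_of U y" using AB(3) by blast
      then have "x - y \<in> B" using coset_of_eq_iff[OF U'(1)] AB(2) by (auto simp: \<J>_def)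
      moreover have "addsub B" using AB(2) by (simp add: \<J>_def)
      ultimately have "(x - y) + y \<in> B" using y(1) addsub_add by blast
      then show "x \<in> B" by simp
    qed
    show "J = J'" using sub[OF J(1,2)] sub[OF J(2,1)] J(3) by blast
  qed
  have "(\<lambda>J. coset_of U ` J) ` \<J> \<subseteq> Pow (coset_of U ` M)" by (auto simp: \<J>_def)
  then have "finite ((\<lambda>J. coset_of U ` J) ` \<J>)" using U'(3) finite_subset by (metis finite_Pow_iff)
  then have finJ: "finite \<J>" using finite_imageD[OF _ inj] by blast
  have "U \<in> \<J>" using U' ne by (auto simp: \<J>_def)
  then obtain J where J: "J \<in> \<J>" and Jmax: "\<And>J'. J' \<in> \<J> \<Longrightarrow> J \<subseteq> J' \<Longrightarrow> J' = J"
    using finite_has_maximal[OF finJ] by blast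
  have Ja: "addsub J" "U \<subseteq> J" "J \<subseteq> M" "J \<noteq> M" using J by (auto simp: \<J>_def)
  obtain z where z: "z \<in> M" "z \<notin> J" using Ja by blast
  \<comment> \<open>By maximality, J and any vector of M outside it span M.\<close>
  have span: "\<exists>k. x - smul k w \<in> J" if w: "w \<in> M" "w \<notin> J" and x: "x \<in> M" for w x
  proof -
    let ?J = "{x\<in>M. \<exists>k. x - smul k w \<in> J}"
    have JJ: "J \<subseteq> ?J"
    proof
      fix y assume y: "y \<in> J"
      then have "y - smul 0 w \<in> J" by (simp add: smul_simps)
      then show "y \<in> ?J" using y Ja(3) by blast
    qed
    have "addsub ?J"
      unfolding addsub_def
    proof (intro conjI ballI)
      show "0 \<in> ?J" using JJ addsub_0[OF Ja(1)] by blast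
      fix x y assume xy: "x \<in> ?J" "y \<in> ?J"
      then obtain k l where kl: "x - smul k w \<in> J" "y - smul l w \<in> J" by blast
      have "(x - smul k w) - (y - smul l w) \<in> J" by (rule addsub_diff[OF Ja(1) kl])
      then have "(x - y) - smul (k - l) w \<in> J" by (simp add: smul_simps algebra_simps)
      then show "x - y \<in> ?J" using xy addsub_diff[OF M] by blast
    qed
    moreover have "w \<in> ?J"
    proof -
      have "w - smul 1 w \<in> J" using addsub_0[OF Ja(1)] by (simp add: smul_simps)
      then show ?thesis using w by blast
    qed
    ultimately have "?J = M"
    proof -
      assume as: "addsub ?J" "w \<in> ?J"
      show ?thesis
      proof (rule ccontr)
        assume "?J \<noteq> M"
        then have "?J \<in> \<J>" using as(1) JJ Ja(2) by (auto simp: \<J>_def)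
        then have "?J = J" using Jmax JJ by blast
        then show False using as(2) w(2) by blast
      qed
    qed
    then show ?thesis using x by blast
  qed
  define T where "T = {k. smul k z \<in> J}"
  have T0: "0 \<in> T" using addsub_0[OF Ja(1)] by (simp add: T_def smul_simps)
  have Td: "x - y \<in> T" if "x \<in> T" "y \<in> T" for x y
    using that addsub_diff[OF Ja(1)] by (simp add: T_def smul_simps)
  have aT: "int a \<in> T" using aU[OF z(1)] Ja(2) by (auto simp: T_def)
  have "T \<noteq> {0}" using aT a by auto
  then obtain d where d: "d \<ge> 1" "T = {k. int d dvd k}" using int_subgroup_generator[OF T0 Td] by metis
  have zJ: "smul k z \<in> J \<longleftrightarrow> int d dvd k" for k using d(2) by (auto simp: T_def)
  have "d \<noteq> 1" using zJ[of 1] z(2) by (auto simp: smul_simps)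
  then obtain p where p: "Factorial_Ring.prime p" "p dvd d" using prime_factor_nat by blast
  \<comment> \<open>If d were a larger multiple of p, then p z would lie outside J, so z would agree
    with k p z modulo J for some k; hence d, and with it p, would divide 1 - k p.\<close>
  have dp: "d = p"
  proof (rule ccontr)
    assume "d \<noteq> p"
    have "\<not> int d dvd int p" using p \<open>d \<noteq> p\<close> by (auto dest: dvd_antisym)
    then have "smul (int p) z \<notin> J" using zJ by simp
    moreover have "smul (int p) z \<in> M" using addsub_smul[OF M z(1)] .
    ultimately obtain k where "z - smul k (smul (int p) z) \<in> J" using span[of "smul (int p) z" z] z by blast
    then have "smul (1 - k * int p) z \<in> J" by (simp add: smul_simps)
    then have "int d dvd 1 - k * int p" using zJ by simp
    then have "int p dvd 1 - k * int p" using p(2) by (meson dvd_trans int_dvd_int_iff)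
    then have "int p dvd (1 - k * int p) + k * int p" by (rule dvd_add) simp
    then have "int p dvd 1" by simp
    then show False using p(1) not_prime_unit by force
  qed
  have pa: "p dvd a" using aT d(2) dp by simp
  have p1: "p > 1" using p(1) prime_gt_1_nat by blast
  have dig: "\<exists>k. 0 \<le> k \<and> k < int p \<and> x - smul k z \<in> J" if x: "x \<in> M" for x
  proof -
    obtain k where k: "x - smul k z \<in> J" using span[OF z x] by blast
    have "smul (int p * (k div int p)) z \<in> J" using zJ dp by simp
    then have "(x - smul k z) + smul (int p * (k div int p)) z \<in> J" using k addsub_add[OF Ja(1)] by blast
    moreover have "(x - smul k z) + smul (int p * (k div int p)) z = x - smul (k mod int p) z"
    proof -
      have "smul k z = smul (int p * (k div int p)) z + smul (k mod int p) z"
        unfolding smul_simps(1)[symmetric] by simp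
      then show ?thesis by simp
    qed
    ultimately show ?thesis using p1 by (intro exI[of _ "k mod int p"]) auto
  qed
  define \<psi> where "\<psi> = (\<lambda>x\<in>M. SOME k. 0 \<le> k \<and> k < int p \<and> x - smul k z \<in> J)"
  have \<psi>: "0 \<le> \<psi> x" "\<psi> x < int p" "x - smul (\<psi> x) z \<in> J" if "x \<in> M" for x
    using someI_ex[OF dig[OF that]] that by (auto simp: \<psi>_def)
  have uniq: "\<psi> x = k mod int p" if x: "x \<in> M" and k: "x - smul k z \<in> J" for x k
  proof -
    have "(x - smul (\<psi> x) z) - (x - smul k z) \<in> J" using addsub_diff[OF Ja(1) \<psi>(3)[OF x] k] .
    then have "smul (k - \<psi> x) z \<in> J" by (simp add: smul_simps)
    then have "int p dvd k - \<psi> x" using zJ dp by simp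
    then have "k mod int p = \<psi> x mod int p" by (simp add: mod_eq_dvd_iff)
    then show ?thesis using \<psi>(1,2)[OF x] by simp
  qed
  have "\<psi> \<in> killed_homs (Zn0 n) M p U"
    unfolding killed_homs_def
  proof (clarify, intro conjI ballI)
    have "\<psi> (x + y) = (\<psi> x + \<psi> y) mod int p" if xy: "x \<in> M" "y \<in> M" for x y
    proof (rule uniq)
      show "x + y \<in> M" using addsub_add[OF M xy] .
      have "(x - smul (\<psi> x) z) + (y - smul (\<psi> y) z) \<in> J" using addsub_add[OF Ja(1)] \<psi>(3) xy by blast
      then show "x + y - smul (\<psi> x + \<psi> y) z \<in> J" by (simp add: smul_simps algebra_simps)
    qed
    then show "\<psi> \<in> sub_homs (Zn0 n) M p"
      using \<psi> p1 by (subst sub_homs_Zn0_iff) (auto simp: \<psi>_def)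
    fix u assume u: "u \<in> U"
    then have "u - smul 0 z \<in> J" using Ja(2) by (auto simp: smul_simps)
    then show "\<psi> u = 0" using uniq[of u 0] u U'(2) by auto
  qed
  moreover have "\<psi> z = 1"
  proof -
    have "z - smul 1 z \<in> J" using addsub_0[OF Ja(1)] by (simp add: smul_simps)
    then show ?thesis using uniq[OF z(1), of 1] p1 by simp
  qed
  ultimately show thesis using that[OF p(1) pa] z(1) by (metis zero_neq_one)
qed

section \<open>Counting tuples of homomorphisms in two ways\<close>

lemma finite_quot_subs:
  assumes "comm_group F" "group K" "finite (Homs F K)"
  shows "finite (quot_subs F K)"
proof -
  have "Surs F K \<subseteq> Homs F K" by (auto simp: Surs_def)
  then show ?thesis using quot_subs_eq[OF assms(1,2)] assms(3) finite_subset by (metis finite_imageI)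
qed

text \<open>Grouped by M: the tuples whose joint kernel contains U are chosen coordinatewise among
  the homomorphisms killing U, so monomials in the hom counts are cardinalities.\<close>

lemma card_hom_pairs_killed:
  assumes fq: "finite (quot_subs F G)" and fs: "\<And>M p. M \<in> quot_subs F G \<Longrightarrow> p > 0 \<Longrightarrow> finite (sub_homs F M p)"
    and q: "\<forall>p\<in>set q. p > 0"
  shows "card {(M, \<Psi>) \<in> hom_pairs F G q. U \<subseteq> joint_kernel M q \<Psi>} =
    (\<Sum>M\<in>{M \<in> quot_subs F G. U \<subseteq> M}. \<Prod>i<length q. card (killed_homs F M (q ! i) U))"
    "finite (hom_pairs F G q)"
proof -
  have qi: "q ! i > 0" if "i < length q" for i using q that by simp
  have fk: "finite (killed_homs F M (q ! i) U)" if "M \<in> quot_subs F G" "i < length q" for M i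
    using fs[OF that(1) qi[OF that(2)]] by (simp add: killed_homs_def)
  show "finite (hom_pairs F G q)"
    unfolding hom_pairs_def
  proof (rule finite_SigmaI[OF fq], rule finite_PiE)
    fix M i assume "M \<in> quot_subs F G" "i \<in> {..<length q}"
    then show "finite (sub_homs F M (q ! i))" using fs qi by simp
  qed simp
  have "{(M, \<Psi>) \<in> hom_pairs F G q. U \<subseteq> joint_kernel M q \<Psi>} =
      Sigma {M \<in> quot_subs F G. U \<subseteq> M} (\<lambda>M. PiE {..<length q} (\<lambda>i. killed_homs F M (q ! i) U))"
    by (auto simp: hom_pairs_def joint_kernel_def killed_homs_def PiE_iff subset_iff extensional_def)
  also have "card \<dots> = (\<Sum>M\<in>{M \<in> quot_subs F G. U \<subseteq> M}. card (PiE {..<length q} (\<lambda>i. killed_homs F M (q ! i) U)))"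
  proof (rule card_SigmaI)
    show "finite {M \<in> quot_subs F G. U \<subseteq> M}" using fq by simp
    show "\<forall>M\<in>{M \<in> quot_subs F G. U \<subseteq> M}. finite (PiE {..<length q} (\<lambda>i. killed_homs F M (q ! i) U))"
      by (intro ballI finite_PiE) (simp_all add: fk)
  qed
  also have "\<dots> = (\<Sum>M\<in>{M \<in> quot_subs F G. U \<subseteq> M}. \<Prod>i<length q. card (killed_homs F M (q ! i) U))"
    by (intro sum.cong refl) (simp add: card_PiE)
  finally show "card {(M, \<Psi>) \<in> hom_pairs F G q. U \<subseteq> joint_kernel M q \<Psi>} =
    (\<Sum>M\<in>{M \<in> quot_subs F G. U \<subseteq> M}. \<Prod>i<length q. card (killed_homs F M (q ! i) U))" .
qed

definition pair_order_bound :: "('b, 'd) monoid_scheme \<Rightarrow> nat list \<Rightarrow> nat" where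
  "pair_order_bound G q = card (carrier G) * (\<Prod>i<length q. q ! i)"

text \<open>The number of pairs over one joint kernel whose quotient lies in the class
  \<open>C\<close>. It involves neither the lattice nor its rank, so moments at every n are combined
  with the same coefficients.\<close>

definition pair_weight :: "('b, 'd) monoid_scheme \<Rightarrow> nat list \<Rightarrow> nat monoid set \<Rightarrow> nat" where
  "pair_weight G q C = card (hom_pairs_at (class_rep C) G q {\<one>\<^bsub>class_rep C\<^esub>})"

text \<open>Grouped by joint kernel: each joint kernel containing U carries
  \<open>pair_weight\<close> many pairs, according to its quotient. Since the order of that quotient
  is at most \<open>pair_order_bound G q\<close>, finitely many classes occur.\<close>

lemma card_hom_pairs_by_class:
  assumes F: "comm_group F" and G: "group G" "finite (carrier G)" and q: "\<forall>p\<in>set q. p > 0"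
    and fp: "finite (hom_pairs F G q)" and fH: "\<And>K::nat monoid. K \<in> fin_ab_groups \<Longrightarrow> finite (Homs F K)"
  shows "card {(M, \<Psi>) \<in> hom_pairs F G q. U \<subseteq> joint_kernel M q \<Psi>} =
    (\<Sum>C\<in>small_classes (pair_order_bound G q). pair_weight G q C * card {M \<in> quot_subs F (class_rep C). U \<subseteq> M})"
proof -
  interpret F: comm_group F by (rule F)
  let ?S = "small_classes (pair_order_bound G q)"
  let ?jk = "\<lambda>(M, \<Psi>). joint_kernel M q \<Psi>"
  let ?A = "{z \<in> hom_pairs F G q. U \<subseteq> ?jk z}"
  let ?Q = "\<lambda>C. {M \<in> quot_subs F (class_rep C). U \<subseteq> M}"
  have cls: "C \<in> fin_ab_iso_classes" if "C \<in> ?S" for C using that by (simp add: small_classes_def)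
  have finQ: "finite (?Q C)" if "C \<in> ?S" for C
    using finite_quot_subs[OF F fin_ab_groupsD(2) fH] class_rep(2)[OF cls[OF that]] by simp
  have into: "?jk z \<in> (\<Union>C\<in>?S. ?Q C)" if z: "z \<in> ?A" for z
  proof -
    obtain M \<Psi> where zz: "z = (M, \<Psi>)" by (cases z)
    have m: "M \<in> quot_subs F G" "\<Psi> \<in> PiE {..<length q} (\<lambda>i. sub_homs F M (q ! i))" "U \<subseteq> joint_kernel M q \<Psi>"
      using z zz by (auto simp: hom_pairs_def)
    let ?J = "joint_kernel M q \<Psi>"
    have Ms: "subgroup M F" using m(1) by (simp add: quot_subs_def)
    have Js: "subgroup ?J F" by (rule F.subgroup_joint_kernel[OF Ms q m(2)])
    note cb = F.card_Mod_joint_kernel[OF m(1) G(2) q m(2)]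
    have ab: "comm_group (F Mod ?J)" using F.abelian_FactGroup[OF Js] .
    obtain C where C: "C \<in> fin_ab_iso_classes" "F Mod ?J \<cong> class_rep C" using class_exists[OF ab cb(1)] by blast
    have "card (carrier (class_rep C)) = card (carrier (F Mod ?J))" using iso_same_card[OF C(2)] by simp
    then have "C \<in> ?S" using cb(2) C(1) by (simp add: small_classes_def pair_order_bound_def)
    moreover have "?J \<in> ?Q C" using Js C(2) m(3) by (simp add: quot_subs_def)
    ultimately show ?thesis using zz by auto
  qed
  have disj: "?Q C \<inter> ?Q D = {}" if "C \<in> ?S" "D \<in> ?S" "C \<noteq> D" for C D
  proof (rule ccontr)
    assume "?Q C \<inter> ?Q D \<noteq> {}"
    then obtain M where M: "subgroup M F" "F Mod M \<cong> class_rep C" "F Mod M \<cong> class_rep D" by (auto simp: quot_subs_def)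
    have "group (F Mod M)" using F.abelian_FactGroup[OF M(1)] comm_group.axioms(2) by blast
    then have "C = D" using class_unique cls that(1,2) M(2,3) by metis
    then show False using that(3) by simp
  qed
  have fib: "card {z \<in> ?A. ?jk z = M'} = pair_weight G q C" if C: "C \<in> ?S" and M': "M' \<in> ?Q C" for C M'
  proof -
    have cr: "comm_group (class_rep C)" "group (class_rep C)" using fin_ab_groupsD class_rep(2)[OF cls[OF C]] by auto
    obtain \<pi> where \<pi>: "\<pi> \<in> Surs F (class_rep C)" "kernel F (class_rep C) \<pi> = M'"
      using quot_subs_Surs[OF F cr(2)] M' by blast
    have "{z \<in> ?A. ?jk z = M'} = hom_pairs_at F G q M'" using M' by (auto simp: hom_pairs_at_def)
    moreover obtain R where "bij_betw R (hom_pairs_at (class_rep C) G q {\<one>\<^bsub>class_rep C\<^esub>}) (hom_pairs_at F G q M')"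
      using bij_hom_pairs_at[OF F cr(1) G(1) \<pi>(1) q] \<pi>(2) by blast
    then have "card (hom_pairs_at F G q M') = pair_weight G q C"
      unfolding pair_weight_def by (rule bij_betw_same_card[symmetric])
    ultimately show ?thesis by simp
  qed
  have finA: "finite ?A" using fp by simp
  have finU: "finite (\<Union>C\<in>?S. ?Q C)" using finite_small_classes finQ by (intro finite_UN_I) auto
  have "card ?A = (\<Sum>z\<in>?A. 1)" by simp
  also have "\<dots> = (\<Sum>M'\<in>(\<Union>C\<in>?S. ?Q C). \<Sum>z\<in>{z \<in> ?A. ?jk z = M'}. 1)"
    by (rule sum.group[OF finA finU, symmetric]) (rule image_subsetI, rule into)
  also have "\<dots> = (\<Sum>C\<in>?S. \<Sum>M'\<in>?Q C. \<Sum>z\<in>{z \<in> ?A. ?jk z = M'}. 1)"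
    by (rule sum.UNION_disjoint[OF finite_small_classes]) (use finQ disj in blast)+
  also have "\<dots> = (\<Sum>C\<in>?S. \<Sum>M'\<in>?Q C. pair_weight G q C)"
  proof (intro sum.cong refl)
    fix C M' assume "C \<in> ?S" "M' \<in> ?Q C"
    then show "(\<Sum>z\<in>{z \<in> ?A. ?jk z = M'}. 1) = pair_weight G q C" using fib by simp
  qed
  also have "\<dots> = (\<Sum>C\<in>?S. pair_weight G q C * card (?Q C))" by (simp add: mult.commute)
  finally show ?thesis by (simp add: case_prod_unfold)
qed

section \<open>Polynomials in the numbers of homomorphisms\<close>

definition poly_eval :: "(real \<times> nat list) list \<Rightarrow> (nat \<Rightarrow> real) \<Rightarrow> real" where
  "poly_eval R x = (\<Sum>(c, q)\<leftarrow>R. c * (\<Prod>i<length q. x (q ! i)))"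

text \<open>A monomial is a coefficient with a list of variable indices, repetitions giving powers.
  The indices are moduli, and positivity makes the cyclic groups of the counting lemmas
  finite.\<close>

definition poly_vars_pos :: "(real \<times> nat list) list \<Rightarrow> bool" where
  "poly_vars_pos R \<longleftrightarrow> (\<forall>(c, q)\<in>set R. \<forall>p\<in>set q. p > 0)"

definition is_poly :: "((nat \<Rightarrow> real) \<Rightarrow> real) \<Rightarrow> bool" where
  "is_poly h \<longleftrightarrow> (\<exists>R. poly_vars_pos R \<and> h = poly_eval R)"

lemma is_poly_const: "is_poly (\<lambda>x. c)"
  unfolding is_poly_def by (rule exI[of _ "[(c, [])]"]) (auto simp: poly_eval_def poly_vars_pos_def)

lemma is_poly_var: "p > 0 \<Longrightarrow> is_poly (\<lambda>x. x p)"
  unfolding is_poly_def by (rule exI[of _ "[(1, [p])]"]) (auto simp: poly_eval_def poly_vars_pos_def)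

lemma is_poly_add: "is_poly f \<Longrightarrow> is_poly g \<Longrightarrow> is_poly (\<lambda>x. f x + g x)"
  unfolding is_poly_def
proof (elim exE conjE)
  fix R S assume "poly_vars_pos R" "f = poly_eval R" "poly_vars_pos S" "g = poly_eval S"
  then show "\<exists>T. poly_vars_pos T \<and> (\<lambda>x. f x + g x) = poly_eval T"
    by (intro exI[of _ "R @ S"]) (auto simp: poly_eval_def poly_vars_pos_def fun_eq_iff)
qed

lemma prod_nth_append:
  "(\<Prod>i<length (q @ r). (x :: nat \<Rightarrow> real) ((q @ r) ! i)) = (\<Prod>i<length q. x (q ! i)) * (\<Prod>i<length r. x (r ! i))"
proof -
  have e: "(\<Prod>i<length q. x (q ! i)) = prod_list (map x q)" for q
    by (simp add: prod.list_conv_set_nth atLeast0LessThan)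
  show ?thesis unfolding e by simp
qed

lemma is_poly_mult: "is_poly f \<Longrightarrow> is_poly g \<Longrightarrow> is_poly (\<lambda>x. f x * g x)"
  unfolding is_poly_def
proof (elim exE conjE)
  fix R S assume R: "poly_vars_pos R" "f = poly_eval R" and S: "poly_vars_pos S" "g = poly_eval S"
  let ?m = "\<lambda>(c, q). map (\<lambda>(d, r). (c * d, q @ r)) S"
  have one: "poly_eval (?m (c, q)) x = c * (\<Prod>i<length q. x (q ! i)) * poly_eval S x" for c q x
    unfolding poly_eval_def by (induction S) (auto simp: prod_nth_append algebra_simps simp del: length_append)
  have "poly_eval (concat (map ?m R)) x = poly_eval R x * poly_eval S x" for x
  proof (induction R)
    case (Cons a R)
    obtain c q where a: "a = (c, q)" by (cases a)
    have "poly_eval (concat (map ?m (a # R))) x = poly_eval (?m (c, q)) x + poly_eval (concat (map ?m R)) x"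
      unfolding poly_eval_def a by simp
    also have "\<dots> = c * (\<Prod>i<length q. x (q ! i)) * poly_eval S x + poly_eval R x * poly_eval S x"
      unfolding one Cons by simp
    also have "\<dots> = poly_eval (a # R) x * poly_eval S x" unfolding poly_eval_def a by (simp add: algebra_simps)
    finally show ?case .
  qed (simp add: poly_eval_def)
  moreover have "poly_vars_pos (concat (map ?m R))" using R(1) S(1) by (fastforce simp: poly_vars_pos_def)
  ultimately show "\<exists>T. poly_vars_pos T \<and> (\<lambda>x. f x * g x) = poly_eval T"
    using R(2) S(2) by (intro exI[of _ "concat (map ?m R)"]) (auto simp: fun_eq_iff)
qed

lemma is_poly_prod: "finite I \<Longrightarrow> (\<And>i. i \<in> I \<Longrightarrow> is_poly (f i)) \<Longrightarrow> is_poly (\<lambda>x. \<Prod>i\<in>I. f i x)"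
  by (induction I rule: finite_induct) (auto intro: is_poly_const is_poly_mult)

text \<open>Subgroups are counted in place of surjections, which divides the usual surjection moment
  by |Aut K|.\<close>

definition subgroup_moment :: "nat \<Rightarrow> 'w pmf \<Rightarrow> ('w \<Rightarrow> (nat \<Rightarrow> int) set) \<Rightarrow> nat monoid \<Rightarrow> real" where
  "subgroup_moment n P U K = (\<Sum>M\<in>quot_subs (Zn0 n) K. measure_pmf.prob P {w. U w \<subseteq> M})"

definition hom_count :: "nat \<Rightarrow> (nat \<Rightarrow> int) set \<Rightarrow> (nat \<Rightarrow> int) set \<Rightarrow> nat \<Rightarrow> real" where
  "hom_count n M U p = real (card (killed_homs (Zn0 n) M p U))"

definition quot_sum :: "nat \<Rightarrow> ('g, 'c) monoid_scheme \<Rightarrow> ((nat \<Rightarrow> real) \<Rightarrow> real) \<Rightarrow> (nat \<Rightarrow> int) set \<Rightarrow> real" where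
  "quot_sum n G h U = (\<Sum>M\<in>{M \<in> quot_subs (Zn0 n) G. U \<subseteq> M}. h (hom_count n M U))"

text \<open>The linear functional that gives the mean of \<open>quot_sum\<close> of a polynomial
  from the moments \<open>m\<close>. Its coefficients are common to all n, to both random models and
  to the limit, so convergence of moments passes through it termwise.\<close>

definition poly_limit :: "('g, 'c) monoid_scheme \<Rightarrow> (nat monoid \<Rightarrow> real) \<Rightarrow> (real \<times> nat list) list \<Rightarrow> real" where
  "poly_limit G m R = (\<Sum>(c, q)\<leftarrow>R. c * (\<Sum>C\<in>small_classes (pair_order_bound G q). real (pair_weight G q C) * m (class_rep C)))"

text \<open>A finite-index subgroup of the lattice has n - 1 generators, and a homomorphism is
  determined by its values on them.\<close>

lemma finite_sub_homs:
  assumes n: "n \<ge> 1" and M: "M \<in> fisub (zero_sum_vecs n)" and p: "p > 0"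
  shows "finite (sub_homs (Zn0 n) M p)" "card (sub_homs (Zn0 n) M p) \<le> p ^ (n - 1)"
proof -
  have fr: "free_rank (n - 1) M"
    using free_rank_fisub[OF free_rank_zero_sum_vecs[of "n - 1"]] M n by simp
  have Ma: "addsub M" using M by (simp add: fisub_def)
  obtain g :: "nat \<Rightarrow> nat \<Rightarrow> int" where g: "\<And>i. i < n - 1 \<Longrightarrow> g i \<in> M"
    and gen: "\<And>S. addsub S \<Longrightarrow> (\<And>i. i < n - 1 \<Longrightarrow> g i \<in> S) \<Longrightarrow> M \<subseteq> S"
  proof (rule free_rank_generators[OF fr], goal_cases)
    case (1 g)
    show ?case by (rule 1(1)[OF 1(2)]) (fact 1(3) | assumption)+
  qed
  let ?f = "\<lambda>\<psi>. \<lambda>i\<in>{..<n - 1}. (\<psi> (g i) :: int)"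
  have D: "\<psi> \<in> extensional M" "\<And>x. x \<in> M \<Longrightarrow> 0 \<le> \<psi> x \<and> \<psi> x < int p"
      "\<And>x y. x \<in> M \<Longrightarrow> y \<in> M \<Longrightarrow> \<psi> (x + y) = (\<psi> x + \<psi> y) mod int p" if "\<psi> \<in> sub_homs (Zn0 n) M p" for \<psi>
    using that by (auto simp: sub_homs_Zn0_iff[OF p])
  have diff: "\<psi> (x - y) = (\<psi> x - \<psi> y) mod int p" if \<psi>: "\<psi> \<in> sub_homs (Zn0 n) M p" and x: "x \<in> M" "y \<in> M" for \<psi> x y
  proof -
    have d: "x - y \<in> M" using addsub_diff[OF Ma x] .
    have "\<psi> ((x - y) + y) = (\<psi> (x - y) + \<psi> y) mod int p" using D(3)[OF \<psi> d x(2)] .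
    then have "\<psi> x = (\<psi> (x - y) + \<psi> y) mod int p" by simp
    then have "(\<psi> x - \<psi> y) mod int p = \<psi> (x - y) mod int p" by (simp add: mod_simps)
    then show ?thesis using D(2)[OF \<psi> d] by simp
  qed
  have zero: "\<psi> 0 = 0" if \<psi>: "\<psi> \<in> sub_homs (Zn0 n) M p" for \<psi>
    using diff[OF \<psi> addsub_0[OF Ma] addsub_0[OF Ma]] by simp
  have inj: "inj_on ?f (sub_homs (Zn0 n) M p)"
  proof (rule inj_onI)
    fix \<psi> \<eta> assume \<psi>: "\<psi> \<in> sub_homs (Zn0 n) M p" and \<eta>: "\<eta> \<in> sub_homs (Zn0 n) M p" and e: "?f \<psi> = ?f \<eta>"
    let ?S = "{x\<in>M. \<psi> x = \<eta> x}"
    have "addsub ?S"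
      unfolding addsub_def
    proof (intro conjI ballI)
      show "0 \<in> ?S" using addsub_0[OF Ma] zero[OF \<psi>] zero[OF \<eta>] by simp
      fix x y assume "x \<in> ?S" "y \<in> ?S"
      then show "x - y \<in> ?S" using diff[OF \<psi>, of x y] diff[OF \<eta>, of x y] addsub_diff[OF Ma] by simp
    qed
    moreover have "g i \<in> ?S" if "i < n - 1" for i using fun_cong[OF e, of i] g[OF that] that by simp
    ultimately have "M \<subseteq> ?S" by (rule gen)
    then show "\<psi> = \<eta>" by (intro extensionalityI[OF D(1)[OF \<psi>] D(1)[OF \<eta>]]) blast
  qed
  let ?T = "PiE {..<n - 1} (\<lambda>_. {0..<int p})"
  have into: "?f ` sub_homs (Zn0 n) M p \<subseteq> ?T"
  proof (rule image_subsetI)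
    fix \<psi> assume "\<psi> \<in> sub_homs (Zn0 n) M p"
    then show "?f \<psi> \<in> ?T" using D(2) g by auto
  qed
  have finT: "finite ?T" by (intro finite_PiE) auto
  show "finite (sub_homs (Zn0 n) M p)" using finite_imageD[OF finite_subset[OF into finT] inj] .
  have "card (sub_homs (Zn0 n) M p) \<le> card ?T" by (rule card_inj_on_le[OF inj into finT])
  also have "card ?T = p ^ (n - 1)" by (simp add: card_PiE)
  finally show "card (sub_homs (Zn0 n) M p) \<le> p ^ (n - 1)" .
qed

lemma quot_subs_fisub:
  assumes "M \<in> quot_subs (Zn0 n) G" "finite (carrier G)"
  shows "M \<in> fisub (zero_sum_vecs n)" "idx (zero_sum_vecs n) M = card (carrier G)"
proof -
  have M: "subgroup M (Zn0 n)" "Zn0 n Mod M \<cong> G" using assms(1) by (auto simp: quot_subs_def)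
  have "finite (carrier (Zn0 n Mod M))" using iso_finite[OF M(2)] assms(2) by simp
  then show "M \<in> fisub (zero_sum_vecs n)" using M(1) by (simp add: fisub_Zn0_iff)
  show "idx (zero_sum_vecs n) M = card (carrier G)" using iso_same_card[OF M(2)] by (simp add: card_Zn0_Mod)
qed

lemma quot_sum_poly:
  assumes n: "n \<ge> 1" and G: "comm_group G" "finite (carrier G)" and R: "poly_vars_pos R"
  shows "quot_sum n G (poly_eval R) U = (\<Sum>(c, q)\<leftarrow>R. c * (\<Sum>C\<in>small_classes (pair_order_bound G q).
     real (pair_weight G q C) * real (card {M \<in> quot_subs (Zn0 n) (class_rep C). U \<subseteq> M})))"
proof -
  have Gg: "group G" using G(1) comm_group.axioms(2) by blast
  note Z = comm_group_Zn0[of n]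
  have fq: "finite (quot_subs (Zn0 n) G)" using finite_quot_subs[OF Z Gg] comm_group.card_Homs_Zn0(1)[OF G(1) n G(2)] by blast
  have fs: "finite (sub_homs (Zn0 n) M p)" if "M \<in> quot_subs (Zn0 n) G" "p > 0" for M p
    using finite_sub_homs(1)[OF n quot_subs_fisub(1)[OF that(1) G(2)] that(2)] .
  have mono: "(\<Sum>M\<in>{M \<in> quot_subs (Zn0 n) G. U \<subseteq> M}. \<Prod>i<length q. hom_count n M U (q ! i)) =
      (\<Sum>C\<in>small_classes (pair_order_bound G q). real (pair_weight G q C) * real (card {M \<in> quot_subs (Zn0 n) (class_rep C). U \<subseteq> M}))"
    if q: "\<forall>p\<in>set q. p > 0" for q
  proof -
    have a1: "card {(M, \<Psi>) \<in> hom_pairs (Zn0 n) G q. U \<subseteq> joint_kernel M q \<Psi>} =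
      (\<Sum>M\<in>{M \<in> quot_subs (Zn0 n) G. U \<subseteq> M}. \<Prod>i<length q. card (killed_homs (Zn0 n) M (q ! i) U))"
      by (rule card_hom_pairs_killed(1)[OF fq _ q]) (rule fs)
    have a2: "finite (hom_pairs (Zn0 n) G q)" by (rule card_hom_pairs_killed(2)[OF fq _ q]) (rule fs)
    have "(\<Sum>M\<in>{M \<in> quot_subs (Zn0 n) G. U \<subseteq> M}. \<Prod>i<length q. card (killed_homs (Zn0 n) M (q ! i) U)) =
      (\<Sum>C\<in>small_classes (pair_order_bound G q). pair_weight G q C * card {M \<in> quot_subs (Zn0 n) (class_rep C). U \<subseteq> M})"
      unfolding a1[symmetric]
      by (rule card_hom_pairs_by_class[OF Z Gg G(2) q a2])
         (use comm_group.card_Homs_Zn0(1)[OF fin_ab_groupsD(1) n fin_ab_groupsD(3)] in blast)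
    then have "real (\<Sum>M\<in>{M \<in> quot_subs (Zn0 n) G. U \<subseteq> M}. \<Prod>i<length q. card (killed_homs (Zn0 n) M (q ! i) U)) =
      real (\<Sum>C\<in>small_classes (pair_order_bound G q). pair_weight G q C * card {M \<in> quot_subs (Zn0 n) (class_rep C). U \<subseteq> M})" by simp
    then show ?thesis unfolding hom_count_def by simp
  qed
  have "quot_sum n G (poly_eval R) U = (\<Sum>(c, q)\<leftarrow>R. c * (\<Sum>M\<in>{M \<in> quot_subs (Zn0 n) G. U \<subseteq> M}. \<Prod>i<length q. hom_count n M U (q ! i)))"
    unfolding quot_sum_def poly_eval_def
    by (induction R) (auto simp: sum.distrib sum_distrib_left)
  also have "\<dots> = (\<Sum>(c, q)\<leftarrow>R. c * (\<Sum>C\<in>small_classes (pair_order_bound G q).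
     real (pair_weight G q C) * real (card {M \<in> quot_subs (Zn0 n) (class_rep C). U \<subseteq> M})))"
    using R mono by (intro arg_cong[of _ _ sum_list] map_cong refl) (auto simp: poly_vars_pos_def)
  finally show ?thesis .
qed

text \<open>The double count rewrites the polynomial as a finite combination of numbers of subgroups
  M \<supseteq> U with prescribed quotient, and the means of these numbers are the moments.\<close>

lemma expectation_quot_sum:
  fixes P :: "'w pmf" and U :: "'w \<Rightarrow> (nat \<Rightarrow> int) set"
  assumes n: "n \<ge> 1" and G: "comm_group G" "finite (carrier G)" and R: "poly_vars_pos R"
  shows "integrable (measure_pmf P) (\<lambda>w. quot_sum n G (poly_eval R) (U w))"
    "measure_pmf.expectation P (\<lambda>w. quot_sum n G (poly_eval R) (U w)) = poly_limit G (subgroup_moment n P U) R"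
proof -
  have cnt: "integrable (measure_pmf P) (\<lambda>w. real (card {M \<in> quot_subs (Zn0 n) K. U w \<subseteq> M}))"
    "measure_pmf.expectation P (\<lambda>w. real (card {M \<in> quot_subs (Zn0 n) K. U w \<subseteq> M})) = subgroup_moment n P U K"
    if K: "K \<in> fin_ab_groups" for K
  proof -
    have fin: "finite (quot_subs (Zn0 n) K)"
      using finite_quot_subs[OF comm_group_Zn0 fin_ab_groupsD(2)[OF K] comm_group.card_Homs_Zn0(1)[OF fin_ab_groupsD(1)[OF K] n fin_ab_groupsD(3)[OF K]]] .
    have e: "real (card {M \<in> quot_subs (Zn0 n) K. U w \<subseteq> M}) = (\<Sum>M\<in>quot_subs (Zn0 n) K. indicator {w. U w \<subseteq> M} w)" for w
      using fin by (simp add: indicator_def sum.If_cases Int_def)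
    show "integrable (measure_pmf P) (\<lambda>w. real (card {M \<in> quot_subs (Zn0 n) K. U w \<subseteq> M}))"
      unfolding e by (intro Bochner_Integration.integrable_sum) (auto intro: integrable_real_indicator simp: measure_pmf.emeasure_eq_measure)
    show "measure_pmf.expectation P (\<lambda>w. real (card {M \<in> quot_subs (Zn0 n) K. U w \<subseteq> M})) = subgroup_moment n P U K"
      unfolding e subgroup_moment_def
      by (subst Bochner_Integration.integral_sum) (auto intro: integrable_real_indicator simp: measure_pmf.emeasure_eq_measure)
  qed
  have cls: "class_rep C \<in> fin_ab_groups" if "C \<in> small_classes B" for C B using that class_rep(2) by (simp add: small_classes_def)
  let ?t = "\<lambda>q w. \<Sum>C\<in>small_classes (pair_order_bound G q). real (pair_weight G q C) * real (card {M \<in> quot_subs (Zn0 n) (class_rep C). U w \<subseteq> M})"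
  have it: "integrable (measure_pmf P) (?t q)" for q
    using cnt(1)[OF cls] by (intro Bochner_Integration.integrable_sum integrable_mult_right) auto
  have et: "measure_pmf.expectation P (?t q) = (\<Sum>C\<in>small_classes (pair_order_bound G q). real (pair_weight G q C) * subgroup_moment n P U (class_rep C))" for q
    using cnt[OF cls] by (subst Bochner_Integration.integral_sum) auto
  have main: "integrable (measure_pmf P) (\<lambda>w. \<Sum>(c, q)\<leftarrow>S. c * ?t q w) \<and>
     measure_pmf.expectation P (\<lambda>w. \<Sum>(c, q)\<leftarrow>S. c * ?t q w) = poly_limit G (subgroup_moment n P U) S" for S
  proof (induction S)
    case (Cons a S)
    obtain c q where a: "a = (c, q)" by (cases a)
    show ?case unfolding a using Cons it[of q] et[of q] by (simp add: poly_limit_def)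
  qed (simp add: poly_limit_def)
  show "integrable (measure_pmf P) (\<lambda>w. quot_sum n G (poly_eval R) (U w))"
    unfolding quot_sum_poly[OF n G R] using main by blast
  show "measure_pmf.expectation P (\<lambda>w. quot_sum n G (poly_eval R) (U w)) = poly_limit G (subgroup_moment n P U) R"
    unfolding quot_sum_poly[OF n G R] using main by blast
qed

lemma tendsto_poly_limit:
  assumes "\<And>K. K \<in> fin_ab_groups \<Longrightarrow> (\<lambda>n. m n K) \<longlonglongrightarrow> l K"
  shows "(\<lambda>n. poly_limit G (m n) R) \<longlonglongrightarrow> poly_limit G l R"
proof (induction R)
  case (Cons a R)
  obtain c q where a: "a = (c, q)" by (cases a)
  have "(\<lambda>n. c * (\<Sum>C\<in>small_classes (pair_order_bound G q). real (pair_weight G q C) * m n (class_rep C)) + poly_limit G (m n) R)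
    \<longlonglongrightarrow> c * (\<Sum>C\<in>small_classes (pair_order_bound G q). real (pair_weight G q C) * l (class_rep C)) + poly_limit G l R"
    using class_rep(2) by (intro tendsto_add tendsto_mult tendsto_sum tendsto_const assms Cons) (auto simp: small_classes_def)
  then show ?case by (simp add: a poly_limit_def)
qed (simp add: poly_limit_def)

section \<open>Reduction modulo a\<close>

definition pow_set :: "('a, 'c) monoid_scheme \<Rightarrow> nat \<Rightarrow> 'a set" where
  "pow_set Y a = {x [^]\<^bsub>Y\<^esub> a | x. x \<in> carrier Y}"

lemma tensor_mod_pow_set: "tensor_mod Y a = Y Mod pow_set Y a"
  by (simp add: tensor_mod_def pow_set_def)

lemma (in comm_group) subgroup_pow_set: "subgroup (pow_set G a) G"
proof (rule subgroupI)
  show "pow_set G a \<subseteq> carrier G" by (auto simp: pow_set_def)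
  show "pow_set G a \<noteq> {}" by (auto simp: pow_set_def)
  fix x assume "x \<in> pow_set G a"
  then obtain y where y: "y \<in> carrier G" "x = y [^] a" by (auto simp: pow_set_def)
  then have "inv x = (inv y) [^] a" by (simp add: nat_pow_inv)
  then show "inv x \<in> pow_set G a" using y unfolding pow_set_def by blast
  fix x' assume "x' \<in> pow_set G a"
  then obtain y' where y': "y' \<in> carrier G" "x' = y' [^] a" by (auto simp: pow_set_def)
  then have "x \<otimes> x' = (y \<otimes> y') [^] a" using y by (simp add: nat_pow_distrib)
  moreover have "y \<otimes> y' \<in> carrier G" using y y' by simp
  ultimately show "x \<otimes> x' \<in> pow_set G a" unfolding pow_set_def by blast
qed

lemma (in comm_group) coset_eq_subgroup_iff:
  assumes "subgroup L G" "y \<in> carrier G"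
  shows "L #> y = L \<longleftrightarrow> y \<in> L"
  using coset_join2[OF assms(2,1)] coset_join1[OF _ assms(2,1)] subgroup.subset[OF assms(1)] by blast

lemma tensor_mod_iso:
  assumes K: "comm_group K" and Y: "comm_group Y" and iso: "K \<cong> Y"
  shows "tensor_mod K a \<cong> tensor_mod Y a"
proof -
  interpret K: comm_group K by (rule K)
  interpret Y: comm_group Y by (rule Y)
  obtain f where f: "f \<in> iso K Y" using iso by (auto simp: is_iso_def)
  then have fh: "f \<in> hom K Y" and fb: "bij_betw f (carrier K) (carrier Y)" by (auto simp: iso_def)
  interpret f: group_hom K Y f by (rule group_homI[OF K.is_group Y.is_group fh])
  let ?P = "pow_set Y a"
  have Ps: "subgroup ?P Y" by (rule Y.subgroup_pow_set)
  interpret P: normal ?P Y using Y.normal_iff_subgroup Ps by blast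
  let ?h = "\<lambda>x. ?P #>\<^bsub>Y\<^esub> f x"
  have hh: "?h \<in> hom K (Y Mod ?P)" using hom_compose[OF fh P.r_coset_hom_Mod] by (simp add: o_def)
  interpret h: group_hom K "Y Mod ?P" ?h by (rule group_homI[OF K.is_group P.factorgroup_is_group hh])
  have "?h ` carrier K = carrier (Y Mod ?P)"
  proof -
    have "?h ` carrier K = (\<lambda>y. ?P #>\<^bsub>Y\<^esub> y) ` (f ` carrier K)" by (simp only: image_image)
    then show ?thesis using fb by (simp add: bij_betw_def carrier_FactGroup)
  qed
  then have "K Mod kernel K (Y Mod ?P) ?h \<cong> Y Mod ?P" by (rule h.FactGroup_iso)
  moreover have "kernel K (Y Mod ?P) ?h = pow_set K a"
  proof -
    have "f x \<in> ?P \<longleftrightarrow> x \<in> pow_set K a" if x: "x \<in> carrier K" for x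
    proof
      assume "f x \<in> ?P"
      then obtain y where y: "y \<in> carrier Y" "f x = y [^]\<^bsub>Y\<^esub> a" unfolding pow_set_def by blast
      have "y \<in> f ` carrier K" using fb y by (simp add: bij_betw_def)
      then obtain z where z: "z \<in> carrier K" "y = f z" by blast
      have "f x = f (z [^]\<^bsub>K\<^esub> a)" using y z f.hom_nat_pow by simp
      moreover have "inj_on f (carrier K)" using fb by (simp add: bij_betw_def)
      ultimately have "x = z [^]\<^bsub>K\<^esub> a" using x K.nat_pow_closed[OF z(1)] by (simp only: inj_on_eq_iff)
      then show "x \<in> pow_set K a" using z unfolding pow_set_def by blast
    next
      assume "x \<in> pow_set K a"
      then obtain z where z: "z \<in> carrier K" "x = z [^]\<^bsub>K\<^esub> a" by (auto simp: pow_set_def)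
      then have "f x = (f z) [^]\<^bsub>Y\<^esub> a" using f.hom_nat_pow by simp
      then show "f x \<in> ?P" using z f.hom_closed unfolding pow_set_def by blast
    qed
    then have "x \<in> carrier K \<Longrightarrow> ?h x = ?P \<longleftrightarrow> x \<in> pow_set K a" for x
      using Y.coset_eq_subgroup_iff[OF Ps f.hom_closed] by simp
    moreover have "pow_set K a \<subseteq> carrier K" using K.subgroup_pow_set subgroup.subset by blast
    ultimately show ?thesis unfolding kernel_def one_FactGroup by blast
  qed
  ultimately show ?thesis by (simp add: tensor_mod_pow_set)
qed

text \<open>Reducing the quotient modulo a is the same as enlarging N to N + a F: both are the image
  of F under the composite of the two projections.\<close>

lemma tensor_mod_Mod:
  assumes F: "comm_group F" and N: "subgroup N F"
  shows "F Mod (N <#>\<^bsub>F\<^esub> pow_set F a) \<cong> tensor_mod (F Mod N) a"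
proof -
  interpret F: comm_group F by (rule F)
  interpret N: normal N F using F.normal_iff_subgroup N by blast
  interpret Q: comm_group "F Mod N" by (rule F.abelian_FactGroup[OF N])
  let ?P = "pow_set (F Mod N) a"
  have Ps: "subgroup ?P (F Mod N)" by (rule Q.subgroup_pow_set)
  interpret P: normal ?P "F Mod N" using Q.normal_iff_subgroup Ps by blast
  let ?h = "\<lambda>x. ?P #>\<^bsub>F Mod N\<^esub> (N #>\<^bsub>F\<^esub> x)"
  have hh: "?h \<in> hom F ((F Mod N) Mod ?P)"
    using hom_compose[OF N.r_coset_hom_Mod P.r_coset_hom_Mod] by (simp add: o_def)
  interpret h: group_hom F "(F Mod N) Mod ?P" ?h by (rule group_homI[OF F.is_group P.factorgroup_is_group hh])
  have "?h ` carrier F = carrier ((F Mod N) Mod ?P)"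
    unfolding carrier_FactGroup[of "F Mod N" ?P] carrier_FactGroup[of F N] by (simp add: image_image)
  then have "F Mod kernel F ((F Mod N) Mod ?P) ?h \<cong> (F Mod N) Mod ?P" by (rule h.FactGroup_iso)
  moreover have "kernel F ((F Mod N) Mod ?P) ?h = N <#>\<^bsub>F\<^esub> pow_set F a"
  proof -
    have c: "N #>\<^bsub>F\<^esub> x \<in> carrier (F Mod N)" if "x \<in> carrier F" for x using that by (auto simp: carrier_FactGroup)
    have pw: "(N #>\<^bsub>F\<^esub> y) [^]\<^bsub>F Mod N\<^esub> a = N #>\<^bsub>F\<^esub> (y [^]\<^bsub>F\<^esub> a)" if "y \<in> carrier F" for y
      using group_hom.hom_nat_pow[OF group_homI[OF F.is_group N.factorgroup_is_group N.r_coset_hom_Mod] that] by simp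
    have "N #>\<^bsub>F\<^esub> x \<in> ?P \<longleftrightarrow> x \<in> N <#>\<^bsub>F\<^esub> pow_set F a" if x: "x \<in> carrier F" for x
    proof
      assume "N #>\<^bsub>F\<^esub> x \<in> ?P"
      then obtain y where y: "y \<in> carrier F" "N #>\<^bsub>F\<^esub> x = N #>\<^bsub>F\<^esub> (y [^]\<^bsub>F\<^esub> a)"
        using pw by (auto simp: pow_set_def carrier_FactGroup)
      have "x \<in> N #>\<^bsub>F\<^esub> (y [^]\<^bsub>F\<^esub> a)" using F.rcos_self[OF x N] y(2) by simp
      then obtain u where u: "u \<in> N" "x = u \<otimes>\<^bsub>F\<^esub> (y [^]\<^bsub>F\<^esub> a)" by (auto simp: r_coset_def)
      moreover have "y [^]\<^bsub>F\<^esub> a \<in> pow_set F a" using y(1) unfolding pow_set_def by blast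
      ultimately show "x \<in> N <#>\<^bsub>F\<^esub> pow_set F a" unfolding set_mult_def by blast
    next
      assume "x \<in> N <#>\<^bsub>F\<^esub> pow_set F a"
      then obtain u y where uy: "u \<in> N" "y \<in> carrier F" "x = u \<otimes>\<^bsub>F\<^esub> (y [^]\<^bsub>F\<^esub> a)"
        by (auto simp: set_mult_def pow_set_def)
      have "x \<in> N #>\<^bsub>F\<^esub> (y [^]\<^bsub>F\<^esub> a)" using uy by (auto simp: r_coset_def)
      then have "N #>\<^bsub>F\<^esub> x = (N #>\<^bsub>F\<^esub> y) [^]\<^bsub>F Mod N\<^esub> a"
        using F.repr_independence[OF _ _ N] uy(2) pw[OF uy(2)] by (metis F.nat_pow_closed)
      then show "N #>\<^bsub>F\<^esub> x \<in> ?P" using c[OF uy(2)] unfolding pow_set_def by blast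
    qed
    then have "x \<in> carrier F \<Longrightarrow> ?h x = ?P \<longleftrightarrow> x \<in> N <#>\<^bsub>F\<^esub> pow_set F a" for x
      using Q.coset_eq_subgroup_iff[OF Ps c] by simp
    moreover have "N <#>\<^bsub>F\<^esub> pow_set F a \<subseteq> carrier F"
      using F.setmult_subset_G[OF subgroup.subset[OF N] subgroup.subset[OF F.subgroup_pow_set]] .
    ultimately show ?thesis unfolding kernel_def one_FactGroup by blast
  qed
  ultimately show ?thesis by (simp add: tensor_mod_pow_set)
qed

section \<open>Moments after reduction modulo a\<close>

definition killed_by :: "nat \<Rightarrow> ('a, 'c) monoid_scheme \<Rightarrow> bool" where
  "killed_by a Y \<longleftrightarrow> (\<forall>x\<in>carrier Y. x [^]\<^bsub>Y\<^esub> a = \<one>\<^bsub>Y\<^esub>)"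

text \<open>Whether M contains a F is visible in the quotient, as the condition that
  \<open>a\<close> kills it. It is therefore a condition on K that is common to all M with this
  quotient.\<close>

lemma pow_set_subset_iff:
  assumes F: "comm_group F" and K: "group K" and M: "M \<in> quot_subs F K"
  shows "pow_set F a \<subseteq> M \<longleftrightarrow> killed_by a K"
proof -
  interpret F: comm_group F by (rule F)
  interpret K: group K by (rule K)
  obtain f where f: "f \<in> Surs F K" "kernel F K f = M" using quot_subs_Surs[OF F K M] by blast
  have fh: "f \<in> hom F K" and im: "f ` carrier F = carrier K" using f by (auto simp: Surs_def Homs_def)
  interpret f: group_hom F K f by (rule group_homI[OF F.is_group K fh])
  have "pow_set F a \<subseteq> M \<longleftrightarrow> (\<forall>x\<in>carrier F. f (x [^]\<^bsub>F\<^esub> a) = \<one>\<^bsub>K\<^esub>)"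
    unfolding f(2)[symmetric] by (auto simp: pow_set_def kernel_def)
  also have "\<dots> \<longleftrightarrow> (\<forall>x\<in>carrier F. (f x) [^]\<^bsub>K\<^esub> a = \<one>\<^bsub>K\<^esub>)" using f.hom_nat_pow by simp
  also have "\<dots> \<longleftrightarrow> killed_by a K" unfolding killed_by_def im[symmetric] by simp
  finally show ?thesis .
qed

lemma set_mult_subset_iff:
  assumes F: "comm_group F" and "subgroup N F" "subgroup A F" "subgroup M F"
  shows "N <#>\<^bsub>F\<^esub> A \<subseteq> M \<longleftrightarrow> N \<subseteq> M \<and> A \<subseteq> M"
proof
  interpret F: comm_group F by (rule F)
  assume s: "N <#>\<^bsub>F\<^esub> A \<subseteq> M"
  have "x \<in> N <#>\<^bsub>F\<^esub> A" if "x \<in> N" for x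
  proof -
    have "x = x \<otimes>\<^bsub>F\<^esub> \<one>\<^bsub>F\<^esub>" using that subgroup.subset[OF assms(2)] by auto
    then show ?thesis using that subgroup.one_closed[OF assms(3)] unfolding set_mult_def by blast
  qed
  moreover have "x \<in> N <#>\<^bsub>F\<^esub> A" if "x \<in> A" for x
  proof -
    have "x = \<one>\<^bsub>F\<^esub> \<otimes>\<^bsub>F\<^esub> x" using that subgroup.subset[OF assms(3)] by auto
    then show ?thesis using that subgroup.one_closed[OF assms(2)] unfolding set_mult_def by blast
  qed
  ultimately show "N \<subseteq> M \<and> A \<subseteq> M" using s by blast
next
  assume "N \<subseteq> M \<and> A \<subseteq> M"
  then show "N <#>\<^bsub>F\<^esub> A \<subseteq> M" using subgroup.m_closed[OF assms(4)] by (auto simp: set_mult_def)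
qed

text \<open>The surjection moment 1 / |K|, converted to subgroups by 1 / |Aut K|. Groups not killed
  by \<open>a\<close> are never quotients of a reduction modulo \<open>a\<close>.\<close>

definition limit_moment :: "nat \<Rightarrow> nat monoid \<Rightarrow> real" where
  "limit_moment a K = (if killed_by a K then 1 / (real (card (carrier K)) * real (card (auto K))) else 0)"

definition mod_a_span :: "nat \<Rightarrow> nat \<Rightarrow> (nat \<Rightarrow> int) set \<Rightarrow> (nat \<Rightarrow> int) set" where
  "mod_a_span n a N = N <#>\<^bsub>Zn0 n\<^esub> pow_set (Zn0 n) a"

lemma auto_pos:
  assumes "comm_group K" "finite (carrier K)"
  shows "card (auto K) > 0"
proof -
  interpret comm_group K by (rule assms)
  have "(\<lambda>x\<in>carrier K. x) \<in> auto K" by (auto simp: auto_def Bij_def hom_def bij_betw_def inj_on_def)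
  moreover have "finite (auto K)"
  proof (rule finite_subset)
    show "auto K \<subseteq> carrier K \<rightarrow>\<^sub>E carrier K" by (auto simp: auto_def Bij_def hom_def PiE_def)
    show "finite (carrier K \<rightarrow>\<^sub>E carrier K)" using assms(2) by (intro finite_PiE) auto
  qed
  ultimately show ?thesis by (auto simp: card_gt_0_iff)
qed

lemma finite_Surs_Zn0:
  assumes "comm_group K" "finite (carrier K)" "n \<ge> 1"
  shows "finite (Surs (Zn0 n) K)"
proof -
  have "Surs (Zn0 n) K \<subseteq> Homs (Zn0 n) K" by (auto simp: Surs_def)
  then show ?thesis using comm_group.card_Homs_Zn0(1)[OF assms(1,3,2)] finite_subset by blast
qed

lemma sum_quot_subs_Zn0:
  assumes K: "comm_group K" "finite (carrier K)" and n: "n \<ge> 1"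
  shows "(\<Sum>M\<in>quot_subs (Zn0 n) K. u M) = (\<Sum>f\<in>Surs (Zn0 n) K. u (kernel (Zn0 n) K f)) / real (card (auto K))"
  using sum_Surs_kernel[OF comm_group_Zn0 K(1) finite_Surs_Zn0[OF K n], of u] auto_pos[OF K] by simp

text \<open>A homomorphism that is not surjective lands in a proper subgroup, which has at most half
  the elements, so the proportion of these is at most a constant times 2^(-(n - 1)).\<close>

lemma card_Surs_Zn0_tendsto:
  assumes K: "comm_group K" "finite (carrier K)"
  shows "(\<lambda>n. real (card (Surs (Zn0 n) K)) / real (card (carrier K)) ^ (n - 1)) \<longlonglongrightarrow> 1"
    "n \<ge> 1 \<Longrightarrow> real (card (Surs (Zn0 n) K)) / real (card (carrier K)) ^ (n - 1) \<le> 1"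
proof -
  interpret K: comm_group K by (rule K)
  define N where "N = card (carrier K)"
  have N0: "N > 0" unfolding N_def using K(2) K.one_closed card_gt_0_iff by blast
  define \<J> where "\<J> = {J. subgroup J K \<and> J \<noteq> carrier K}"
  have finJ: "finite \<J>"
    by (rule finite_subset[of _ "Pow (carrier K)"]) (use K(2) subgroup.subset in \<open>auto simp: \<J>_def\<close>)
  have up: "card (Surs (Zn0 n) K) \<le> N ^ (n - 1)" if n: "n \<ge> 1" for n
    using card_mono[OF K.card_Homs_Zn0(1)[OF n K(2)], of "Surs (Zn0 n) K"] K.card_Homs_Zn0(2)[OF n K(2)]
    by (auto simp: Surs_def N_def)
  have low: "real N ^ (n - 1) * (1 - real (card \<J>) * (1/2) ^ (n - 1)) \<le> real (card (Surs (Zn0 n) K))" if n: "n \<ge> 1" for n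
  proof -
    let ?H = "Homs (Zn0 n) K"
    have Z: "group (Zn0 n)" using comm_group_Zn0 comm_group.axioms(2) by blast
    have fin: "finite ?H" using K.card_Homs_Zn0(1)[OF n K(2)] .
    have sub: "?H - Surs (Zn0 n) K \<subseteq> (\<Union>J\<in>\<J>. Homs (Zn0 n) (K\<lparr>carrier := J\<rparr>))"
    proof
      fix f assume f: "f \<in> ?H - Surs (Zn0 n) K"
      then have fh: "f \<in> hom (Zn0 n) K" and fe: "f \<in> extensional (carrier (Zn0 n))" by (auto simp: Homs_def)
      interpret f: group_hom "Zn0 n" K f by (rule group_homI[OF Z K.is_group fh])
      let ?J = "f ` carrier (Zn0 n)"
      have "subgroup ?J K" by (rule f.img_is_subgroup)
      moreover have "?J \<noteq> carrier K" using f by (auto simp: Surs_def)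
      ultimately have "?J \<in> \<J>" by (simp add: \<J>_def)
      moreover have "f \<in> Homs (Zn0 n) (K\<lparr>carrier := ?J\<rparr>)" using fh fe by (auto simp: Homs_def hom_def)
      ultimately show "f \<in> (\<Union>J\<in>\<J>. Homs (Zn0 n) (K\<lparr>carrier := J\<rparr>))" by blast
    qed
    have cJ: "finite (Homs (Zn0 n) (K\<lparr>carrier := J\<rparr>)) \<and> real (card (Homs (Zn0 n) (K\<lparr>carrier := J\<rparr>))) \<le> real N ^ (n - 1) * (1/2) ^ (n - 1)"
      if J: "J \<in> \<J>" for J
    proof -
      have Js: "subgroup J K" "J \<noteq> carrier K" using J by (auto simp: \<J>_def)
      have cg: "comm_group (K\<lparr>carrier := J\<rparr>)" 
      proof (rule group.group_comm_groupI[OF K.subgroup_imp_group[OF Js(1)]])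
        fix x y assume "x \<in> carrier (K\<lparr>carrier := J\<rparr>)" "y \<in> carrier (K\<lparr>carrier := J\<rparr>)"
        then have "x \<in> carrier K" "y \<in> carrier K" using subgroup.subset[OF Js(1)] by auto
        then show "x \<otimes>\<^bsub>K\<lparr>carrier := J\<rparr>\<^esub> y = y \<otimes>\<^bsub>K\<lparr>carrier := J\<rparr>\<^esub> x" using K.m_comm by simp
      qed
      have fJ: "finite (carrier (K\<lparr>carrier := J\<rparr>))" using finite_subset[OF subgroup.subset[OF Js(1)] K(2)] by simp
      have "2 * card J \<le> N" using K.subgroup_proper_card_le[OF K(2) Js] by (simp add: N_def)
      then have "2 * real (card J) \<le> real N" by (metis of_nat_le_iff of_nat_mult of_nat_numeral)
      then have "real (card J) ^ (n - 1) \<le> (real N * (1/2)) ^ (n - 1)" by (intro power_mono) auto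
      then have "real (card J) ^ (n - 1) \<le> real N ^ (n - 1) * (1/2) ^ (n - 1)" by (simp only: power_mult_distrib)
      then show ?thesis using comm_group.card_Homs_Zn0[OF cg n fJ] by simp
    qed
    have "real (card (?H - Surs (Zn0 n) K)) \<le> real (card (\<Union>J\<in>\<J>. Homs (Zn0 n) (K\<lparr>carrier := J\<rparr>)))"
      using card_mono[OF _ sub] finJ cJ by simp
    also have "\<dots> \<le> real (\<Sum>J\<in>\<J>. card (Homs (Zn0 n) (K\<lparr>carrier := J\<rparr>)))"
      using card_UN_le[OF finJ] by (simp only: of_nat_le_iff)
    also have "\<dots> = (\<Sum>J\<in>\<J>. real (card (Homs (Zn0 n) (K\<lparr>carrier := J\<rparr>))))" by simp
    also have "\<dots> \<le> (\<Sum>J\<in>\<J>. real N ^ (n - 1) * (1/2) ^ (n - 1))" using cJ by (intro sum_mono) blast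
    finally have b: "real (card (?H - Surs (Zn0 n) K)) \<le> real (card \<J>) * (real N ^ (n - 1) * (1/2) ^ (n - 1))" by simp
    have s: "Surs (Zn0 n) K \<subseteq> ?H" by (auto simp: Surs_def)
    have "card (?H - Surs (Zn0 n) K) = card ?H - card (Surs (Zn0 n) K)" by (rule card_Diff_subset[OF finite_subset[OF s fin] s])
    then have "real (card ?H) = real (card (Surs (Zn0 n) K)) + real (card (?H - Surs (Zn0 n) K))"
      using card_mono[OF fin s] by simp
    moreover have "real (card ?H) = real N ^ (n - 1)" using K.card_Homs_Zn0(2)[OF n K(2)] by (simp add: N_def)
    ultimately show ?thesis using b by (simp add: algebra_simps)
  qed
  have pos: "real N ^ (n - 1) > 0" for n using N0 by simp
  show bound: "real (card (Surs (Zn0 n) K)) / real (card (carrier K)) ^ (n - 1) \<le> 1" if "n \<ge> 1"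
  proof -
    have "real (card (Surs (Zn0 n) K)) \<le> real (N ^ (n - 1))" using up[OF that] by (simp only: of_nat_le_iff)
    then show ?thesis using pos[of n] by (simp add: N_def divide_le_eq)
  qed
  show "(\<lambda>n. real (card (Surs (Zn0 n) K)) / real (card (carrier K)) ^ (n - 1)) \<longlonglongrightarrow> 1"
  proof (rule tendsto_sandwich[of "\<lambda>n. 1 - real (card \<J>) * (1/2) ^ (n - 1)" _ _ "\<lambda>_. 1"])
    show "\<forall>\<^sub>F n in sequentially. 1 - real (card \<J>) * (1/2) ^ (n - 1) \<le> real (card (Surs (Zn0 n) K)) / real (card (carrier K)) ^ (n - 1)"
      using eventually_ge_at_top[of 1]
    proof eventually_elim
      case (elim n)
      show ?case using low[OF elim] pos[of n] by (simp add: N_def le_divide_eq mult.commute)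
    qed
    show "\<forall>\<^sub>F n in sequentially. real (card (Surs (Zn0 n) K)) / real (card (carrier K)) ^ (n - 1) \<le> 1"
      using eventually_ge_at_top[of 1]
    proof eventually_elim
      case (elim n)
      have "real (card (Surs (Zn0 n) K)) \<le> real (N ^ (n - 1))" using up[OF elim] by (simp only: of_nat_le_iff)
      then show ?case using pos[of n] by (simp add: N_def divide_le_eq)
    qed
    have "(\<lambda>n. (1/2::real) ^ (n - 1)) \<longlonglongrightarrow> 0"
      by (rule filterlim_sequentially_Suc[THEN iffD1]) (simp, rule LIMSEQ_realpow_zero, auto)
    then have "(\<lambda>n. 1 - real (card \<J>) * (1/2) ^ (n - 1)) \<longlonglongrightarrow> 1 - real (card \<J>) * 0" by (intro tendsto_intros)
    then show "(\<lambda>n. 1 - real (card \<J>) * (1/2) ^ (n - 1)) \<longlonglongrightarrow> 1" by simp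
  qed simp
qed

text \<open>N + a F lies in M exactly when N and a F both do, and by
  \<open>pow_set_subset_iff\<close> the second condition is the same for every M in the sum.\<close>

lemma subgroup_moment_mod_a:
  assumes n: "n \<ge> 1" and K: "K \<in> fin_ab_groups" and N: "\<And>w. w \<in> set_pmf P \<Longrightarrow> subgroup (N w) (Zn0 n)"
  shows "subgroup_moment n P (\<lambda>w. mod_a_span n a (N w)) K =
    (if killed_by a K then subgroup_moment n P N K else 0)"
proof -
  interpret Z: comm_group "Zn0 n" by (rule comm_group_Zn0)
  have "measure_pmf.prob P {w. mod_a_span n a (N w) \<subseteq> M} = (if killed_by a K then measure_pmf.prob P {w. N w \<subseteq> M} else 0)"
    if M: "M \<in> quot_subs (Zn0 n) K" for M
  proof -
    have Ms: "subgroup M (Zn0 n)" using M by (simp add: quot_subs_def)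
    have "mod_a_span n a (N w) \<subseteq> M \<longleftrightarrow> N w \<subseteq> M \<and> killed_by a K" if "w \<in> set_pmf P" for w
      using set_mult_subset_iff[OF comm_group_Zn0 N[OF that] Z.subgroup_pow_set Ms]
        pow_set_subset_iff[OF comm_group_Zn0 fin_ab_groupsD(2)[OF K] M] by (simp add: mod_a_span_def)
    then have "measure_pmf.prob P {w. mod_a_span n a (N w) \<subseteq> M} = measure_pmf.prob P {w. N w \<subseteq> M \<and> killed_by a K}"
      by (intro measure_pmf.finite_measure_eq_AE) (auto simp: AE_measure_pmf_iff)
    then show ?thesis by simp
  qed
  then show ?thesis unfolding subgroup_moment_def by (simp add: sum.neutral)
qed

lemma subgroup_pmf_set: "n \<ge> 1 \<Longrightarrow> N \<in> set_pmf (subgroup_pmf n) \<Longrightarrow> N \<in> fisub (zero_sum_vecs n)"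
  by (auto simp: set_pmf_iff pmf_subgroup_pmf subgroup_weight_def split: if_splits)

text \<open>Every M of index |K| contains the random subgroup with the same probability |K|^(-n).
  The result is arranged as a ratio tending to 1 times the limiting moment.\<close>

lemma subgroup_moment_pmf:
  assumes n: "n \<ge> 1" and K: "K \<in> fin_ab_groups"
  shows "subgroup_moment n (subgroup_pmf n) (\<lambda>N. N) K =
    real (card (Surs (Zn0 n) K)) / real (card (carrier K)) ^ (n - 1) / (real (card (carrier K)) * real (card (auto K)))"
proof -
  note Kd = fin_ab_groupsD[OF K]
  have p: "measure_pmf.prob (subgroup_pmf n) {N. N \<subseteq> M} = (1 / real (card (carrier K))) ^ n" if "M \<in> quot_subs (Zn0 n) K" for M
    using prob_subgroup_pmf[OF n quot_subs_fisub(1)[OF that Kd(3)]] quot_subs_fisub(2)[OF that Kd(3)] by simp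
  have "subgroup_moment n (subgroup_pmf n) (\<lambda>N. N) K = (\<Sum>M\<in>quot_subs (Zn0 n) K. (1 / real (card (carrier K))) ^ n)"
    unfolding subgroup_moment_def by (intro sum.cong refl p)
  also have "\<dots> = (\<Sum>f\<in>Surs (Zn0 n) K. (1 / real (card (carrier K))) ^ n) / real (card (auto K))"
    by (rule sum_quot_subs_Zn0[OF Kd(1,3) n])
  also have "\<dots> = real (card (Surs (Zn0 n) K)) / real (card (carrier K)) ^ n / real (card (auto K))"
    by (simp add: power_divide)
  also have "real (card (carrier K)) ^ n = real (card (carrier K)) ^ (n - 1) * real (card (carrier K))"
    using n by (cases n) auto
  finally show ?thesis by simp
qed

lemma subgroup_moment_pmf_tendsto:
  assumes K: "K \<in> fin_ab_groups"
  shows "(\<lambda>n. subgroup_moment n (subgroup_pmf n) (\<lambda>N. mod_a_span n a N) K) \<longlonglongrightarrow> limit_moment a K"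
proof -
  note Kd = fin_ab_groupsD[OF K]
  have "(\<lambda>n. if killed_by a K then real (card (Surs (Zn0 n) K)) / real (card (carrier K)) ^ (n - 1) / (real (card (carrier K)) * real (card (auto K))) else 0)
     \<longlonglongrightarrow> limit_moment a K"
    unfolding limit_moment_def
    using tendsto_mult_right[OF card_Surs_Zn0_tendsto(1)[OF Kd(1,3)], of "1 / (real (card (carrier K)) * real (card (auto K)))"] by simp
  moreover have "\<forall>\<^sub>F n in sequentially. (if killed_by a K then real (card (Surs (Zn0 n) K)) / real (card (carrier K)) ^ (n - 1) / (real (card (carrier K)) * real (card (auto K))) else 0)
     = subgroup_moment n (subgroup_pmf n) (\<lambda>N. mod_a_span n a N) K"
    using eventually_ge_at_top[of 1]
  proof eventually_elim
    case (elim n)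
    have "subgroup N (Zn0 n)" if "N \<in> set_pmf (subgroup_pmf n)" for N
      using subgroup_pmf_set[OF elim that] by (simp add: fisub_Zn0_iff)
    then show ?case using subgroup_moment_mod_a[OF elim K, of "subgroup_pmf n" "\<lambda>N. N" a] subgroup_moment_pmf[OF elim K] by simp
  qed
  ultimately show ?thesis by (rule Lim_transform_eventually)
qed

section \<open>The sieve\<close>

lemma subgroup_moment_laplacian_tendsto:
  assumes eps: "eps > 0" and bal: "\<And>n. n \<ge> 1 \<Longrightarrow> eps_balanced_digraph n eps (\<Gamma> n)" and K: "K \<in> fin_ab_groups"
  shows "(\<lambda>n. subgroup_moment n (\<Gamma> n) (\<lambda>D. mod_a_span n a (laplacian_image n D)) K) \<longlonglongrightarrow> limit_moment a K"
proof -
  note Kd = fin_ab_groupsD[OF K]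
  let ?S = "\<lambda>n. (\<Sum>f\<in>Surs (Zn0 n) K. measure_pmf.prob (\<Gamma> n) {D. laplacian_image n D \<subseteq> kernel (Zn0 n) K f})"
  have "?S \<longlonglongrightarrow> 1 / real (card (carrier K))"
    by (rule comm_group.sur_moment_laplacian[OF Kd(1,3) eps]) (rule bal)
  from tendsto_mult_right[OF this, of "1 / real (card (auto K))"]
  have t: "(\<lambda>n. ?S n / real (card (auto K))) \<longlonglongrightarrow> 1 / (real (card (carrier K)) * real (card (auto K)))" by simp
  have "(\<lambda>n. if killed_by a K then ?S n / real (card (auto K)) else 0) \<longlonglongrightarrow> limit_moment a K"
    unfolding limit_moment_def using t by (cases "killed_by a K") simp_all
  moreover have "\<forall>\<^sub>F n in sequentially. (if killed_by a K then ?S n / real (card (auto K)) else 0)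
     = subgroup_moment n (\<Gamma> n) (\<lambda>D. mod_a_span n a (laplacian_image n D)) K"
    using eventually_ge_at_top[of 1]
  proof eventually_elim
    case (elim n)
    have "subgroup_moment n (\<Gamma> n) (laplacian_image n) K = ?S n / real (card (auto K))"
      unfolding subgroup_moment_def by (rule sum_quot_subs_Zn0[OF Kd(1,3) elim])
    moreover have "subgroup_moment n (\<Gamma> n) (\<lambda>D. mod_a_span n a (laplacian_image n D)) K =
      (if killed_by a K then subgroup_moment n (\<Gamma> n) (laplacian_image n) K else 0)"
      by (rule subgroup_moment_mod_a[OF elim K subgroup_laplacian_image])
    ultimately show ?case by simp
  qed
  ultimately show ?thesis by (rule Lim_transform_eventually)
qed

text \<open>As a polynomial in x it is 1 at x = 1 and vanishes at p, ..., p^m. For x = p^r it is the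
  Moebius function of the lattice of subspaces of an r-dimensional space, summed over dimensions at
  most m.\<close>

definition sieve_factor :: "nat \<Rightarrow> nat \<Rightarrow> real \<Rightarrow> real" where
  "sieve_factor m p x = (\<Prod>i\<in>{1..m}. (real p ^ i - x) / (real p ^ i - 1))"

text \<open>For x = p^r the number of linearly independent (m + 1)-tuples in an r-dimensional space;
  it vanishes for r \<le> m, where the truncated sieve is exact.\<close>

definition excess_factor :: "nat \<Rightarrow> nat \<Rightarrow> real \<Rightarrow> real" where
  "excess_factor m p x = (\<Prod>i<Suc m. x - real p ^ i)"

definition sieve_main :: "nat set \<Rightarrow> nat \<Rightarrow> (nat \<Rightarrow> real) \<Rightarrow> real" where
  "sieve_main P m x = (\<Prod>p\<in>P. sieve_factor m p (x p))"

text \<open>Expanded, this is the sum over nonempty sets of primes of the products of their excess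
  factors.\<close>

definition sieve_err :: "nat set \<Rightarrow> nat \<Rightarrow> (nat \<Rightarrow> real) \<Rightarrow> real" where
  "sieve_err P m x = (\<Prod>p\<in>P. 1 + excess_factor m p (x p)) - 1"

lemma is_poly_affine: "p > 0 \<Longrightarrow> is_poly (\<lambda>x. c + d * x p)"
  by (rule is_poly_add[OF is_poly_const is_poly_mult[OF is_poly_const is_poly_var]])

lemma is_poly_sieve_main:
  assumes "finite P" and P: "\<And>p. p \<in> P \<Longrightarrow> p > 0"
  shows "is_poly (sieve_main P m)"
proof -
  have e: "(real p ^ i - x p) / (real p ^ i - 1) = real p ^ i / (real p ^ i - 1) + (- 1 / (real p ^ i - 1)) * x p" for p i and x :: "nat \<Rightarrow> real"
    by (simp add: diff_divide_distrib)
  have eq: "sieve_main P m = (\<lambda>x. \<Prod>p\<in>P. \<Prod>i\<in>{1..m}. real p ^ i / (real p ^ i - 1) + (- 1 / (real p ^ i - 1)) * x p)"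
    unfolding sieve_main_def sieve_factor_def e by (rule refl)
  show ?thesis unfolding eq
    by (rule is_poly_prod[OF assms(1)], rule is_poly_prod[OF finite_atLeastAtMost], rule is_poly_affine, rule P)
qed

lemma is_poly_sieve_err:
  assumes "finite P" and P: "\<And>p. p \<in> P \<Longrightarrow> p > 0"
  shows "is_poly (sieve_err P m)"
proof -
  have e: "x p - real p ^ i = - (real p ^ i) + 1 * x p" for p i and x :: "nat \<Rightarrow> real" by simp
  have eq: "sieve_err P m = (\<lambda>x. (\<Prod>p\<in>P. 1 + (\<Prod>i<Suc m. - (real p ^ i) + 1 * x p)) + (- 1))"
    unfolding sieve_err_def excess_factor_def e by simp
  show ?thesis unfolding eq
    by (rule is_poly_add[OF is_poly_prod[OF assms(1)] is_poly_const], rule is_poly_add[OF is_poly_const],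
        rule is_poly_prod[OF finite_lessThan], rule is_poly_affine, rule P)
qed

text \<open>For 1 \<le> r \<le> m both factors vanish. For r > m the denominators of
  \<open>sieve_factor\<close> are at least 1, so it is bounded by the numerators, and the remaining
  factor x - 1 of \<open>excess_factor\<close> is at least 1.\<close>

lemma sieve_factor_bounds:
  assumes p: "Factorial_Ring.prime p" and x: "x = real p ^ r"
  shows "excess_factor m p x \<ge> 0" "x = 1 \<Longrightarrow> sieve_factor m p x = 1 \<and> excess_factor m p x = 0"
    "x \<noteq> 1 \<Longrightarrow> \<bar>sieve_factor m p x\<bar> \<le> excess_factor m p x"
proof -
  have p2: "real p \<ge> 2" using prime_ge_2_nat[OF p] by simp
  have pw: "real p ^ i \<ge> 2" if "i \<ge> 1" for i
  proof -
    have "real p ^ 1 \<le> real p ^ i" by (rule power_increasing) (use that p2 in auto)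
    then show ?thesis using p2 unfolding power_one_right by linarith
  qed
  show one: "sieve_factor m p x = 1 \<and> excess_factor m p x = 0" if "x = 1"
  proof
    show "sieve_factor m p x = 1" unfolding sieve_factor_def
    proof (rule prod.neutral, rule ballI)
      fix i assume "i \<in> {1..m}"
      then have "real p ^ i \<ge> 2" using pw by simp
      then show "(real p ^ i - x) / (real p ^ i - 1) = 1" using that by simp
    qed
    show "excess_factor m p x = 0" unfolding excess_factor_def
      by (rule prod_zero) (use that in \<open>auto intro!: bexI[of _ 0]\<close>)
  qed
  show other: "\<bar>sieve_factor m p x\<bar> \<le> excess_factor m p x" if x1: "x \<noteq> 1"
  proof (cases "r \<le> m")
    case True
    have r1: "r \<ge> 1" using x x1 by (cases r) auto
    have "sieve_factor m p x = 0" unfolding sieve_factor_def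
      by (rule prod_zero) (use True r1 x in \<open>auto intro!: bexI[of _ r]\<close>)
    moreover have "excess_factor m p x = 0" unfolding excess_factor_def
      by (rule prod_zero) (use True x in \<open>auto intro!: bexI[of _ r]\<close>)
    ultimately show ?thesis by simp
  next
    case False
    have lt: "real p ^ i < x" if "i \<le> m" for i
      unfolding x by (rule power_strict_increasing) (use that False p2 in auto)
    have "\<bar>sieve_factor m p x\<bar> = (\<Prod>i\<in>{1..m}. \<bar>(real p ^ i - x) / (real p ^ i - 1)\<bar>)"
      unfolding sieve_factor_def by (rule abs_prod)
    also have "\<dots> \<le> (\<Prod>i\<in>{1..m}. x - real p ^ i)"
    proof (rule prod_mono, intro conjI)
      fix i assume i: "i \<in> {1..m}"
      have a: "real p ^ i - 1 \<ge> 1" "x - real p ^ i > 0" using pw[of i] lt[of i] i by auto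
      have "\<bar>(real p ^ i - x) / (real p ^ i - 1)\<bar> = (x - real p ^ i) / (real p ^ i - 1)" using a by (simp add: abs_divide)
      also have "\<dots> \<le> (x - real p ^ i) / 1" using a by (intro divide_left_mono) auto
      finally show "\<bar>(real p ^ i - x) / (real p ^ i - 1)\<bar> \<le> x - real p ^ i" by simp
    qed simp
    also have "\<dots> \<le> (x - 1) * (\<Prod>i\<in>{1..m}. x - real p ^ i)"
    proof -
      have "real p ^ 1 \<le> x" unfolding x by (rule power_increasing) (use False p2 in auto)
      then have x2: "1 \<le> x - 1" using p2 by simp
      have "0 \<le> (\<Prod>i\<in>{1..m}. x - real p ^ i)"
      proof (rule prod_nonneg)
        fix i assume "i \<in> {1..m}"
        then show "0 \<le> x - real p ^ i" using less_imp_le[OF lt[of i]] by simp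
      qed
      from mult_right_mono[OF x2 this] show ?thesis by (simp only: mult_1_left)
    qed
    also have "\<dots> = excess_factor m p x"
    proof -
      have "{..<Suc m} = insert 0 {1..m}" by auto
      then show ?thesis unfolding excess_factor_def by simp
    qed
    finally show ?thesis .
  qed
  show "excess_factor m p x \<ge> 0" using one other by (cases "x = 1") (simp, linarith)
qed

text \<open>If one variable differs from 1, the main term is at most its excess y times the product
  Y of the factors 1 + excess of the others; this is (1 + y) Y - Y, and Y \<ge> 1.\<close>

lemma sieve_bounds:
  assumes fin: "finite P" and P: "\<And>p. p \<in> P \<Longrightarrow> Factorial_Ring.prime p" and x: "\<And>p. p \<in> P \<Longrightarrow> \<exists>r. x p = real p ^ r"
  shows "(\<And>p. p \<in> P \<Longrightarrow> x p = 1) \<Longrightarrow> sieve_main P m x = 1 \<and> sieve_err P m x = 0"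
    "q \<in> P \<Longrightarrow> x q \<noteq> 1 \<Longrightarrow> \<bar>sieve_main P m x\<bar> \<le> sieve_err P m x"
proof -
  have y0: "excess_factor m p (x p) \<ge> 0" if "p \<in> P" for p
    using x[OF that] sieve_factor_bounds(1)[OF P[OF that]] by blast
  have y1: "sieve_factor m p (x p) = 1 \<and> excess_factor m p (x p) = 0" if "p \<in> P" "x p = 1" for p
    using x[OF that(1)] sieve_factor_bounds(2)[OF P[OF that(1)]] that(2) by metis
  have y2: "\<bar>sieve_factor m p (x p)\<bar> \<le> excess_factor m p (x p)" if "p \<in> P" "x p \<noteq> 1" for p
    using x[OF that(1)] sieve_factor_bounds(3)[OF P[OF that(1)]] that(2) by metis
  have y3: "\<bar>sieve_factor m p (x p)\<bar> \<le> 1 + excess_factor m p (x p)" if "p \<in> P" for p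
    using y1[OF that] y2[OF that] by (cases "x p = 1") auto
  show "sieve_main P m x = 1 \<and> sieve_err P m x = 0" if all: "\<And>p. p \<in> P \<Longrightarrow> x p = 1"
    using y1 all by (simp add: sieve_main_def sieve_err_def)
  show "\<bar>sieve_main P m x\<bar> \<le> sieve_err P m x" if q: "q \<in> P" "x q \<noteq> 1"
  proof -
    let ?Y = "\<Prod>p\<in>P - {q}. 1 + excess_factor m p (x p)"
    have Y1: "1 \<le> ?Y" by (rule prod_ge_1) (use y0 in auto)
    have "\<bar>sieve_main P m x\<bar> = \<bar>sieve_factor m q (x q)\<bar> * (\<Prod>p\<in>P - {q}. \<bar>sieve_factor m p (x p)\<bar>)"
      unfolding sieve_main_def abs_prod by (rule prod.remove[OF fin q(1)])
    also have "\<dots> \<le> excess_factor m q (x q) * ?Y"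
    proof (rule mult_mono[OF y2[OF q]])
      show "(\<Prod>p\<in>P - {q}. \<bar>sieve_factor m p (x p)\<bar>) \<le> ?Y" by (rule prod_mono) (use y3 in auto)
    qed (use y0[OF q(1)] in \<open>auto intro: prod_nonneg\<close>)
    also have "\<dots> = (1 + excess_factor m q (x q)) * ?Y - ?Y" by (simp add: algebra_simps)
    also have "(1 + excess_factor m q (x q)) * ?Y = (\<Prod>p\<in>P. 1 + excess_factor m p (x p))"
      by (rule prod.remove[OF fin q(1), symmetric])
    finally show ?thesis using Y1 by (simp add: sieve_err_def)
  qed
qed

text \<open>Finite index holds because the coordinates modulo \<open>a\<close> determine the coset:
  two zero-sum vectors congruent modulo a differ by a times an integer vector that is again
  zero-sum.\<close>

lemma mod_a_span_props:
  assumes a: "a > 0" and N: "subgroup N (Zn0 n)"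
  shows "subgroup (mod_a_span n a N) (Zn0 n)" "mod_a_span n a N \<in> fisub (zero_sum_vecs n)"
    "x \<in> zero_sum_vecs n \<Longrightarrow> smul (int a) x \<in> mod_a_span n a N" "N \<subseteq> mod_a_span n a N"
proof -
  interpret Z: comm_group "Zn0 n" by (rule comm_group_Zn0)
  let ?U = "mod_a_span n a N"
  show s: "subgroup ?U (Zn0 n)" unfolding mod_a_span_def by (rule Z.mult_subgroups[OF N Z.subgroup_pow_set])
  have sub: "N \<subseteq> ?U \<and> pow_set (Zn0 n) a \<subseteq> ?U"
    using set_mult_subset_iff[OF comm_group_Zn0 N Z.subgroup_pow_set s, of a] unfolding mod_a_span_def by blast
  then show "N \<subseteq> ?U" by blast
  show pw: "smul (int a) x \<in> ?U" if x: "x \<in> zero_sum_vecs n" for x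
  proof -
    have "x [^]\<^bsub>Zn0 n\<^esub> a \<in> pow_set (Zn0 n) a" unfolding pow_set_def using x by auto
    then show ?thesis using sub by (auto simp: nat_pow_Zn0 smul_def)
  qed
  have ads: "addsub ?U" "?U \<subseteq> zero_sum_vecs n" using s by (auto simp: subgroup_Zn0_iff)
  let ?g = "\<lambda>x::nat \<Rightarrow> int. \<lambda>i\<in>{1..n}. x i mod int a"
  have "finite (coset_of ?U ` zero_sum_vecs n)"
  proof (rule card_image_factor_le(1)[of ?g])
    have "?g ` zero_sum_vecs n \<subseteq> PiE {1..n} (\<lambda>_. {0..<int a})" using a by auto
    then show "finite (?g ` zero_sum_vecs n)" by (rule finite_subset) (intro finite_PiE, auto)
    fix x y assume x: "x \<in> zero_sum_vecs n" and y: "y \<in> zero_sum_vecs n" and e: "?g x = ?g y"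
    \<comment> \<open>The quotient has to lie in the zero-sum lattice, since only multiples of its
      vectors are known to belong to the span.\<close>
    define z where "z = (\<lambda>i. (x i - y i) div int a)"
    have az: "int a * z i = x i - y i" for i
    proof (cases "i \<in> {1..n}")
      case True
      then have "x i mod int a = y i mod int a" using fun_cong[OF e, of i] by simp
      then have "int a dvd x i - y i" by (simp add: mod_eq_dvd_iff)
      then show ?thesis by (simp add: z_def)
    next
      case False
      then show ?thesis using x y by (simp add: z_def zero_sum_vecs_def int_vecs_def)
    qed
    have "int a * (\<Sum>i\<in>{1..n}. z i) = (\<Sum>i\<in>{1..n}. x i - y i)" unfolding sum_distrib_left az by (rule refl)
    also have "\<dots> = 0" using x y by (simp add: zero_sum_vecs_def sum_subtractf)
    finally have "(\<Sum>i\<in>{1..n}. z i) = 0" using a by simp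
    moreover have "z i = 0" if "i \<notin> {1..n}" for i using that x y by (simp add: z_def zero_sum_vecs_def int_vecs_def)
    ultimately have "z \<in> zero_sum_vecs n" by (simp add: zero_sum_vecs_def int_vecs_def)
    then have "smul (int a) z \<in> ?U" by (rule pw)
    moreover have "smul (int a) z = x - y" unfolding smul_def by (auto simp: az fun_eq_iff)
    ultimately show "coset_of ?U x = coset_of ?U y" using coset_of_eq_iff[OF ads(1)] by simp
  qed
  then show "?U \<in> fisub (zero_sum_vecs n)" using ads by (simp add: fisub_def)
qed

lemma mod_p_homs_Zn0:
  assumes n: "n \<ge> 1" and M: "M \<in> fisub (zero_sum_vecs n)" and U: "U \<subseteq> M" and p: "Factorial_Ring.prime p"
  shows "mod_p_homs n p M U"
proof
  show "Factorial_Ring.prime p" "U \<subseteq> M" by (fact p U)+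
  show "addsub M" using M by (simp add: fisub_def)
  have "killed_homs (Zn0 n) M p U \<subseteq> sub_homs (Zn0 n) M p" by (auto simp: killed_homs_def)
  then show "finite (killed_homs (Zn0 n) M p U)"
    using finite_sub_homs(1)[OF n M prime_gt_0_nat[OF p]] by (rule finite_subset)
qed

lemma hom_count_power:
  assumes "n \<ge> 1" "M \<in> fisub (zero_sum_vecs n)" "U \<subseteq> M" "Factorial_Ring.prime p"
  shows "\<exists>r. hom_count n M U p = real p ^ r"
proof -
  interpret H: mod_p_homs n p M U by (rule mod_p_homs_Zn0[OF assms])
  show ?thesis using H.card_V_power unfolding hom_count_def H.V_def by (metis of_nat_power)
qed

lemma hom_count_eq_1:
  assumes "n \<ge> 1" "M \<in> fisub (zero_sum_vecs n)" "U \<subseteq> M" "Factorial_Ring.prime p"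
  shows "hom_count n M U p = 1 \<longleftrightarrow> (\<forall>\<psi>\<in>killed_homs (Zn0 n) M p U. \<forall>x\<in>M. \<psi> x = 0)"
proof -
  interpret H: mod_p_homs n p M U by (rule mod_p_homs_Zn0[OF assms])
  let ?V = "killed_homs (Zn0 n) M p U"
  let ?W = "{\<psi>\<in>?V. \<forall>x\<in>M. \<psi> x = 0}"
  have lk: "list_kernel M [] = M" by (simp add: list_kernel_def)
  have c: "card ?W = 1" using H.card_vanishing[of "[]" 0] unfolding H.V_def lk by simp
  have sub: "?W \<subseteq> ?V" by blast
  have "hom_count n M U p = 1 \<longleftrightarrow> card ?V = 1" by (simp add: hom_count_def)
  also have "\<dots> \<longleftrightarrow> ?W = ?V"
  proof
    assume "card ?V = 1"
    then have "card ?W = card ?V" using c by simp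
    then show "?W = ?V" by (rule card_subset_eq[OF H.finV sub])
  next
    assume e: "?W = ?V"
    show "card ?V = 1" using c unfolding e .
  qed
  also have "\<dots> \<longleftrightarrow> (\<forall>\<psi>\<in>?V. \<forall>x\<in>M. \<psi> x = 0)" by blast
  finally show ?thesis .
qed

text \<open>Only M = U contributes to the indicator, and there all hom counts are 1 and the main
  term is exact. For larger M the group M / U is nontrivial and killed by \<open>a\<close>, so it
  has a nonzero homomorphism to \<int>/p for some prime p dividing \<open>a\<close>, and the main
  term is bounded by the error term.\<close>

lemma sieve_pointwise:
  assumes n: "n \<ge> 1" and G: "comm_group G" "finite (carrier G)" and a: "a > 0"
    and U: "U \<in> fisub (zero_sum_vecs n)" and aU: "\<And>x. x \<in> zero_sum_vecs n \<Longrightarrow> smul (int a) x \<in> U"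
  shows "\<bar>of_bool (Zn0 n Mod U \<cong> G) - quot_sum n G (sieve_main (prime_factors a) m) U\<bar>
    \<le> quot_sum n G (sieve_err (prime_factors a) m) U"
proof -
  let ?P = "prime_factors a"
  let ?S = "{M \<in> quot_subs (Zn0 n) G. U \<subseteq> M}"
  have Gg: "group G" using G(1) comm_group.axioms(2) by blast
  have fq: "finite ?S" using finite_quot_subs[OF comm_group_Zn0 Gg comm_group.card_Homs_Zn0(1)[OF G(1) n G(2)]] by simp
  have Us: "subgroup U (Zn0 n)" using U by (simp add: fisub_Zn0_iff)
  have "of_bool (Zn0 n Mod U \<cong> G) = (\<Sum>M\<in>?S. of_bool (M = U) :: real)"
  proof -
    have "(\<Sum>M\<in>?S. of_bool (M = U) :: real) = (\<Sum>M\<in>?S. if M = U then 1 else 0)" by (intro sum.cong) auto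
    also have "\<dots> = (if U \<in> ?S then 1 else 0)" by (rule sum.delta[OF fq])
    also have "\<dots> = of_bool (Zn0 n Mod U \<cong> G)" using Us by (simp add: quot_subs_def)
    finally show ?thesis by simp
  qed
  then have "of_bool (Zn0 n Mod U \<cong> G) - quot_sum n G (sieve_main ?P m) U
      = (\<Sum>M\<in>?S. of_bool (M = U) - sieve_main ?P m (hom_count n M U))"
    unfolding quot_sum_def sum_subtractf by simp
  then have "\<bar>of_bool (Zn0 n Mod U \<cong> G) - quot_sum n G (sieve_main ?P m) U\<bar>
      \<le> (\<Sum>M\<in>?S. \<bar>of_bool (M = U) - sieve_main ?P m (hom_count n M U)\<bar>)" by (simp only: sum_abs)
  also have "\<dots> \<le> (\<Sum>M\<in>?S. sieve_err ?P m (hom_count n M U))"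
  proof (rule sum_mono)
    fix M assume "M \<in> ?S"
    then have M: "M \<in> quot_subs (Zn0 n) G" "U \<subseteq> M" by auto
    have Mf: "M \<in> fisub (zero_sum_vecs n)" using quot_subs_fisub(1)[OF M(1) G(2)] .
    have Ma: "addsub M" "M \<subseteq> zero_sum_vecs n" using Mf by (auto simp: fisub_def)
    have P: "Factorial_Ring.prime p" if "p \<in> ?P" for p using that by (rule in_prime_factors_imp_prime)
    have xp: "\<exists>r. hom_count n M U p = real p ^ r" if "p \<in> ?P" for p by (rule hom_count_power[OF n Mf M(2) P[OF that]])
    show "\<bar>of_bool (M = U) - sieve_main ?P m (hom_count n M U)\<bar> \<le> sieve_err ?P m (hom_count n M U)"
    proof (cases "M = U")
      case True
      have one: "hom_count n M U p = 1" if "p \<in> ?P" for p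
        unfolding hom_count_eq_1[OF n Mf M(2) P[OF that]] using True by (simp add: killed_homs_def)
      have "sieve_main ?P m (hom_count n M U) = 1 \<and> sieve_err ?P m (hom_count n M U) = 0"
      proof (rule sieve_bounds(1)[where x = "hom_count n M U", OF finite_set_mset])
        fix p assume p: "p \<in> ?P"
        show "Factorial_Ring.prime p" by (rule P[OF p])
        show "\<exists>r. hom_count n M U p = real p ^ r" by (rule xp[OF p])
        show "hom_count n M U p = 1" by (rule one[OF p])
      qed
      then show ?thesis using True by simp
    next
      case False
      have UM: "U \<in> fisub M" using fisub_trans_iff[OF Mf addsub_zero_sum_vecs] U M(2) by blast
      obtain q \<psi> where q: "Factorial_Ring.prime q" "q dvd a" "\<psi> \<in> killed_homs (Zn0 n) M q U" "\<exists>x\<in>M. \<psi> x \<noteq> 0"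
      proof (rule exists_mod_p_hom[where n = n, OF Ma(1) UM _ a], goal_cases)
        case 1 show ?case using False by simp
      next
        case (2 x) then show ?case using aU Ma(2) by blast
      next
        case (3 p \<psi>) show ?case by (rule 3(1)[OF 3(2-5)])
      qed
      have qP: "q \<in> ?P" using q(1,2) a by (simp add: in_prime_factors_iff)
      have ne: "hom_count n M U q \<noteq> 1" unfolding hom_count_eq_1[OF n Mf M(2) q(1)] using q(3,4) by blast
      have "\<bar>sieve_main ?P m (hom_count n M U)\<bar> \<le> sieve_err ?P m (hom_count n M U)"
      proof (rule sieve_bounds(2)[where x = "hom_count n M U", OF finite_set_mset _ _ qP ne])
        fix p assume p: "p \<in> ?P"
        show "Factorial_Ring.prime p" by (rule P[OF p])
        show "\<exists>r. hom_count n M U p = real p ^ r" by (rule xp[OF p])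
      qed
      then show ?thesis using False by simp
    qed
  qed
  finally show ?thesis unfolding quot_sum_def .
qed

text \<open>The mean of the pointwise bound. The encodings \<open>R\<close> and \<open>S\<close>
  make both sides functions of the moments alone.\<close>

lemma prob_sieve_bound:
  fixes P :: "'w pmf" and U :: "'w \<Rightarrow> (nat \<Rightarrow> int) set"
  assumes n: "n \<ge> 1" and G: "comm_group G" "finite (carrier G)" and a: "a > 0"
    and U: "\<And>w. w \<in> set_pmf P \<Longrightarrow> U w \<in> fisub (zero_sum_vecs n)"
    and aU: "\<And>w x. w \<in> set_pmf P \<Longrightarrow> x \<in> zero_sum_vecs n \<Longrightarrow> smul (int a) x \<in> U w"
    and R: "poly_vars_pos R" "sieve_main (prime_factors a) m = poly_eval R"
    and S: "poly_vars_pos S" "sieve_err (prime_factors a) m = poly_eval S"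
  shows "\<bar>measure_pmf.prob P {w. Zn0 n Mod U w \<cong> G} - poly_limit G (subgroup_moment n P U) R\<bar>
    \<le> poly_limit G (subgroup_moment n P U) S"
proof -
  let ?b = "\<lambda>w. indicator {w. Zn0 n Mod U w \<cong> G} w :: real"
  have ib: "integrable (measure_pmf P) ?b" by (auto intro!: integrable_real_indicator simp: measure_pmf.emeasure_eq_measure)
  note r = expectation_quot_sum[OF n G R(1), of P U] and s = expectation_quot_sum[OF n G S(1), of P U]
  have d: "measure_pmf.expectation P (\<lambda>w. ?b w - quot_sum n G (poly_eval R) (U w))
     = measure_pmf.prob P {w. Zn0 n Mod U w \<cong> G} - poly_limit G (subgroup_moment n P U) R"
    unfolding Bochner_Integration.integral_diff[OF ib r(1)] r(2) by simp
  have "\<bar>measure_pmf.prob P {w. Zn0 n Mod U w \<cong> G} - poly_limit G (subgroup_moment n P U) R\<bar>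
    \<le> measure_pmf.expectation P (\<lambda>w. \<bar>?b w - quot_sum n G (poly_eval R) (U w)\<bar>)"
    unfolding d[symmetric] by (rule integral_abs_bound)
  also have "\<dots> \<le> measure_pmf.expectation P (\<lambda>w. quot_sum n G (poly_eval S) (U w))"
  proof (rule integral_mono_AE)
    show "integrable (measure_pmf P) (\<lambda>w. \<bar>?b w - quot_sum n G (poly_eval R) (U w)\<bar>)"
      by (intro integrable_abs Bochner_Integration.integrable_diff ib r(1))
    show "integrable (measure_pmf P) (\<lambda>w. quot_sum n G (poly_eval S) (U w))" by (rule s(1))
    show "AE w in measure_pmf P. \<bar>?b w - quot_sum n G (poly_eval R) (U w)\<bar> \<le> quot_sum n G (poly_eval S) (U w)"
      unfolding AE_measure_pmf_iff
    proof
      fix w assume w: "w \<in> set_pmf P"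
      have "?b w = of_bool (Zn0 n Mod U w \<cong> G)" by (simp add: indicator_def)
      then show "\<bar>?b w - quot_sum n G (poly_eval R) (U w)\<bar> \<le> quot_sum n G (poly_eval S) (U w)"
        using sieve_pointwise[OF n G a U[OF w] aU[OF w], of m] unfolding R(2) S(2) by simp
    qed
  qed
  finally show ?thesis unfolding s(2) .
qed

section \<open>The sieve error in the explicit model\<close>

lemma fisub_Int:
  assumes A: "A \<in> fisub M" and B: "B \<in> fisub M"
  shows "A \<inter> B \<in> fisub M"
proof -
  have ab: "addsub A" "addsub B" using A B by (auto simp: fisub_def)
  have i: "addsub (A \<inter> B)" using ab by (auto simp: addsub_def)
  have "finite (coset_of (A \<inter> B) ` M)"
  proof (rule card_image_factor_le(1)[of "\<lambda>x. (coset_of A x, coset_of B x)"])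
    have "(\<lambda>x. (coset_of A x, coset_of B x)) ` M \<subseteq> coset_of A ` M \<times> coset_of B ` M" by auto
    then show "finite ((\<lambda>x. (coset_of A x, coset_of B x)) ` M)"
      by (rule finite_subset) (use A B in \<open>simp add: fisub_def\<close>)
    fix x y assume "(coset_of A x, coset_of B x) = (coset_of A y, coset_of B y)"
    then show "coset_of (A \<inter> B) x = coset_of (A \<inter> B) y"
      using coset_of_eq_iff[OF ab(1)] coset_of_eq_iff[OF ab(2)] coset_of_eq_iff[OF i] by simp
  qed
  then show ?thesis using i A by (auto simp: fisub_def)
qed

lemma fisub_INT:
  assumes "finite J" "addsub M" "\<And>p. p \<in> J \<Longrightarrow> K p \<in> fisub M"
  shows "M \<inter> (\<Inter>p\<in>J. K p) \<in> fisub M"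
  using assms(1,3)
proof (induction J rule: finite_induct)
  case empty
  then show ?case using full_fisub(1)[OF assms(2)] by simp
next
  case (insert q J)
  have e: "M \<inter> (\<Inter>p\<in>insert q J. K p) = K q \<inter> (M \<inter> (\<Inter>p\<in>J. K p))" by auto
  show ?case unfolding e
  proof (rule fisub_Int)
    show "K q \<in> fisub M" using insert.prems by simp
    show "M \<inter> (\<Inter>p\<in>J. K p) \<in> fisub M" by (rule insert.IH) (use insert.prems in simp)
  qed
qed

lemma prod_prime_powers_dvd:
  assumes "finite J" "\<And>p. p \<in> J \<Longrightarrow> Factorial_Ring.prime p" "\<And>p. p \<in> J \<Longrightarrow> p ^ k dvd (D::nat)"
  shows "(\<Prod>p\<in>J. p ^ k) dvd D"
  using assms
proof (induction J rule: finite_induct)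
  case (insert q J)
  have "coprime (q ^ k) (\<Prod>p\<in>J. p ^ k)"
  proof (rule prod_coprime_right)
    fix p assume p: "p \<in> J"
    have "coprime q p" by (rule primes_coprime) (use insert p in auto)
    then show "coprime (q ^ k) (p ^ k)" by simp
  qed
  moreover have "(\<Prod>p\<in>J. p ^ k) dvd D" using insert by simp
  moreover have "q ^ k dvd D" using insert by simp
  ultimately show ?case using insert(1,2) by (simp add: divides_mult)
qed simp

definition kernel_lists :: "nat \<Rightarrow> nat set \<Rightarrow> nat \<Rightarrow> (nat \<Rightarrow> int) set \<Rightarrow> (nat \<Rightarrow> ((nat \<Rightarrow> int) \<Rightarrow> int) list) set" where
  "kernel_lists n J k M = PiE J (\<lambda>p. indep_lists M (sub_homs (Zn0 n) M p) k)"

definition common_kernel :: "nat set \<Rightarrow> (nat \<Rightarrow> int) set \<Rightarrow> (nat \<Rightarrow> ((nat \<Rightarrow> int) \<Rightarrow> int) list) \<Rightarrow> (nat \<Rightarrow> int) set" where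
  "common_kernel J M l = M \<inter> (\<Inter>p\<in>J. list_kernel M (l p))"

lemma killed_homs_empty: "killed_homs F M p {} = sub_homs F M p"
  by (simp add: killed_homs_def)

text \<open>The locale with U = {} treats all homomorphisms on M. Lists killed by U are then
  selected from a set that does not depend on U, so randomness enters only through containment in a
  kernel.\<close>

lemma indep_lists_sub_homs:
  assumes n: "n \<ge> 1" and M: "M \<in> fisub (zero_sum_vecs n)" and p: "Factorial_Ring.prime p"
  shows "finite (indep_lists M (sub_homs (Zn0 n) M p) k)"
    "card (indep_lists M (sub_homs (Zn0 n) M p) k) \<le> (p ^ (n - 1)) ^ k"
    "l \<in> indep_lists M (sub_homs (Zn0 n) M p) k \<Longrightarrow> list_kernel M l \<in> fisub M \<and> idx M (list_kernel M l) = p ^ k"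
    "U \<subseteq> M \<Longrightarrow> excess_factor m p (hom_count n M U p)
       = real (card {l \<in> indep_lists M (sub_homs (Zn0 n) M p) (Suc m). U \<subseteq> list_kernel M l})"
proof -
  let ?V = "sub_homs (Zn0 n) M p"
  note fV = finite_sub_homs[OF n M prime_gt_0_nat[OF p]]
  have sub: "indep_lists M ?V k \<subseteq> {l. set l \<subseteq> ?V \<and> length l = k}" using indep_lists_set by blast
  show "finite (indep_lists M ?V k)" by (rule finite_subset[OF sub finite_lists_length_eq[OF fV(1)]])
  have "card (indep_lists M ?V k) \<le> card ?V ^ k"
    using card_mono[OF finite_lists_length_eq[OF fV(1)] sub] card_lists_length_eq[OF fV(1)] by simp
  also have "\<dots> \<le> (p ^ (n - 1)) ^ k" by (rule power_mono[OF fV(2)]) simp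
  finally show "card (indep_lists M ?V k) \<le> (p ^ (n - 1)) ^ k" .
  interpret E: mod_p_homs n p M "{}" by (rule mod_p_homs_Zn0[OF n M _ p]) simp
  have EV: "E.V = ?V" by (simp only: E.V_def killed_homs_empty)
  show "list_kernel M l \<in> fisub M \<and> idx M (list_kernel M l) = p ^ k" if "l \<in> indep_lists M ?V k"
    by (rule E.idx_list_kernel[unfolded EV, OF that])
  show "excess_factor m p (hom_count n M U p) = real (card {l \<in> indep_lists M ?V (Suc m). U \<subseteq> list_kernel M l})" if U: "U \<subseteq> M"
  proof -
    interpret H: mod_p_homs n p M U by (rule mod_p_homs_Zn0[OF n M U p])
    have "H.V = {\<psi>\<in>?V. \<forall>u\<in>U. \<psi> u = 0}" by (simp only: H.V_def killed_homs_def)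
    then have "indep_lists M H.V (Suc m) = {l \<in> indep_lists M ?V (Suc m). U \<subseteq> list_kernel M l}"
      by (simp only: indep_lists_killed[OF U])
    then show ?thesis using H.card_indep_lists[of "Suc m"] unfolding excess_factor_def hom_count_def H.V_def by (simp only:)
  qed
qed

text \<open>The index in M is divisible by p^k for every p in \<open>J\<close>, and these powers are
  pairwise coprime.\<close>

lemma common_kernel_index:
  assumes n: "n \<ge> 1" and M: "M \<in> fisub (zero_sum_vecs n)" and J: "finite J" "\<And>p. p \<in> J \<Longrightarrow> Factorial_Ring.prime p"
    and l: "l \<in> kernel_lists n J k M"
  shows "common_kernel J M l \<in> fisub (zero_sum_vecs n)"
    "idx (zero_sum_vecs n) (common_kernel J M l) \<ge> idx (zero_sum_vecs n) M * (\<Prod>p\<in>J. p ^ k)"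
proof -
  let ?K = "common_kernel J M l"
  have Ma: "addsub M" using M by (simp add: fisub_def)
  have lp: "list_kernel M (l p) \<in> fisub M \<and> idx M (list_kernel M (l p)) = p ^ k" if "p \<in> J" for p
    by (rule indep_lists_sub_homs(3)[OF n M J(2)[OF that]]) (use l that in \<open>auto simp: kernel_lists_def\<close>)
  have KM: "?K \<in> fisub M" unfolding common_kernel_def using lp by (intro fisub_INT[OF J(1) Ma]) blast
  then show KF: "?K \<in> fisub (zero_sum_vecs n)" using fisub_trans_iff[OF M addsub_zero_sum_vecs] by blast
  have Ka: "addsub ?K" "?K \<subseteq> M" using KM by (auto simp: fisub_def)
  have "(\<Prod>p\<in>J. p ^ k) dvd idx M ?K"
  proof (rule prod_prime_powers_dvd[OF J])
    fix p assume p: "p \<in> J"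
    have "?K \<subseteq> list_kernel M (l p)" unfolding common_kernel_def using p by blast
    then have "idx M ?K = idx M (list_kernel M (l p)) * idx (list_kernel M (l p)) ?K"
      using idx_tower(2)[OF _ Ka(1) _ Ma] lp[OF p] by blast
    then show "p ^ k dvd idx M ?K" using lp[OF p] by simp
  qed
  moreover have "idx M ?K > 0" using idx_pos[OF KM] addsub_0[OF Ma] by blast
  ultimately have "(\<Prod>p\<in>J. p ^ k) \<le> idx M ?K" by (simp add: dvd_imp_le)
  then show "idx (zero_sum_vecs n) ?K \<ge> idx (zero_sum_vecs n) M * (\<Prod>p\<in>J. p ^ k)"
    using idx_tower(2)[OF M Ka addsub_zero_sum_vecs] by simp
qed

lemma card_kernel_lists:
  assumes n: "n \<ge> 1" and M: "M \<in> fisub (zero_sum_vecs n)" and J: "finite J" "\<And>p. p \<in> J \<Longrightarrow> Factorial_Ring.prime p"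
  shows "finite (kernel_lists n J k M)" "card (kernel_lists n J k M) \<le> (\<Prod>p\<in>J. p ^ k) ^ (n - 1)"
proof -
  show "finite (kernel_lists n J k M)" unfolding kernel_lists_def
    by (intro finite_PiE J(1) indep_lists_sub_homs(1)[OF n M J(2)])
  have "card (kernel_lists n J k M) = (\<Prod>p\<in>J. card (indep_lists M (sub_homs (Zn0 n) M p) k))"
    unfolding kernel_lists_def by (rule card_PiE[OF J(1)])
  also have "\<dots> \<le> (\<Prod>p\<in>J. (p ^ (n - 1)) ^ k)" by (intro prod_mono conjI indep_lists_sub_homs(2)[OF n M J(2)]) simp_all
  also have "\<dots> = (\<Prod>p\<in>J. p ^ k) ^ (n - 1)" by (simp add: prod_power_distrib[symmetric] power_mult[symmetric] mult.commute)
  finally show "card (kernel_lists n J k M) \<le> (\<Prod>p\<in>J. p ^ k) ^ (n - 1)" .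
qed

text \<open>The product counts families of lists killed by U. Replacing U by the smaller N can only
  increase the count, and for N the containment probabilities are known exactly.\<close>

lemma prod_excess_le:
  assumes n: "n \<ge> 1" and M: "M \<in> fisub (zero_sum_vecs n)" and J: "finite J" "\<And>p. p \<in> J \<Longrightarrow> Factorial_Ring.prime p"
    and U: "U \<subseteq> M" "N \<subseteq> U"
  shows "(\<Prod>p\<in>J. excess_factor m p (hom_count n M U p)) \<le> (\<Sum>l\<in>kernel_lists n J (Suc m) M. indicator {N. N \<subseteq> common_kernel J M l} N)"
proof -
  let ?I = "\<lambda>p. indep_lists M (sub_homs (Zn0 n) M p) (Suc m)"
  let ?L = "kernel_lists n J (Suc m) M"
  let ?B = "PiE J (\<lambda>p. {l \<in> ?I p. U \<subseteq> list_kernel M l})"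
  have finL: "finite ?L" by (rule card_kernel_lists(1)[OF n M J])
  have "(\<Prod>p\<in>J. excess_factor m p (hom_count n M U p)) = (\<Prod>p\<in>J. real (card {l \<in> ?I p. U \<subseteq> list_kernel M l}))"
    by (rule prod.cong[OF refl]) (rule indep_lists_sub_homs(4)[OF n M J(2) U(1)])
  also have "\<dots> = real (card ?B)" by (simp add: card_PiE[OF J(1)])
  also have "\<dots> \<le> real (card {l\<in>?L. N \<subseteq> common_kernel J M l})"
  proof -
    have "?B \<subseteq> {l\<in>?L. N \<subseteq> common_kernel J M l}"
    proof
      fix l assume l: "l \<in> ?B"
      have "l \<in> ?L" unfolding kernel_lists_def using l by (auto simp: PiE_iff)
      moreover have "N \<subseteq> list_kernel M (l p)" if "p \<in> J" for p using l that U(2) by (auto simp: PiE_iff)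
      ultimately show "l \<in> {l\<in>?L. N \<subseteq> common_kernel J M l}" using U by (auto simp: common_kernel_def)
    qed
    then show ?thesis using finL by (simp add: card_mono)
  qed
  also have "\<dots> = (\<Sum>l\<in>?L. indicator {N. N \<subseteq> common_kernel J M l} N)"
    using finL by (simp add: indicator_def sum.If_cases Int_def)
  finally show ?thesis .
qed

lemma card_quot_subs_Zn0:
  assumes n: "n \<ge> 1" and G: "comm_group G" "finite (carrier G)"
  shows "finite (quot_subs (Zn0 n) G)" "card (quot_subs (Zn0 n) G) \<le> card (carrier G) ^ (n - 1)"
proof -
  have Gg: "group G" using G(1) comm_group.axioms(2) by blast
  note H = comm_group.card_Homs_Zn0[OF G(1) n G(2)]
  show "finite (quot_subs (Zn0 n) G)" by (rule finite_quot_subs[OF comm_group_Zn0 Gg H(1)])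
  have "quot_subs (Zn0 n) G \<subseteq> kernel (Zn0 n) G ` Homs (Zn0 n) G"
  proof
    fix M assume "M \<in> quot_subs (Zn0 n) G"
    then obtain f where "f \<in> Surs (Zn0 n) G" "kernel (Zn0 n) G f = M" using quot_subs_Surs[OF comm_group_Zn0 Gg] by blast
    then show "M \<in> kernel (Zn0 n) G ` Homs (Zn0 n) G" by (auto simp: Surs_def)
  qed
  then have "card (quot_subs (Zn0 n) G) \<le> card (Homs (Zn0 n) G)" by (rule surj_card_le[OF H(1)])
  then show "card (quot_subs (Zn0 n) G) \<le> card (carrier G) ^ (n - 1)" using H(2) by simp
qed

text \<open>With g = |G| and q the product of the p^k, there are at most g^(n - 1) subgroups M and
  q^(n - 1) families of lists for each, while each common kernel has index at least g q and so
  probability at most (g q)^(-n). Since the exponent n exceeds the rank by one, a factor 1 / (g q)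
  survives, uniformly in n; q \<ge> 2^k as \<open>J\<close> is nonempty.\<close>

lemma sum_prob_common_kernel:
  assumes n: "n \<ge> 1" and G: "comm_group G" "finite (carrier G)"
    and J: "finite J" "\<And>p. p \<in> J \<Longrightarrow> Factorial_Ring.prime p" "J \<noteq> {}"
  shows "(\<Sum>M\<in>quot_subs (Zn0 n) G. \<Sum>l\<in>kernel_lists n J k M. measure_pmf.prob (subgroup_pmf n) {N. N \<subseteq> common_kernel J M l}) \<le> (1 / 2) ^ k"
proof -
  let ?g = "real (card (carrier G))" and ?q = "real (\<Prod>p\<in>J. p ^ k)"
  interpret G: comm_group G by (rule G(1))
  have g1: "?g \<ge> 1"
  proof -
    have "card (carrier G) > 0" using G(2) G.one_closed card_gt_0_iff by blast
    then show ?thesis by simp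
  qed
  have q2: "?q \<ge> 2 ^ k"
  proof -
    obtain p where p: "p \<in> J" using J(3) by blast
    have "(2::nat) ^ k \<le> p ^ k" by (rule power_mono) (use prime_ge_2_nat[OF J(2)[OF p]] in auto)
    also have "p ^ k dvd (\<Prod>p\<in>J. p ^ k)" by (rule dvd_prodI[OF J(1) p])
    then have "p ^ k \<le> (\<Prod>p\<in>J. p ^ k)" by (rule dvd_imp_le) (use J(2) prime_gt_0_nat in \<open>auto intro!: prod_pos\<close>)
    finally have "real (2 ^ k) \<le> ?q" by (simp only: of_nat_le_iff)
    then show ?thesis by simp
  qed
  have q0: "?q > 0" using q2 by (smt (verit) zero_less_power)
  have pr: "measure_pmf.prob (subgroup_pmf n) {N. N \<subseteq> common_kernel J M l} \<le> (1 / (?g * ?q)) ^ n"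
    if M: "M \<in> quot_subs (Zn0 n) G" and l: "l \<in> kernel_lists n J k M" for M l
  proof -
    note Mf = quot_subs_fisub[OF M G(2)]
    have c1: "common_kernel J M l \<in> fisub (zero_sum_vecs n)" by (rule common_kernel_index(1)[OF n Mf(1) J(1,2) l])
    have c2: "idx (zero_sum_vecs n) (common_kernel J M l) \<ge> idx (zero_sum_vecs n) M * (\<Prod>p\<in>J. p ^ k)"
      by (rule common_kernel_index(2)[OF n Mf(1) J(1,2) l])
    have "?g * ?q \<le> real (idx (zero_sum_vecs n) (common_kernel J M l))"
      using c2 unfolding Mf(2) by (metis of_nat_le_iff of_nat_mult)
    moreover have "?g * ?q > 0" using g1 q0 by simp
    ultimately show ?thesis unfolding prob_subgroup_pmf[OF n c1] by (intro power_mono divide_left_mono) auto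
  qed
  have "(\<Sum>M\<in>quot_subs (Zn0 n) G. \<Sum>l\<in>kernel_lists n J k M. measure_pmf.prob (subgroup_pmf n) {N. N \<subseteq> common_kernel J M l})
     \<le> (\<Sum>M\<in>quot_subs (Zn0 n) G. \<Sum>l\<in>kernel_lists n J k M. (1 / (?g * ?q)) ^ n)"
    by (intro sum_mono pr)
  also have "\<dots> \<le> (\<Sum>M\<in>quot_subs (Zn0 n) G. ?q ^ (n - 1) * (1 / (?g * ?q)) ^ n)"
  proof (rule sum_mono)
    fix M assume M: "M \<in> quot_subs (Zn0 n) G"
    have "real (card (kernel_lists n J k M)) \<le> real ((\<Prod>p\<in>J. p ^ k) ^ (n - 1))"
      using card_kernel_lists(2)[OF n quot_subs_fisub(1)[OF M G(2)] J(1,2)] by (simp only: of_nat_le_iff)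
    then have "real (card (kernel_lists n J k M)) * (1 / (?g * ?q)) ^ n \<le> ?q ^ (n - 1) * (1 / (?g * ?q)) ^ n"
      using g1 q0 by (intro mult_right_mono) auto
    then show "(\<Sum>l\<in>kernel_lists n J k M. (1 / (?g * ?q)) ^ n) \<le> ?q ^ (n - 1) * (1 / (?g * ?q)) ^ n"
      by (simp only: sum_constant)
  qed
  also have "\<dots> = real (card (quot_subs (Zn0 n) G)) * (?q ^ (n - 1) * (1 / (?g * ?q)) ^ n)" by (simp only: sum_constant)
  also have "\<dots> \<le> ?g ^ (n - 1) * (?q ^ (n - 1) * (1 / (?g * ?q)) ^ n)"
  proof (rule mult_right_mono)
    have "real (card (quot_subs (Zn0 n) G)) \<le> real (card (carrier G) ^ (n - 1))"
      using card_quot_subs_Zn0(2)[OF n G] by (simp only: of_nat_le_iff)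
    then show "real (card (quot_subs (Zn0 n) G)) \<le> ?g ^ (n - 1)" by simp
  qed (use g1 q0 in auto)
  also have "\<dots> = 1 / (?g * ?q)"
  proof -
    obtain j where j: "n = Suc j" using n by (cases n) auto
    show ?thesis unfolding j using g1 q0 by (simp add: field_simps power_mult_distrib del: of_nat_prod)
  qed
  also have "\<dots> \<le> 1 / 2 ^ k"
  proof -
    have "1 * 2 ^ k \<le> ?g * ?q" by (rule mult_mono[OF g1 q2]) (use g1 in auto)
    then show ?thesis by (intro divide_left_mono) (use g1 q0 in auto)
  qed
  finally show ?thesis by (simp add: power_divide)
qed

text \<open>Each nonempty set of primes dividing \<open>a\<close> contributes at most 2^(-(m + 1)),
  by \<open>sum_prob_common_kernel\<close> with lists of length m + 1; the power of 2 in front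
  bounds the number of these sets.\<close>

lemma expectation_sieve_err_le:
  assumes n: "n \<ge> 1" and G: "comm_group G" "finite (carrier G)" and a: "a > 0"
  shows "measure_pmf.expectation (subgroup_pmf n) (\<lambda>N. quot_sum n G (sieve_err (prime_factors a) m) (mod_a_span n a N))
    \<le> 2 ^ card (prime_factors a) * (1 / 2) ^ Suc m"
proof -
  let ?P = "prime_factors a"
  define \<J> where "\<J> = Pow ?P - {{}}"
  have fJ: "finite \<J>" by (simp add: \<J>_def)
  have JD: "finite J" "\<And>p. p \<in> J \<Longrightarrow> Factorial_Ring.prime p" "J \<noteq> {}" if "J \<in> \<J>" for J
    using that finite_subset[of J ?P] by (auto simp: \<J>_def)
  let ?Q = "quot_subs (Zn0 n) G"
  have fQ: "finite ?Q" by (rule card_quot_subs_Zn0(1)[OF n G])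
  let ?f = "\<lambda>N. \<Sum>J\<in>\<J>. \<Sum>M\<in>?Q. \<Sum>l\<in>kernel_lists n J (Suc m) M. indicator {N. N \<subseteq> common_kernel J M l} N :: real"
  have expand: "sieve_err ?P m x = (\<Sum>J\<in>\<J>. \<Prod>p\<in>J. excess_factor m p (x p))" for x
  proof -
    have "(\<Prod>p\<in>?P. excess_factor m p (x p) + 1) = (\<Sum>J\<in>Pow ?P. \<Prod>p\<in>J. excess_factor m p (x p))"
      by (subst prod_add) simp_all
    also have "\<dots> = (\<Prod>p\<in>{}. excess_factor m p (x p)) + (\<Sum>J\<in>\<J>. \<Prod>p\<in>J. excess_factor m p (x p))"
      unfolding \<J>_def by (rule sum.remove) auto
    finally show ?thesis unfolding sieve_err_def by (simp add: add.commute)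
  qed
  have le: "quot_sum n G (sieve_err ?P m) (mod_a_span n a N) \<le> ?f N" if N: "N \<in> set_pmf (subgroup_pmf n)" for N
  proof -
    let ?U = "mod_a_span n a N"
    let ?S = "{M\<in>?Q. ?U \<subseteq> M}"
    have Ns: "subgroup N (Zn0 n)" using subgroup_pmf_set[OF n N] by (simp add: fisub_Zn0_iff)
    have NU: "N \<subseteq> ?U" by (rule mod_a_span_props(4)[OF a Ns])
    have "quot_sum n G (sieve_err ?P m) ?U = (\<Sum>J\<in>\<J>. \<Sum>M\<in>?S. \<Prod>p\<in>J. excess_factor m p (hom_count n M ?U p))"
      unfolding quot_sum_def expand by (rule sum.swap)
    also have "\<dots> \<le> ?f N"
    proof (rule sum_mono)
      fix J assume J: "J \<in> \<J>"
      have "(\<Sum>M\<in>?S. \<Prod>p\<in>J. excess_factor m p (hom_count n M ?U p))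
        \<le> (\<Sum>M\<in>?S. \<Sum>l\<in>kernel_lists n J (Suc m) M. indicator {N. N \<subseteq> common_kernel J M l} N)"
      proof (rule sum_mono)
        fix M assume "M \<in> ?S"
        then have M: "M \<in> ?Q" "?U \<subseteq> M" by auto
        show "(\<Prod>p\<in>J. excess_factor m p (hom_count n M ?U p)) \<le> (\<Sum>l\<in>kernel_lists n J (Suc m) M. indicator {N. N \<subseteq> common_kernel J M l} N)"
          by (rule prod_excess_le[OF n quot_subs_fisub(1)[OF M(1) G(2)] JD(1,2)[OF J] M(2) NU])
      qed
      also have "\<dots> \<le> (\<Sum>M\<in>?Q. \<Sum>l\<in>kernel_lists n J (Suc m) M. indicator {N. N \<subseteq> common_kernel J M l} N)"
        by (rule sum_mono2[OF fQ]) (auto intro: sum_nonneg)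
      finally show "(\<Sum>M\<in>?S. \<Prod>p\<in>J. excess_factor m p (hom_count n M ?U p))
        \<le> (\<Sum>M\<in>?Q. \<Sum>l\<in>kernel_lists n J (Suc m) M. indicator {N. N \<subseteq> common_kernel J M l} N)" .
    qed
    finally show ?thesis .
  qed
  have int: "integrable (measure_pmf (subgroup_pmf n)) (indicator {N. N \<subseteq> T} :: _ \<Rightarrow> real)" for T
    by (auto intro!: integrable_real_indicator simp: measure_pmf.emeasure_eq_measure)
  have "measure_pmf.expectation (subgroup_pmf n) (\<lambda>N. quot_sum n G (sieve_err ?P m) (mod_a_span n a N))
     \<le> measure_pmf.expectation (subgroup_pmf n) ?f"
  proof (rule integral_mono_AE')
    show "integrable (measure_pmf (subgroup_pmf n)) ?f" by (intro Bochner_Integration.integrable_sum int)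
    show "AE N in measure_pmf (subgroup_pmf n). quot_sum n G (sieve_err ?P m) (mod_a_span n a N) \<le> ?f N"
      unfolding AE_measure_pmf_iff using le by blast
    show "AE N in measure_pmf (subgroup_pmf n). 0 \<le> ?f N" by (intro AE_I2 sum_nonneg) simp
  qed
  also have "\<dots> = (\<Sum>J\<in>\<J>. \<Sum>M\<in>?Q. \<Sum>l\<in>kernel_lists n J (Suc m) M. measure_pmf.prob (subgroup_pmf n) {N. N \<subseteq> common_kernel J M l})"
    by (simp add: Bochner_Integration.integral_sum int Bochner_Integration.integrable_sum)
  also have "\<dots> \<le> (\<Sum>J\<in>\<J>. (1 / 2) ^ Suc m)"
    by (rule sum_mono) (rule sum_prob_common_kernel[OF n G JD])
  also have "\<dots> = real (card \<J>) * (1 / 2) ^ Suc m" by (simp only: sum_constant)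
  also have "\<dots> \<le> 2 ^ card ?P * (1 / 2) ^ Suc m"
  proof (rule mult_right_mono)
    have "card \<J> \<le> card (Pow ?P)" unfolding \<J>_def by (intro card_mono) auto
    then have "real (card \<J>) \<le> real (2 ^ card ?P)" by (simp only: of_nat_le_iff card_Pow[OF finite_set_mset])
    then show "real (card \<J>) \<le> 2 ^ card ?P" by simp
  qed simp
  finally show ?thesis .
qed

section \<open>Convergence\<close>

text \<open>In both models the probability is within the mean error of the mean main term. Main
  terms and errors have the same limits in the two models, because they are the same functionals of
  the moments.\<close>

lemma prob_difference_tendsto_0:
  assumes eps: "eps > 0" and bal: "\<And>n. n \<ge> 1 \<Longrightarrow> eps_balanced_digraph n eps (\<Gamma> n)"
    and G: "comm_group G" "finite (carrier G)" and a: "a > 0"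
  shows "(\<lambda>n. measure_pmf.prob (\<Gamma> n) {D. Zn0 n Mod mod_a_span n a (laplacian_image n D) \<cong> G}
    - measure_pmf.prob (subgroup_pmf n) {N. Zn0 n Mod mod_a_span n a N \<cong> G}) \<longlonglongrightarrow> 0"
proof (rule LIMSEQ_I)
  fix r :: real assume r: "r > 0"
  let ?P = "prime_factors a"
  \<comment> \<open>The sieve level is fixed before n grows: the bound of
    \<open>expectation_sieve_err_le\<close> is uniform in n and tends to 0 with m.\<close>
  have "(\<lambda>m. 2 ^ card ?P * (1 / 2 :: real) ^ Suc m) \<longlonglongrightarrow> 2 ^ card ?P * 0"
    by (intro tendsto_mult tendsto_const LIMSEQ_Suc LIMSEQ_realpow_zero) auto
  then have "\<forall>\<^sub>F m in sequentially. 2 ^ card ?P * (1 / 2 :: real) ^ Suc m < r / 2"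
    using r by (intro order_tendstoD(2)[where y = "2 ^ card ?P * 0"]) auto
  then obtain m where m: "2 ^ card ?P * (1 / 2 :: real) ^ Suc m < r / 2" by (auto simp: eventually_sequentially)
  have P0: "p > 0" if "p \<in> ?P" for p using prime_gt_0_nat[OF in_prime_factors_imp_prime[OF that]] .
  obtain R where R: "poly_vars_pos R" "sieve_main ?P m = poly_eval R"
    using is_poly_sieve_main[OF finite_set_mset P0] unfolding is_poly_def by blast
  obtain S where S: "poly_vars_pos S" "sieve_err ?P m = poly_eval S"
    using is_poly_sieve_err[OF finite_set_mset P0] unfolding is_poly_def by blast
  let ?A = "\<lambda>n. subgroup_moment n (\<Gamma> n) (\<lambda>D. mod_a_span n a (laplacian_image n D))"
  let ?B = "\<lambda>n. subgroup_moment n (subgroup_pmf n) (\<lambda>N. mod_a_span n a N)"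
  have A: "(\<lambda>n. poly_limit G (?A n) T) \<longlonglongrightarrow> poly_limit G (limit_moment a) T" for T
    by (rule tendsto_poly_limit) (rule subgroup_moment_laplacian_tendsto[OF eps bal])
  have B: "(\<lambda>n. poly_limit G (?B n) T) \<longlonglongrightarrow> poly_limit G (limit_moment a) T" for T
    by (rule tendsto_poly_limit) (rule subgroup_moment_pmf_tendsto)
  \<comment> \<open>The limiting mean error is common to both models, so it can be bounded in the
    explicit one; this controls the digraphs as well.\<close>
  have "poly_limit G (limit_moment a) S \<le> 2 ^ card ?P * (1 / 2 :: real) ^ Suc m"
  proof (rule LIMSEQ_le_const2[OF B])
    have "poly_limit G (?B n) S \<le> 2 ^ card ?P * (1 / 2 :: real) ^ Suc m" if n: "n \<ge> 1" for n
      using expectation_sieve_err_le[OF n G a, of m] expectation_quot_sum(2)[OF n G S(1), of "subgroup_pmf n" "\<lambda>N. mod_a_span n a N"]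
      unfolding S(2) by simp
    then show "\<exists>N. \<forall>n\<ge>N. poly_limit G (?B n) S \<le> 2 ^ card ?P * (1 / 2 :: real) ^ Suc m" by blast
  qed
  then have small: "2 * poly_limit G (limit_moment a) S < r" using m by simp
  have lim: "(\<lambda>n. \<bar>poly_limit G (?A n) R - poly_limit G (?B n) R\<bar> + poly_limit G (?A n) S + poly_limit G (?B n) S)
     \<longlonglongrightarrow> \<bar>poly_limit G (limit_moment a) R - poly_limit G (limit_moment a) R\<bar> + poly_limit G (limit_moment a) S + poly_limit G (limit_moment a) S"
    by (intro tendsto_add tendsto_rabs tendsto_diff A B)
  have "\<forall>\<^sub>F n in sequentially. \<bar>poly_limit G (?A n) R - poly_limit G (?B n) R\<bar> + poly_limit G (?A n) S + poly_limit G (?B n) S < r"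
    by (rule order_tendstoD(2)[OF lim]) (use small in simp)
  then obtain n0 where n0: "\<And>n. n \<ge> n0 \<Longrightarrow> \<bar>poly_limit G (?A n) R - poly_limit G (?B n) R\<bar> + poly_limit G (?A n) S + poly_limit G (?B n) S < r"
    by (auto simp: eventually_sequentially)
  show "\<exists>no. \<forall>n\<ge>no. norm (measure_pmf.prob (\<Gamma> n) {D. Zn0 n Mod mod_a_span n a (laplacian_image n D) \<cong> G}
    - measure_pmf.prob (subgroup_pmf n) {N. Zn0 n Mod mod_a_span n a N \<cong> G} - 0) < r"
  proof (intro exI[of _ "max n0 1"] allI impI)
    fix n assume "max n0 1 \<le> n"
    then have n: "n \<ge> 1" "n \<ge> n0" by auto
    have sB: "subgroup N (Zn0 n)" if "N \<in> set_pmf (subgroup_pmf n)" for N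
      using subgroup_pmf_set[OF n(1) that] by (simp add: fisub_Zn0_iff)
    note mA = mod_a_span_props[OF a subgroup_laplacian_image] and mB = mod_a_span_props[OF a sB]
    have bA: "\<bar>measure_pmf.prob (\<Gamma> n) {D. Zn0 n Mod mod_a_span n a (laplacian_image n D) \<cong> G} - poly_limit G (?A n) R\<bar> \<le> poly_limit G (?A n) S"
      by (rule prob_sieve_bound[OF n(1) G a _ _ R S]) (rule mA(2), rule mA(3))
    have bB: "\<bar>measure_pmf.prob (subgroup_pmf n) {N. Zn0 n Mod mod_a_span n a N \<cong> G} - poly_limit G (?B n) R\<bar> \<le> poly_limit G (?B n) S"
      by (rule prob_sieve_bound[OF n(1) G a _ _ R S]) (erule mB(2), erule mB(3))
    show "norm (measure_pmf.prob (\<Gamma> n) {D. Zn0 n Mod mod_a_span n a (laplacian_image n D) \<cong> G}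
      - measure_pmf.prob (subgroup_pmf n) {N. Zn0 n Mod mod_a_span n a N \<cong> G} - 0) < r"
      using n0[OF n(2)] bA bB unfolding real_norm_def by linarith
  qed
qed

section \<open>Convergence of the explicit model to Y\<close>

definition quot_class :: "nat \<Rightarrow> (nat \<Rightarrow> int) set \<Rightarrow> nat monoid set" where
  "quot_class n N = (SOME C. C \<in> fin_ab_iso_classes \<and> Zn0 n Mod N \<cong> class_rep C)"

lemma quot_class:
  assumes "N \<in> fisub (zero_sum_vecs n)"
  shows "quot_class n N \<in> fin_ab_iso_classes" "Zn0 n Mod N \<cong> class_rep (quot_class n N)"
    "C \<in> fin_ab_iso_classes \<Longrightarrow> quot_class n N = C \<longleftrightarrow> N \<in> quot_subs (Zn0 n) (class_rep C)"
proof -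
  have N: "subgroup N (Zn0 n)" "finite (carrier (Zn0 n Mod N))" using assms by (auto simp: fisub_Zn0_iff)
  have cg: "comm_group (Zn0 n Mod N)" by (rule comm_group.abelian_FactGroup[OF comm_group_Zn0 N(1)])
  have "\<exists>C. C \<in> fin_ab_iso_classes \<and> Zn0 n Mod N \<cong> class_rep C"
    by (rule class_exists[OF cg N(2)]) (intro exI conjI)
  from someI_ex[OF this] show q: "quot_class n N \<in> fin_ab_iso_classes" "Zn0 n Mod N \<cong> class_rep (quot_class n N)"
    unfolding quot_class_def by simp_all
  show "quot_class n N = C \<longleftrightarrow> N \<in> quot_subs (Zn0 n) (class_rep C)" if C: "C \<in> fin_ab_iso_classes"
  proof
    show "N \<in> quot_subs (Zn0 n) (class_rep C)" if "quot_class n N = C" using q(2) N(1) that by (simp add: quot_subs_def)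
    assume "N \<in> quot_subs (Zn0 n) (class_rep C)"
    then have "Zn0 n Mod N \<cong> class_rep C" by (simp add: quot_subs_def)
    then show "quot_class n N = C" by (rule class_unique[OF comm_group.axioms(2)[OF cg] q(1) C q(2)])
  qed
qed

definition sur_ratio :: "nat \<Rightarrow> nat monoid set \<Rightarrow> real" where
  "sur_ratio n C = real (card (Surs (Zn0 n) (class_rep C))) / real (card (carrier (class_rep C))) ^ (n - 1)"

lemma sur_ratio:
  assumes C: "C \<in> fin_ab_iso_classes"
  shows "(\<lambda>n. sur_ratio n C) \<longlonglongrightarrow> 1" "n \<ge> 1 \<Longrightarrow> sur_ratio n C \<le> 1" "sur_ratio n C \<ge> 0"
proof -
  note K = fin_ab_groupsD(1,3)[OF class_rep(2)[OF C]]
  show "(\<lambda>n. sur_ratio n C) \<longlonglongrightarrow> 1" unfolding sur_ratio_def by (rule card_Surs_Zn0_tendsto(1)[OF K])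
  show "sur_ratio n C \<le> 1" if "n \<ge> 1" unfolding sur_ratio_def by (rule card_Surs_Zn0_tendsto(2)[OF K that])
  show "sur_ratio n C \<ge> 0" by (simp add: sur_ratio_def)
qed

text \<open>There are |Sur(F, K)| / |Aut K| subgroups with quotient K, each of weight |K|^(-n) over
  the zeta product. Multiplying by that product and by Q leaves the weight of Y times a ratio
  tending to 1.\<close>

lemma pmf_quot_class:
  assumes n: "n \<ge> 1" and C: "C \<in> fin_ab_iso_classes"
  shows "Q_const * zeta_prod (n - 1) * pmf (map_pmf (quot_class n) (subgroup_pmf n)) C = Y_weight (class_rep C) * sur_ratio n C"
proof -
  let ?K = "class_rep C"
  note K = class_rep(2)[OF C]
  note Kd = fin_ab_groupsD[OF K]
  let ?k = "real (card (carrier ?K))"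
  let ?Q = "quot_subs (Zn0 n) ?K"
  have fQ: "finite ?Q" by (rule card_quot_subs_Zn0(1)[OF n Kd(1,3)])
  have "pmf (map_pmf (quot_class n) (subgroup_pmf n)) C = measure_pmf.prob (subgroup_pmf n) (quot_class n -` {C})" by (rule pmf_map)
  also have "\<dots> = measure_pmf.prob (subgroup_pmf n) ?Q"
    by (rule measure_pmf.finite_measure_eq_AE)
       (use quot_class(3)[OF subgroup_pmf_set[OF n] C] in \<open>auto simp: AE_measure_pmf_iff\<close>)
  also have "\<dots> = (\<Sum>M\<in>?Q. pmf (subgroup_pmf n) M)" by (rule measure_measure_pmf_finite[OF fQ])
  also have "\<dots> = (\<Sum>M\<in>?Q. (1 / ?k) ^ n / zeta_prod (n - 1))"
    using quot_subs_fisub[OF _ Kd(3), of _ n] by (intro sum.cong refl) (simp add: pmf_subgroup_pmf[OF n] subgroup_weight_def)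
  also have "\<dots> = (\<Sum>f\<in>Surs (Zn0 n) ?K. (1 / ?k) ^ n / zeta_prod (n - 1)) / real (card (auto ?K))"
    by (rule sum_quot_subs_Zn0[OF Kd(1,3) n])
  also have "\<dots> = real (card (Surs (Zn0 n) ?K)) * ((1 / ?k) ^ n / zeta_prod (n - 1)) / real (card (auto ?K))"
    by (simp only: sum_constant)
  also have "(1 / ?k) ^ n = 1 / ?k ^ (n - 1) / ?k" using n by (cases n) (auto simp: power_divide)
  finally have e: "pmf (map_pmf (quot_class n) (subgroup_pmf n)) C
     = real (card (Surs (Zn0 n) ?K)) * (1 / ?k ^ (n - 1) / ?k / zeta_prod (n - 1)) / real (card (auto ?K))" .
  show ?thesis unfolding e Y_weight_def sur_ratio_def using zeta_prod_pos[of "n - 1"] by simp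
qed

lemma Y_weight_nonneg: "Y_weight H \<ge> 0"
  using Q_const_zeta_prod(2) by (simp add: Y_weight_def)

text \<open>Finite sums of weights are limits of probabilities in the explicit model, up to a
  normaliser tending to 1. This bounds all finite sums and makes the sums over classes
  converge.\<close>

lemma sum_Y_weight_le_1:
  assumes S: "finite S" "S \<subseteq> fin_ab_iso_classes"
  shows "(\<Sum>C\<in>S. Y_weight (class_rep C)) \<le> 1"
proof -
  have "(\<lambda>n. \<Sum>C\<in>S. Y_weight (class_rep C) * sur_ratio n C) \<longlonglongrightarrow> (\<Sum>C\<in>S. Y_weight (class_rep C) * 1)"
    using S(2) by (intro tendsto_sum tendsto_mult tendsto_const sur_ratio(1)) blast
  moreover have "(\<lambda>n. Q_const * zeta_prod (n - 1)) \<longlonglongrightarrow> 1"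
    by (rule filterlim_sequentially_Suc[THEN iffD1]) (simp add: Q_const_zeta_prod(1))
  moreover have "(\<Sum>C\<in>S. Y_weight (class_rep C) * sur_ratio n C) \<le> Q_const * zeta_prod (n - 1)" if n: "n \<ge> 1" for n
  proof -
    let ?p = "map_pmf (quot_class n) (subgroup_pmf n)"
    have "(\<Sum>C\<in>S. Y_weight (class_rep C) * sur_ratio n C) = Q_const * zeta_prod (n - 1) * (\<Sum>C\<in>S. pmf ?p C)"
      unfolding sum_distrib_left using pmf_quot_class[OF n] S(2) by (intro sum.cong refl) (auto simp: subset_iff)
    also have "(\<Sum>C\<in>S. pmf ?p C) = measure_pmf.prob ?p S" by (rule measure_measure_pmf_finite[OF S(1), symmetric])
    also have "Q_const * zeta_prod (n - 1) * \<dots> \<le> Q_const * zeta_prod (n - 1) * 1"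
      using Q_const_zeta_prod(2) zeta_prod_pos[of "n - 1"] by (intro mult_left_mono measure_pmf.prob_le_1) simp
    finally show ?thesis by simp
  qed
  ultimately have "(\<Sum>C\<in>S. Y_weight (class_rep C) * 1) \<le> 1"
    by (intro LIMSEQ_le[of "\<lambda>n. \<Sum>C\<in>S. Y_weight (class_rep C) * sur_ratio n C" _ "\<lambda>n. Q_const * zeta_prod (n - 1)"]) auto
  then show ?thesis by simp
qed

lemma Y_weight_summable: "T \<subseteq> fin_ab_iso_classes \<Longrightarrow> (\<lambda>C. Y_weight (class_rep C)) summable_on T"
proof (rule nonneg_bdd_above_summable_on)
  assume T: "T \<subseteq> fin_ab_iso_classes"
  show "bdd_above (sum (\<lambda>C. Y_weight (class_rep C)) ` {F. F \<subseteq> T \<and> finite F})"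
    by (rule bdd_aboveI[of _ 1]) (use T sum_Y_weight_le_1 in auto)
qed (rule Y_weight_nonneg)

text \<open>The lower estimate comes from finite subsets of the index set, the upper one from the
  factors being at most 1.\<close>

lemma infsum_dominated_tendsto:
  fixes y :: "'c \<Rightarrow> real"
  assumes y: "\<And>C. C \<in> T \<Longrightarrow> y C \<ge> 0" "y summable_on T"
    and s: "\<And>n C. n \<ge> 1 \<Longrightarrow> C \<in> T \<Longrightarrow> 0 \<le> s n C \<and> s n C \<le> 1" "\<And>C. C \<in> T \<Longrightarrow> (\<lambda>n. s n C) \<longlonglongrightarrow> 1"
  shows "(\<lambda>n::nat. infsum (\<lambda>C. y C * s n C) T) \<longlonglongrightarrow> infsum y T"
proof -
  have le: "y C * s n C \<le> y C" "0 \<le> y C * s n C" if "n \<ge> 1" "C \<in> T" for n C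
    using mult_left_mono[of "s n C" 1 "y C"] s(1)[OF that] y(1)[OF that(2)] by auto
  have sm: "(\<lambda>C. y C * s n C) summable_on T" if n: "n \<ge> 1" for n
    by (rule summable_on_comparison_test[OF y(2)]) (use le[OF n] in auto)
  show ?thesis
  proof (rule order_tendstoI)
    fix b assume b: "b < infsum y T"
    have "(sum y \<longlongrightarrow> infsum y T) (finite_subsets_at_top T)" using has_sum_infsum[OF y(2)] by (simp add: has_sum_def)
    then have "\<forall>\<^sub>F S in finite_subsets_at_top T. b < sum y S" by (rule order_tendstoD(1)) (rule b)
    then obtain S where S: "finite S" "S \<subseteq> T" "b < sum y S" unfolding eventually_finite_subsets_at_top by blast
    have "(\<lambda>n. \<Sum>C\<in>S. y C * s n C) \<longlonglongrightarrow> (\<Sum>C\<in>S. y C * 1)"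
      using S(2) by (intro tendsto_sum tendsto_mult tendsto_const s(2)) blast
    then have "\<forall>\<^sub>F n in sequentially. b < (\<Sum>C\<in>S. y C * s n C)" by (rule order_tendstoD(1)) (use S(3) in simp)
    then show "\<forall>\<^sub>F n in sequentially. b < infsum (\<lambda>C. y C * s n C) T"
      using eventually_ge_at_top[of 1]
    proof eventually_elim
      case (elim n)
      have "(\<Sum>C\<in>S. y C * s n C) \<le> infsum (\<lambda>C. y C * s n C) T"
        by (rule finite_sum_le_infsum[OF sm[OF elim(2)] S(1,2)]) (use le(2)[OF elim(2)] in auto)
      then show ?case using elim(1) by linarith
    qed
  next
    fix b assume b: "infsum y T < b"
    show "\<forall>\<^sub>F n in sequentially. infsum (\<lambda>C. y C * s n C) T < b"
      using eventually_ge_at_top[of 1]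
    proof eventually_elim
      case (elim n)
      have "infsum (\<lambda>C. y C * s n C) T \<le> infsum y T" by (rule infsum_mono[OF sm[OF elim] y(2)]) (rule le(1)[OF elim])
      then show ?case using b by linarith
    qed
  qed
qed

text \<open>The reduction of F / N modulo \<open>a\<close> depends only on the isomorphism class of
  F / N, so the event is a union of fibres of \<open>quot_class\<close>.\<close>

lemma prob_subgroup_pmf_tensor:
  assumes n: "n \<ge> 1" and a: "a > 0" and G: "comm_group G"
  shows "measure_pmf.prob (subgroup_pmf n) {N. Zn0 n Mod mod_a_span n a N \<cong> G}
    = infsum (pmf (map_pmf (quot_class n) (subgroup_pmf n))) {C \<in> fin_ab_iso_classes. tensor_mod (class_rep C) a \<cong> G}"
proof -
  let ?T = "{C \<in> fin_ab_iso_classes. tensor_mod (class_rep C) a \<cong> G}"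
  let ?p = "map_pmf (quot_class n) (subgroup_pmf n)"
  have iff: "Zn0 n Mod mod_a_span n a N \<cong> G \<longleftrightarrow> quot_class n N \<in> ?T" if N: "N \<in> set_pmf (subgroup_pmf n)" for N
  proof -
    have Nf: "N \<in> fisub (zero_sum_vecs n)" by (rule subgroup_pmf_set[OF n N])
    then have Ns: "subgroup N (Zn0 n)" by (simp add: fisub_Zn0_iff)
    note q = quot_class(1,2)[OF Nf]
    have cg: "comm_group (Zn0 n Mod N)" by (rule comm_group.abelian_FactGroup[OF comm_group_Zn0 Ns])
    have Us: "subgroup (mod_a_span n a N) (Zn0 n)" by (rule mod_a_span_props(1)[OF a Ns])
    have g1: "group (Zn0 n Mod mod_a_span n a N)"
      by (rule comm_group.axioms(2)[OF comm_group.abelian_FactGroup[OF comm_group_Zn0 Us]])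
    have "Zn0 n Mod mod_a_span n a N \<cong> tensor_mod (Zn0 n Mod N) a"
      unfolding mod_a_span_def by (rule tensor_mod_Mod[OF comm_group_Zn0 Ns])
    moreover have "tensor_mod (Zn0 n Mod N) a \<cong> tensor_mod (class_rep (quot_class n N)) a"
      by (rule tensor_mod_iso[OF cg fin_ab_groupsD(1)[OF class_rep(2)[OF q(1)]] q(2)])
    ultimately have i: "Zn0 n Mod mod_a_span n a N \<cong> tensor_mod (class_rep (quot_class n N)) a" by (rule iso_trans)
    show ?thesis using iso_trans[OF i] iso_trans[OF group.iso_sym[OF g1 i]] q(1) by blast
  qed
  have "measure_pmf.prob (subgroup_pmf n) {N. Zn0 n Mod mod_a_span n a N \<cong> G} = measure_pmf.prob (subgroup_pmf n) (quot_class n -` ?T)"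
    by (rule measure_pmf.finite_measure_eq_AE) (use iff in \<open>auto simp: AE_measure_pmf_iff\<close>)
  also have "\<dots> = measure_pmf.prob ?p ?T" by simp
  also have "\<dots> = infsum (pmf ?p) ?T"
    by (simp add: measure_pmf_conv_infsetsum infsetsum_infsum[OF pmf_abs_summable])
  finally show ?thesis .
qed

text \<open>After multiplication by Q times the zeta product, which tends to 1, the probability is a
  sum of weights of Y with ratios tending to 1.\<close>

lemma prob_subgroup_pmf_tendsto:
  assumes G: "comm_group G" and a: "a > 0"
  shows "(\<lambda>n. measure_pmf.prob (subgroup_pmf n) {N. Zn0 n Mod mod_a_span n a N \<cong> G}) \<longlonglongrightarrow> prob_Y_tensor a G"
proof -
  let ?T = "{C \<in> fin_ab_iso_classes. tensor_mod (class_rep C) a \<cong> G}"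
  let ?y = "\<lambda>C. Y_weight (class_rep C)"
  let ?b = "\<lambda>n. measure_pmf.prob (subgroup_pmf n) {N. Zn0 n Mod mod_a_span n a N \<cong> G}"
  have pY: "prob_Y_tensor a G = infsum ?y ?T"
    unfolding prob_Y_tensor_def Let_def class_rep_def[symmetric]
    by (rule infsum_cong_neutral) auto
  have "(\<lambda>n. infsum (\<lambda>C. ?y C * sur_ratio n C) ?T) \<longlonglongrightarrow> infsum ?y ?T"
    by (rule infsum_dominated_tendsto) (use Y_weight_nonneg sur_ratio Y_weight_summable[of ?T] in auto)
  moreover have "(\<lambda>n. Q_const * zeta_prod (n - 1)) \<longlonglongrightarrow> 1"
    by (rule filterlim_sequentially_Suc[THEN iffD1]) (simp add: Q_const_zeta_prod(1))
  ultimately have "(\<lambda>n. infsum (\<lambda>C. ?y C * sur_ratio n C) ?T / (Q_const * zeta_prod (n - 1))) \<longlonglongrightarrow> infsum ?y ?T / 1"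
    by (rule tendsto_divide) simp
  moreover have "\<forall>\<^sub>F n in sequentially. infsum (\<lambda>C. ?y C * sur_ratio n C) ?T / (Q_const * zeta_prod (n - 1)) = ?b n"
  proof -
    have "\<forall>\<^sub>F n in sequentially. 0 < Q_const * zeta_prod (n - 1)"
      by (rule order_tendstoD(1)[OF \<open>(\<lambda>n. Q_const * zeta_prod (n - 1)) \<longlonglongrightarrow> 1\<close>]) simp
    then show ?thesis using eventually_ge_at_top[of 1]
    proof eventually_elim
      case (elim n)
      have "infsum (\<lambda>C. ?y C * sur_ratio n C) ?T
        = infsum (\<lambda>C. Q_const * zeta_prod (n - 1) * pmf (map_pmf (quot_class n) (subgroup_pmf n)) C) ?T"
        by (rule infsum_cong) (use pmf_quot_class[OF elim(2)] in auto)
      also have "\<dots> = Q_const * zeta_prod (n - 1) * ?b n"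
        unfolding prob_subgroup_pmf_tensor[OF elim(2) a G] by (rule infsum_cmult_right')
      finally have e: "infsum (\<lambda>C. ?y C * sur_ratio n C) ?T = Q_const * zeta_prod (n - 1) * ?b n" .
      have "Q_const * zeta_prod (n - 1) \<noteq> 0" using elim(1) by linarith
      then show ?case unfolding e by (rule nonzero_mult_div_cancel_left)
    qed
  qed
  ultimately show ?thesis unfolding pY by (simp add: Lim_transform_eventually)
qed

theorem mainTheorem1:
  fixes eps :: real
    and \<Gamma> :: "nat \<Rightarrow> (nat \<Rightarrow> nat \<Rightarrow> nat) pmf"
  assumes eps_pos: "eps > 0"
    and balanced: "\<And>n. n \<ge> 1 \<Longrightarrow> eps_balanced_digraph n eps (\<Gamma> n)"
  shows "\<forall>(a::nat) (G::('g, 'c) monoid_scheme).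
           a > 0 \<longrightarrow> comm_group G \<longrightarrow> finite (carrier G) \<longrightarrow>
           (\<forall>x \<in> carrier G. x [^]\<^bsub>G\<^esub> a = \<one>\<^bsub>G\<^esub>) \<longrightarrow>
           (\<lambda>n. measure_pmf.prob (\<Gamma> n) {D. tensor_mod (sandpile n D) a \<cong> G})
             \<longlonglongrightarrow> prob_Y_tensor a G"
proof (intro allI impI)
  fix a :: nat and G :: "('g, 'c) monoid_scheme"
  assume a: "a > 0" and G: "comm_group G" "finite (carrier G)"
  \<comment> \<open>The reduced sandpile group is a quotient of the lattice by one subgroup
    containing a F, the form in which the two models are compared.\<close>
  have eq: "tensor_mod (sandpile n D) a \<cong> G \<longleftrightarrow> Zn0 n Mod mod_a_span n a (laplacian_image n D) \<cong> G" for n D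
  proof -
    let ?U = "mod_a_span n a (laplacian_image n D)"
    have Us: "subgroup ?U (Zn0 n)" by (rule mod_a_span_props(1)[OF a subgroup_laplacian_image])
    have g1: "group (Zn0 n Mod ?U)" by (rule comm_group.axioms(2)[OF comm_group.abelian_FactGroup[OF comm_group_Zn0 Us]])
    have i: "Zn0 n Mod ?U \<cong> tensor_mod (sandpile n D) a"
      unfolding mod_a_span_def sandpile_def by (rule tensor_mod_Mod[OF comm_group_Zn0 subgroup_laplacian_image])
    show ?thesis using iso_trans[OF i] iso_trans[OF group.iso_sym[OF g1 i]] by blast
  qed
  have "(\<lambda>n. measure_pmf.prob (\<Gamma> n) {D. Zn0 n Mod mod_a_span n a (laplacian_image n D) \<cong> G}) \<longlonglongrightarrow> 0 + prob_Y_tensor a G"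
    using tendsto_add[OF prob_difference_tendsto_0[OF eps_pos balanced G a] prob_subgroup_pmf_tendsto[OF G(1) a]] by simp
  then show "(\<lambda>n. measure_pmf.prob (\<Gamma> n) {D. tensor_mod (sandpile n D) a \<cong> G}) \<longlonglongrightarrow> prob_Y_tensor a G"
    by (simp add: eq)
qed

end
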